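(* Let $\omega \ge 0$ and $\gamma\in\mathbb{R}$ be fixed constants. Given $u_0\in H^s(\mathbb{R})$, $s>\frac32$, there exist a maximal $T=T(\gamma,\omega,u_0)>0$ and a unique solution $u=u(\cdot,u_0)$ to the Cauchy problem $$u_t-u_{txx}+2\omega u_x+3uu_x=\gamma(2u_xu_{xx}+uu_{xxx}),\quad t>0,\ x\in\mathbb{R},\qquad u(0,x)=u_0(x),\ x\in\mathbb{R},$$ such that $$u=u(\cdot,u_0)\in C\left([0,T);H^s(\mathbb{R})\right)\cap C^1\left([0,T);H^{s-1}(\mathbb{R})\right).$$ Moreover, the solution depends continuously on the initial data.
   Context: All functions are real-valued, and $H^s(\mathbb{R})$ is the usual $L^2$-based Sobolev space. Let $p(x)=\frac12 e^{-|x|}$, $x\in\mathbb{R}$, so that $p*f=(1-\partial_x^2)^{-1}f$ for $f\in L^2(\mathbb{R})$, where $*$ denotes convolution in $x$. The equation is understood in its equivalent nonlocal form $$u_t+\gamma uu_x+\partial_x p*\left(\frac{3-\gamma}{2}u^2+\frac{\gamma}{2}u_x^2+2\omega u\right)=0,$$ with $u(0,\cdot)=u_0$. Maximality of $T$ (possibly $T=+\infty$) means that the solution cannot be extended in this class to a larger interval $[0,T^* )$ with $T^*>T$. *)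

theory Defs
  imports "HOL-Analysis.Analysis"
begin

text \<open>
  Elements of \<open>L\<^sup>2\<close> and of the Sobolev spaces are represented by Borel functions, and are
  identified when they agree almost everywhere.
\<close>

definition square_integrable :: "(real \<Rightarrow> 'a::{banach, second_countable_topology}) \<Rightarrow> bool" where
  "square_integrable f \<longleftrightarrow>
     f \<in> borel_measurable lborel \<and> integrable lborel (\<lambda>x. (norm (f x))\<^sup>2)"

definition truncated_fourier :: "real \<Rightarrow> (real \<Rightarrow> real) \<Rightarrow> real \<Rightarrow> complex" where
  "truncated_fourier R f \<xi> =
     (LINT x:{-R..R}|lborel. exp (- \<i> * of_real (x * \<xi>)) * of_real (f x)) / of_real (sqrt (2 * pi))"

text \<open>
  The unitary (Plancherel) Fourier transform on \<open>L\<^sup>2\<close>: the \<open>L\<^sup>2\<close> limit of the transforms of the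
  truncations of \<open>f\<close>. By Plancherel's theorem it exists for every square integrable \<open>f\<close>, and it
  is determined up to a null set. The nonnegative integral is used for the \<open>L\<^sup>2\<close> distance
  because, unlike the Bochner integral, it is not \<open>0\<close> when the integrand is not integrable.
\<close>

definition has_fourier :: "(real \<Rightarrow> real) \<Rightarrow> (real \<Rightarrow> complex) \<Rightarrow> bool" where
  "has_fourier f g \<longleftrightarrow> square_integrable g \<and>
     ((\<lambda>R. \<integral>\<^sup>+ \<xi>. ennreal ((cmod (truncated_fourier R f \<xi> - g \<xi>))\<^sup>2) \<partial>lborel) \<longlongrightarrow> 0) at_top"

definition fourier :: "(real \<Rightarrow> real) \<Rightarrow> real \<Rightarrow> complex" where
  "fourier f = (SOME g. has_fourier f g)"

text \<open>
  The space \<open>H\<^sup>s\<close> for \<open>s \<ge> 0\<close> only: for negative \<open>s\<close> it would also contain distributions that are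
  not functions.
\<close>

definition sobolev :: "real \<Rightarrow> (real \<Rightarrow> real) set" where
  "sobolev s = {f. square_integrable f \<and>
     integrable lborel (\<lambda>\<xi>. (1 + \<xi>\<^sup>2) powr s * (cmod (fourier f \<xi>))\<^sup>2)}"

definition sobolev_norm :: "real \<Rightarrow> (real \<Rightarrow> real) \<Rightarrow> real" where
  "sobolev_norm s f = sqrt (LINT \<xi>|lborel. (1 + \<xi>\<^sup>2) powr s * (cmod (fourier f \<xi>))\<^sup>2)"

definition test_function :: "(real \<Rightarrow> real) \<Rightarrow> bool" where
  "test_function \<phi> \<longleftrightarrow>
     (\<forall>n x. (deriv ^^ n) \<phi> differentiable at x) \<and> (\<exists>R. \<forall>x. \<bar>x\<bar> > R \<longrightarrow> \<phi> x = 0)"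

definition locally_integrable :: "(real \<Rightarrow> real) \<Rightarrow> bool" where
  "locally_integrable f \<longleftrightarrow>
     f \<in> borel_measurable lborel \<and> (\<forall>R. set_integrable lborel {-R..R} f)"

definition has_weak_deriv :: "(real \<Rightarrow> real) \<Rightarrow> (real \<Rightarrow> real) \<Rightarrow> bool" where
  "has_weak_deriv f g \<longleftrightarrow> locally_integrable f \<and> locally_integrable g \<and>
     (\<forall>\<phi>. test_function \<phi> \<longrightarrow>
        (LINT x|lborel. f x * deriv \<phi> x) = - (LINT x|lborel. g x * \<phi> x))"

definition convolution :: "(real \<Rightarrow> real) \<Rightarrow> (real \<Rightarrow> real) \<Rightarrow> real \<Rightarrow> real" where
  "convolution f g x = (LINT y|lborel. f (x - y) * g y)"

definition peak_kernel :: "real \<Rightarrow> real" where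
  "peak_kernel x = exp (- \<bar>x\<bar>) / 2"

definition time_interval :: "ereal \<Rightarrow> real set" where
  "time_interval T = {t. 0 \<le> t \<and> ereal t < T}"

text \<open>\<open>u \<in> C([0,T); H\<^sup>s)\<close>\<close>

definition sobolev_continuous :: "real \<Rightarrow> ereal \<Rightarrow> (real \<Rightarrow> real \<Rightarrow> real) \<Rightarrow> bool" where
  "sobolev_continuous s T u \<longleftrightarrow>
     (\<forall>t\<in>time_interval T. u t \<in> sobolev s \<and>
        ((\<lambda>\<tau>. sobolev_norm s (\<lambda>x. u \<tau> x - u t x)) \<longlongrightarrow> 0) (at t within time_interval T))"

text \<open>\<open>u \<in> C\<^sup>1([0,T); H\<^sup>s)\<close>, with time derivative \<open>u'\<close> (one-sided at time \<open>0\<close>)\<close>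

definition sobolev_C1 ::
    "real \<Rightarrow> ereal \<Rightarrow> (real \<Rightarrow> real \<Rightarrow> real) \<Rightarrow> (real \<Rightarrow> real \<Rightarrow> real) \<Rightarrow> bool" where
  "sobolev_C1 s T u u' \<longleftrightarrow>
     sobolev_continuous s T u \<and> sobolev_continuous s T u' \<and>
     (\<forall>t\<in>time_interval T.
        ((\<lambda>\<tau>. sobolev_norm s (\<lambda>x. (u \<tau> x - u t x) / (\<tau> - t) - u' t x)) \<longlongrightarrow> 0)
          (at t within time_interval T))"

definition rod_flux ::
    "real \<Rightarrow> real \<Rightarrow> (real \<Rightarrow> real) \<Rightarrow> (real \<Rightarrow> real) \<Rightarrow> real \<Rightarrow> real" where
  "rod_flux \<omega> \<gamma> v v\<^sub>x x =
     (3 - \<gamma>) / 2 * (v x)\<^sup>2 + \<gamma> / 2 * (v\<^sub>x x)\<^sup>2 + 2 * \<omega> * v x"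

text \<open>
  The nonlocal equation at a fixed time, for the profile \<open>v\<close> and the time derivative \<open>v\<^sub>t\<close>.
  Here \<open>w\<close> is the weak derivative of the convolution of the kernel with the flux.
\<close>

definition rod_equation :: "real \<Rightarrow> real \<Rightarrow> (real \<Rightarrow> real) \<Rightarrow> (real \<Rightarrow> real) \<Rightarrow> bool" where
  "rod_equation \<omega> \<gamma> v v\<^sub>t \<longleftrightarrow>
     (\<exists>v\<^sub>x w. has_weak_deriv v v\<^sub>x \<and>
        has_weak_deriv (convolution peak_kernel (rod_flux \<omega> \<gamma> v v\<^sub>x)) w \<and>
        (AE x in lborel. v\<^sub>t x + \<gamma> * v x * v\<^sub>x x + w x = 0))"

definition rod_solution ::
    "real \<Rightarrow> real \<Rightarrow> real \<Rightarrow> (real \<Rightarrow> real) \<Rightarrow> ereal \<Rightarrow> (real \<Rightarrow> real \<Rightarrow> real) \<Rightarrow> bool" where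
  "rod_solution \<omega> \<gamma> s u\<^sub>0 T u \<longleftrightarrow>
     sobolev_continuous s T u \<and>
     (\<exists>u'. sobolev_C1 (s - 1) T u u' \<and>
        (\<forall>t\<in>time_interval T. 0 < t \<longrightarrow> rod_equation \<omega> \<gamma> (u t) (u' t))) \<and>
     (AE x in lborel. u 0 x = u\<^sub>0 x)"

definition maximal_rod_solution ::
    "real \<Rightarrow> real \<Rightarrow> real \<Rightarrow> (real \<Rightarrow> real) \<Rightarrow> ereal \<Rightarrow> (real \<Rightarrow> real \<Rightarrow> real) \<Rightarrow> bool" where
  "maximal_rod_solution \<omega> \<gamma> s u\<^sub>0 T u \<longleftrightarrow>
     0 < T \<and> rod_solution \<omega> \<gamma> s u\<^sub>0 T u \<and>
     \<not> (\<exists>T' v. T < T' \<and> rod_solution \<omega> \<gamma> s u\<^sub>0 T' v \<and>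
          (\<forall>t\<in>time_interval T. AE x in lborel. v t x = u t x))"

end

theory Submission
  imports Defs "HOL-Probability.Probability"
begin

text \<open>
 On the Fourier side the equation is an ordinary differential equation \<open>U' = Nl U\<close> in a weighted
 \<open>L\<^sup>2\<close> space, where \<open>Nl\<close> loses one power of \<open>J k = sqrt (1 + k\<^sup>2)\<close>. For the transform of a real
 function the loss is absent from the energy identity, because the symmetrized symbol of the
 transport term is a commutator. The resulting energy estimates, for a solution in \<open>H\<^sup>s\<close> and for the
 difference of two solutions in \<open>H\<^bsup>s-1\<^esup>\<close>, also hold when the weight is multiplied by \<open>J / (R + J)\<close>, with
 constants independent of \<open>R\<close>. Such a norm measures the part of the function at frequencies above
 \<open>R\<close>, so high frequencies of a solution are controlled by those of its data. Hence convergence in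
 \<open>H\<^bsup>s-1\<^esup>\<close>, which follows from the stability estimate, improves to \<open>H\<^sup>s\<close>; this is used for the limit of
 frequency truncated Euler polygons and again for the continuous dependence on the data, where no
 Lipschitz estimate in \<open>H\<^sup>s\<close> is available. The existence time depends only on the norm of the data,
 which turns local into maximal solutions.
\<close>

text \<open>The threshold s > 3/2 makes \<open>\<rho>\<close>, the reciprocal of the H^(s-1) weight,
  square integrable, so that the transform of u_x is integrable. Every estimate of the quadratic
  term thus becomes a pointwise inequality between kernels in two frequencies: a kernel dominated by
  a product of three weights times \<open>\<rho> (v - l) + \<rho> l + \<rho> v\<close> is controlled
  by the three weighted norms, since one factor can be taken in L^1 and the other two in L^2. High
  frequencies are measured by a quotient instead of an indicator because the commutator bound asks
  for a positive increasing weight of polynomial growth. The obstacle is that the cancellation can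
  be used only where the double integrals converge absolutely, which takes one derivative more than
  the bound controls. Truncated polygons have it, and so do differences of H^s functions measured in
  H^(s-1); a general solution in H^s does not, and its high frequency bound is inherited from the
  polygons through uniqueness. One stability estimate for approximate solutions yields convergence,
  uniqueness and dependence.\<close>

abbreviation "BM \<equiv> borel_measurable borel"
abbreviation "cr \<equiv> complex_of_real"

section \<open>Weighted square integrable functions\<close>

definition L2 :: "(real \<Rightarrow> real) set" where
 "L2 = {f. f \<in> BM \<and> integrable lborel (\<lambda>x. (f x)\<^sup>2)}"

text \<open>The Bochner integral of a nonintegrable function is 0, so a bound on
  \<open>l2n f\<close> says something only together with \<open>f \<in> L2\<close>; hence the
  membership claims that accompany the norm bounds below.\<close>

definition l2n :: "(real \<Rightarrow> real) \<Rightarrow> real" where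
 "l2n f = sqrt (LINT x|lborel. (f x)\<^sup>2)"

lemma l2n_nonneg [simp]: "0 \<le> l2n f"
 by (simp add: l2n_def)

lemma l2n_sq: "(l2n f)\<^sup>2 = (LINT x|lborel. (f x)\<^sup>2)"
 by (simp add: l2n_def)

lemma nn_integral_L2:
 assumes "f \<in> L2" shows "(\<integral>\<^sup>+x. ennreal ((f x)\<^sup>2) \<partial>lborel) = ennreal ((l2n f)\<^sup>2)"
 using assms by (simp add: l2n_sq L2_def nn_integral_eq_integral)

text \<open>A finite nonnegative integral is itself evidence of integrability, so one inequality in
  \<open>ennreal\<close> yields membership and norm bound together. This is the exit from the
  Tonelli computations.\<close>

lemma L2I_nn:
 assumes [measurable]: "f \<in> BM"
  and le: "(\<integral>\<^sup>+x. ennreal ((f x)\<^sup>2) \<partial>lborel) \<le> ennreal (c\<^sup>2)" and "0 \<le> c"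
 shows "f \<in> L2" "l2n f \<le> c"
proof -
 have i: "integrable lborel (\<lambda>x. (f x)\<^sup>2)"
  by (rule integrableI_bounded) (use le in \<open>auto intro: le_less_trans\<close>)
 then show f: "f \<in> L2" by (simp add: L2_def)
 have "(l2n f)\<^sup>2 \<le> c\<^sup>2" using le nn_integral_L2[OF f] by simp
 then show "l2n f \<le> c" using \<open>0 \<le> c\<close> power2_le_imp_le by blast
qed

lemma L2_dom:
 assumes [measurable]: "f \<in> BM" and g: "g \<in> L2"
  and le: "AE x in lborel. \<bar>f x\<bar> \<le> g x"
 shows "f \<in> L2" "l2n f \<le> l2n g"
proof -
 have "(\<integral>\<^sup>+x. ennreal ((f x)\<^sup>2) \<partial>lborel) \<le> (\<integral>\<^sup>+x. ennreal ((g x)\<^sup>2) \<partial>lborel)"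
  using le by (intro nn_integral_mono_AE) (auto intro!: ennreal_leI abs_le_square_iff[THEN iffD1] elim!: eventually_mono)
 then have *: "(\<integral>\<^sup>+x. ennreal ((f x)\<^sup>2) \<partial>lborel) \<le> ennreal ((l2n g)\<^sup>2)"
  using nn_integral_L2[OF g] by simp
 show "f \<in> L2" "l2n f \<le> l2n g" using L2I_nn[OF assms(1) *] by auto
qed

lemma l2n_cong_AE:
 assumes [measurable]: "f \<in> BM" "g \<in> BM"
  and "AE x in lborel. f x = g x"
 shows "l2n f = l2n g"
 unfolding l2n_def using assms by (intro arg_cong[where f=sqrt] integral_cong_AE) auto

lemma L2_scale: "f \<in> L2 \<Longrightarrow> (\<lambda>x. c * f x) \<in> L2"
 by (auto simp: L2_def power_mult_distrib)

lemma l2n_scale: "l2n (\<lambda>x. c * f x) = \<bar>c\<bar> * l2n f"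
 by (simp add: l2n_def power_mult_distrib real_sqrt_mult)

lemma L2_abs: "f \<in> L2 \<Longrightarrow> (\<lambda>x. \<bar>f x\<bar>) \<in> L2"
 by (auto simp: L2_def)

lemma abs_mult_le: "\<bar>a * b\<bar> \<le> a\<^sup>2 + b\<^sup>2" for a b :: real
proof -
 have "0 \<le> (\<bar>a\<bar> - \<bar>b\<bar>)\<^sup>2" by simp
 then have "2 * (\<bar>a\<bar> * \<bar>b\<bar>) \<le> a\<^sup>2 + b\<^sup>2" by (simp add: power2_diff mult.assoc)
 moreover have "0 \<le> \<bar>a\<bar> * \<bar>b\<bar>" by simp
 ultimately show ?thesis unfolding abs_mult by linarith
qed

lemma L2_mult_integrable:
 assumes "f \<in> L2" "g \<in> L2" shows "integrable lborel (\<lambda>x. f x * g x)"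
proof (rule Bochner_Integration.integrable_bound)
 show "integrable lborel (\<lambda>x. (f x)\<^sup>2 + (g x)\<^sup>2)" using assms by (auto simp: L2_def)
 show "(\<lambda>x. f x * g x) \<in> borel_measurable lborel" using assms by (auto simp: L2_def)
 have "norm (f x * g x) \<le> norm ((f x)\<^sup>2 + (g x)\<^sup>2)" for x
  using abs_mult_le[of "f x" "g x"] by simp
 then show "AE x in lborel. norm (f x * g x) \<le> norm ((f x)\<^sup>2 + (g x)\<^sup>2)" by simp
qed

lemma nn_CS:
 assumes "f \<in> L2" "g \<in> L2"
 shows "(\<integral>\<^sup>+x. ennreal \<bar>f x * g x\<bar> \<partial>lborel) \<le> ennreal (l2n f * l2n g)"
proof -
 have [measurable]: "f \<in> BM" "g \<in> BM"
  using assms by (auto simp: L2_def)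
 have "(\<integral>\<^sup>+x. ennreal \<bar>f x\<bar> * ennreal \<bar>g x\<bar> \<partial>lborel)\<^sup>2
   \<le> (\<integral>\<^sup>+x. ennreal \<bar>f x\<bar> ^ 2 \<partial>lborel) * (\<integral>\<^sup>+x. ennreal \<bar>g x\<bar> ^ 2 \<partial>lborel)"
  by (rule Cauchy_Schwarz_nn_integral) auto
 also have "\<dots> = ennreal ((l2n f)\<^sup>2) * ennreal ((l2n g)\<^sup>2)"
  by (simp add: ennreal_power nn_integral_L2 assms)
 also have "\<dots> = (ennreal (l2n f * l2n g))\<^sup>2"
  by (simp add: ennreal_power ennreal_mult power_mult_distrib)
 finally have "(\<integral>\<^sup>+x. ennreal \<bar>f x * g x\<bar> \<partial>lborel)\<^sup>2 \<le> (ennreal (l2n f * l2n g))\<^sup>2"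
  by (simp add: abs_mult ennreal_mult)
 then show ?thesis
  by (cases "\<integral>\<^sup>+x. ennreal \<bar>f x * g x\<bar> \<partial>lborel")
   (auto simp: top_unique ennreal_power power2_le_iff_abs_le abs_le_square_iff[symmetric])
qed

lemma CS_abs:
 assumes "f \<in> L2" "g \<in> L2"
 shows "(LINT x|lborel. \<bar>f x * g x\<bar>) \<le> l2n f * l2n g"
proof -
 have "integrable lborel (\<lambda>x. \<bar>f x * g x\<bar>)" using L2_mult_integrable[OF assms] by simp
 then have "ennreal (LINT x|lborel. \<bar>f x * g x\<bar>) = (\<integral>\<^sup>+x. ennreal \<bar>f x * g x\<bar> \<partial>lborel)"
  by (simp add: nn_integral_eq_integral)
 then show ?thesis using nn_CS[OF assms] by (metis ennreal_le_iff l2n_nonneg mult_nonneg_nonneg)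
qed

lemma CS:
 assumes "f \<in> L2" "g \<in> L2"
 shows "\<bar>LINT x|lborel. f x * g x\<bar> \<le> l2n f * l2n g"
 by (rule order_trans[OF _ CS_abs[OF assms]])
  (use integral_norm_bound[of lborel "\<lambda>x. f x * g x"] in \<open>simp only: real_norm_def\<close>)

lemma L2_add:
 assumes "f \<in> L2" "g \<in> L2" shows "(\<lambda>x. f x + g x) \<in> L2"
proof -
 have "integrable lborel (\<lambda>x. (f x)\<^sup>2 + (g x)\<^sup>2 + 2 * (f x * g x))"
  using assms L2_mult_integrable[OF assms] by (auto simp: L2_def)
 then have "integrable lborel (\<lambda>x. (f x + g x)\<^sup>2)" by (simp add: power2_sum algebra_simps)
 then show ?thesis using assms by (auto simp: L2_def)
qed

lemma l2n_add:
 assumes "f \<in> L2" "g \<in> L2" shows "l2n (\<lambda>x. f x + g x) \<le> l2n f + l2n g"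
proof (rule power2_le_imp_le)
 have i: "integrable lborel (\<lambda>x. (f x)\<^sup>2)" "integrable lborel (\<lambda>x. (g x)\<^sup>2)"
  "integrable lborel (\<lambda>x. f x * g x)"
  using assms L2_mult_integrable[OF assms] by (auto simp: L2_def)
 have "(l2n (\<lambda>x. f x + g x))\<^sup>2 = (LINT x|lborel. (f x)\<^sup>2 + (g x)\<^sup>2 + 2 * (f x * g x))"
  by (simp add: l2n_sq power2_sum algebra_simps)
 also have "\<dots> = (l2n f)\<^sup>2 + (l2n g)\<^sup>2 + 2 * (LINT x|lborel. f x * g x)"
  using i by (simp add: l2n_sq)
 also have "\<dots> \<le> (l2n f + l2n g)\<^sup>2"
  using CS[OF assms] by (simp add: power2_sum abs_le_iff)
 finally show "(l2n (\<lambda>x. f x + g x))\<^sup>2 \<le> (l2n f + l2n g)\<^sup>2" .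
qed simp

section \<open>Translations, reflections and convolution estimates\<close>

lemma nn_shift:
 fixes f :: "real \<Rightarrow> ennreal"
 assumes [measurable]: "f \<in> BM"
 shows "(\<integral>\<^sup>+x. f (x - c) \<partial>lborel) = (\<integral>\<^sup>+x. f x \<partial>lborel)"
 using nn_integral_real_affine[of f 1 "-c"] by simp

lemma nn_reflect:
 fixes f :: "real \<Rightarrow> ennreal"
 assumes [measurable]: "f \<in> BM"
 shows "(\<integral>\<^sup>+x. f (c - x) \<partial>lborel) = (\<integral>\<^sup>+x. f x \<partial>lborel)"
 using nn_integral_real_affine[of f "-1" c] by simp

lemma L2_shift:
 assumes "f \<in> L2" shows "(\<lambda>x. f (x - c)) \<in> L2" "l2n (\<lambda>x. f (x - c)) = l2n f"
proof -
 show "(\<lambda>x. f (x - c)) \<in> L2"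
  using assms lborel_integrable_real_affine[of "\<lambda>x. (f x)\<^sup>2" 1 "-c"] by (auto simp: L2_def)
 show "l2n (\<lambda>x. f (x - c)) = l2n f"
  using lborel_integral_real_affine[of 1 "\<lambda>x. (f x)\<^sup>2" "-c"] by (simp add: l2n_def)
qed

lemma L2_reflect:
 assumes "f \<in> L2" shows "(\<lambda>x. f (c - x)) \<in> L2" "l2n (\<lambda>x. f (c - x)) = l2n f"
proof -
 show "(\<lambda>x. f (c - x)) \<in> L2"
  using assms lborel_integrable_real_affine[of "\<lambda>x. (f x)\<^sup>2" "-1" c] by (auto simp: L2_def)
 show "l2n (\<lambda>x. f (c - x)) = l2n f"
  using lborel_integral_real_affine[of "-1" "\<lambda>x. (f x)\<^sup>2" c] by (simp add: l2n_def)
qed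

text \<open>With z = x - y the integral over x is taken first: for fixed z, Cauchy-Schwarz and
  translation invariance bound it by \<open>l2n b * l2n c\<close>, and what remains is the L^1 norm
  of \<open>a\<close>.\<close>

lemma tri1:
 assumes [measurable]: "a \<in> BM" and b: "b \<in> L2" and c: "c \<in> L2"
  and A: "(\<integral>\<^sup>+x. ennreal \<bar>a x\<bar> \<partial>lborel) \<le> ennreal A" "0 \<le> A"
 shows "(\<integral>\<^sup>+x. \<integral>\<^sup>+y. ennreal \<bar>a (x - y) * b y * c x\<bar> \<partial>lborel \<partial>lborel) \<le> ennreal (A * l2n b * l2n c)"
proof -
 have [measurable]: "b \<in> BM" "c \<in> BM"
  using assms by (auto simp: L2_def)
 have "(\<integral>\<^sup>+x. \<integral>\<^sup>+y. ennreal \<bar>a (x - y) * b y * c x\<bar> \<partial>lborel \<partial>lborel)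
   = (\<integral>\<^sup>+x. \<integral>\<^sup>+z. ennreal \<bar>a z * b (x - z) * c x\<bar> \<partial>lborel \<partial>lborel)"
 proof (rule nn_integral_cong)
  fix x show "(\<integral>\<^sup>+y. ennreal \<bar>a (x - y) * b y * c x\<bar> \<partial>lborel) = (\<integral>\<^sup>+z. ennreal \<bar>a z * b (x - z) * c x\<bar> \<partial>lborel)"
   using nn_reflect[of "\<lambda>z. ennreal \<bar>a z * b (x - z) * c x\<bar>" x] by simp
 qed
 also have "\<dots> = (\<integral>\<^sup>+z. \<integral>\<^sup>+x. ennreal \<bar>a z * b (x - z) * c x\<bar> \<partial>lborel \<partial>lborel)"
  by (rule lborel_pair.Fubini') measurable
 also have "\<dots> = (\<integral>\<^sup>+z. ennreal \<bar>a z\<bar> * (\<integral>\<^sup>+x. ennreal \<bar>b (x - z) * c x\<bar> \<partial>lborel) \<partial>lborel)"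
  by (subst nn_integral_cmult[symmetric]) (auto simp: abs_mult ennreal_mult mult.assoc)
 also have "\<dots> \<le> (\<integral>\<^sup>+z. ennreal \<bar>a z\<bar> * ennreal (l2n b * l2n c) \<partial>lborel)"
  using nn_CS[OF L2_shift(1)[OF b] c] L2_shift(2)[OF b]
  by (intro nn_integral_mono mult_left_mono) auto
 also have "\<dots> = (\<integral>\<^sup>+z. ennreal \<bar>a z\<bar> \<partial>lborel) * ennreal (l2n b * l2n c)"
  by (rule nn_integral_multc) simp
 also have "\<dots> \<le> ennreal A * ennreal (l2n b * l2n c)"
  by (intro mult_right_mono A) auto
 finally show ?thesis using A(2) by (simp add: ennreal_mult mult.assoc)
qed

text \<open>Reflecting y to x - y interchanges the first two factors and reduces this to
  \<open>tri1\<close>.\<close>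

lemma tri2:
 assumes [measurable]: "b \<in> BM" and a: "a \<in> L2" and c: "c \<in> L2"
  and A: "(\<integral>\<^sup>+x. ennreal \<bar>b x\<bar> \<partial>lborel) \<le> ennreal A" "0 \<le> A"
 shows "(\<integral>\<^sup>+x. \<integral>\<^sup>+y. ennreal \<bar>a (x - y) * b y * c x\<bar> \<partial>lborel \<partial>lborel) \<le> ennreal (l2n a * A * l2n c)"
proof -
 have [measurable]: "a \<in> BM" "c \<in> BM"
  using assms by (auto simp: L2_def)
 have "(\<integral>\<^sup>+x. \<integral>\<^sup>+y. ennreal \<bar>a (x - y) * b y * c x\<bar> \<partial>lborel \<partial>lborel)
   = (\<integral>\<^sup>+x. \<integral>\<^sup>+z. ennreal \<bar>b z * a (x - z) * c x\<bar> \<partial>lborel \<partial>lborel)"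
  by (simp add: mult.commute)
 also have "\<dots> = (\<integral>\<^sup>+x. \<integral>\<^sup>+y. ennreal \<bar>b (x - y) * a y * c x\<bar> \<partial>lborel \<partial>lborel)"
 proof (rule nn_integral_cong)
  fix x show "(\<integral>\<^sup>+z. ennreal \<bar>b z * a (x - z) * c x\<bar> \<partial>lborel) = (\<integral>\<^sup>+y. ennreal \<bar>b (x - y) * a y * c x\<bar> \<partial>lborel)"
   using nn_reflect[of "\<lambda>z. ennreal \<bar>b z * a (x - z) * c x\<bar>" x] by simp
 qed
 also have "\<dots> \<le> ennreal (A * l2n a * l2n c)" by (rule tri1) (use assms in auto)
 finally show ?thesis by (simp add: mult_ac)
qed

text \<open>The convolution of two L^2 functions is bounded uniformly in x, which leaves the L^1
  norm of \<open>c\<close>.\<close>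

lemma tri3:
 assumes [measurable]: "c \<in> BM" and a: "a \<in> L2" and b: "b \<in> L2"
  and A: "(\<integral>\<^sup>+x. ennreal \<bar>c x\<bar> \<partial>lborel) \<le> ennreal A" "0 \<le> A"
 shows "(\<integral>\<^sup>+x. \<integral>\<^sup>+y. ennreal \<bar>a (x - y) * b y * c x\<bar> \<partial>lborel \<partial>lborel) \<le> ennreal (l2n a * l2n b * A)"
proof -
 have [measurable]: "a \<in> BM" "b \<in> BM"
  using assms by (auto simp: L2_def)
 have "(\<integral>\<^sup>+x. \<integral>\<^sup>+y. ennreal \<bar>a (x - y) * b y * c x\<bar> \<partial>lborel \<partial>lborel)
   = (\<integral>\<^sup>+x. (\<integral>\<^sup>+y. ennreal \<bar>a (x - y) * b y\<bar> \<partial>lborel) * ennreal \<bar>c x\<bar> \<partial>lborel)"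
  by (subst nn_integral_multc[symmetric]) (auto simp: abs_mult ennreal_mult)
 also have "\<dots> \<le> (\<integral>\<^sup>+x. ennreal (l2n a * l2n b) * ennreal \<bar>c x\<bar> \<partial>lborel)"
  using nn_CS[OF L2_reflect(1)[OF a] b] L2_reflect(2)[OF a]
  by (intro nn_integral_mono mult_right_mono) auto
 also have "\<dots> = ennreal (l2n a * l2n b) * (\<integral>\<^sup>+x. ennreal \<bar>c x\<bar> \<partial>lborel)"
  by (rule nn_integral_cmult) simp
 also have "\<dots> \<le> ennreal (l2n a * l2n b) * ennreal A"
  by (intro mult_left_mono A) auto
 finally show ?thesis using A(2) by (simp add: ennreal_mult)
qed

text \<open>Young's inequality for L^1 and L^2. Writing \<bar>a\<bar> as a product of two square
  roots lets Cauchy-Schwarz pull out one L^1 norm pointwise; Tonelli yields the second.\<close>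

lemma young:
 assumes [measurable]: "a \<in> BM" and b: "b \<in> L2"
  and A: "(\<integral>\<^sup>+x. ennreal \<bar>a x\<bar> \<partial>lborel) \<le> ennreal A" "0 \<le> A"
 shows "(\<integral>\<^sup>+x. (\<integral>\<^sup>+y. ennreal \<bar>a (x - y) * b y\<bar> \<partial>lborel)\<^sup>2 \<partial>lborel) \<le> ennreal ((A * l2n b)\<^sup>2)"
proof -
 have [measurable]: "b \<in> BM" using b by (auto simp: L2_def)
 have "(\<integral>\<^sup>+y. ennreal \<bar>a (x - y) * b y\<bar> \<partial>lborel)\<^sup>2
   \<le> ennreal A * (\<integral>\<^sup>+y. ennreal (\<bar>a (x - y)\<bar> * (b y)\<^sup>2) \<partial>lborel)" for x
 proof -
  have "(\<integral>\<^sup>+y. ennreal \<bar>a (x - y) * b y\<bar> \<partial>lborel)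
   = (\<integral>\<^sup>+y. ennreal (sqrt \<bar>a (x - y)\<bar>) * ennreal (sqrt \<bar>a (x - y)\<bar> * \<bar>b y\<bar>) \<partial>lborel)"
   by (intro nn_integral_cong) (simp add: ennreal_mult[symmetric] abs_mult mult.assoc[symmetric])
  then have "(\<integral>\<^sup>+y. ennreal \<bar>a (x - y) * b y\<bar> \<partial>lborel)\<^sup>2
   \<le> (\<integral>\<^sup>+y. ennreal (sqrt \<bar>a (x - y)\<bar>) ^ 2 \<partial>lborel) * (\<integral>\<^sup>+y. ennreal (sqrt \<bar>a (x - y)\<bar> * \<bar>b y\<bar>) ^ 2 \<partial>lborel)"
   by (simp del: power2_eq_square) (intro Cauchy_Schwarz_nn_integral; measurable)
  also have "\<dots> = (\<integral>\<^sup>+y. ennreal \<bar>a (x - y)\<bar> \<partial>lborel) * (\<integral>\<^sup>+y. ennreal (\<bar>a (x - y)\<bar> * (b y)\<^sup>2) \<partial>lborel)"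
   by (simp add: ennreal_power power_mult_distrib)
  also have "(\<integral>\<^sup>+y. ennreal \<bar>a (x - y)\<bar> \<partial>lborel) = (\<integral>\<^sup>+y. ennreal \<bar>a y\<bar> \<partial>lborel)"
   by (rule nn_reflect) simp
  finally show ?thesis using A by (meson dual_order.trans mult_right_mono zero_le)
 qed
 note bnd = this
 have "(\<integral>\<^sup>+x. (\<integral>\<^sup>+y. ennreal (\<bar>a (x - y)\<bar> * (b y)\<^sup>2) \<partial>lborel) \<partial>lborel)
   = (\<integral>\<^sup>+y. (\<integral>\<^sup>+x. ennreal (\<bar>a (x - y)\<bar> * (b y)\<^sup>2) \<partial>lborel) \<partial>lborel)"
  by (rule lborel_pair.Fubini') measurable
 also have "\<dots> = (\<integral>\<^sup>+y. ennreal ((b y)\<^sup>2) * (\<integral>\<^sup>+x. ennreal (\<bar>a (x - y)\<bar>) \<partial>lborel) \<partial>lborel)"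
  by (subst nn_integral_cmult[symmetric]) (auto simp: ennreal_mult mult_ac)
 also have "\<dots> = (\<integral>\<^sup>+y. ennreal ((b y)\<^sup>2) * (\<integral>\<^sup>+x. ennreal \<bar>a x\<bar> \<partial>lborel) \<partial>lborel)"
  by (intro nn_integral_cong arg_cong2[where f="(*)"] refl nn_shift) simp
 also have "\<dots> = (\<integral>\<^sup>+y. ennreal ((b y)\<^sup>2) \<partial>lborel) * (\<integral>\<^sup>+x. ennreal \<bar>a x\<bar> \<partial>lborel)"
  by (rule nn_integral_multc) simp
 also have "\<dots> \<le> ennreal ((l2n b)\<^sup>2) * ennreal A"
  by (simp add: nn_integral_L2[OF b] mult_left_mono A)
 finally have inner: "(\<integral>\<^sup>+x. (\<integral>\<^sup>+y. ennreal (\<bar>a (x - y)\<bar> * (b y)\<^sup>2) \<partial>lborel) \<partial>lborel) \<le> ennreal ((l2n b)\<^sup>2) * ennreal A" .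
 have "(\<integral>\<^sup>+x. (\<integral>\<^sup>+y. ennreal \<bar>a (x - y) * b y\<bar> \<partial>lborel)\<^sup>2 \<partial>lborel)
   \<le> (\<integral>\<^sup>+x. ennreal A * (\<integral>\<^sup>+y. ennreal (\<bar>a (x - y)\<bar> * (b y)\<^sup>2) \<partial>lborel) \<partial>lborel)"
  using bnd by (intro nn_integral_mono)
 also have "\<dots> = ennreal A * (\<integral>\<^sup>+x. (\<integral>\<^sup>+y. ennreal (\<bar>a (x - y)\<bar> * (b y)\<^sup>2) \<partial>lborel) \<partial>lborel)"
  by (rule nn_integral_cmult) measurable
 also have "\<dots> \<le> ennreal A * (ennreal ((l2n b)\<^sup>2) * ennreal A)"
  by (intro mult_left_mono inner) simp
 finally show ?thesis using A(2)
  by (simp add: ennreal_mult[symmetric] power_mult_distrib power2_eq_square mult_ac)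
qed

section \<open>Weighted spaces of transforms\<close>

lemma borel_measurable_cnj [measurable]: "cnj \<in> BM"
 by (intro borel_measurable_continuous_onI continuous_intros)

definition weight :: "(real \<Rightarrow> real) \<Rightarrow> bool" where
 "weight w \<longleftrightarrow> w \<in> BM \<and> (\<forall>y. 0 < w y)"

definition H :: "(real \<Rightarrow> real) \<Rightarrow> (real \<Rightarrow> complex) set" where
 "H w = {f. f \<in> BM \<and> (\<lambda>y. w y * cmod (f y)) \<in> L2}"

definition nm :: "(real \<Rightarrow> real) \<Rightarrow> (real \<Rightarrow> complex) \<Rightarrow> real" where
 "nm w f = l2n (\<lambda>y. w y * cmod (f y))"

abbreviation nd :: "(real \<Rightarrow> real) \<Rightarrow> (real \<Rightarrow> complex) \<Rightarrow> (real \<Rightarrow> complex) \<Rightarrow> real" where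
 "nd w f g \<equiv> nm w (\<lambda>y. f y - g y)"

abbreviation dq :: "(real \<Rightarrow> real) \<Rightarrow> (real \<Rightarrow> real \<Rightarrow> complex) \<Rightarrow> real \<Rightarrow> real \<Rightarrow> (real \<Rightarrow> complex) \<Rightarrow> real" where
 "dq w U \<tau> t V \<equiv> nm w (\<lambda>y. (U \<tau> y - U t y) / cr (\<tau> - t) - V y)"

abbreviation aeq :: "(real \<Rightarrow> complex) \<Rightarrow> (real \<Rightarrow> complex) \<Rightarrow> bool" where
 "aeq f g \<equiv> AE y in lborel. f y = g y"

abbreviation dint :: "(real \<Rightarrow> real \<Rightarrow> real) \<Rightarrow> ennreal" where
 "dint \<kappa> \<equiv> \<integral>\<^sup>+y. \<integral>\<^sup>+z. ennreal (\<kappa> y z) \<partial>lborel \<partial>lborel"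

text \<open>The real part of the weighted Hermitian product is the linear term in the expansion of a
  squared norm, see \<open>nm_sq_add\<close>, and so the quantity that an energy estimate has to
  bound.\<close>

definition ip :: "(real \<Rightarrow> real) \<Rightarrow> (real \<Rightarrow> complex) \<Rightarrow> (real \<Rightarrow> complex) \<Rightarrow> real" where
 "ip w f g = (LINT y|lborel. (w y)\<^sup>2 * Re (f y * cnj (g y)))"

lemma weight_measurable [measurable_dest]: "weight w \<Longrightarrow> w \<in> BM"
 by (simp add: weight_def)

lemma weight_pos: "weight w \<Longrightarrow> 0 < w y"
 by (simp add: weight_def)

lemma weight_nonneg: "weight w \<Longrightarrow> 0 \<le> w y"
 by (simp add: weight_def less_imp_le)

lemma H_measurable [measurable_dest]: "f \<in> H w \<Longrightarrow> f \<in> BM"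
 by (simp add: H_def)

lemma H_L2: "f \<in> H w \<Longrightarrow> (\<lambda>y. w y * cmod (f y)) \<in> L2"
 by (simp add: H_def)

lemma nm_nonneg [simp]: "0 \<le> nm w f"
 by (simp add: nm_def)

text \<open>Changes of weight go through this comparison: a pointwise bound, almost everywhere and
  with different functions on the two sides, transfers membership and norm at once.\<close>

lemma H_dom:
 assumes w[measurable]: "weight w" and f[measurable]: "f \<in> BM" and g: "g \<in> H w'"
  and le: "AE y in lborel. w y * cmod (f y) \<le> c * (w' y * cmod (g y))" and c: "0 \<le> c"
 shows "f \<in> H w" "nm w f \<le> c * nm w' g"
proof -
 have m: "(\<lambda>y. w y * cmod (f y)) \<in> BM" by measurable
 have ae: "AE y in lborel. \<bar>w y * cmod (f y)\<bar> \<le> c * (w' y * cmod (g y))"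
  using le weight_nonneg[OF w] by simp
 note d = L2_dom[OF m L2_scale[OF H_L2[OF g], of c] ae]
 show "f \<in> H w" using d(1) f by (simp add: H_def)
 show "nm w f \<le> c * nm w' g" using d(2) c by (simp add: nm_def l2n_scale)
qed

lemma H_cong_AE:
 assumes "weight w" "f \<in> H w" "g \<in> BM" "AE y in lborel. f y = g y"
 shows "g \<in> H w"
 by (rule H_dom(1)[OF assms(1,3,2), of 1]) (use assms(4) in auto)

lemma nm_cong_AE:
 assumes [measurable]: "weight w" "f \<in> BM" "g \<in> BM"
  and "AE y in lborel. f y = g y"
 shows "nm w f = nm w g"
 unfolding nm_def by (rule l2n_cong_AE) (use assms(4) in auto)

lemma H_add:
 assumes w: "weight w" and fg: "f \<in> H w" "g \<in> H w"
 shows "(\<lambda>y. f y + g y) \<in> H w" "nm w (\<lambda>y. f y + g y) \<le> nm w f + nm w g"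
proof -
 have [measurable]: "w \<in> BM" "f \<in> BM" "g \<in> BM"
  using assms by (auto simp: weight_def H_def)
 have le: "\<bar>w y * cmod (f y + g y)\<bar> \<le> w y * cmod (f y) + w y * cmod (g y)" for y
  using weight_nonneg[OF w, of y] norm_triangle_ineq[of "f y" "g y"]
  by (simp add: abs_mult distrib_left[symmetric] mult_left_mono)
 have m: "(\<lambda>y. w y * cmod (f y + g y)) \<in> BM" by measurable
 have ae: "AE y in lborel. \<bar>w y * cmod (f y + g y)\<bar> \<le> w y * cmod (f y) + w y * cmod (g y)"
  using le by simp
 note d = L2_dom[OF m L2_add[OF H_L2[OF fg(1)] H_L2[OF fg(2)]] ae]
 show "(\<lambda>y. f y + g y) \<in> H w" using d(1) by (simp add: H_def)
 show "nm w (\<lambda>y. f y + g y) \<le> nm w f + nm w g"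
  using d(2) l2n_add[OF H_L2[OF fg(1)] H_L2[OF fg(2)]] by (simp add: nm_def)
qed

lemma H_scale:
 assumes w: "weight w" and f: "f \<in> H w"
 shows "(\<lambda>y. c * f y) \<in> H w" "nm w (\<lambda>y. c * f y) = cmod c * nm w f"
proof -
 have eq: "(\<lambda>y. w y * cmod (c * f y)) = (\<lambda>y. cmod c * (w y * cmod (f y)))"
  by (auto simp: norm_mult)
 have "f \<in> BM" using f by (simp add: H_def)
 then show "(\<lambda>y. c * f y) \<in> H w"
  using L2_scale[OF H_L2[OF f], of "cmod c"] by (simp add: H_def eq)
 show "nm w (\<lambda>y. c * f y) = cmod c * nm w f" by (simp add: nm_def eq l2n_scale)
qed

lemma H_zero [simp]: "(\<lambda>y. 0) \<in> H w" "nm w (\<lambda>y. 0) = 0"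
 by (auto simp: H_def L2_def nm_def l2n_def)

lemma H_diff:
 assumes w: "weight w" and fg: "f \<in> H w" "g \<in> H w"
 shows "(\<lambda>y. f y - g y) \<in> H w" "nd w f g \<le> nm w f + nm w g"
 using H_add[OF w fg(1) H_scale(1)[OF w fg(2), of "-1"]] H_scale(2)[OF w fg(2), of "-1"] by auto

lemma nm_minus_commute: "nd w f g = nd w g f"
 by (simp add: nm_def norm_minus_commute)

lemma nm_tri:
 assumes w: "weight w" and "f \<in> H w" "g \<in> H w" "h \<in> H w"
 shows "nd w f h \<le> nd w f g + nd w g h"
 using H_add(2)[OF w H_diff(1)[OF w assms(2,3)] H_diff(1)[OF w assms(3,4)]] by simp

lemma nm_tri_diff:
 assumes w: "weight w" and "f \<in> H w" "g \<in> H w"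
 shows "nm w f \<le> nm w g + nd w f g"
 using H_add(2)[OF w assms(3) H_diff(1)[OF w assms(2,3)]] by simp

lemma nm_sq: "(nm w f)\<^sup>2 = (LINT y|lborel. (w y)\<^sup>2 * (cmod (f y))\<^sup>2)"
 by (simp add: nm_def l2n_sq power_mult_distrib)

lemma nn_integral_nm:
 assumes "f \<in> H w" shows "(\<integral>\<^sup>+y. ennreal ((w y * cmod (f y))\<^sup>2) \<partial>lborel) = ennreal ((nm w f)\<^sup>2)"
 using nn_integral_L2[OF H_L2[OF assms]] by (simp add: nm_def)

lemma ip_integrable:
 assumes "f \<in> H w" "g \<in> H w" "weight w"
 shows "integrable lborel (\<lambda>y. (w y)\<^sup>2 * Re (f y * cnj (g y)))"
  "integrable lborel (\<lambda>y. cr ((w y)\<^sup>2) * (f y * cnj (g y)))"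
proof -
 note [measurable] = H_measurable[OF assms(1)] H_measurable[OF assms(2)] weight_measurable[OF assms(3)]
 have i: "integrable lborel (\<lambda>y. (w y * cmod (f y)) * (w y * cmod (g y)))"
  by (intro L2_mult_integrable H_L2 assms)
 show "integrable lborel (\<lambda>y. cr ((w y)\<^sup>2) * (f y * cnj (g y)))"
 proof (rule Bochner_Integration.integrable_bound[OF i])
  show "(\<lambda>y. cr ((w y)\<^sup>2) * (f y * cnj (g y))) \<in> borel_measurable lborel"
   by measurable
 qed (auto simp: norm_mult power2_eq_square mult_ac norm_power abs_mult)
 then have "integrable lborel (\<lambda>y. Re (cr ((w y)\<^sup>2) * (f y * cnj (g y))))"
  by (rule integrable_Re)
 moreover have "Re (cr ((w y)\<^sup>2) * (f y * cnj (g y))) = (w y)\<^sup>2 * Re (f y * cnj (g y))" for y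
  by (subst Re_complex_of_real[symmetric, of "(w y)\<^sup>2"], subst times_complex.sel(1)) simp
 ultimately show "integrable lborel (\<lambda>y. (w y)\<^sup>2 * Re (f y * cnj (g y)))" by simp
qed

lemma ip_add:
 assumes "f \<in> H w" "g \<in> H w" "h \<in> H w" "weight w"
 shows "ip w (\<lambda>y. f y + g y) h = ip w f h + ip w g h"
proof -
 have "ip w (\<lambda>y. f y + g y) h
   = (LINT y|lborel. (w y)\<^sup>2 * Re (f y * cnj (h y)) + (w y)\<^sup>2 * Re (g y * cnj (h y)))"
  unfolding ip_def by (intro Bochner_Integration.integral_cong) (auto simp: algebra_simps)
 then show ?thesis using ip_integrable(1)[OF assms(1,3,4)] ip_integrable(1)[OF assms(2,3,4)]
  by (simp add: ip_def)
qed

lemma ip_CS: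
 assumes "f \<in> H w" "g \<in> H w" "weight w"
 shows "\<bar>ip w f g\<bar> \<le> nm w f * nm w g"
proof -
 have "\<bar>ip w f g\<bar> \<le> (LINT y|lborel. \<bar>(w y)\<^sup>2 * Re (f y * cnj (g y))\<bar>)"
  unfolding ip_def using integral_norm_bound[of lborel "\<lambda>y. (w y)\<^sup>2 * Re (f y * cnj (g y))"]
  by (simp only: real_norm_def)
 also have "\<dots> \<le> (LINT y|lborel. \<bar>(w y * cmod (f y)) * (w y * cmod (g y))\<bar>)"
 proof (rule integral_mono)
  show "integrable lborel (\<lambda>y. \<bar>(w y)\<^sup>2 * Re (f y * cnj (g y))\<bar>)"
   using ip_integrable(1)[OF assms] by (rule integrable_abs)
  show "integrable lborel (\<lambda>y. \<bar>(w y * cmod (f y)) * (w y * cmod (g y))\<bar>)"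
   by (intro integrable_abs L2_mult_integrable H_L2 assms)
  show "\<bar>(w y)\<^sup>2 * Re (f y * cnj (g y))\<bar> \<le> \<bar>(w y * cmod (f y)) * (w y * cmod (g y))\<bar>" for y
   using mult_left_mono[OF abs_Re_le_cmod[of "f y * cnj (g y)"], of "(w y)\<^sup>2"]
   by (simp add: abs_mult norm_mult power2_eq_square mult_ac)
 qed
 also have "\<dots> \<le> nm w f * nm w g" unfolding nm_def by (intro CS_abs H_L2 assms)
 finally show ?thesis .
qed

text \<open>With \<open>t\<close> a time step, the middle term is the production of energy and the
  last one the second order error.\<close>

lemma nm_sq_add:
 assumes "f \<in> H w" "g \<in> H w" "weight w"
 shows "(nm w (\<lambda>y. f y + cr t * g y))\<^sup>2 = (nm w f)\<^sup>2 + 2 * t * ip w g f + t\<^sup>2 * (nm w g)\<^sup>2"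
proof -
 have [simp]: "integrable lborel (\<lambda>y. (w y)\<^sup>2 * (cmod (f y))\<^sup>2)" "integrable lborel (\<lambda>y. (w y)\<^sup>2 * (cmod (g y))\<^sup>2)"
  using H_L2[OF assms(1)] H_L2[OF assms(2)] by (auto simp: L2_def power_mult_distrib)
 have "(w y)\<^sup>2 * (cmod (f y + cr t * g y))\<^sup>2
   = (w y)\<^sup>2 * (cmod (f y))\<^sup>2 + 2 * t * ((w y)\<^sup>2 * Re (g y * cnj (f y))) + t\<^sup>2 * ((w y)\<^sup>2 * (cmod (g y))\<^sup>2)" for y
  unfolding cmod_power2 by (simp add: power2_eq_square algebra_simps)
 then have "(nm w (\<lambda>y. f y + cr t * g y))\<^sup>2
   = (LINT y|lborel. (w y)\<^sup>2 * (cmod (f y))\<^sup>2 + 2 * t * ((w y)\<^sup>2 * Re (g y * cnj (f y))) + t\<^sup>2 * ((w y)\<^sup>2 * (cmod (g y))\<^sup>2))"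
  by (simp add: nm_sq)
 also have "\<dots> = (nm w f)\<^sup>2 + 2 * t * ip w g f + t\<^sup>2 * (nm w g)\<^sup>2"
  using ip_integrable(1)[OF assms(2,1,3)] by (simp add: nm_sq ip_def)
 finally show ?thesis .
qed

lemma nm_eq_0:
 assumes "f \<in> H w" "weight w" "nm w f = 0" shows "AE y in lborel. f y = 0"
proof -
 note [measurable] = H_measurable[OF assms(1)] weight_measurable[OF assms(2)]
 have "(\<integral>\<^sup>+y. ennreal ((w y * cmod (f y))\<^sup>2) \<partial>lborel) = 0"
  using nn_integral_nm[OF assms(1)] assms(3) by simp
 then have "AE y in lborel. ennreal ((w y * cmod (f y))\<^sup>2) = 0"
  by (subst (asm) nn_integral_0_iff_AE) auto
 then show ?thesis using weight_pos[OF assms(2)] by (auto elim!: eventually_mono simp: less_le)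
qed

text \<open>Fatou's lemma. The uniform bound on the norms also puts the pointwise limit into the
  space.\<close>

lemma nm_fatou:
 assumes w[measurable]: "weight w" and fn: "\<And>n::nat. f n \<in> H w" and g[measurable]: "g \<in> BM"
  and lim: "AE y in lborel. (\<lambda>n. f n y) \<longlonglongrightarrow> g y" and C: "\<And>n. nm w (f n) \<le> C"
 shows "g \<in> H w" "nm w g \<le> C"
proof -
 have [measurable]: "f n \<in> BM" for n using fn by (simp add: H_def)
 have C0: "0 \<le> C" using C[of 0] nm_nonneg[of w "f 0"] by linarith
 have "(\<integral>\<^sup>+y. ennreal ((w y * cmod (g y))\<^sup>2) \<partial>lborel)
   = (\<integral>\<^sup>+y. liminf (\<lambda>n. ennreal ((w y * cmod (f n y))\<^sup>2)) \<partial>lborel)"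
 proof (rule nn_integral_cong_AE, use lim in eventually_elim)
  fix y assume "(\<lambda>n. f n y) \<longlonglongrightarrow> g y"
  then have "(\<lambda>n. ennreal ((w y * cmod (f n y))\<^sup>2)) \<longlonglongrightarrow> ennreal ((w y * cmod (g y))\<^sup>2)"
   by (intro tendsto_intros)
  then show "ennreal ((w y * cmod (g y))\<^sup>2) = liminf (\<lambda>n. ennreal ((w y * cmod (f n y))\<^sup>2))"
   by (intro lim_imp_Liminf[symmetric]) auto
 qed
 also have "\<dots> \<le> liminf (\<lambda>n. (\<integral>\<^sup>+y. ennreal ((w y * cmod (f n y))\<^sup>2) \<partial>lborel))"
  by (rule nn_integral_liminf) measurable
 also have "\<dots> \<le> ennreal (C\<^sup>2)"
  by (rule Liminf_le, simp, rule always_eventually) (auto simp: nn_integral_nm[OF fn] intro!: ennreal_leI power_mono C)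
 finally have *: "(\<integral>\<^sup>+y. ennreal ((w y * cmod (g y))\<^sup>2) \<partial>lborel) \<le> ennreal (C\<^sup>2)" .
 have m: "(\<lambda>y. w y * cmod (g y)) \<in> BM" by measurable
 show "g \<in> H w" "nm w g \<le> C" using L2I_nn[OF m * C0] g by (auto simp: H_def nm_def)
qed

text \<open>The weighted squares converge in L^1, so a subsequence converges almost everywhere; the
  strictly positive weight is then divided out.\<close>

lemma nm_conv_subseq:
 assumes w[measurable]: "weight w" and fn: "\<And>n::nat. f n \<in> H w" and g: "g \<in> H w"
  and lim: "(\<lambda>n. nd w (f n) g) \<longlonglongrightarrow> 0"
 obtains r where "strict_mono r" "AE y in lborel. (\<lambda>n. f (r n) y) \<longlonglongrightarrow> g y"
proof -
 have [measurable]: "f n \<in> BM" for n using fn by (simp add: H_def)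
 note [measurable] = H_measurable[OF g] weight_measurable[OF w]
 let ?u = "\<lambda>n y. (w y * cmod (f n y - g y))\<^sup>2"
 have i: "integrable lborel (?u n)" for n
  using H_L2[OF H_diff(1)[OF w fn[of n] g]] by (simp only: L2_def mem_Collect_eq)
 have "(\<lambda>n. LINT y|lborel. norm (?u n y)) \<longlonglongrightarrow> 0"
  using tendsto_power[OF lim, of 2] by (simp add: nm_sq power_mult_distrib)
 then obtain r where r: "strict_mono r" "AE y in lborel. (\<lambda>n. ?u (r n) y) \<longlonglongrightarrow> 0"
  using tendsto_L1_AE_subseq[of lborel ?u] i by auto
 from r(2) have "AE y in lborel. (\<lambda>n. f (r n) y) \<longlonglongrightarrow> g y"
 proof eventually_elim
  fix y assume "(\<lambda>n. ?u (r n) y) \<longlonglongrightarrow> 0"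
  then have "(\<lambda>n. sqrt (?u (r n) y)) \<longlonglongrightarrow> sqrt 0" by (intro tendsto_real_sqrt)
  then have "(\<lambda>n. w y * cmod (f (r n) y - g y)) \<longlonglongrightarrow> 0" using weight_nonneg[OF w] by simp
  then have "(\<lambda>n. inverse (w y) * (w y * cmod (f (r n) y - g y))) \<longlonglongrightarrow> inverse (w y) * 0"
   by (intro tendsto_intros)
  then have "(\<lambda>n. cmod (f (r n) y - g y)) \<longlonglongrightarrow> 0" using weight_pos[OF w, of y] by (simp add: field_simps)
  then show "(\<lambda>n. f (r n) y) \<longlonglongrightarrow> g y" using LIM_zero_cancel tendsto_norm_zero_iff by blast
 qed
 with r(1) show ?thesis by (rule that)
qed

text \<open>Convergence is measured with one weight, the bound with another. The almost everywhere
  convergent subsequence forgets the first weight, and Fatou applies with the second. In this way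
  the bounds for every \<open>gw R\<close> pass from the Euler polygons to their limit.\<close>

lemma nm_lsc:
 assumes w: "weight w" and w': "weight w'" and fn: "\<And>n::nat. f n \<in> H w" "\<And>n. f n \<in> H w'"
  and g: "g \<in> H w" and lim: "(\<lambda>n. nd w (f n) g) \<longlonglongrightarrow> 0" and C: "\<And>n. nm w' (f n) \<le> C"
 shows "g \<in> H w'" "nm w' g \<le> C"
proof -
 obtain r where "strict_mono r" and r: "AE y in lborel. (\<lambda>n. f (r n) y) \<longlonglongrightarrow> g y"
  by (rule nm_conv_subseq[OF w fn(1) g lim])
 show "g \<in> H w'" "nm w' g \<le> C"
  using nm_fatou[OF w' fn(2) H_measurable[OF g] r C] by auto
qed

lemma ennreal_suminf_bounded_terms:
 fixes h :: "nat \<Rightarrow> real"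
 assumes h: "\<And>k. 0 \<le> h k" and fin: "(\<Sum>k. ennreal (h k)) \<noteq> \<infinity>"
 shows "\<exists>S\<ge>0. \<forall>k. h k \<le> S"
proof -
 obtain S where S: "(\<Sum>k. ennreal (h k)) = ennreal S" "0 \<le> S"
  using fin by (metis ennreal_cases infinity_ennreal_def)
 have "h k \<le> S" for k
 proof -
  have "(\<Sum>i\<in>{k}. ennreal (h i)) \<le> (\<Sum>k. ennreal (h k))" by (rule sum_le_suminf) auto
  then show ?thesis using S by simp
 qed
 then show ?thesis using S by blast
qed

lemma le_geometric_of_sq:
 fixes x :: real
 assumes "0 < w" "4^k * (w * x)\<^sup>2 \<le> S"
 shows "x \<le> sqrt S / w * (1/2)^k"
proof -
 have "(4::real)^k = 2^k * 2^k" by (simp flip: power_mult_distrib)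
 then have "(2^k * (w * x))\<^sup>2 \<le> S" using assms(2) by (simp only: power2_eq_square mult_ac)
 then have "2^k * (w * x) \<le> sqrt S" by (rule real_le_rsqrt)
 then have le: "(1/2)^k * (2^k * (w * x)) \<le> (1/2)^k * sqrt S" by (rule mult_left_mono) simp
 define h :: real where "h = (1/2)^k"
 have "h * 2^k = 1" by (simp add: h_def flip: power_mult_distrib)
 then have "w * x \<le> h * sqrt S" using le unfolding h_def[symmetric] mult.assoc[symmetric] by simp
 then show ?thesis using assms(1) unfolding h_def[symmetric] by (simp add: field_simps)
qed

text \<open>Riesz-Fischer with a weight. Along a subsequence with gaps below 8^(-k), the sum of 4^k
  times the squared increments has finite integral, since 4/64 = 1/16 is the ratio of a convergent
  series. The sum is therefore finite almost everywhere, which makes the increments decay like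
  2^(-k) at almost every point.\<close>

theorem H_complete:
 assumes w: "weight w" and fn: "\<And>n::nat. f n \<in> H w"
  and Cauchy: "\<And>e. 0 < e \<Longrightarrow> \<exists>N. \<forall>m\<ge>N. \<forall>n\<ge>N. nd w (f m) (f n) < e"
 obtains g where "g \<in> H w" "(\<lambda>n. nd w (f n) g) \<longlonglongrightarrow> 0"
proof -
 have [measurable]: "f n \<in> BM" for n using fn by (simp add: H_def)
 note [measurable] = weight_measurable[OF w]
 have "\<forall>k. \<exists>N. \<forall>m\<ge>N. \<forall>n\<ge>N. nd w (f m) (f n) < (1/8)^k"
  using Cauchy by simp
 then obtain N where N: "\<And>k m n. N k \<le> m \<Longrightarrow> N k \<le> n \<Longrightarrow> nd w (f m) (f n) < (1/8::real)^k"
  by metis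
 \<comment> \<open>The partial sum dominates every \<open>N i\<close> with i up to k, so
   \<open>r k\<close> and \<open>r (Suc k)\<close> both lie beyond \<open>N k\<close> without
   \<open>N\<close> being monotone; the summand k sends \<open>r\<close> to infinity.\<close>
 define r where "r k = (\<Sum>i\<le>k. N i) + k" for k
 have rN: "N k \<le> r k" "N k \<le> r (Suc k)" "k \<le> r k" for k
  using member_le_sum[of k "{..k}" N] by (auto simp: r_def)
 let ?g = "\<lambda>k y. w y * cmod (f (r (Suc k)) y - f (r k) y)"
 have "(\<integral>\<^sup>+y. (\<Sum>k. ennreal (4^k * (?g k y)\<^sup>2)) \<partial>lborel) = (\<Sum>k. (\<integral>\<^sup>+y. ennreal (4^k * (?g k y)\<^sup>2) \<partial>lborel))"
  by (rule nn_integral_suminf) measurable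
 also have "\<dots> \<le> (\<Sum>k. ennreal ((1/16)^k))"
 proof (intro suminf_le summableI)
  fix k
  have "(\<integral>\<^sup>+y. ennreal (4^k * (?g k y)\<^sup>2) \<partial>lborel) = ennreal (4^k) * (\<integral>\<^sup>+y. ennreal ((?g k y)\<^sup>2) \<partial>lborel)"
   by (subst nn_integral_cmult[symmetric]) (auto simp: ennreal_mult)
  also have "\<dots> = ennreal (4^k * (nd w (f (r (Suc k))) (f (r k)))\<^sup>2)"
   by (subst nn_integral_nm[OF H_diff(1)[OF w fn fn]]) (simp add: ennreal_mult)
  also have "\<dots> \<le> ennreal (4^k * ((1/8)^k)\<^sup>2)"
   using N[OF rN(2) rN(1), of k] by (intro ennreal_leI mult_left_mono power_mono) auto
  also have "4^k * ((1/8)^k)\<^sup>2 = (1/16::real)^k"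
   by (simp add: power2_eq_square power_mult_distrib[symmetric])
  finally show "(\<integral>\<^sup>+y. ennreal (4^k * (?g k y)\<^sup>2) \<partial>lborel) \<le> ennreal ((1/16)^k)" .
 qed
 also have "\<dots> = ennreal (\<Sum>k. (1/16)^k)"
  by (rule suminf_ennreal2) (auto intro: summable_geometric)
 also have "\<dots> < \<infinity>" by simp
 finally have "(\<integral>\<^sup>+y. (\<Sum>k. ennreal (4^k * (?g k y)\<^sup>2)) \<partial>lborel) \<noteq> \<infinity>" by simp
 then have fin_ae: "AE y in lborel. (\<Sum>k. ennreal (4^k * (?g k y)\<^sup>2)) \<noteq> \<infinity>"
  by (intro nn_integral_PInf_AE) measurable
 have conv_pt: "convergent (\<lambda>k. f (r k) y)" if fin: "(\<Sum>k. ennreal (4^k * (?g k y)\<^sup>2)) \<noteq> \<infinity>" for y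
 proof -
  obtain S where S: "0 \<le> S" "\<And>k. 4^k * (?g k y)\<^sup>2 \<le> S"
   using ennreal_suminf_bounded_terms[OF _ fin] by auto
  have b: "cmod (f (r (Suc k)) y - f (r k) y) \<le> sqrt S / w y * (1/2)^k" for k
   using S(2)[of k] weight_pos[OF w] by (intro le_geometric_of_sq)
  have "summable (\<lambda>k. f (r (Suc k)) y - f (r k) y)"
  proof (rule summable_comparison_test')
   show "summable (\<lambda>k. sqrt S / w y * (1/2)^k)" by (intro summable_mult summable_geometric) simp
   show "norm (f (r (Suc k)) y - f (r k) y) \<le> sqrt S / w y * (1/2)^k" for k by (rule b)
  qed
  then have "convergent (\<lambda>n. \<Sum>k<n. f (r (Suc k)) y - f (r k) y)"
   using summable_iff_convergent by blast
  then have "convergent (\<lambda>n. f (r n) y - f (r 0) y)" by (simp only: sum_lessThan_telescope[of "\<lambda>k. f (r k) y"])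
  then obtain L where "(\<lambda>n. f (r n) y - f (r 0) y) \<longlonglongrightarrow> L" unfolding convergent_def ..
  then have "(\<lambda>n. (f (r n) y - f (r 0) y) + f (r 0) y) \<longlonglongrightarrow> L + f (r 0) y" by (intro tendsto_add tendsto_const)
  then have "(\<lambda>n. f (r n) y) \<longlonglongrightarrow> L + f (r 0) y" by (simp only: diff_add_cancel)
  then show ?thesis unfolding convergent_def ..
 qed
 have conv: "AE y in lborel. convergent (\<lambda>k. f (r k) y)"
  using fin_ae by (rule eventually_mono) (rule conv_pt)
 define g where "g = (\<lambda>y. lim (\<lambda>k. f (r k) y))"
 have [measurable]: "g \<in> BM" unfolding g_def by measurable
 have lim: "AE y in lborel. (\<lambda>k. f (r k) y) \<longlonglongrightarrow> g y"
  using conv by (auto elim!: eventually_mono simp: g_def convergent_LIMSEQ_iff)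
 \<comment> \<open>Fatou in the second index turns the Cauchy bound into a bound for the distance to
   the pointwise limit; the shift by \<open>k + N k\<close> keeps every index beyond
   \<open>N k\<close>.\<close>
 have close: "(\<lambda>y. f n y - g y) \<in> H w \<and> nd w (f n) g \<le> (1/8)^k" if "N k \<le> n" for n k
 proof -
  have "nd w (f n) (f (r (j + k + N k))) \<le> (1/8)^k" for j
   using N[OF that, of "r (j + k + N k)"] rN(3)[of "j + k + N k"] by simp
  moreover have "AE y in lborel. (\<lambda>j. f n y - f (r (j + k + N k)) y) \<longlonglongrightarrow> f n y - g y"
   using lim
  proof eventually_elim
   fix y assume "(\<lambda>k. f (r k) y) \<longlonglongrightarrow> g y"
   then show "(\<lambda>j. f n y - f (r (j + k + N k)) y) \<longlonglongrightarrow> f n y - g y"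
    using LIMSEQ_ignore_initial_segment[of "\<lambda>k. f (r k) y" "g y" "k + N k"]
    by (intro tendsto_diff tendsto_const) (simp only: add.assoc)
  qed
  moreover have "(\<lambda>y. f n y - f (r (j + k + N k)) y) \<in> H w" for j by (intro H_diff w fn)
  ultimately show ?thesis
   using nm_fatou[OF w, of "\<lambda>j y. f n y - f (r (j + k + N k)) y" "\<lambda>y. f n y - g y" "(1/8)^k"] by auto
 qed
 have "g \<in> H w"
  using H_diff(1)[OF w fn[of "N 0"] close[of 0 "N 0", OF order_refl, THEN conjunct1]] by simp
 moreover have "(\<lambda>n. nd w (f n) g) \<longlonglongrightarrow> 0"
 proof (rule LIMSEQ_I)
  fix e :: real assume "0 < e"
  have "(1/8::real) < 1" by simp
  from real_arch_pow_inv[OF \<open>0 < e\<close> this] obtain k where k: "(1/8)^k < e" by blast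
  show "\<exists>no. \<forall>n\<ge>no. norm (nd w (f n) g - 0) < e"
  proof (intro exI[of _ "N k"] allI impI)
   fix n assume "N k \<le> n"
   from close[OF this] k show "norm (nd w (f n) g - 0) < e" by simp
  qed
 qed
 ultimately show ?thesis by (rule that)
qed

section \<open>The Fourier transform on \<open>L\<^sup>2\<close>\<close>

text \<open>After truncation to [-n, n] the positive and negative parts are densities of two
  measures that agree, with finite values, on all half-lines. The measures are equal, hence so are
  the densities almost everywhere. At each point one of the two parts is 0, so both are.\<close>

lemma AE_zero_of_interval_integrals:
 fixes g :: "real \<Rightarrow> real"
 assumes g: "\<And>R. set_integrable lborel {-R..R} g" and [measurable]: "g \<in> BM"
  and zero: "\<And>a b. a \<le> b \<Longrightarrow> (LINT x:{a..b}|lborel. g x) = 0"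
 shows "AE x in lborel. g x = 0"
proof -
 have "AE x in lborel. indicator {-real n..real n} x * g x = 0" for n :: nat
 proof -
  define h where "h x = indicator {-real n..real n} x * g x" for x
  have [measurable]: "h \<in> BM" unfolding h_def by measurable
  have hi: "integrable lborel h" using g[of "real n"] by (simp add: set_integrable_def h_def[abs_def])
  have ih: "integrable lborel (\<lambda>x. indicator {a<..} x * h x)" for a
   using integrable_mult_indicator[OF _ hi, of "{a<..}"] by simp
  have zero_tail: "(LINT x|lborel. indicator {a<..} x * h x) = 0" for a
  proof (cases "a < real n")
   case True
   define c where "c = max a (-real n)"
   have "(LINT x|lborel. indicator {a<..} x * h x) = (LINT x|lborel. indicator {c..real n} x * g x)"
    by (intro integral_cong_AE) (use AE_lborel_singleton[of c] in \<open>auto elim!: eventually_mono simp: c_def h_def indicator_def split: if_splits\<close>)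
   also have "\<dots> = (LINT x:{c..real n}|lborel. g x)" by (simp add: set_lebesgue_integral_def)
   also have "\<dots> = 0" by (rule zero) (use True in \<open>auto simp: c_def\<close>)
   finally show ?thesis .
  next
   case False
   then have "(\<lambda>x. indicator {a<..} x * h x) = (\<lambda>_. 0)" by (auto simp: h_def indicator_def)
   then show ?thesis by simp
  qed
  have pn: "(\<integral>\<^sup>+x. ennreal (h x) * indicator {a<..} x \<partial>lborel) = (\<integral>\<^sup>+x. ennreal (- h x) * indicator {a<..} x \<partial>lborel)"
   "(\<integral>\<^sup>+x. ennreal (h x) * indicator {a<..} x \<partial>lborel) < \<infinity>" for a
  proof -
   have ip: "integrable lborel (\<lambda>x. max 0 (indicator {a<..} x * h x))"
    and im: "integrable lborel (\<lambda>x. max 0 (- (indicator {a<..} x * h x)))"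
    using ih[of a] by auto
   have "(LINT x|lborel. max 0 (indicator {a<..} x * h x)) - (LINT x|lborel. max 0 (- (indicator {a<..} x * h x)))
    = (LINT x|lborel. max 0 (indicator {a<..} x * h x) - max 0 (- (indicator {a<..} x * h x)))"
    using ip im by simp
   also have "\<dots> = (LINT x|lborel. indicator {a<..} x * h x)"
    by (intro Bochner_Integration.integral_cong) auto
   finally have eq: "(LINT x|lborel. max 0 (indicator {a<..} x * h x)) = (LINT x|lborel. max 0 (- (indicator {a<..} x * h x)))"
    using zero_tail[of a] by simp
   have 1: "(\<integral>\<^sup>+x. ennreal (h x) * indicator {a<..} x \<partial>lborel) = ennreal (LINT x|lborel. max 0 (indicator {a<..} x * h x))"
    by (subst nn_integral_eq_integral[symmetric, OF ip])
     (auto intro!: nn_integral_cong simp: indicator_def ennreal_max_0 max_def ennreal_neg)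
   have 2: "(\<integral>\<^sup>+x. ennreal (- h x) * indicator {a<..} x \<partial>lborel) = ennreal (LINT x|lborel. max 0 (- (indicator {a<..} x * h x)))"
    by (subst nn_integral_eq_integral[symmetric, OF im])
     (auto intro!: nn_integral_cong simp: indicator_def ennreal_max_0 max_def ennreal_neg)
   show "(\<integral>\<^sup>+x. ennreal (h x) * indicator {a<..} x \<partial>lborel) = (\<integral>\<^sup>+x. ennreal (- h x) * indicator {a<..} x \<partial>lborel)"
    unfolding 1 2 eq ..
   show "(\<integral>\<^sup>+x. ennreal (h x) * indicator {a<..} x \<partial>lborel) < \<infinity>" unfolding 1 by simp
  qed
  have "density lborel (\<lambda>x. ennreal (h x)) = density lborel (\<lambda>x. ennreal (- h x))"
   by (rule measure_eqI_lessThan) (use pn in \<open>auto simp: emeasure_density\<close>)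
  then have "AE x in lborel. ennreal (h x) = ennreal (- h x)"
   by (subst (asm) sigma_finite_measure.density_unique_iff[OF sigma_finite_lborel]) auto
  moreover have "h x = 0" if "ennreal (h x) = ennreal (- h x)" for x
   using that by (cases "0 \<le> h x") (auto simp: ennreal_neg ennreal_eq_0_iff)
  ultimately show ?thesis unfolding h_def[symmetric] by (auto elim!: eventually_mono)
 qed
 then have "AE x in lborel. \<forall>n. indicator {-real n..real n} x * g x = 0"
  by (subst AE_all_countable) blast
 then show ?thesis
 proof eventually_elim
  fix x assume *: "\<forall>n. indicator {-real n..real n} x * g x = 0"
  obtain n where "\<bar>x\<bar> \<le> real n" using real_arch_simple by blast
  then have "x \<in> {-real n..real n}" by auto
  then show "g x = 0" using *[rule_format, of n] by simp
 qed
qed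

section \<open>The transform of integrable functions\<close>

abbreviation "one \<equiv> (\<lambda>_::real. 1::real)"

lemma weight_one [simp]: "weight one"
 by (simp add: weight_def)

text \<open>The sign \<open>c\<close> of the phase covers both directions: \<open>-1\<close> is the
  unitary transform, \<open>1\<close> its inverse.\<close>

definition ft :: "real \<Rightarrow> (real \<Rightarrow> complex) \<Rightarrow> real \<Rightarrow> complex" where
 "ft c f k = (LINT x|lborel. iexp (c * x * k) * f x) / cr (sqrt (2 * pi))"

lemma ft_integrable:
 assumes "integrable lborel f"
 shows "integrable lborel (\<lambda>x. iexp (c * x * k) * f x)"
proof (rule Bochner_Integration.integrable_bound[OF assms])
 have [measurable]: "f \<in> BM" using assms by auto
 show "(\<lambda>x. iexp (c * x * k) * f x) \<in> borel_measurable lborel" by measurable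
qed (simp add: norm_mult)

lemma ft_measurable [measurable]:
 assumes [measurable]: "f \<in> BM"
 shows "ft c f \<in> BM"
 unfolding ft_def by measurable

lemma sqrt_2pi: "1 \<le> sqrt (2 * pi)"
 using pi_ge_two by simp

lemma ft_bound:
 assumes "integrable lborel f"
 shows "cmod (ft c f k) \<le> (LINT x|lborel. cmod (f x))"
proof -
 have "cmod (LINT x|lborel. iexp (c * x * k) * f x) \<le> (LINT x|lborel. cmod (iexp (c * x * k) * f x))"
  by (rule integral_norm_bound)
 also have "\<dots> = (LINT x|lborel. cmod (f x))" by (simp add: norm_mult)
 finally have le: "cmod (LINT x|lborel. iexp (c * x * k) * f x) \<le> (LINT x|lborel. cmod (f x))" .
 have "cmod (ft c f k) = cmod (LINT x|lborel. iexp (c * x * k) * f x) / sqrt (2 * pi)"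
  by (simp add: ft_def norm_divide)
 also have "\<dots> \<le> (LINT x|lborel. cmod (f x)) / 1"
  using le sqrt_2pi by (intro frac_le) auto
 finally show ?thesis by simp
qed

lemma ft_cnj: "cnj (ft c f k) = ft (-c) (\<lambda>x. cnj (f x)) k"
proof -
 have "cnj (LINT x|lborel. iexp (c * x * k) * f x) = (LINT x|lborel. cnj (iexp (c * x * k) * f x))"
  by (rule Bochner_Integration.integral_cnj[symmetric])
 also have "\<dots> = (LINT x|lborel. iexp (- c * x * k) * cnj (f x))"
  by (intro Bochner_Integration.integral_cong) (auto simp: exp_cnj)
 finally show ?thesis by (simp only: ft_def complex_cnj_divide complex_cnj_complex_of_real)
qed

lemma ft_add:
 assumes "integrable lborel f" "integrable lborel g"
 shows "ft c (\<lambda>x. f x + g x) k = ft c f k + ft c g k"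
 using ft_integrable[OF assms(1), of c k] ft_integrable[OF assms(2), of c k]
 by (simp add: ft_def distrib_left add_divide_distrib)

lemma ft_cmult: "ft c (\<lambda>x. a * f x) k = a * ft c f k"
proof -
 have "(LINT x|lborel. iexp (c * x * k) * (a * f x)) = (LINT x|lborel. a * (iexp (c * x * k) * f x))"
  by (simp only: mult_ac)
 then show ?thesis unfolding ft_def by simp
qed

lemma ft_diff:
 assumes "integrable lborel f" "integrable lborel g"
 shows "ft c (\<lambda>x. f x - g x) k = ft c f k - ft c g k"
 using ft_add[OF assms(1), of "\<lambda>x. -1 * g x" c k] assms(2) ft_cmult[of c "-1" g k] by simp

lemma ft_cong_AE:
 assumes [measurable]: "f \<in> BM" "g \<in> BM" and "AE x in lborel. f x = g x"
 shows "ft c f k = ft c g k"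
proof -
 have "(LINT x|lborel. iexp (c * x * k) * f x) = (LINT x|lborel. iexp (c * x * k) * g x)"
  by (rule integral_cong_AE) (measurable, use assms(3) in \<open>auto elim!: eventually_mono\<close>)
 then show ?thesis by (simp add: ft_def)
qed

text \<open>The multiplication formula, by Fubini. The L^2 theory below comes from testing it
  against Gaussians, whose transforms are explicit.\<close>

lemma ft_swap:
 assumes f: "integrable lborel f" and h: "integrable lborel h"
 shows "(LINT k|lborel. ft c f k * h k) = (LINT x|lborel. f x * ft c h x)"
proof -
 have [measurable]: "f \<in> BM" "h \<in> BM" using f h by auto
 let ?F = "\<lambda>(k, x). iexp (c * x * k) * f x * h k"
 have "integrable (lborel \<Otimes>\<^sub>M lborel) ?F"
 proof (rule lborel_pair.Fubini_integrable)
  show "?F \<in> borel_measurable (lborel \<Otimes>\<^sub>M lborel)" by measurable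
  show "integrable lborel (\<lambda>k. LINT x|lborel. norm (?F (k, x)))"
   using h by (simp add: norm_mult)
  show "AE k in lborel. integrable lborel (\<lambda>x. ?F (k, x))"
   using ft_integrable[OF f] by simp
 qed
 then have "integrable (lborel \<Otimes>\<^sub>M lborel) (case_prod (\<lambda>k x. iexp (c * x * k) * f x * h k))" by simp
 note fub = lborel_pair.Fubini_integral[OF this]
 have "(LINT k|lborel. ft c f k * h k)
   = (LINT k|lborel. (LINT x|lborel. iexp (c * x * k) * f x * h k)) / cr (sqrt (2 * pi))"
  by (simp add: ft_def)
 also have "\<dots> = (LINT x|lborel. (LINT k|lborel. iexp (c * x * k) * f x * h k)) / cr (sqrt (2 * pi))"
  using fub by simp
 also have "(\<lambda>x. LINT k|lborel. iexp (c * x * k) * f x * h k) = (\<lambda>x. f x * (LINT k|lborel. iexp (c * k * x) * h k))"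
  by (subst integral_mult_right_zero[symmetric]) (simp only: mult_ac)
 also have "(LINT x|lborel. f x * (LINT k|lborel. iexp (c * k * x) * h k)) / cr (sqrt (2 * pi))
   = (LINT x|lborel. f x * ft c h x)"
  by (simp add: ft_def)
 finally show ?thesis .
qed

text \<open>\<open>gs\<close> is a Gaussian damping factor in frequency, and \<open>gk\<close> the
  centred normal density of standard deviation \<open>\<delta>\<close>; by \<open>ft_gk\<close> the
  transform of the latter is the former up to 1 / sqrt(2 pi). Writing \<open>gk\<close> through
  \<open>std_normal_density\<close> lets the characteristic function of the normal law supply the
  transform.\<close>

definition gs :: "real \<Rightarrow> real \<Rightarrow> complex" where
 "gs \<delta> k = cr (exp (- (\<delta> * k)\<^sup>2 / 2))"

definition gk :: "real \<Rightarrow> real \<Rightarrow> real" where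
 "gk \<delta> y = std_normal_density (y / \<delta>) / \<delta>"

lemma gk_nonneg: "0 < \<delta> \<Longrightarrow> 0 \<le> gk \<delta> y"
 by (simp add: gk_def)

lemma gk_even: "gk \<delta> (- y) = gk \<delta> y"
 by (simp add: gk_def normal_density_def)

lemma gk_measurable [measurable]: "gk \<delta> \<in> BM"
 unfolding gk_def by measurable

lemma gs_measurable [measurable]: "gs \<delta> \<in> BM"
 unfolding gs_def by measurable

lemma gs_eq: "gs \<delta> k = cr (sqrt (2 * pi) * std_normal_density (\<delta> * k))"
proof -
 have "s * (1 / s * e) = e" if "s \<noteq> 0" for s e :: real using that by simp
 then show ?thesis unfolding gs_def std_normal_density_def by auto
qed

lemma gs_eq_gk: "0 < \<delta> \<Longrightarrow> gs \<delta> k = cr (sqrt (2 * pi) / \<delta> * gk (1 / \<delta>) k)"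
proof -
 assume "0 < \<delta>"
 then have "s / \<delta> * (D / (1 / \<delta>)) = s * D" for s D :: real by simp
 moreover have "k / (1 / \<delta>) = \<delta> * k" by simp
 ultimately show ?thesis unfolding gs_eq gk_def by (simp only:)
qed

lemma char_std: "(LINT x|lborel. iexp (t * x) * cr (std_normal_density x)) = cr (exp (- t\<^sup>2 / 2))"
proof -
 have "(LINT x|lborel. iexp (t * x) * cr (std_normal_density x)) = char std_normal_distribution t"
  unfolding char_def by (subst integral_density) (auto simp: scaleR_conv_of_real mult.commute)
 then show ?thesis by (simp add: char_std_normal_distribution)
qed

lemma gk_integrable: "0 < \<delta> \<Longrightarrow> integrable lborel (gk \<delta>)"
 using lborel_integrable_real_affine[of std_normal_density "1/\<delta>" 0] by (simp add: gk_def[abs_def])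

lemma gk_integral: "0 < \<delta> \<Longrightarrow> (LINT y|lborel. gk \<delta> y) = 1"
 using lborel_integral_real_affine[of "1/\<delta>" std_normal_density 0] by (simp add: gk_def[abs_def])

lemma gk_nn: "0 < \<delta> \<Longrightarrow> (\<integral>\<^sup>+y. ennreal \<bar>gk \<delta> y\<bar> \<partial>lborel) \<le> ennreal 1"
 using nn_integral_eq_integral[OF gk_integrable[of \<delta>]] gk_integral[of \<delta>] by (simp add: gk_nonneg)

lemma std_normal_density_le_1: "std_normal_density x \<le> 1"
proof -
 have "1 / sqrt (2 * pi) * exp (- x\<^sup>2 / 2) \<le> 1 * 1"
  using sqrt_2pi by (intro mult_mono) (auto simp: divide_le_eq_1)
 then show ?thesis by (simp add: std_normal_density_def)
qed

lemma gk_bound: "0 < \<delta> \<Longrightarrow> gk \<delta> y \<le> 1 / \<delta>"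
 unfolding gk_def by (intro divide_right_mono std_normal_density_le_1) simp

lemma char_std_scaled:
 assumes "0 < \<delta>"
 shows "(LINT k|lborel. iexp (t * k) * cr (std_normal_density (\<delta> * k)))
  = cr (exp (- (t / \<delta>)\<^sup>2 / 2) / \<delta>)"
proof -
 let ?F = "\<lambda>x. iexp ((t / \<delta>) * x) * cr (std_normal_density x)"
 have *: "iexp ((t / \<delta>) * (0 + \<delta> * k)) = iexp (t * k)" for k
 proof -
  have "(t / \<delta>) * (0 + \<delta> * k) = t * k" using assms by simp
  then show ?thesis by (simp only:)
 qed
 have "(LINT x|lborel. ?F x) = \<bar>\<delta>\<bar> *\<^sub>R (LINT k|lborel. ?F (0 + \<delta> * k))"
  using assms by (intro lborel_integral_real_affine) simp
 also have "\<dots> = cr \<delta> * (LINT k|lborel. iexp (t * k) * cr (std_normal_density (\<delta> * k)))"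
  unfolding * using assms by (simp add: scaleR_conv_of_real)
 finally have "cr \<delta> * (LINT k|lborel. iexp (t * k) * cr (std_normal_density (\<delta> * k)))
  = cr (exp (- (t / \<delta>)\<^sup>2 / 2))"
  unfolding char_std by (simp only:)
 then have "(LINT k|lborel. iexp (t * k) * cr (std_normal_density (\<delta> * k)))
  = cr (exp (- (t / \<delta>)\<^sup>2 / 2)) / cr \<delta>"
  using assms by (simp add: eq_divide_eq mult.commute)
 then show ?thesis by (simp only: of_real_divide)
qed

lemma iexp_add: "iexp (a + b) = iexp a * iexp b"
 by (simp add: distrib_left exp_add)

lemma ft_gs:
 assumes "0 < \<delta>"
 shows "ft c (\<lambda>k. iexp (a * k) * gs \<delta> k) y = cr (sqrt (2 * pi) * gk \<delta> (a + c * y))"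
proof -
 have "iexp (c * k * y) * (iexp (a * k) * gs \<delta> k)
   = cr (sqrt (2 * pi)) * (iexp ((a + c * y) * k) * cr (std_normal_density (\<delta> * k)))" for k
 proof -
  have "(a + c * y) * k = c * k * y + a * k" by (simp add: algebra_simps)
  then show ?thesis by (simp only: iexp_add gs_eq of_real_mult mult_ac)
 qed
 then have "ft c (\<lambda>k. iexp (a * k) * gs \<delta> k) y = cr (sqrt (2 * pi)) * cr (exp (- ((a + c * y) / \<delta>)\<^sup>2 / 2) / \<delta>)
   / cr (sqrt (2 * pi))"
  unfolding ft_def by (simp only: integral_mult_right_zero char_std_scaled[OF assms])
 also have "\<dots> = cr (exp (- ((a + c * y) / \<delta>)\<^sup>2 / 2) / \<delta>)"
  using sqrt_2pi by simp
 also have "exp (- ((a + c * y) / \<delta>)\<^sup>2 / 2) / \<delta> = sqrt (2 * pi) * gk \<delta> (a + c * y)"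
 proof -
  have "e / \<delta> = q * (1 / q * e / \<delta>)" if "q \<noteq> 0" for q e :: real using that by simp
  then show ?thesis unfolding gk_def std_normal_density_def by auto
 qed
 finally show ?thesis .
qed

lemma ft_gk:
 assumes "0 < \<delta>"
 shows "ft c (\<lambda>y. cr (gk \<delta> (x - y))) k = iexp (c * x * k) * gs \<delta> (c * k) / cr (sqrt (2 * pi))"
proof -
 let ?F = "\<lambda>y. iexp (c * y * k) * cr (gk \<delta> (x - y))"
 have F: "?F (x + - \<delta> * z) = iexp (c * x * k) * (iexp ((- c * \<delta> * k) * z) * cr (std_normal_density (1 * z))) / cr \<delta>" for z
 proof -
  have e1: "c * (x + - \<delta> * z) * k = c * x * k + (- c * \<delta> * k) * z" by (simp add: algebra_simps)
  have e2: "gk \<delta> (x - (x + - \<delta> * z)) = std_normal_density (1 * z) / \<delta>"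
   using assms by (simp add: gk_def)
  show ?thesis unfolding e1 e2 iexp_add of_real_divide by (simp add: divide_inverse mult_ac)
 qed
 have "(LINT y|lborel. ?F y) = \<bar>- \<delta>\<bar> *\<^sub>R (LINT z|lborel. ?F (x + - \<delta> * z))"
  using assms by (intro lborel_integral_real_affine) simp
 also have "\<dots> = cr \<delta> * (iexp (c * x * k) * cr (exp (- ((- c * \<delta> * k) / 1)\<^sup>2 / 2) / 1) / cr \<delta>)"
  unfolding F using assms by (simp only: scaleR_conv_of_real integral_mult_right_zero integral_divide_zero char_std_scaled abs_minus_cancel abs_of_pos zero_less_one)
 also have "\<dots> = iexp (c * x * k) * gs \<delta> (c * k)"
  using assms by (simp add: gs_def mult_ac)
 finally show ?thesis unfolding ft_def by (simp only:)
qed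

lemma ennreal_norm_integral_le:
 fixes f :: "real \<Rightarrow> 'a::{banach, second_countable_topology}"
 shows "ennreal (norm (LINT x|M. f x)) \<le> (\<integral>\<^sup>+x. ennreal (norm (f x)) \<partial>M)"
 by (cases "integrable M f") (auto simp: integral_norm_bound_ennreal not_integrable_integral_eq)

lemma gs_integrable: "0 < \<delta> \<Longrightarrow> integrable lborel (gs \<delta>)"
proof -
 assume \<delta>: "0 < \<delta>"
 then have "gs \<delta> = (\<lambda>k. cr (sqrt (2 * pi) / \<delta> * gk (1 / \<delta>) k))"
  by (intro ext gs_eq_gk)
 then show ?thesis using gk_integrable[of "1/\<delta>"] \<delta> by (simp del: real_sqrt_mult)
qed

lemma norm_gs: "cmod (gs \<delta> k) = exp (- (\<delta> * k)\<^sup>2 / 2)"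
 by (simp only: gs_def norm_of_real) simp

lemma gs_bounded: "cmod (gs \<delta> k) \<le> 1"
 by (simp add: norm_gs)

lemma cmod_in_L2: "f \<in> H one \<longleftrightarrow> f \<in> BM \<and> (\<lambda>x. cmod (f x)) \<in> L2"
 by (simp add: H_def)

lemma nm_one: "nm one f = l2n (\<lambda>x. cmod (f x))"
 by (simp add: nm_def)

text \<open>One half of Plancherel's identity. Damped by a Gaussian, the squared norm of the
  transform becomes, by the multiplication formula, the pairing of \<open>f\<close> with the
  convolution of its conjugate and a kernel of mass one, which is at most the squared norm of
  \<open>f\<close>. Removing the damping costs only Fatou's lemma.\<close>

theorem ft_contraction:
 assumes f: "f \<in> H one" and fi: "integrable lborel f" and c: "c = 1 \<or> c = -1"
 shows "ft c f \<in> H one" "nm one (ft c f) \<le> nm one f"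
proof -
 have [measurable]: "f \<in> BM" using f by (simp add: H_def)
 have bound: "(\<integral>\<^sup>+k. ennreal ((cmod (ft c f k))\<^sup>2 * cmod (gs \<delta> k)) \<partial>lborel) \<le> ennreal ((nm one f)\<^sup>2)"
  if \<delta>: "0 < \<delta>" for \<delta>
 proof -
  \<comment> \<open>With this factor \<open>ft c f k * B k\<close> is the damped square, while the
    transform of \<open>B\<close> is the Gaussian average of the conjugate of
    \<open>f\<close>.\<close>
  define B where "B k = gs \<delta> k * cnj (ft c f k)" for k
  have [measurable]: "B \<in> BM" unfolding B_def[abs_def] by measurable
  let ?M = "LINT x|lborel. cmod (f x)"
  have Bi: "integrable lborel B"
  proof (rule Bochner_Integration.integrable_bound)
   show "integrable lborel (\<lambda>k. cr ?M * gs \<delta> k)" using gs_integrable[OF \<delta>] by simp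
   have "cmod (B k) \<le> cmod (cr ?M * gs \<delta> k)" for k
    using mult_right_mono[OF ft_bound[OF fi, of c k], of "cmod (gs \<delta> k)"]
    by (simp add: B_def norm_mult mult.commute abs_of_nonneg)
   then show "AE k in lborel. cmod (B k) \<le> cmod (cr ?M * gs \<delta> k)" by simp
  qed simp
  have Bx: "ft c B x = (LINT y|lborel. cnj (f y) * cr (gk \<delta> (x - y)))" for x
  proof -
   have hi: "integrable lborel (\<lambda>k. iexp ((c * x) * k) * gs \<delta> k)"
    using ft_integrable[OF gs_integrable[OF \<delta>], of 1 "c * x"] by (simp add: mult.commute)
   have "(LINT k|lborel. iexp (c * k * x) * B k)
     = (LINT k|lborel. ft (-c) (\<lambda>y. cnj (f y)) k * (iexp ((c * x) * k) * gs \<delta> k))"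
    unfolding B_def ft_cnj by (simp only: mult_ac)
   also have "\<dots> = (LINT y|lborel. cnj (f y) * ft (-c) (\<lambda>k. iexp ((c * x) * k) * gs \<delta> k) y)"
    by (rule ft_swap[OF _ hi]) (use fi in simp)
   also have "\<dots> = (LINT y|lborel. cr (sqrt (2 * pi)) * (cnj (f y) * cr (gk \<delta> (x - y))))"
   proof (rule Bochner_Integration.integral_cong[OF refl])
    fix y
    have "gk \<delta> (c * x + - c * y) = gk \<delta> (x - y)"
     using c gk_even[of \<delta> "x - y"] by auto
    then show "cnj (f y) * ft (-c) (\<lambda>k. iexp ((c * x) * k) * gs \<delta> k) y
     = cr (sqrt (2 * pi)) * (cnj (f y) * cr (gk \<delta> (x - y)))"
     unfolding ft_gs[OF \<delta>] by (simp only: of_real_mult mult_ac)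
   qed
   also have "\<dots> = cr (sqrt (2 * pi)) * (LINT y|lborel. cnj (f y) * cr (gk \<delta> (x - y)))"
    by (rule integral_mult_right_zero)
   finally show ?thesis unfolding ft_def[of c B] using sqrt_2pi by simp
  qed
  have eqB: "ft c f k * B k = cr ((cmod (ft c f k))\<^sup>2 * cmod (gs \<delta> k))" for k
  proof -
   have g: "gs \<delta> k = cr (cmod (gs \<delta> k))" by (simp only: norm_gs) (simp only: gs_def)
   show ?thesis unfolding of_real_mult complex_norm_square B_def by (subst g) (simp only: mult_ac)
  qed
  have "(LINT k|lborel. ft c f k * B k) = (LINT x|lborel. f x * ft c B x)"
   by (rule ft_swap[OF fi Bi])
  then have "cr (LINT k|lborel. (cmod (ft c f k))\<^sup>2 * cmod (gs \<delta> k)) = (LINT x|lborel. f x * ft c B x)"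
   unfolding eqB by (simp only: integral_complex_of_real)
  moreover have i: "integrable lborel (\<lambda>k. (cmod (ft c f k))\<^sup>2 * cmod (gs \<delta> k))"
  proof (rule Bochner_Integration.integrable_bound)
   show "integrable lborel (\<lambda>k. cr (?M\<^sup>2) * gs \<delta> k)" using gs_integrable[OF \<delta>] by simp
   have "norm ((cmod (ft c f k))\<^sup>2 * cmod (gs \<delta> k)) \<le> cmod (cr (?M\<^sup>2) * gs \<delta> k)" for k
    using mult_right_mono[OF power_mono[OF ft_bound[OF fi, of c k], of 2], of "cmod (gs \<delta> k)"]
    by (simp add: norm_mult norm_power)
   then show "AE k in lborel. norm ((cmod (ft c f k))\<^sup>2 * cmod (gs \<delta> k)) \<le> cmod (cr (?M\<^sup>2) * gs \<delta> k)" by simp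
  qed simp
  moreover have "0 \<le> (LINT k|lborel. (cmod (ft c f k))\<^sup>2 * cmod (gs \<delta> k))"
   by (rule integral_nonneg_AE) simp
  ultimately have "(LINT k|lborel. (cmod (ft c f k))\<^sup>2 * cmod (gs \<delta> k)) = cmod (LINT x|lborel. f x * ft c B x)"
   by (metis norm_of_real abs_of_nonneg)
  then have "(\<integral>\<^sup>+k. ennreal ((cmod (ft c f k))\<^sup>2 * cmod (gs \<delta> k)) \<partial>lborel) = ennreal (cmod (LINT x|lborel. f x * ft c B x))"
   by (subst nn_integral_eq_integral[OF i]) auto
  also have "\<dots> \<le> (\<integral>\<^sup>+x. ennreal (cmod (f x * ft c B x)) \<partial>lborel)"
   by (rule ennreal_norm_integral_le)
  also have "\<dots> \<le> (\<integral>\<^sup>+x. \<integral>\<^sup>+y. ennreal \<bar>gk \<delta> (x - y) * cmod (f y) * cmod (f x)\<bar> \<partial>lborel \<partial>lborel)"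
  proof (rule nn_integral_mono)
   fix x
   have "ennreal (cmod (f x * ft c B x)) = ennreal (cmod (LINT y|lborel. cnj (f y) * cr (gk \<delta> (x - y)))) * ennreal (cmod (f x))"
    unfolding Bx norm_mult by (subst ennreal_mult) (auto simp: mult.commute)
   also have "\<dots> \<le> (\<integral>\<^sup>+y. ennreal (cmod (cnj (f y) * cr (gk \<delta> (x - y)))) \<partial>lborel) * ennreal (cmod (f x))"
    by (intro mult_right_mono ennreal_norm_integral_le) simp
   also have "\<dots> = (\<integral>\<^sup>+y. ennreal (cmod (cnj (f y) * cr (gk \<delta> (x - y)))) * ennreal (cmod (f x)) \<partial>lborel)"
    by (rule nn_integral_multc[symmetric]) measurable
   also have "\<dots> = (\<integral>\<^sup>+y. ennreal \<bar>gk \<delta> (x - y) * cmod (f y) * cmod (f x)\<bar> \<partial>lborel)"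
    by (intro nn_integral_cong) (simp add: ennreal_mult[symmetric] norm_mult abs_mult mult_ac)
   finally show "ennreal (cmod (f x * ft c B x)) \<le> (\<integral>\<^sup>+y. ennreal \<bar>gk \<delta> (x - y) * cmod (f y) * cmod (f x)\<bar> \<partial>lborel)" .
  qed
  also have "\<dots> \<le> ennreal (1 * l2n (\<lambda>x. cmod (f x)) * l2n (\<lambda>x. cmod (f x)))"
   by (rule tri1) (use f gk_nn[OF \<delta>] in \<open>auto simp: cmod_in_L2\<close>)
  finally show ?thesis by (simp add: nm_one power2_eq_square)
 qed
 define \<delta> where "\<delta> n = 1 / real (Suc n)" for n
 have \<delta>0: "\<delta> \<longlonglongrightarrow> 0" unfolding \<delta>_def by (rule LIMSEQ_Suc[OF lim_1_over_n])
 have "(\<integral>\<^sup>+k. ennreal ((cmod (ft c f k))\<^sup>2) \<partial>lborel)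
   = (\<integral>\<^sup>+k. liminf (\<lambda>n. ennreal ((cmod (ft c f k))\<^sup>2 * cmod (gs (\<delta> n) k))) \<partial>lborel)"
 proof (rule nn_integral_cong)
  fix k
  have "(\<lambda>n. (cmod (ft c f k))\<^sup>2 * exp (- (\<delta> n * k)\<^sup>2 / 2)) \<longlonglongrightarrow> (cmod (ft c f k))\<^sup>2 * exp (- (0 * k)\<^sup>2 / 2)"
   by (intro tendsto_intros \<delta>0) simp
  then have "(\<lambda>n. ennreal ((cmod (ft c f k))\<^sup>2 * cmod (gs (\<delta> n) k))) \<longlonglongrightarrow> ennreal ((cmod (ft c f k))\<^sup>2)"
   unfolding norm_gs by (intro tendsto_ennrealI) simp
  then show "ennreal ((cmod (ft c f k))\<^sup>2) = liminf (\<lambda>n. ennreal ((cmod (ft c f k))\<^sup>2 * cmod (gs (\<delta> n) k)))"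
   by (intro lim_imp_Liminf[symmetric]) auto
 qed
 also have "\<dots> \<le> liminf (\<lambda>n. (\<integral>\<^sup>+k. ennreal ((cmod (ft c f k))\<^sup>2 * cmod (gs (\<delta> n) k)) \<partial>lborel))"
  by (rule nn_integral_liminf) measurable
 also have "\<dots> \<le> ennreal ((nm one f)\<^sup>2)"
  by (rule Liminf_le, simp, rule always_eventually, rule allI, rule bound) (simp add: \<delta>_def)
 finally have *: "(\<integral>\<^sup>+k. ennreal ((cmod (ft c f k))\<^sup>2) \<partial>lborel) \<le> ennreal ((nm one f)\<^sup>2)" .
 have m: "(\<lambda>k. cmod (ft c f k)) \<in> BM" by measurable
 show "ft c f \<in> H one" "nm one (ft c f) \<le> nm one f"
  using L2I_nn[OF m * nm_nonneg] by (auto simp: cmod_in_L2 nm_one)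
qed

lemma integrable_powr_tail:
 assumes "1 < a"
 shows "(\<integral>\<^sup>+x. ennreal (x powr (-a)) * indicator {1..} x \<partial>lborel) < \<infinity>"
proof -
 have "(\<integral>\<^sup>+x. ennreal (x powr (-a)) * indicator {1..} x \<partial>lborel) = ennreal (0 - (- 1 / (a - 1)) * 1 powr (1 - a))"
 proof (rule nn_integral_FTC_atLeast[where F="\<lambda>x. (- 1 / (a - 1)) * x powr (1 - a)" and T=0 and a=1])
  show "DERIV (\<lambda>x. (- 1 / (a - 1)) * x powr (1 - a)) x :> x powr (-a)" if "1 \<le> x" for x
   using that assms by (auto intro!: derivative_eq_intros simp: divide_simps) (simp add: algebra_simps)
  have "((\<lambda>x. x powr (1 - a)) \<longlongrightarrow> 0) at_top"
   using assms by (intro tendsto_neg_powr filterlim_ident) auto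
  from tendsto_mult_right_zero[OF this, of "- 1 / (a - 1)"]
  show "((\<lambda>x. (- 1 / (a - 1)) * x powr (1 - a)) \<longlongrightarrow> 0) at_top" by simp
 qed auto
 then show ?thesis by simp
qed

text \<open>Outside [-1, 1] the bracket 1 + k^2 is at least k^2, so the integrand is at most a power
  of order -2\<sigma> < -1.\<close>

lemma integrable_bracket:
 assumes "1/2 < \<sigma>"
 shows "integrable lborel (\<lambda>k::real. (1 + k\<^sup>2) powr (-\<sigma>))"
proof (rule integrableI_bounded)
 have le: "(1 + k\<^sup>2) powr (-\<sigma>) \<le> indicator {-1..1} k + k powr (-(2*\<sigma>)) * indicator {1..} k + (-k) powr (-(2*\<sigma>)) * indicator {1..} (-k)" for k :: real
 proof -
  have *: "(1 + k\<^sup>2) powr (-\<sigma>) \<le> \<bar>k\<bar> powr (-(2*\<sigma>))" if "1 \<le> \<bar>k\<bar>"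
  proof -
   have "\<bar>k\<bar> powr (-(2*\<sigma>)) = (\<bar>k\<bar> powr 2) powr (-\<sigma>)" unfolding powr_powr by simp
   also have "\<bar>k\<bar> powr 2 = k\<^sup>2" using that by (simp add: powr_numeral)
   finally have e: "\<bar>k\<bar> powr (-(2*\<sigma>)) = (k\<^sup>2) powr (-\<sigma>)" .
   have "0 < k\<^sup>2" using that by (simp add: power2_eq_square) (auto simp: zero_less_mult_iff)
   then show ?thesis unfolding e using assms by (intro powr_mono2') auto
  qed
  have 1: "(1 + k\<^sup>2) powr (-\<sigma>) \<le> 1"
   using powr_mono2'[of "-\<sigma>" 1 "1 + k\<^sup>2"] assms by simp
  consider "\<bar>k\<bar> \<le> 1" | "1 < k" | "k < -1" by linarith
  then show ?thesis
   by cases (use * 1 in \<open>auto simp: indicator_def intro: order_trans[OF 1]\<close>)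
 qed
 have "(\<integral>\<^sup>+k. ennreal (norm ((1 + k\<^sup>2) powr (-\<sigma>))) \<partial>lborel)
  \<le> (\<integral>\<^sup>+k. (indicator {-1..1::real} k + ennreal (k powr (-(2*\<sigma>))) * indicator {1..} k) + ennreal ((-k) powr (-(2*\<sigma>))) * indicator {1..} (-k) \<partial>lborel)"
 proof (rule nn_integral_mono)
  fix k :: real
  have "ennreal (norm ((1 + k\<^sup>2) powr (-\<sigma>))) \<le> ennreal (indicator {-1..1} k + k powr (-(2*\<sigma>)) * indicator {1..} k + (-k) powr (-(2*\<sigma>)) * indicator {1..} (-k))"
   using le[of k] by (intro ennreal_leI) simp
  also have "ennreal (indicator {-1..1} k + k powr (-(2*\<sigma>)) * indicator {1..} k + (-k) powr (-(2*\<sigma>)) * indicator {1..} (-k))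
   = (indicator {-1..1::real} k + ennreal (k powr (-(2*\<sigma>))) * indicator {1..} k) + ennreal ((-k) powr (-(2*\<sigma>))) * indicator {1..} (-k)"
   by (subst ennreal_plus, simp, simp, subst ennreal_plus, simp, simp) (simp add: ennreal_mult ennreal_indicator del: indicator_simps)
  finally show "ennreal (norm ((1 + k\<^sup>2) powr (-\<sigma>))) \<le> (indicator {-1..1::real} k + ennreal (k powr (-(2*\<sigma>))) * indicator {1..} k) + ennreal ((-k) powr (-(2*\<sigma>))) * indicator {1..} (-k)" .
 qed
 also have "\<dots> = ((\<integral>\<^sup>+k. indicator {-1..1::real} k \<partial>lborel) + (\<integral>\<^sup>+k. ennreal (k powr (-(2*\<sigma>))) * indicator {1..} k \<partial>lborel))
   + (\<integral>\<^sup>+k. ennreal ((-k) powr (-(2*\<sigma>))) * indicator {1..} (-k) \<partial>lborel)"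
  by (subst nn_integral_add, measurable, subst nn_integral_add, measurable)
 also have "(\<integral>\<^sup>+k. ennreal ((-k) powr (-(2*\<sigma>))) * indicator {1..} (-k) \<partial>lborel) = (\<integral>\<^sup>+k. ennreal (k powr (-(2*\<sigma>))) * indicator {1..} k \<partial>lborel)"
  using nn_reflect[of "\<lambda>k. ennreal (k powr (-(2*\<sigma>))) * indicator {1..} k" 0] by simp
 also have "(\<integral>\<^sup>+k. indicator {-1..1::real} k \<partial>lborel) + (\<integral>\<^sup>+k. ennreal (k powr (-(2*\<sigma>))) * indicator {1..} k \<partial>lborel)
   + (\<integral>\<^sup>+k. ennreal (k powr (-(2*\<sigma>))) * indicator {1..} k \<partial>lborel) < \<infinity>"
  using integrable_powr_tail[of "2*\<sigma>"] assms by (simp add: ennreal_add_eq_top less_top)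
 finally show "(\<integral>\<^sup>+k. ennreal (norm ((1 + k\<^sup>2) powr (-\<sigma>))) \<partial>lborel) < \<infinity>" .
qed simp

lemma indicator_Icc_L2: "(indicator {a..b} :: real \<Rightarrow> real) \<in> L2"
proof -
 have "integrable lborel (indicator {a..b} :: real \<Rightarrow> real)"
  by (rule integrable_real_indicator) (auto simp: emeasure_lborel_Icc_eq)
 then show ?thesis by (simp add: L2_def power2_eq_square indicator_inter_arith[symmetric])
qed

text \<open>Gaussian averages of the indicator of [a, b] converge to it off the endpoints. Their
  pairings with \<open>h\<close> vanish by Fubini, hence so does the limit pairing, and
  \<open>AE_zero_of_interval_integrals\<close> applies to real and imaginary parts.\<close>

theorem AE_zero_of_gk:
 assumes h: "h \<in> H one"
  and zero: "\<And>\<delta> x. 0 < \<delta> \<Longrightarrow> (LINT y|lborel. h y * cr (gk \<delta> (x - y))) = 0"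
 shows "AE y in lborel. h y = 0"
proof -
 have [measurable]: "h \<in> BM" using h by (simp add: H_def)
 have hL2: "(\<lambda>y. cmod (h y)) \<in> L2" using h by (simp add: cmod_in_L2)
 have main: "(LINT y|lborel. h y * cr (indicator {a..b} y)) = 0" if ab: "a \<le> b" for a b
 proof -
  define \<delta> where "\<delta> n = 1 / real (Suc n)" for n
  have \<delta>0: "\<delta> \<longlonglongrightarrow> 0" unfolding \<delta>_def by (rule LIMSEQ_Suc[OF lim_1_over_n])
  have \<delta>: "0 < \<delta> n" "\<delta> n \<le> 1" for n by (auto simp: \<delta>_def)
  define \<Phi> where "\<Phi> n y = (LINT x|lborel. indicator {a..b} x * gk (\<delta> n) (x - y))" for n y
  have [measurable]: "\<Phi> n \<in> BM" for n unfolding \<Phi>_def[abs_def] by measurable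
  have ind: "(indicator {a..b} :: real \<Rightarrow> real) \<in> L2"
   by (rule indicator_Icc_L2)
  have \<Phi>_zero: "(LINT y|lborel. h y * cr (\<Phi> n y)) = 0" for n
  proof -
   let ?F = "\<lambda>x y. h y * cr (gk (\<delta> n) (x - y)) * cr (indicator {a..b} x)"
   have "integrable (lborel \<Otimes>\<^sub>M lborel) (case_prod ?F)"
   proof (rule integrableI_bounded)
    show "case_prod ?F \<in> borel_measurable (lborel \<Otimes>\<^sub>M lborel)" by measurable
    have "(\<integral>\<^sup>+p. ennreal (norm (case_prod ?F p)) \<partial>(lborel \<Otimes>\<^sub>M lborel))
      = (\<integral>\<^sup>+x. \<integral>\<^sup>+y. ennreal (norm (?F x y)) \<partial>lborel \<partial>lborel)"
     by (subst lborel.nn_integral_fst[symmetric]) auto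
    also have "\<dots> = (\<integral>\<^sup>+x. \<integral>\<^sup>+y. ennreal \<bar>gk (\<delta> n) (x - y) * cmod (h y) * indicator {a..b} x\<bar> \<partial>lborel \<partial>lborel)"
     by (intro nn_integral_cong) (simp add: norm_mult abs_mult mult_ac)
    also have "\<dots> \<le> ennreal (1 * l2n (\<lambda>y. cmod (h y)) * l2n (indicator {a..b}))"
     by (rule tri1) (use hL2 ind gk_nn[OF \<delta>(1)] in auto)
    also have "\<dots> < \<infinity>" by simp
    finally show "(\<integral>\<^sup>+p. ennreal (norm (case_prod ?F p)) \<partial>(lborel \<Otimes>\<^sub>M lborel)) < \<infinity>" .
   qed
   then have "(LINT y|lborel. (LINT x|lborel. ?F x y)) = (LINT x|lborel. (LINT y|lborel. ?F x y))"
    by (rule lborel_pair.Fubini_integral)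
   also have "\<dots> = 0"
    using zero[OF \<delta>(1)] by (simp only: integral_mult_left_zero mult_zero_left integral_zero)
   finally have "(LINT y|lborel. (LINT x|lborel. ?F x y)) = 0" .
   moreover have "(LINT x|lborel. ?F x y) = h y * cr (\<Phi> n y)" for y
   proof -
    have "(LINT x|lborel. ?F x y) = (LINT x|lborel. h y * cr (indicator {a..b} x * gk (\<delta> n) (x - y)))"
     by (simp only: of_real_mult mult_ac)
    also have "\<dots> = h y * cr (\<Phi> n y)"
     unfolding \<Phi>_def by (simp only: integral_mult_right_zero integral_complex_of_real)
    finally show ?thesis .
   qed
   ultimately show ?thesis by simp
  qed
  have \<Phi>_eq: "\<Phi> n y = (LINT z|lborel. indicator {a..b} (y + \<delta> n * z) * std_normal_density z)" for n y
  proof -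
   have "\<Phi> n y = \<bar>\<delta> n\<bar> *\<^sub>R (LINT z|lborel. indicator {a..b} (y + \<delta> n * z) * gk (\<delta> n) (y + \<delta> n * z - y))"
    unfolding \<Phi>_def using \<delta>(1)[of n] by (intro lborel_integral_real_affine) simp
   also have "(\<lambda>z. indicator {a..b} (y + \<delta> n * z) * gk (\<delta> n) (y + \<delta> n * z - y))
     = (\<lambda>z. indicator {a..b} (y + \<delta> n * z) * std_normal_density z / \<delta> n)"
    using \<delta>(1)[of n] by (simp add: gk_def)
   finally show ?thesis using \<delta>(1)[of n] by simp
  qed
  have sdi: "integrable lborel std_normal_density" by simp
  have \<Phi>_lim: "(\<lambda>n. \<Phi> n y) \<longlonglongrightarrow> indicator {a..b} y" if y: "y \<noteq> a" "y \<noteq> b" for y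
  proof -
   have "(\<lambda>n. LINT z|lborel. indicator {a..b} (y + \<delta> n * z) * std_normal_density z)
     \<longlonglongrightarrow> (LINT z|lborel. indicator {a..b} y * std_normal_density z)"
   proof (rule integral_dominated_convergence[OF _ _ sdi])
    show "AE z in lborel. (\<lambda>n. indicator {a..b} (y + \<delta> n * z) * std_normal_density z)
     \<longlonglongrightarrow> indicator {a..b} y * std_normal_density z"
    proof (rule AE_I2, rule tendsto_mult[OF _ tendsto_const])
     fix z
     have l: "(\<lambda>n. y + \<delta> n * z) \<longlonglongrightarrow> y + 0 * z" by (intro tendsto_add tendsto_mult tendsto_const \<delta>0)
     have "\<forall>\<^sub>F n in sequentially. indicator {a..b} (y + \<delta> n * z) = (indicator {a..b} y :: real)"
     proof -
      consider "y < a" | "a < y" "y < b" | "b < y" using y by linarith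
      then show ?thesis
      proof cases
       case 1
       then have "\<forall>\<^sub>F n in sequentially. y + \<delta> n * z < a" using order_tendstoD(2)[OF l] by simp
       then show ?thesis using 1 by (auto elim!: eventually_mono)
      next
       case 2
       then have "\<forall>\<^sub>F n in sequentially. a < y + \<delta> n * z" "\<forall>\<^sub>F n in sequentially. y + \<delta> n * z < b"
        using order_tendstoD[OF l] by simp_all
       then show ?thesis by eventually_elim (use 2 in auto)
      next
       case 3
       then have "\<forall>\<^sub>F n in sequentially. b < y + \<delta> n * z" using order_tendstoD(1)[OF l] by simp
       then show ?thesis using 3 by (auto elim!: eventually_mono)
      qed
     qed
     then show "(\<lambda>n. indicator {a..b} (y + \<delta> n * z)) \<longlonglongrightarrow> (indicator {a..b} y :: real)"
      by (rule tendsto_eventually)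
    qed
    show "AE z in lborel. norm (indicator {a..b} (y + \<delta> n * z) * std_normal_density z) \<le> std_normal_density z" for n
     by (simp add: indicator_def)
   qed auto
   then show ?thesis unfolding \<Phi>_eq by simp
  qed
  define L where "L = max \<bar>a\<bar> \<bar>b\<bar>"
  \<comment> \<open>The majorant has to be square integrable in y, because \<open>h\<close> is only
    in L^2. Where the integrand is nonzero, y = x - \<delta> z with x in [a, b] and \<delta> \<le>
    1, so y^2 \<le> 2 L^2 + 2 z^2; the mean of 1 + 2 L^2 + 2 z^2 under the normal law is 3 + 2
    L^2.\<close>
  have \<Phi>_bd: "\<bar>\<Phi> n y\<bar> \<le> (3 + 2 * L\<^sup>2) / (1 + y\<^sup>2)" for n y
  proof -
   have i2: "integrable lborel (\<lambda>z. std_normal_density z * z ^ 2)"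
    using integrable_std_normal_moment[of 2] .
   have m2: "(LINT z|lborel. std_normal_density z * z ^ 2) = 1"
    using integral_std_normal_moment_even[of 1] by (simp add: numeral_2_eq_2)
   have nn: "0 \<le> \<Phi> n y" unfolding \<Phi>_eq by (rule integral_nonneg_AE) simp
   have "(1 + y\<^sup>2) * \<Phi> n y = (LINT z|lborel. (1 + y\<^sup>2) * (indicator {a..b} (y + \<delta> n * z) * std_normal_density z))"
    unfolding \<Phi>_eq by (rule integral_mult_right_zero[symmetric])
   also have "\<dots> \<le> (LINT z|lborel. (1 + 2 * L\<^sup>2) * std_normal_density z + 2 * (std_normal_density z * z\<^sup>2))"
   proof (rule integral_mono)
    show "integrable lborel (\<lambda>z. (1 + y\<^sup>2) * (indicator {a..b} (y + \<delta> n * z) * std_normal_density z))"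
    proof (intro integrable_mult_right Bochner_Integration.integrable_bound[OF sdi])
     show "AE z in lborel. norm (indicator {a..b} (y + \<delta> n * z) * std_normal_density z) \<le> norm (std_normal_density z)"
      by (simp add: indicator_def)
    qed measurable
    show "integrable lborel (\<lambda>z. (1 + 2 * L\<^sup>2) * std_normal_density z + 2 * (std_normal_density z * z\<^sup>2))"
     using i2 by simp
    fix z
    show "(1 + y\<^sup>2) * (indicator {a..b} (y + \<delta> n * z) * std_normal_density z)
      \<le> (1 + 2 * L\<^sup>2) * std_normal_density z + 2 * (std_normal_density z * z\<^sup>2)"
    proof (cases "y + \<delta> n * z \<in> {a..b}")
     case True
     define x where "x = y + \<delta> n * z"
     have "\<bar>x\<bar> \<le> \<bar>L\<bar>" using True by (auto simp: L_def x_def)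
     then have x2: "x\<^sup>2 \<le> L\<^sup>2" by (simp add: abs_le_square_iff)
     have dz: "(\<delta> n * z)\<^sup>2 \<le> z\<^sup>2"
     proof -
      have "(\<delta> n)\<^sup>2 * z\<^sup>2 \<le> 1 * z\<^sup>2"
       using \<delta>[of n] by (intro mult_right_mono power_le_one) auto
      then show ?thesis by (simp add: power_mult_distrib)
     qed
     have "0 \<le> (x + \<delta> n * z)\<^sup>2" by simp
     then have "(x - \<delta> n * z)\<^sup>2 \<le> 2 * x\<^sup>2 + 2 * (\<delta> n * z)\<^sup>2" by (simp add: power2_sum power2_diff)
     moreover have "y = x - \<delta> n * z" by (simp add: x_def)
     ultimately have "y\<^sup>2 \<le> 2 * L\<^sup>2 + 2 * z\<^sup>2" using x2 dz by simp
     then have "(1 + y\<^sup>2) * std_normal_density z \<le> (1 + 2 * L\<^sup>2 + 2 * z\<^sup>2) * std_normal_density z"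
      by (intro mult_right_mono) auto
     then show ?thesis using True by (simp add: algebra_simps)
    next
     case False
     then show ?thesis by simp
    qed
   qed
   also have "\<dots> = (1 + 2 * L\<^sup>2) + 2" using i2 by (simp add: m2)
   finally have "(1 + y\<^sup>2) * \<Phi> n y \<le> 3 + 2 * L\<^sup>2" by simp
   moreover have "0 < 1 + y\<^sup>2" by (smt (verit) zero_le_power2)
   ultimately show ?thesis using nn by (simp add: pos_le_divide_eq mult.commute)
  qed
  have dom: "integrable lborel (\<lambda>y. cmod (h y) * ((3 + 2 * L\<^sup>2) / (1 + y\<^sup>2)))"
  proof (rule L2_mult_integrable[OF hL2])
   have i: "integrable lborel (\<lambda>y::real. (1 + y\<^sup>2) powr (-1))" by (rule integrable_bracket) simp
   have "integrable lborel (\<lambda>y::real. (1 / (1 + y\<^sup>2))\<^sup>2)"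
   proof (rule Bochner_Integration.integrable_bound[OF i])
    have "(1 / (1 + y\<^sup>2))\<^sup>2 \<le> (1 + y\<^sup>2) powr (-1)" for y :: real
    proof -
     have pos: "0 < 1 + y\<^sup>2" by (smt (verit) zero_le_power2)
     have "1 / (1 + y\<^sup>2) \<le> 1" using pos by (simp add: divide_le_eq_1)
     then have "(1 / (1 + y\<^sup>2)) * (1 / (1 + y\<^sup>2)) \<le> 1 * (1 / (1 + y\<^sup>2))"
      using pos by (intro mult_right_mono) auto
     then show ?thesis using pos by (simp add: power2_eq_square powr_minus divide_inverse)
    qed
    then show "AE y in lborel. norm ((1 / (1 + y\<^sup>2))\<^sup>2) \<le> norm ((1 + y\<^sup>2) powr (-1::real))" by simp
   qed measurable
   then have "(\<lambda>y. 1 / (1 + y\<^sup>2)) \<in> L2" by (simp add: L2_def)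
   from L2_scale[OF this, of "3 + 2 * L\<^sup>2"] show "(\<lambda>y. (3 + 2 * L\<^sup>2) / (1 + y\<^sup>2)) \<in> L2" by simp
  qed
  have "(\<lambda>n. LINT y|lborel. h y * cr (\<Phi> n y)) \<longlonglongrightarrow> (LINT y|lborel. h y * cr (indicator {a..b} y))"
  proof (rule integral_dominated_convergence[OF _ _ dom])
   have "AE y in lborel. y \<noteq> a" "AE y in lborel. y \<noteq> b" by (rule AE_lborel_singleton)+
   then show "AE y in lborel. (\<lambda>n. h y * cr (\<Phi> n y)) \<longlonglongrightarrow> h y * cr (indicator {a..b} y)"
    by eventually_elim (intro tendsto_mult tendsto_of_real tendsto_const \<Phi>_lim)
   show "AE y in lborel. norm (h y * cr (\<Phi> n y)) \<le> cmod (h y) * ((3 + 2 * L\<^sup>2) / (1 + y\<^sup>2))" for n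
    by (rule AE_I2) (auto simp only: norm_mult norm_of_real intro!: mult_left_mono \<Phi>_bd norm_ge_zero)
  qed measurable
  then show ?thesis unfolding \<Phi>_zero by (simp add: LIMSEQ_const_iff)
 qed
 have hi: "integrable lborel (\<lambda>y. h y * cr (indicator {a..b} y))" for a b
 proof -
  have ind: "(indicator {a..b} :: real \<Rightarrow> real) \<in> L2"
   by (rule indicator_Icc_L2)
  show ?thesis
   by (rule Bochner_Integration.integrable_bound[OF L2_mult_integrable[OF hL2 ind]]) (auto simp: norm_mult)
 qed
 have re: "Re (h y * cr (indicator {a..b} y)) = indicator {a..b} y *\<^sub>R Re (h y)"
  and im: "Im (h y * cr (indicator {a..b} y)) = indicator {a..b} y *\<^sub>R Im (h y)" for a b y by auto
 have "AE y in lborel. Re (h y) = 0"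
 proof (rule AE_zero_of_interval_integrals)
  show "set_integrable lborel {-R..R} (\<lambda>y. Re (h y))" for R
   using integrable_Re[OF hi[of "-R" R]] unfolding set_integrable_def re .
  show "(LINT x:{a..b}|lborel. Re (h x)) = 0" if "a \<le> b" for a b
   unfolding set_lebesgue_integral_def re[symmetric] using main[OF that] hi[of a b] by (subst integral_Re) auto
 qed measurable
 moreover have "AE y in lborel. Im (h y) = 0"
 proof (rule AE_zero_of_interval_integrals)
  show "set_integrable lborel {-R..R} (\<lambda>y. Im (h y))" for R
   using integrable_Im[OF hi[of "-R" R]] unfolding set_integrable_def im .
  show "(LINT x:{a..b}|lborel. Im (h x)) = 0" if "a \<le> b" for a b
   unfolding set_lebesgue_integral_def im[symmetric] using main[OF that] hi[of a b] by (subst integral_Im) auto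
 qed measurable
 ultimately show ?thesis by eventually_elim (simp add: complex_eq_iff)
qed

section \<open>The L^2 transform of real functions\<close>

definition trunc :: "real \<Rightarrow> (real \<Rightarrow> real) \<Rightarrow> real \<Rightarrow> complex" where
 "trunc R f x = cr (indicator {-R..R} x * f x)"

lemma truncated_fourier_eq: "truncated_fourier R f = ft (-1) (trunc R f)"
proof
 fix k
 have "indicator {-R..R} x *\<^sub>R (exp (- \<i> * cr (x * k)) * cr (f x)) = iexp (-1 * x * k) * trunc R f x" for x
  by (simp add: trunc_def scaleR_conv_of_real mult_ac)
 then show "truncated_fourier R f k = ft (-1) (trunc R f) k"
  unfolding truncated_fourier_def set_lebesgue_integral_def ft_def by (simp only:)
qed

lemma H_of_real: "(\<lambda>x. cr (f x)) \<in> H one \<longleftrightarrow> f \<in> L2"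
proof
 assume "(\<lambda>x. cr (f x)) \<in> H one"
 then have "(\<lambda>x. cr (f x)) \<in> BM" "(\<lambda>x. \<bar>f x\<bar>) \<in> L2"
  by (auto simp: cmod_in_L2)
 then have "(\<lambda>x. Re (cr (f x))) \<in> BM" "integrable lborel (\<lambda>x. \<bar>f x\<bar>\<^sup>2)"
  by (measurable, simp add: L2_def)
 then show "f \<in> L2" by (simp add: L2_def)
next
 assume "f \<in> L2"
 then show "(\<lambda>x. cr (f x)) \<in> H one" using L2_abs[of f] by (auto simp: cmod_in_L2 L2_def)
qed

lemma trunc_H:
 assumes f: "f \<in> L2" shows "trunc R f \<in> H one" "integrable lborel (trunc R f)"
proof -
 have [measurable]: "f \<in> BM" using f by (simp add: L2_def)
 have m: "(\<lambda>x. indicator {-R..R} x * f x) \<in> BM" by measurable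
 have "(\<lambda>x. indicator {-R..R} x * f x) \<in> L2"
  by (rule L2_dom(1)[OF m L2_abs[OF f]]) (auto simp: indicator_def)
 then show "trunc R f \<in> H one" unfolding trunc_def[abs_def] by (simp only: H_of_real)
 have "integrable lborel (\<lambda>x. indicator {-R..R} x * f x)"
  by (rule L2_mult_integrable[OF indicator_Icc_L2 f])
 then show "integrable lborel (trunc R f)" unfolding trunc_def[abs_def] by (rule integrable_of_real)
qed

lemma trunc_tendsto:
 assumes f: "f \<in> L2"
 shows "((\<lambda>R. nm one (\<lambda>x. trunc R f x - cr (f x))) \<longlongrightarrow> 0) at_top"
proof -
 have [measurable]: "f \<in> BM" using f by (simp add: L2_def)
 have fi: "integrable lborel (\<lambda>x. (f x)\<^sup>2)" using f by (simp add: L2_def)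
 let ?s = "\<lambda>R x. (cmod (trunc R f x - cr (f x)))\<^sup>2"
 have s: "?s R x = (1 - indicator {-R..R} x) * (f x)\<^sup>2" for R x
  by (simp add: trunc_def indicator_def)
 have "((\<lambda>R. LINT x|lborel. ?s R x) \<longlongrightarrow> (LINT (x::real)|lborel. 0)) at_top"
 proof (rule integral_dominated_convergence_at_top[where w="\<lambda>x. (f x)\<^sup>2"])
  show "\<forall>\<^sub>F R in at_top. AE x in lborel. norm (?s R x) \<le> (f x)\<^sup>2"
   unfolding s by (intro always_eventually allI AE_I2) (simp add: indicator_def)
  show "AE x in lborel. ((\<lambda>R. ?s R x) \<longlongrightarrow> 0) at_top"
  proof (rule AE_I2)
   fix x
   have "\<forall>\<^sub>F R in at_top. ?s R x = 0"
    unfolding s using eventually_ge_at_top[of "\<bar>x\<bar>"] by eventually_elim (auto simp: indicator_def)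
   then show "((\<lambda>R. ?s R x) \<longlongrightarrow> 0) at_top" by (rule tendsto_eventually)
  qed
  show "?s R \<in> borel_measurable lborel" for R unfolding trunc_def by measurable
 qed (use fi in simp_all)
 then have "((\<lambda>R. sqrt (LINT x|lborel. ?s R x)) \<longlongrightarrow> sqrt 0) at_top"
  by (intro tendsto_real_sqrt) simp
 then show ?thesis by (simp add: nm_def l2n_def)
qed

lemma square_integrable_complex: "square_integrable g \<longleftrightarrow> g \<in> H one" for g :: "real \<Rightarrow> complex"
 by (auto simp: square_integrable_def cmod_in_L2 L2_def)

lemma square_integrable_real: "square_integrable f \<longleftrightarrow> f \<in> L2" for f :: "real \<Rightarrow> real"
 by (simp add: square_integrable_def L2_def)

lemma ft_trunc_H: "f \<in> L2 \<Longrightarrow> ft (-1) (trunc R f) \<in> H one"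
 by (rule ft_contraction(1)) (auto intro: trunc_H)

lemma has_fourier_iff:
 assumes f: "f \<in> L2"
 shows "has_fourier f g \<longleftrightarrow> g \<in> H one \<and> ((\<lambda>R. nd one (ft (-1) (trunc R f)) g) \<longlongrightarrow> 0) at_top"
proof (cases "g \<in> H one")
 case True
 let ?n = "\<lambda>R. nd one (ft (-1) (trunc R f)) g"
 have eq: "(\<integral>\<^sup>+k. ennreal ((cmod (truncated_fourier R f k - g k))\<^sup>2) \<partial>lborel) = ennreal ((?n R)\<^sup>2)" for R
  using nn_integral_nm[OF H_diff(1)[OF weight_one ft_trunc_H[OF f] True], of R]
  by (simp add: truncated_fourier_eq)
 have "((\<lambda>R. ennreal ((?n R)\<^sup>2)) \<longlongrightarrow> 0) at_top \<longleftrightarrow> ((\<lambda>R. (?n R)\<^sup>2) \<longlongrightarrow> 0) at_top"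
  using tendsto_ennreal_iff[of "\<lambda>R. (?n R)\<^sup>2" at_top 0] by simp
 also have "\<dots> \<longleftrightarrow> (?n \<longlongrightarrow> 0) at_top"
 proof
  assume "((\<lambda>R. (?n R)\<^sup>2) \<longlongrightarrow> 0) at_top"
  then have "((\<lambda>R. sqrt ((?n R)\<^sup>2)) \<longlongrightarrow> sqrt 0) at_top" by (rule tendsto_real_sqrt)
  then show "(?n \<longlongrightarrow> 0) at_top" by simp
 next
  assume "(?n \<longlongrightarrow> 0) at_top"
  from tendsto_power[OF this, of 2] show "((\<lambda>R. (?n R)\<^sup>2) \<longlongrightarrow> 0) at_top" by simp
 qed
 finally show ?thesis using True by (simp add: has_fourier_def square_integrable_complex eq)
next
 case False
 then show ?thesis by (simp add: has_fourier_def square_integrable_complex)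
qed

lemma tendsto_0_le:
 fixes f g :: "'a \<Rightarrow> real"
 assumes "(g \<longlongrightarrow> 0) F" "\<And>x. 0 \<le> f x" "\<And>x. f x \<le> g x"
 shows "(f \<longlongrightarrow> 0) F"
 by (rule tendsto_sandwich[OF _ _ tendsto_const assms(1)]) (auto intro!: always_eventually assms)

text \<open>Truncations converge to \<open>f\<close> in L^2, and \<open>ft_contraction\<close> makes
  their transforms Cauchy. Completeness gives a limit along integer radii; the bound by
  \<open>?r R\<close> then recovers the limit along all real radii, which is what
  \<open>has_fourier\<close> asks for.\<close>

theorem fourier_exists:
 assumes f: "f \<in> L2" shows "\<exists>g. has_fourier f g"
proof -
 let ?T = "\<lambda>R. ft (-1) (trunc R f)"
 let ?r = "\<lambda>R. nm one (\<lambda>x. trunc R f x - cr (f x))"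
 have fH: "(\<lambda>x. cr (f x)) \<in> H one" using f by (simp only: H_of_real)
 have T: "nd one (?T R) (?T R') \<le> ?r R + ?r R'" for R R'
 proof -
  have "nd one (?T R) (?T R') = nm one (ft (-1) (\<lambda>x. trunc R f x - trunc R' f x))"
  proof -
   have "ft (-1) (\<lambda>x. trunc R f x - trunc R' f x) = (\<lambda>k. ?T R k - ?T R' k)"
    by (intro ext ft_diff trunc_H f)
   then show ?thesis by (simp only:)
  qed
  also have "\<dots> \<le> nm one (\<lambda>x. trunc R f x - trunc R' f x)"
   by (rule ft_contraction(2)) (auto intro!: trunc_H f H_diff(1))
  also have "\<dots> \<le> ?r R + nm one (\<lambda>x. cr (f x) - trunc R' f x)"
   by (rule nm_tri[OF weight_one trunc_H(1)[OF f] fH trunc_H(1)[OF f]])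
  finally show ?thesis by (simp only: nm_minus_commute[of one "\<lambda>x. cr (f x)"])
 qed
 have rn: "(\<lambda>n. ?r (real n)) \<longlonglongrightarrow> 0"
  by (rule filterlim_compose[OF trunc_tendsto[OF f] filterlim_real_sequentially])
 obtain g where g: "g \<in> H one" "(\<lambda>n. nd one (?T (real n)) g) \<longlonglongrightarrow> 0"
 proof (rule H_complete[OF weight_one])
  show "?T (real n) \<in> H one" for n by (rule ft_trunc_H[OF f])
  fix e :: real assume "0 < e"
  then have "\<forall>\<^sub>F n in sequentially. ?r (real n) < e / 2"
   using order_tendstoD(2)[OF rn, of "e/2"] by simp
  then obtain N where N: "\<And>n. N \<le> n \<Longrightarrow> ?r (real n) < e / 2" by (auto simp: eventually_sequentially)
  show "\<exists>N. \<forall>m\<ge>N. \<forall>n\<ge>N. nd one (?T (real m)) (?T (real n)) < e"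
  proof (intro exI[of _ N] allI impI)
   fix m n assume "N \<le> m" "N \<le> n"
   then show "nd one (?T (real m)) (?T (real n)) < e"
    using T[of "real m" "real n"] N[of m] N[of n] by linarith
  qed
 qed
 have le: "nd one (?T R) g \<le> ?r R" for R
 proof (rule LIMSEQ_le_const)
  have "(\<lambda>n. (?r R + ?r (real n)) + nd one (?T (real n)) g) \<longlonglongrightarrow> (?r R + 0) + 0"
   by (intro tendsto_add tendsto_const rn g(2))
  then show "(\<lambda>n. (?r R + ?r (real n)) + nd one (?T (real n)) g) \<longlonglongrightarrow> ?r R" by simp
  show "\<exists>N. \<forall>n\<ge>N. nd one (?T R) g \<le> (?r R + ?r (real n)) + nd one (?T (real n)) g"
  proof (intro exI[of _ 0] allI impI)
   fix n
   have "nd one (?T R) g \<le> nd one (?T R) (?T (real n)) + nd one (?T (real n)) g"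
    by (rule nm_tri[OF weight_one ft_trunc_H[OF f] ft_trunc_H[OF f] g(1)])
   then show "nd one (?T R) g \<le> (?r R + ?r (real n)) + nd one (?T (real n)) g"
    using T[of R "real n"] by linarith
  qed
 qed
 have "((\<lambda>R. nd one (?T R) g) \<longlongrightarrow> 0) at_top"
  by (rule tendsto_0_le[OF trunc_tendsto[OF f] nm_nonneg le])
 then show ?thesis using g(1) has_fourier_iff[OF f] by blast
qed

lemma has_fourier_fourier: "f \<in> L2 \<Longrightarrow> has_fourier f (fourier f)"
 unfolding fourier_def using fourier_exists by (rule someI_ex)

lemma has_fourier_H: "f \<in> L2 \<Longrightarrow> has_fourier f g \<Longrightarrow> g \<in> H one"
 by (simp add: has_fourier_iff)

lemma has_fourier_unique:
 assumes f: "f \<in> L2" and g: "has_fourier f g" and g': "has_fourier f g'"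
 shows "aeq g g'"
proof -
 have H: "g \<in> H one" "g' \<in> H one" using has_fourier_H[OF f] g g' by auto
 let ?T = "\<lambda>R. ft (-1) (trunc R f)"
 have "((\<lambda>R::real. nd one g g') \<longlongrightarrow> 0) at_top"
 proof (rule tendsto_0_le)
  show "((\<lambda>R. nd one (?T R) g + nd one (?T R) g') \<longlongrightarrow> 0) at_top"
   using tendsto_add[of _ 0 at_top _ 0] g g' has_fourier_iff[OF f] by fastforce
  show "nd one g g' \<le> nd one (?T R) g + nd one (?T R) g'" for R
   using nm_tri[OF weight_one H(1) ft_trunc_H[OF f] H(2), of R]
   by (simp only: nm_minus_commute[of one g])
 qed simp
 then have "nd one g g' = 0" by (simp add: tendsto_const_iff)
 then have "AE k in lborel. g k - g' k = 0" by (rule nm_eq_0[OF H_diff(1)[OF weight_one H] weight_one])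
 then show ?thesis by simp
qed

lemma has_fourier_cong:
 assumes f: "f \<in> L2" and f': "f' \<in> L2" and ae: "AE x in lborel. f x = f' x"
  and g: "has_fourier f g" and gg': "g' \<in> BM" "aeq g g'"
 shows "has_fourier f' g'"
proof -
 note [measurable] = H_measurable[OF has_fourier_H[OF f g]] gg'(1)
 have gH: "g \<in> H one" by (rule has_fourier_H[OF f g])
 have g'H: "g' \<in> H one" by (rule H_cong_AE[OF weight_one gH gg'])
 have "ft (-1) (trunc R f) k = ft (-1) (trunc R f') k" for R k
 proof (rule ft_cong_AE)
  show "AE x in lborel. trunc R f x = trunc R f' x"
   using ae by eventually_elim (simp add: trunc_def)
 qed (use trunc_H(1)[OF f] trunc_H(1)[OF f'] in \<open>auto simp: H_def\<close>)
 moreover have "nd one (ft (-1) (trunc R f)) g = nd one (ft (-1) (trunc R f)) g'" for R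
 proof (rule nm_cong_AE)
  note [measurable] = H_measurable[OF trunc_H(1)[OF f]]
  show "(\<lambda>k. ft (-1) (trunc R f) k - g k) \<in> BM"
   "(\<lambda>k. ft (-1) (trunc R f) k - g' k) \<in> BM" by measurable
  show "AE k in lborel. ft (-1) (trunc R f) k - g k = ft (-1) (trunc R f) k - g' k"
   using gg'(2) by eventually_elim simp
 qed simp
 ultimately show ?thesis using g g'H by (simp add: has_fourier_iff[OF f] has_fourier_iff[OF f'])
qed

lemma has_fourier_lincomb:
 assumes f: "f \<in> L2" "f' \<in> L2" and g: "has_fourier f g" "has_fourier f' g'"
 shows "has_fourier (\<lambda>x. a * f x + b * f' x) (\<lambda>k. cr a * g k + cr b * g' k)"
proof -
 have L: "(\<lambda>x. a * f x + b * f' x) \<in> L2" by (intro L2_add L2_scale f)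
 have gH: "g \<in> H one" "g' \<in> H one" using has_fourier_H f g by auto
 let ?T = "\<lambda>f R. ft (-1) (trunc R f)"
 have T: "?T (\<lambda>x. a * f x + b * f' x) R k = cr a * ?T f R k + cr b * ?T f' R k" for R k
 proof -
  have "trunc R (\<lambda>x. a * f x + b * f' x) = (\<lambda>x. cr a * trunc R f x + cr b * trunc R f' x)"
   by (auto simp: trunc_def algebra_simps)
  then show ?thesis
   using trunc_H(2)[OF f(1), of R] trunc_H(2)[OF f(2), of R] by (simp add: ft_add ft_cmult)
 qed
 have H: "(\<lambda>k. cr a * g k + cr b * g' k) \<in> H one"
  by (intro H_add(1) H_scale(1) weight_one gH)
 have "((\<lambda>R. nm one (\<lambda>k. ?T (\<lambda>x. a * f x + b * f' x) R k - (cr a * g k + cr b * g' k))) \<longlongrightarrow> 0) at_top"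
 proof (rule tendsto_0_le)
  have "((\<lambda>R. \<bar>a\<bar> * nd one (?T f R) g + \<bar>b\<bar> * nd one (?T f' R) g') \<longlongrightarrow> \<bar>a\<bar> * 0 + \<bar>b\<bar> * 0) at_top"
   using g by (intro tendsto_add tendsto_mult tendsto_const) (auto simp: has_fourier_iff f)
  then show "((\<lambda>R. \<bar>a\<bar> * nd one (?T f R) g + \<bar>b\<bar> * nd one (?T f' R) g') \<longlongrightarrow> 0) at_top" by simp
  fix R
  have D: "(\<lambda>k. ?T f R k - g k) \<in> H one" "(\<lambda>k. ?T f' R k - g' k) \<in> H one"
   by (intro H_diff(1) weight_one ft_trunc_H f gH)+
  have "(\<lambda>k. ?T (\<lambda>x. a * f x + b * f' x) R k - (cr a * g k + cr b * g' k))
   = (\<lambda>k. cr a * (?T f R k - g k) + cr b * (?T f' R k - g' k))"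
   unfolding T by (auto simp: algebra_simps)
  then show "nm one (\<lambda>k. ?T (\<lambda>x. a * f x + b * f' x) R k - (cr a * g k + cr b * g' k))
    \<le> \<bar>a\<bar> * nd one (?T f R) g + \<bar>b\<bar> * nd one (?T f' R) g'"
   using H_add(2)[OF weight_one H_scale(1)[OF weight_one D(1), of "cr a"] H_scale(1)[OF weight_one D(2), of "cr b"]]
    H_scale(2)[OF weight_one D(1), of "cr a"] H_scale(2)[OF weight_one D(2), of "cr b"] by simp
 qed simp
 then show ?thesis using H by (simp add: has_fourier_iff[OF L])
qed

lemma nm_reflect:
 assumes "g \<in> H one" shows "(\<lambda>k. cnj (g (-k))) \<in> H one" "nm one (\<lambda>k. cnj (g (-k))) = nm one g"
proof -
 have [measurable]: "g \<in> BM" using assms by (simp add: H_def)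
 have L: "(\<lambda>k. cmod (g k)) \<in> L2" using assms by (simp add: cmod_in_L2)
 show "(\<lambda>k. cnj (g (-k))) \<in> H one" using L2_reflect(1)[OF L, of 0] by (simp add: cmod_in_L2)
 show "nm one (\<lambda>k. cnj (g (-k))) = nm one g" using L2_reflect(2)[OF L, of 0] by (simp add: nm_one)
qed

text \<open>The reflected conjugate of \<open>g\<close> is again the limit of the transforms of the
  real truncations; uniqueness identifies it with \<open>g\<close>.\<close>

lemma has_fourier_hermitian:
 assumes f: "f \<in> L2" and g: "has_fourier f g"
 shows "AE k in lborel. g (-k) = cnj (g k)"
proof -
 let ?T = "\<lambda>R. ft (-1) (trunc R f)"
 have gH: "g \<in> H one" by (rule has_fourier_H[OF f g])
 have T: "cnj (?T R (-k)) = ?T R k" for R k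
 proof -
  have "cnj (?T R (-k)) = ft (-(-1)) (\<lambda>x. cnj (trunc R f x)) (-k)" by (rule ft_cnj)
  also have "\<dots> = ?T R k" by (simp add: ft_def trunc_def)
  finally show ?thesis .
 qed
 have "nm one (\<lambda>k. ?T R k - cnj (g (-k))) = nd one (?T R) g" for R
  using nm_reflect(2)[OF H_diff(1)[OF weight_one ft_trunc_H[OF f] gH], of R] by (simp add: T)
 then have "has_fourier f (\<lambda>k. cnj (g (-k)))"
  using g nm_reflect(1)[OF gH] by (simp add: has_fourier_iff[OF f])
 from has_fourier_unique[OF f g this] show ?thesis by eventually_elim simp
qed

lemma pair_CS:
 assumes "f \<in> H one" "g \<in> H one"
 shows "integrable lborel (\<lambda>x. f x * g x)" "cmod (LINT x|lborel. f x * g x) \<le> nm one f * nm one g"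
proof -
 note [measurable] = H_measurable[OF assms(1)] H_measurable[OF assms(2)]
 have L: "(\<lambda>x. cmod (f x)) \<in> L2" "(\<lambda>x. cmod (g x)) \<in> L2" using assms by (auto simp: cmod_in_L2)
 show "integrable lborel (\<lambda>x. f x * g x)"
  by (rule Bochner_Integration.integrable_bound[OF L2_mult_integrable[OF L]]) (auto simp: norm_mult)
 have "cmod (LINT x|lborel. f x * g x) \<le> (LINT x|lborel. cmod (f x * g x))" by (rule integral_norm_bound)
 also have "\<dots> = (LINT x|lborel. \<bar>cmod (f x) * cmod (g x)\<bar>)" by (simp add: norm_mult)
 also have "\<dots> \<le> nm one f * nm one g" unfolding nm_one by (rule CS_abs[OF L])
 finally show "cmod (LINT x|lborel. f x * g x) \<le> nm one f * nm one g" .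
qed

lemma pair_tendsto:
 assumes H: "\<And>R. F R \<in> H one" "G \<in> H one" "\<psi> \<in> H one" and lim: "((\<lambda>R. nm one (\<lambda>x. F R x - G x)) \<longlongrightarrow> 0) at_top"
 shows "((\<lambda>R::real. LINT x|lborel. F R x * \<psi> x) \<longlongrightarrow> (LINT x|lborel. G x * \<psi> x)) at_top"
proof (rule LIM_zero_cancel, rule tendsto_norm_zero_cancel, rule tendsto_0_le)
 show "((\<lambda>R. nm one (\<lambda>x. F R x - G x) * nm one \<psi>) \<longlongrightarrow> 0) at_top"
  using tendsto_mult_right[OF lim, of "nm one \<psi>"] by (simp add: mult.commute)
 show "norm ((LINT x|lborel. F R x * \<psi> x) - (LINT x|lborel. G x * \<psi> x)) \<le> nm one (\<lambda>x. F R x - G x) * nm one \<psi>" for R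
  using pair_CS(2)[OF H_diff(1)[OF weight_one H(1,2)] H(3), of R] pair_CS(1)[OF H(1) H(3), of R] pair_CS(1)[OF H(2,3)]
  by (simp add: left_diff_distrib)
qed simp

text \<open>The multiplication formula for truncations, passed to the limit on both sides. Since
  \<open>\<psi>\<close> is in L^1 and L^2, its transform is given by \<open>ft\<close> and is square
  integrable.\<close>

lemma fourier_pairing:
 assumes f: "f \<in> L2" and g: "has_fourier f g" and \<psi>: "\<psi> \<in> H one" "integrable lborel \<psi>"
 shows "(LINT k|lborel. g k * \<psi> k) = (LINT x|lborel. cr (f x) * ft (-1) \<psi> x)"
proof -
 have fH: "(\<lambda>x. cr (f x)) \<in> H one" using f by (simp only: H_of_real)
 have \<psi>': "ft (-1) \<psi> \<in> H one" by (rule ft_contraction(1)[OF \<psi>]) simp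
 have 1: "((\<lambda>R. LINT k|lborel. ft (-1) (trunc R f) k * \<psi> k) \<longlongrightarrow> (LINT k|lborel. g k * \<psi> k)) at_top"
  using g by (intro pair_tendsto ft_trunc_H f \<psi>) (auto simp: has_fourier_iff[OF f])
 have 2: "((\<lambda>R. LINT x|lborel. trunc R f x * ft (-1) \<psi> x) \<longlongrightarrow> (LINT x|lborel. cr (f x) * ft (-1) \<psi> x)) at_top"
  by (intro pair_tendsto trunc_H f fH \<psi>' trunc_tendsto)
 have "(LINT k|lborel. ft (-1) (trunc R f) k * \<psi> k) = (LINT x|lborel. trunc R f x * ft (-1) \<psi> x)" for R
  by (rule ft_swap[OF trunc_H(2)[OF f] \<psi>(2)])
 then show ?thesis using 1 2 tendsto_unique[OF trivial_limit_at_top_linorder] by simp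
qed

lemma gk_H:
 assumes "0 < \<delta>" shows "(\<lambda>y. cr (gk \<delta> (x - y))) \<in> H one" "integrable lborel (\<lambda>y. cr (gk \<delta> (x - y)))"
proof -
 have "integrable lborel (\<lambda>y. (gk \<delta> y)\<^sup>2)"
 proof (rule Bochner_Integration.integrable_bound)
  show "integrable lborel (\<lambda>y. 1 / \<delta> * gk \<delta> y)" using gk_integrable[OF assms] by simp
  have "(gk \<delta> y)\<^sup>2 \<le> 1 / \<delta> * gk \<delta> y" for y
   unfolding power2_eq_square using gk_bound[OF assms, of y] gk_nonneg[OF assms, of y] by (intro mult_right_mono)
  then show "AE y in lborel. norm ((gk \<delta> y)\<^sup>2) \<le> norm (1 / \<delta> * gk \<delta> y)"
   using gk_nonneg[OF assms] assms by simp
 qed measurable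
 then have "gk \<delta> \<in> L2" by (simp add: L2_def)
 then have "(\<lambda>y. gk \<delta> (x - y)) \<in> L2" by (rule L2_reflect)
 then show "(\<lambda>y. cr (gk \<delta> (x - y))) \<in> H one" by (simp only: H_of_real)
 have "integrable lborel (\<lambda>y. gk \<delta> (x - y))"
  using lborel_integrable_real_affine[OF gk_integrable[OF assms], of "-1" x] by simp
 then show "integrable lborel (\<lambda>y. cr (gk \<delta> (x - y)))" by (rule integrable_of_real)
qed

lemma gs_H:
 assumes "0 < \<delta>" shows "(\<lambda>k. iexp (a * k) * gs \<delta> k) \<in> H one" "integrable lborel (\<lambda>k. iexp (a * k) * gs \<delta> k)"
proof -
 show i: "integrable lborel (\<lambda>k. iexp (a * k) * gs \<delta> k)"
  using ft_integrable[OF gs_integrable[OF assms], of 1 a] by (simp add: mult.commute)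
 have "integrable lborel (\<lambda>k. (cmod (iexp (a * k) * gs \<delta> k))\<^sup>2)"
 proof (rule Bochner_Integration.integrable_bound[OF i])
  have "(cmod (gs \<delta> k))\<^sup>2 \<le> cmod (gs \<delta> k)" for k
   unfolding power2_eq_square using gs_bounded[of \<delta> k] by (simp add: mult_left_le)
  then show "AE k in lborel. norm ((cmod (iexp (a * k) * gs \<delta> k))\<^sup>2) \<le> norm (iexp (a * k) * gs \<delta> k)"
   by (simp add: norm_mult)
 qed measurable
 then show "(\<lambda>k. iexp (a * k) * gs \<delta> k) \<in> H one" by (simp add: cmod_in_L2 L2_def)
qed

text \<open>Both transforms are tested against Gaussians, whose transforms are explicit; no isometry
 is needed.\<close>

theorem fourier_inversion:
 assumes f: "f \<in> L2" and g: "has_fourier f g" and gi: "integrable lborel g"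
 shows "AE x in lborel. cr (f x) = ft 1 g x"
proof -
 have gH: "g \<in> H one" by (rule has_fourier_H[OF f g])
 have fH: "(\<lambda>x. cr (f x)) \<in> H one" using f by (simp only: H_of_real)
 have uH: "ft 1 g \<in> H one" by (rule ft_contraction(1)[OF gH gi]) simp
 have "AE x in lborel. cr (f x) - ft 1 g x = 0"
 proof (rule AE_zero_of_gk)
  show "(\<lambda>x. cr (f x) - ft 1 g x) \<in> H one" by (rule H_diff(1)[OF weight_one fH uH])
  fix \<delta> x :: real assume \<delta>: "0 < \<delta>"
  let ?K = "\<lambda>y. cr (gk \<delta> (x - y))" and ?s = "cr (sqrt (2 * pi))"
  let ?\<psi> = "\<lambda>k. iexp (x * k) * gs \<delta> k"
  have "(LINT k|lborel. g k * ?\<psi> k) = (LINT y|lborel. cr (f y) * ft (-1) ?\<psi> y)"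
   by (rule fourier_pairing[OF f g gs_H[OF \<delta>]])
  also have "\<dots> = (LINT y|lborel. ?s * (cr (f y) * ?K y))"
  proof (rule Bochner_Integration.integral_cong[OF refl])
   fix y
   have "gk \<delta> (x + - 1 * y) = gk \<delta> (x - y)" by simp
   then show "cr (f y) * ft (-1) ?\<psi> y = ?s * (cr (f y) * ?K y)"
    unfolding ft_gs[OF \<delta>] by (simp only: of_real_mult mult_ac)
  qed
  finally have 1: "(LINT k|lborel. g k * ?\<psi> k) = ?s * (LINT y|lborel. cr (f y) * ?K y)"
   by (simp only: integral_mult_right_zero)
  have "(LINT y|lborel. ft 1 g y * ?K y) = (LINT k|lborel. g k * ft 1 ?K k)"
   by (rule ft_swap[OF gi gk_H(2)[OF \<delta>]])
  also have "\<dots> = (LINT k|lborel. g k * ?\<psi> k / ?s)"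
   unfolding ft_gk[OF \<delta>] by simp
  finally have 2: "?s * (LINT y|lborel. ft 1 g y * ?K y) = (LINT k|lborel. g k * ?\<psi> k)"
   using sqrt_2pi by simp
  have "?s * (LINT y|lborel. cr (f y) * ?K y) = ?s * (LINT y|lborel. ft 1 g y * ?K y)"
   using 1 2 by simp
  then have "(LINT y|lborel. cr (f y) * ?K y) = (LINT y|lborel. ft 1 g y * ?K y)"
   using sqrt_2pi by simp
  then show "(LINT y|lborel. (cr (f y) - ft 1 g y) * ?K y) = 0"
   using pair_CS(1)[OF fH gk_H(1)[OF \<delta>]] pair_CS(1)[OF uH gk_H(1)[OF \<delta>]] by (simp add: left_diff_distrib)
 qed
 then show ?thesis by eventually_elim simp
qed

lemma ft_hermitian_real:
 assumes [measurable]: "g \<in> BM" and herm: "AE k in lborel. g (-k) = cnj (g k)"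
 shows "ft 1 g x = cr (Re (ft 1 g x))"
proof -
 have "cnj (ft 1 g x) = ft (-1) (\<lambda>k. cnj (g k)) x" by (rule ft_cnj)
 also have "\<dots> = ft (-1) (\<lambda>k. g (-k)) x"
  by (rule ft_cong_AE) (measurable, use herm in \<open>auto elim!: eventually_mono\<close>)
 also have "\<dots> = ft 1 g x"
  unfolding ft_def using lborel_integral_real_affine[of "-1" "\<lambda>k. iexp (1 * k * x) * g k" 0] by simp
 finally show ?thesis by (simp add: complex_eq_iff)
qed

text \<open>This direction starts from frequency and produces a real function with prescribed
  transform. \<open>g\<close> and the transform of its inverse transform have the same Gaussian
  averages, so \<open>AE_zero_of_gk\<close> identifies them.\<close>

theorem has_fourier_ft:
 assumes gH: "g \<in> H one" and gi: "integrable lborel g" and herm: "AE k in lborel. g (-k) = cnj (g k)"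
 shows "(\<lambda>x. Re (ft 1 g x)) \<in> L2" "has_fourier (\<lambda>x. Re (ft 1 g x)) g"
proof -
 let ?f = "\<lambda>x. Re (ft 1 g x)"
 have real: "cr (?f x) = ft 1 g x" for x
  using ft_hermitian_real[OF H_measurable[OF gH] herm] by simp
 have uH: "ft 1 g \<in> H one" by (rule ft_contraction(1)[OF gH gi]) simp
 then have "(\<lambda>x. cr (?f x)) \<in> H one" unfolding real .
 then show fL: "?f \<in> L2" by (simp only: H_of_real)
 obtain g' where g': "has_fourier ?f g'" using fourier_exists[OF fL] by blast
 have g'H: "g' \<in> H one" by (rule has_fourier_H[OF fL g'])
 have "AE k in lborel. g' k - g k = 0"
 proof (rule AE_zero_of_gk)
  show "(\<lambda>k. g' k - g k) \<in> H one" by (rule H_diff(1)[OF weight_one g'H gH])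
  fix \<delta> x :: real assume \<delta>: "0 < \<delta>"
  let ?K = "\<lambda>k. cr (gk \<delta> (x - k))" and ?s = "cr (sqrt (2 * pi))"
  let ?\<psi> = "\<lambda>y. iexp ((-x) * y) * gs \<delta> y"
  have gsm: "gs \<delta> (- y) = gs \<delta> y" for y by (simp add: gs_def)
  have "(LINT k|lborel. g' k * ?K k) = (LINT y|lborel. ft 1 g y * ft (-1) ?K y)"
   using fourier_pairing[OF fL g' gk_H[OF \<delta>]] unfolding real .
  also have "\<dots> = (LINT y|lborel. ft 1 g y * (?\<psi> y / ?s))"
   unfolding ft_gk[OF \<delta>] by (simp add: gsm)
  also have "\<dots> = (LINT y|lborel. ft 1 g y * ?\<psi> y) / ?s" by simp
  also have "(LINT y|lborel. ft 1 g y * ?\<psi> y) = (LINT k|lborel. g k * ft 1 ?\<psi> k)"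
   by (rule ft_swap[OF gi gs_H(2)[OF \<delta>]])
  also have "\<dots> = (LINT k|lborel. ?s * (g k * ?K k))"
  proof (rule Bochner_Integration.integral_cong[OF refl])
   fix k
   have "gk \<delta> (- x + 1 * k) = gk \<delta> (x - k)" using gk_even[of \<delta> "x - k"] by simp
   then show "g k * ft 1 ?\<psi> k = ?s * (g k * ?K k)" unfolding ft_gs[OF \<delta>] by (simp only: of_real_mult mult_ac)
  qed
  also have "\<dots> / ?s = (LINT k|lborel. g k * ?K k)" using sqrt_2pi by (simp only: integral_mult_right_zero) simp
  finally show "(LINT k|lborel. (g' k - g k) * ?K k) = 0"
   using pair_CS(1)[OF g'H gk_H(1)[OF \<delta>]] pair_CS(1)[OF gH gk_H(1)[OF \<delta>]] by (simp add: left_diff_distrib)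
 qed
 then have "aeq g' g" by eventually_elim simp
 then show "has_fourier ?f g"
  by (intro has_fourier_cong[OF fL fL _ g' H_measurable[OF gH]]) auto
qed

section \<open>Test functions and weak derivatives\<close>

text \<open>The numerator \<open>r\<close> and the pole order \<open>k\<close> make the family
  closed under differentiation: each derivative is again a bump, with the same \<open>c\<close> and
  other \<open>r\<close> and \<open>k\<close>, so smoothness reduces to a single derivative. As
  \<open>c\<close> tends to 0, the choice \<open>r\<close> = 1, \<open>k\<close> = 0 tends to the
  indicator of the open interval.\<close>

definition bump :: "real \<Rightarrow> real \<Rightarrow> real \<Rightarrow> real poly \<Rightarrow> nat \<Rightarrow> real \<Rightarrow> real" where
 "bump a b c r k x = (if a < x \<and> x < b
   then poly r x * (1 / ((x - a) * (b - x)))^k * exp (- (c * (1 / ((x - a) * (b - x))))) else 0)"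

lemma power_exp_bound:
 fixes y :: real
 assumes "0 \<le> y" "0 < m" shows "y ^ m * exp (- y) \<le> real m ^ m"
proof -
 have "y / real m \<le> exp (y / real m)" using exp_ge_add_one_self[of "y / real m"] by linarith
 then have "(y / real m) ^ m \<le> exp (y / real m) ^ m" using assms by (intro power_mono) auto
 also have "exp (y / real m) ^ m = exp y" using assms(2) by (simp add: exp_of_nat_mult[symmetric])
 finally have "y ^ m \<le> exp y * real m ^ m" using assms(2) by (simp add: power_divide pos_divide_le_eq)
 then show ?thesis by (simp add: exp_minus field_simps)
qed

text \<open>With q = (x - a)(b - x), the derivative of r q^(-k) exp(-c/q) has poles of order k, k +
  1 and k + 2; this is its numerator over q^(k + 2).\<close>

definition bump_poly :: "real \<Rightarrow> real \<Rightarrow> real \<Rightarrow> real poly \<Rightarrow> nat \<Rightarrow> real poly" where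
 "bump_poly a b c r k = (let q = [:-a, 1:] * [:b, -1:] in
   pderiv r * q * q - smult (real k) (r * pderiv q * q) + smult c (r * pderiv q))"

text \<open>The exponential beats the pole of order \<open>k\<close> with two powers to spare; the
  surplus makes the difference quotients vanish at the endpoints.\<close>

lemma bump_bound:
 assumes c: "0 < c" and ab: "a < b"
 obtains M where "0 \<le> M" "\<And>x. a < x \<Longrightarrow> x < b \<Longrightarrow> \<bar>bump a b c r k x\<bar> \<le> M * ((x - a) * (b - x))\<^sup>2"
proof -
 have "continuous_on {a..b} (poly r)" by (intro continuous_intros)
 then have "bounded (poly r ` {a..b})" by (intro compact_imp_bounded compact_continuous_image) auto
 then obtain B where B: "0 < B" "\<And>x. x \<in> {a..b} \<Longrightarrow> \<bar>poly r x\<bar> \<le> B" by (auto simp: bounded_pos)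
 let ?m = "k + 2"
 show ?thesis
 proof (rule that[of "B * (real ?m ^ ?m / c ^ ?m)"])
  fix x assume x: "a < x" "x < b"
  define q where "q = (x - a) * (b - x)"
  have q: "0 < q" using x by (simp add: q_def)
  have e: "(1/q)^k * exp (- (c * (1/q))) = q\<^sup>2 * ((c * (1/q)) ^ ?m * exp (- (c * (1/q)))) / c ^ ?m"
  proof -
   have "(c * (1/q)) ^ ?m = c ^ ?m * ((1/q)^k * (1/q)^2)" by (simp only: power_mult_distrib power_add mult_ac)
   moreover have "q\<^sup>2 * (1/q)^2 = 1" using q by (simp add: power_one_over)
   ultimately show ?thesis using c q by (simp add: field_simps)
  qed
  have "(1/q)^k * exp (- (c * (1/q))) \<le> q\<^sup>2 * real ?m ^ ?m / c ^ ?m"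
   unfolding e using c q by (intro divide_right_mono mult_left_mono power_exp_bound) auto
  then have "\<bar>poly r x\<bar> * ((1/q)^k * exp (- (c * (1/q)))) \<le> B * (q\<^sup>2 * real ?m ^ ?m / c ^ ?m)"
   using B x q by (intro mult_mono) auto
  then show "\<bar>bump a b c r k x\<bar> \<le> B * (real ?m ^ ?m / c ^ ?m) * ((x - a) * (b - x))\<^sup>2"
   using x q unfolding bump_def q_def[symmetric] by (simp add: abs_mult mult_ac)
 qed (use B c in simp)
qed

lemma bump_deriv:
 assumes c: "0 < c" and ab: "a < b"
 shows "(bump a b c r k has_real_derivative bump a b c (bump_poly a b c r k) (k + 2) x) (at x)"
proof -
 consider "x < a \<or> b < x" | "x = a \<or> x = b" | "a < x" "x < b" by linarith
 then show ?thesis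
 proof cases
  case 1
  have z: "bump a b c r' k' x = 0" for r' k' using 1 by (auto simp: bump_def)
  have "open ({..<a} \<union> {b<..})" by auto
  moreover have "x \<in> {..<a} \<union> {b<..}" using 1 by auto
  ultimately have "\<forall>\<^sub>F y in nhds x. y \<in> {..<a} \<union> {b<..}" by (rule eventually_nhds_in_open)
  then have ev: "\<forall>\<^sub>F y in nhds x. bump a b c r k y = 0" by eventually_elim (auto simp: bump_def)
  show ?thesis unfolding z by (subst DERIV_cong_ev[OF refl ev refl]) simp
 next
  \<comment> \<open>At an endpoint the function is O((y - x)^2): one of the two factors of q equals
    \<bar>y - x\<bar> and the other is at most b - a.\<close>
  case 2
  obtain M where M: "0 \<le> M" "\<And>y. a < y \<Longrightarrow> y < b \<Longrightarrow> \<bar>bump a b c r k y\<bar> \<le> M * ((y - a) * (b - y))\<^sup>2"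
   using bump_bound[OF c ab] by metis
  have z: "bump a b c r' k' x = 0" for r' k' using 2 by (auto simp: bump_def)
  have bd: "\<bar>bump a b c r k y\<bar> \<le> (M * (b - a)\<^sup>2) * (y - x)\<^sup>2" for y
  proof (cases "a < y \<and> y < b")
   case True
   have "((y - a) * (b - y))\<^sup>2 \<le> ((b - a) * \<bar>y - x\<bar>)\<^sup>2"
   proof (rule power_mono)
    show "(y - a) * (b - y) \<le> (b - a) * \<bar>y - x\<bar>"
    proof (cases "x = a")
     case True': True
     have "(b - y) * (y - a) \<le> (b - a) * (y - a)" using True by (intro mult_right_mono) auto
     then show ?thesis using True True' by (simp add: mult.commute)
    next
     case False
     then have "x = b" using 2 by simp
     have "(y - a) * (b - y) \<le> (b - a) * (b - y)" using True by (intro mult_right_mono) auto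
     then show ?thesis using True \<open>x = b\<close> by simp
    qed
   qed (use True in simp)
   then have "M * ((y - a) * (b - y))\<^sup>2 \<le> M * ((b - a) * \<bar>y - x\<bar>)\<^sup>2" using M(1) by (rule mult_left_mono)
   also have "\<dots> = (M * (b - a)\<^sup>2) * (y - x)\<^sup>2" by (simp add: power_mult_distrib)
   finally show ?thesis using M(2)[of y] True by simp
  next
   case False
   have "bump a b c r k y = 0" unfolding bump_def using False by (rule if_not_P)
   then show ?thesis using M(1) by simp
  qed
  have "((\<lambda>y. (bump a b c r k y - bump a b c r k x) / (y - x)) \<longlongrightarrow> 0) (at x)"
  proof (rule tendsto_norm_zero_cancel, rule tendsto_0_le)
   have "((\<lambda>y. (M * (b - a)\<^sup>2) * \<bar>y - x\<bar>) \<longlongrightarrow> (M * (b - a)\<^sup>2) * \<bar>x - x\<bar>) (at x)"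
    by (intro tendsto_intros)
   then show "((\<lambda>y. (M * (b - a)\<^sup>2) * \<bar>y - x\<bar>) \<longlongrightarrow> 0) (at x)" by simp
   show "norm ((bump a b c r k y - bump a b c r k x) / (y - x)) \<le> (M * (b - a)\<^sup>2) * \<bar>y - x\<bar>" for y
   proof (cases "y = x")
    case False
    have "\<bar>bump a b c r k y\<bar> / \<bar>y - x\<bar> \<le> ((M * (b - a)\<^sup>2) * (y - x)\<^sup>2) / \<bar>y - x\<bar>"
     by (intro divide_right_mono bd) simp
    also have "\<dots> = (M * (b - a)\<^sup>2) * \<bar>y - x\<bar>"
    proof -
     define d where "d = \<bar>y - x\<bar>"
     have "(y - x)\<^sup>2 = d * d" "d \<noteq> 0" using False by (auto simp: d_def power2_eq_square)
     then show ?thesis unfolding d_def[symmetric] by simp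
    qed
    finally show ?thesis by (simp add: z)
   qed simp
  qed simp
  then show ?thesis by (simp add: has_field_derivative_iff z)
 next
  case 3
  have "\<forall>\<^sub>F y in nhds x. y \<in> {a<..<b}" using 3 by (intro eventually_nhds_in_open) auto
  then have ev: "\<forall>\<^sub>F y in nhds x. bump a b c r k y
    = poly r y * (1 / ((y - a) * (b - y)))^k * exp (- (c * (1 / ((y - a) * (b - y)))))"
   by eventually_elim (simp add: bump_def)
  define q where "q = (x - a) * (b - x)"
  define q' where "q' = (b - x) - (x - a)"
  have q: "q \<noteq> 0" using 3 by (simp add: q_def)
  have dq: "((\<lambda>y. 1 / ((y - a) * (b - y))) has_real_derivative - q' * (1/q)^2) (at x)"
  proof -
   have dQ: "((\<lambda>y. (y - a) * (b - y)) has_real_derivative q') (at x)"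
    by (auto intro!: derivative_eq_intros simp: q'_def)
   have "((\<lambda>y. 1 / ((y - a) * (b - y))) has_real_derivative (0 * q - 1 * q') / (q * q)) (at x)"
    unfolding q_def by (rule DERIV_divide[OF DERIV_const dQ]) (use q in \<open>simp add: q_def\<close>)
   then show ?thesis by (simp add: power2_eq_square)
  qed
  have "((\<lambda>y. poly r y * (1 / ((y - a) * (b - y)))^k * exp (- (c * (1 / ((y - a) * (b - y)))))) has_real_derivative
    (poly (pderiv r) x * (1/q)^k + poly r x * (real k * (- q' * (1/q)^2) * (1/q)^(k - 1))) * exp (- (c * (1/q)))
    + poly r x * (1/q)^k * (exp (- (c * (1/q))) * (- (c * (- q' * (1/q)^2))))) (at x)"
   by (rule derivative_eq_intros dq poly_DERIV refl | simp add: q_def algebra_simps)+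
  also have "(poly (pderiv r) x * (1/q)^k + poly r x * (real k * (- q' * (1/q)^2) * (1/q)^(k - 1))) * exp (- (c * (1/q)))
    + poly r x * (1/q)^k * (exp (- (c * (1/q))) * (- (c * (- q' * (1/q)^2))))
    = (poly (pderiv r) x * q * q - real k * poly r x * q' * q + c * poly r x * q') * (1/q)^(k + 2) * exp (- (c * (1/q)))"
  proof -
   \<comment> \<open>For \<open>k\<close> = 0 the truncated exponent \<open>k - 1\<close> does no
     harm because the factor \<open>real k\<close> vanishes; otherwise one power of q is
     restored.\<close>
   have k1: "real k * (1/q)^(k - 1) = real k * q * (1/q)^k"
    using q by (cases k) (auto simp: field_simps)
   have k2: "(1/q)^(k+2) = (1/q)^k * (1/q)^2" by (rule power_add)
   have k3: "q * q * (1/q)^2 = 1" using q by (simp add: power2_eq_square)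
   have alg: "(A * u + B * (K * (- q' * v) * t)) * E + B * u * (E * (- (c * (- q' * v))))
     = (A * q * q - K * B * q' * q + c * B * q') * (u * v) * E"
    if "K * t = K * q * u" "q * q * v = 1" for A B E K t u v :: real
    using that by algebra
   show ?thesis unfolding k2 by (rule alg[OF k1 k3])
  qed
  also have "poly (pderiv r) x * q * q - real k * poly r x * q' * q + c * poly r x * q' = poly (bump_poly a b c r k) x"
   by (simp add: bump_poly_def Let_def q_def q'_def pderiv_mult pderiv_pCons algebra_simps)
  also have "poly (bump_poly a b c r k) x * (1/q)^(k + 2) * exp (- (c * (1/q))) = bump a b c (bump_poly a b c r k) (k + 2) x"
   using 3 by (simp add: bump_def q_def)
  finally show ?thesis by (subst DERIV_cong_ev[OF refl ev refl])
 qed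
qed

lemma test_function_bump:
 assumes "0 < c" "a < b" shows "test_function (bump a b c r k)"
proof -
 have "\<exists>r' k'. (deriv ^^ n) (bump a b c r k) = bump a b c r' k'" for n
 proof (induction n)
  case (Suc n)
  then obtain r' k' where "(deriv ^^ n) (bump a b c r k) = bump a b c r' k'" by blast
  moreover have "deriv (bump a b c r' k') = bump a b c (bump_poly a b c r' k') (k' + 2)"
   using bump_deriv[OF assms] by (auto intro!: ext DERIV_imp_deriv)
  ultimately show ?case by auto
 qed auto
 then have "(deriv ^^ n) (bump a b c r k) differentiable at x" for n x
  using bump_deriv[OF assms] by (metis real_differentiable_def)
 moreover have "\<forall>x. \<bar>x\<bar> > max \<bar>a\<bar> \<bar>b\<bar> \<longrightarrow> bump a b c r k x = 0" by (auto simp: bump_def)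
 ultimately show ?thesis unfolding test_function_def by blast
qed

lemma test_function_props:
 assumes "test_function \<phi>"
 obtains R B where "0 \<le> R" "0 \<le> B" "\<And>x. (\<phi> has_real_derivative deriv \<phi> x) (at x)"
  "continuous_on UNIV \<phi>" "continuous_on UNIV (deriv \<phi>)"
  "\<And>x. \<bar>\<phi> x\<bar> \<le> B * indicator {-R..R} x" "\<And>x. \<bar>deriv \<phi> x\<bar> \<le> B * indicator {-R..R} x" "\<phi> R = 0" "\<phi> (-R) = 0"
proof -
 obtain R0 where R0: "\<And>x. R0 < \<bar>x\<bar> \<Longrightarrow> \<phi> x = 0" using assms by (auto simp: test_function_def)
 \<comment> \<open>The added 1 puts R strictly beyond the support bound, so \<open>\<phi>\<close>
   vanishes near R and -R, and its derivative vanishes wherever R \<le> \<bar>x\<bar>.\<close>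
 define R where "R = max R0 0 + 1"
 have d: "(deriv ^^ n) \<phi> differentiable at x" for n x using assms by (auto simp: test_function_def)
 have D: "(\<phi> has_real_derivative deriv \<phi> x) (at x)" for x
  using d[of 0 x] by (metis funpow_0 DERIV_imp_deriv real_differentiable_def)
 have c1: "continuous_on UNIV \<phi>"
  using d[of 0] by (auto intro!: continuous_at_imp_continuous_on differentiable_imp_continuous_within)
 have c2: "continuous_on UNIV (deriv \<phi>)"
  using d[of 1] by (auto intro!: continuous_at_imp_continuous_on differentiable_imp_continuous_within)
 have z: "\<phi> x = 0" if "R \<le> \<bar>x\<bar>" for x using R0[of x] that by (auto simp: R_def)
 have dz: "deriv \<phi> x = 0" if "R \<le> \<bar>x\<bar>" for x
 proof -
  have "open {y. R0 < \<bar>y\<bar>}" by (intro open_Collect_less continuous_intros)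
  then have "\<forall>\<^sub>F y in nhds x. y \<in> {y. R0 < \<bar>y\<bar>}"
   using that by (intro eventually_nhds_in_open) (auto simp: R_def)
  then have ev: "\<forall>\<^sub>F y in nhds x. \<phi> y = 0" by eventually_elim (auto simp: R0)
  have "(\<phi> has_real_derivative 0) (at x)" by (subst DERIV_cong_ev[OF refl ev refl]) simp
  then show ?thesis by (rule DERIV_imp_deriv)
 qed
 have "bounded (\<phi> ` {-R..R})" "bounded (deriv \<phi> ` {-R..R})"
  by (intro compact_imp_bounded compact_continuous_image continuous_on_subset[OF c1] continuous_on_subset[OF c2]; simp)+
 then obtain B1 B2 where B: "0 < B1" "\<And>x. x \<in> {-R..R} \<Longrightarrow> \<bar>\<phi> x\<bar> \<le> B1" "0 < B2" "\<And>x. x \<in> {-R..R} \<Longrightarrow> \<bar>deriv \<phi> x\<bar> \<le> B2"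
  unfolding bounded_pos by auto
 show ?thesis
 proof (rule that[of R "max B1 B2"])
  show "\<bar>\<phi> x\<bar> \<le> max B1 B2 * indicator {-R..R} x" for x
   using B(2)[of x] z[of x] by (cases "x \<in> {-R..R}") (auto simp: abs_le_iff)
  show "\<bar>deriv \<phi> x\<bar> \<le> max B1 B2 * indicator {-R..R} x" for x
   using B(4)[of x] dz[of x] by (cases "x \<in> {-R..R}") (auto simp: abs_le_iff)
 qed (use D c1 c2 B(1) z R_def in auto)
qed

lemma test_function_measurable:
 assumes "test_function \<phi>"
 shows "\<phi> \<in> BM" "deriv \<phi> \<in> BM"
 by (rule test_function_props[OF assms], rule borel_measurable_continuous_onI, assumption)+

lemma locally_integrable_mult_test:
 assumes g: "locally_integrable g" and m[measurable]: "\<psi> \<in> BM"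
  and b: "\<And>x. \<bar>\<psi> x\<bar> \<le> B * indicator {-R..R} x"
 shows "integrable lborel (\<lambda>x. g x * \<psi> x)"
proof -
 have [measurable]: "g \<in> BM" using g by (simp add: locally_integrable_def)
 have "integrable lborel (\<lambda>x. B * (indicator {-R..R} x * g x))"
  using g by (intro integrable_mult_right) (simp add: locally_integrable_def set_integrable_def)
 then show ?thesis
 proof (rule Bochner_Integration.integrable_bound)
  have "\<bar>g x\<bar> * \<bar>\<psi> x\<bar> \<le> \<bar>g x\<bar> * (B * indicator {-R..R} x)" for x by (intro mult_left_mono b) simp
  then have "norm (g x * \<psi> x) \<le> norm (B * (indicator {-R..R} x * g x))" for x
   using b[of x] by (auto simp: abs_mult indicator_def split: if_splits)
    (smt (verit, best) mult.commute mult_left_mono abs_ge_zero)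
  then show "AE x in lborel. norm (g x * \<psi> x) \<le> norm (B * (indicator {-R..R} x * g x))" by simp
 qed measurable
qed

text \<open>The bumps with \<open>c\<close> = 1/(n + 1) converge to the indicator of (a, b), so
  dominated convergence turns the assumption on test functions into vanishing integrals over
  intervals.\<close>

lemma AE_zero_of_test_functions:
 assumes g: "locally_integrable g" and zero: "\<And>\<phi>. test_function \<phi> \<Longrightarrow> (LINT x|lborel. g x * \<phi> x) = 0"
 shows "AE x in lborel. g x = 0"
proof (rule AE_zero_of_interval_integrals)
 show [measurable]: "g \<in> BM" using g by (simp add: locally_integrable_def)
 show "set_integrable lborel {-R..R} g" for R using g by (simp add: locally_integrable_def)
 fix a b :: real assume "a \<le> b"
 show "(LINT x:{a..b}|lborel. g x) = 0"
 proof (cases "a < b")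
  case True
  let ?\<phi> = "\<lambda>n. bump a b (1 / real (Suc n)) [:1:] 0"
  have m[measurable]: "?\<phi> n \<in> BM" for n
   by (intro test_function_measurable test_function_bump) (use True in auto)
  have "(\<lambda>n. LINT x|lborel. g x * ?\<phi> n x) \<longlonglongrightarrow> (LINT x|lborel. indicator {a..b} x * g x)"
  proof (rule integral_dominated_convergence[where w="\<lambda>x. norm (indicator {- max \<bar>a\<bar> \<bar>b\<bar>..max \<bar>a\<bar> \<bar>b\<bar>} x * g x)"])
   show "integrable lborel (\<lambda>x. norm (indicator {- max \<bar>a\<bar> \<bar>b\<bar>..max \<bar>a\<bar> \<bar>b\<bar>} x * g x))"
    using g by (intro integrable_norm) (simp add: locally_integrable_def set_integrable_def)
   have "AE x in lborel. x \<noteq> a" "AE x in lborel. x \<noteq> b" by (rule AE_lborel_singleton)+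
   then show "AE x in lborel. (\<lambda>n. g x * ?\<phi> n x) \<longlonglongrightarrow> indicator {a..b} x * g x"
   proof eventually_elim
    fix x assume x: "x \<noteq> a" "x \<noteq> b"
    show "(\<lambda>n. g x * ?\<phi> n x) \<longlonglongrightarrow> indicator {a..b} x * g x"
    proof (cases "a < x \<and> x < b")
     case True
     have "(\<lambda>n. g x * exp (- (1 / real (Suc n) * (1 / ((x - a) * (b - x)))))) \<longlonglongrightarrow> g x * exp (- (0 * (1 / ((x - a) * (b - x)))))"
      by (intro tendsto_intros LIMSEQ_Suc[OF lim_1_over_n])
     then show ?thesis using True by (simp add: bump_def mult.commute)
    next
     case False
     have "?\<phi> n x = 0" for n unfolding bump_def using False by (rule if_not_P)
     moreover have "x \<notin> {a..b}" using False x by auto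
     ultimately show ?thesis by simp
    qed
   qed
   show "AE x in lborel. norm (g x * ?\<phi> n x) \<le> norm (indicator {- max \<bar>a\<bar> \<bar>b\<bar>..max \<bar>a\<bar> \<bar>b\<bar>} x * g x)" for n
   proof (rule AE_I2)
    fix x
    have "\<bar>?\<phi> n x\<bar> \<le> indicator {- max \<bar>a\<bar> \<bar>b\<bar>..max \<bar>a\<bar> \<bar>b\<bar>} x"
    proof (cases "a < x \<and> x < b")
     case True
     then have "0 \<le> 1 / real (Suc n) * (1 / ((x - a) * (b - x)))" by simp
     then have "exp (- (1 / real (Suc n) * (1 / ((x - a) * (b - x))))) \<le> 1" by simp
     moreover have "x \<in> {- max \<bar>a\<bar> \<bar>b\<bar>..max \<bar>a\<bar> \<bar>b\<bar>}" using True by (auto simp: max_def abs_if)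
     ultimately show ?thesis using True by (simp add: bump_def)
    next
     case False
     have "?\<phi> n x = 0" unfolding bump_def using False by (rule if_not_P)
     then show ?thesis by simp
    qed
    then have "\<bar>g x\<bar> * \<bar>?\<phi> n x\<bar> \<le> \<bar>g x\<bar> * indicator {- max \<bar>a\<bar> \<bar>b\<bar>..max \<bar>a\<bar> \<bar>b\<bar>} x"
     by (rule mult_left_mono) simp
    then show "norm (g x * ?\<phi> n x) \<le> norm (indicator {- max \<bar>a\<bar> \<bar>b\<bar>..max \<bar>a\<bar> \<bar>b\<bar>} x * g x)"
     by (simp add: abs_mult mult.commute)
   qed
  qed measurable
  moreover have "(LINT x|lborel. g x * ?\<phi> n x) = 0" for n
   by (rule zero, rule test_function_bump) (use True in auto)
  ultimately show ?thesis by (simp add: LIMSEQ_const_iff set_lebesgue_integral_def)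
 next
  case False
  then have "a = b" using \<open>a \<le> b\<close> by simp
  have "(LINT x|lborel. indicator {a..b} x * g x) = (LINT (x::real)|lborel. 0)"
   by (rule integral_cong_AE) (measurable, use AE_lborel_singleton[of a] \<open>a = b\<close> in \<open>auto elim!: eventually_mono\<close>)
  then show ?thesis by (simp add: set_lebesgue_integral_def)
 qed
qed

text \<open>This makes the existentially quantified \<open>v\<^sub>x\<close> and \<open>w\<close> of
  \<open>rod_equation\<close> canonical.\<close>

lemma weak_deriv_unique:
 assumes "has_weak_deriv v g" "has_weak_deriv v h"
 shows "AE x in lborel. g x = h x"
proof -
 have gh: "locally_integrable g" "locally_integrable h" using assms by (auto simp: has_weak_deriv_def)
 have "AE x in lborel. g x - h x = 0"
 proof (rule AE_zero_of_test_functions)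
  show "locally_integrable (\<lambda>x. g x - h x)"
   using gh unfolding locally_integrable_def by (auto intro: set_integral_diff)
  fix \<phi> assume \<phi>: "test_function \<phi>"
  obtain R B where "continuous_on UNIV \<phi>" and b: "\<And>x. \<bar>\<phi> x\<bar> \<le> B * indicator {-R..R} x"
   using test_function_props[OF \<phi>] by metis
  then have m: "\<phi> \<in> BM" by (auto intro: borel_measurable_continuous_onI)
  show "(LINT x|lborel. (g x - h x) * \<phi> x) = 0"
   using assms \<phi> locally_integrable_mult_test[OF gh(1) m b] locally_integrable_mult_test[OF gh(2) m b]
   by (simp add: has_weak_deriv_def left_diff_distrib)
 qed
 then show ?thesis by simp
qed

section \<open>Convolution, derivatives and the kernel in frequency\<close>

definition cv :: "(real \<Rightarrow> complex) \<Rightarrow> (real \<Rightarrow> complex) \<Rightarrow> real \<Rightarrow> complex" where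
 "cv f g k = (LINT l|lborel. f (k - l) * g l)"

text \<open>The multiplier that becomes d/dx under the inverse transform \<open>ft 1\<close>; see
  \<open>weak_deriv_ft\<close>.\<close>

definition mulx :: "(real \<Rightarrow> complex) \<Rightarrow> real \<Rightarrow> complex" where
 "mulx V k = \<i> * cr k * V k"

lemma mulx_measurable [measurable]: "V \<in> BM \<Longrightarrow> mulx V \<in> BM"
 unfolding mulx_def[abs_def] by measurable

lemma cv_pair_integrable:
 fixes f g :: "real \<Rightarrow> complex"
 assumes f: "integrable lborel f" and g: "integrable lborel g"
 shows "integrable (lborel \<Otimes>\<^sub>M lborel) (case_prod (\<lambda>l k. f (k - l) * g l))"
proof (rule lborel_pair.Fubini_integrable)
 have [measurable]: "f \<in> BM" "g \<in> BM" using f g by auto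
 show "case_prod (\<lambda>l k. f (k - l) * g l) \<in> borel_measurable (lborel \<Otimes>\<^sub>M lborel)" by measurable
 have s: "(LINT k|lborel. cmod (f (k - l))) = (LINT k|lborel. cmod (f k))" for l
  using lborel_integral_real_affine[of 1 "\<lambda>k. cmod (f k)" "-l"] by simp
 show "integrable lborel (\<lambda>l. LINT k|lborel. norm (case_prod (\<lambda>l k. f (k - l) * g l) (l, k)))"
  using g by (simp add: norm_mult s)
 have "integrable lborel (\<lambda>k. f (k - l))" for l
  using lborel_integrable_real_affine[OF f, of 1 "-l"] by simp
 then show "AE l in lborel. integrable lborel (\<lambda>k. case_prod (\<lambda>l k. f (k - l) * g l) (l, k))" by simp
qed

lemma cv_integrable:
 assumes f: "integrable lborel f" and g: "integrable lborel g"
 shows "integrable lborel (cv f g)"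
 using lborel_pair.integrable_snd[OF cv_pair_integrable[OF f g]] by (simp add: cv_def[abs_def])

text \<open>The convolution theorem. The factor sqrt(2 pi) belongs to the unitary normalization and
  is what the quotient by \<open>sqrt (2 * pi)\<close> in the symbol \<open>br\<close>
  cancels.\<close>

lemma ft_cv:
 assumes f: "integrable lborel f" and g: "integrable lborel g"
 shows "ft c (cv f g) x = cr (sqrt (2 * pi)) * (ft c f x * ft c g x)"
proof -
 have [measurable]: "f \<in> BM" "g \<in> BM" using f g by auto
 let ?E = "\<lambda>l k. iexp (c * k * x) * (f (k - l) * g l)"
 let ?A = "LINT k|lborel. iexp (c * k * x) * f k"
 have i: "integrable (lborel \<Otimes>\<^sub>M lborel) (case_prod ?E)"
  by (rule Bochner_Integration.integrable_bound[OF cv_pair_integrable[OF f g]]) (auto simp: norm_mult)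
 have inner: "(LINT k|lborel. ?E l k) = ?A * (iexp (c * l * x) * g l)" for l
 proof -
  have e: "iexp (c * k * x) = iexp (c * (k - l) * x) * iexp (c * l * x)" for k
  proof -
   have "c * k * x = c * (k - l) * x + c * l * x" by (simp add: algebra_simps)
   then show ?thesis by (simp only: iexp_add)
  qed
  have "(LINT k|lborel. ?E l k) = (LINT k|lborel. (iexp (c * (k - l) * x) * f (k - l)) * (iexp (c * l * x) * g l))"
  proof (rule Bochner_Integration.integral_cong[OF refl])
   fix k show "?E l k = (iexp (c * (k - l) * x) * f (k - l)) * (iexp (c * l * x) * g l)"
    by (subst e[of k]) (simp only: mult_ac)
  qed
  also have "\<dots> = (LINT k|lborel. iexp (c * (k - l) * x) * f (k - l)) * (iexp (c * l * x) * g l)"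
   by (rule integral_mult_left_zero)
  also have "(LINT k|lborel. iexp (c * (k - l) * x) * f (k - l)) = ?A"
   using lborel_integral_real_affine[of 1 "\<lambda>k. iexp (c * k * x) * f k" "-l"] by simp
  finally show ?thesis .
 qed
 have "(LINT k|lborel. iexp (c * k * x) * cv f g k) = (LINT k|lborel. (LINT l|lborel. ?E l k))"
  unfolding cv_def by (simp only: integral_mult_right_zero)
 also have "\<dots> = (LINT l|lborel. (LINT k|lborel. ?E l k))"
  by (rule lborel_pair.Fubini_integral[OF i])
 also have "\<dots> = ?A * (LINT l|lborel. iexp (c * l * x) * g l)"
  unfolding inner by (rule integral_mult_right_zero)
 finally have "(LINT k|lborel. iexp (c * k * x) * cv f g k) = ?A * (LINT l|lborel. iexp (c * l * x) * g l)" .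
 then show ?thesis unfolding ft_def using sqrt_2pi by simp
qed

text \<open>Integration by parts, as the fundamental theorem for the product of the phase with
  \<open>\<phi>\<close> on an interval at whose ends \<open>\<phi>\<close> vanishes.\<close>

lemma ft_test_deriv:
 assumes \<phi>: "test_function \<phi>"
 shows "ft 1 (\<lambda>x. cr (deriv \<phi> x)) k = - (\<i> * cr k) * ft 1 (\<lambda>x. cr (\<phi> x)) k"
  "integrable lborel (\<lambda>x. cr (deriv \<phi> x))" "integrable lborel (\<lambda>x. cr (\<phi> x))"
proof -
 obtain R B where R: "0 \<le> R" and D: "\<And>x. (\<phi> has_real_derivative deriv \<phi> x) (at x)"
  and c: "continuous_on UNIV \<phi>" "continuous_on UNIV (deriv \<phi>)"
  and b: "\<And>x. \<bar>\<phi> x\<bar> \<le> B * indicator {-R..R} x" "\<And>x. \<bar>deriv \<phi> x\<bar> \<le> B * indicator {-R..R} x"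
  and z: "\<phi> R = 0" "\<phi> (-R) = 0"
  using test_function_props[OF \<phi>] by metis
 have one: "locally_integrable (\<lambda>_. 1)"
  unfolding locally_integrable_def set_integrable_def
  using integrable_real_indicator[of "{-R..R}" lborel for R] by (auto simp: emeasure_lborel_Icc_eq)
 note m = test_function_measurable[OF \<phi>]
 have i: "integrable lborel \<phi>" "integrable lborel (deriv \<phi>)"
  using locally_integrable_mult_test[OF one m(1) b(1)] locally_integrable_mult_test[OF one m(2) b(2)] by simp_all
 then show I: "integrable lborel (\<lambda>x. cr (deriv \<phi> x))" "integrable lborel (\<lambda>x. cr (\<phi> x))"
  by (auto intro: integrable_of_real)
 let ?f = "\<lambda>x. iexp (x * k) * cr (deriv \<phi> x) + (\<i> * cr k) * (iexp (x * k) * cr (\<phi> x))"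
 have "(LINT x|lborel. indicator {-R..R} x *\<^sub>R ?f x) = iexp (R * k) * cr (\<phi> R) - iexp ((-R) * k) * cr (\<phi> (-R))"
 proof (rule integral_FTC_atLeastAtMost)
  show "-R \<le> R" using R by simp
  show "((\<lambda>x. iexp (x * k) * cr (\<phi> x)) has_vector_derivative ?f x) (at x within {-R..R})" for x
  proof -
   have 1: "((\<lambda>x. cr (\<phi> x)) has_vector_derivative cr (deriv \<phi> x)) (at x within {-R..R})"
    using D[of x] by (intro has_vector_derivative_of_real) (auto intro: has_vector_derivative_at_within simp: has_real_derivative_iff_has_vector_derivative)
   have "((\<lambda>x. iexp (x * k)) has_vector_derivative (\<i> * cr k) * iexp (x * k)) (at x within {-R..R})"
   proof -
    have "((\<lambda>z. exp (\<i> * (z * cr k))) has_field_derivative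
      exp (\<i> * (cr x * cr k)) * (\<i> * cr k)) (at (cr x))"
     by (auto intro!: derivative_eq_intros)
    from has_vector_derivative_real_field[OF this]
    show ?thesis by (simp only: of_real_mult mult.commute[of "\<i> * cr k"])
   qed
   from has_vector_derivative_mult[OF this 1]
   show ?thesis by (simp add: algebra_simps)
  qed
  show "continuous_on {-R..R} ?f"
   by (intro continuous_intros continuous_on_subset[OF c(1)] continuous_on_subset[OF c(2)]) auto
 qed
 also have "\<dots> = 0" using z by simp
 also have "(\<lambda>x. indicator {-R..R} x *\<^sub>R ?f x) = ?f"
 proof
  fix x show "indicator {-R..R} x *\<^sub>R ?f x = ?f x"
   using b(1)[of x] b(2)[of x] by (cases "x \<in> {-R..R}") auto
 qed
 finally have "(LINT x|lborel. ?f x) = 0" .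
 moreover have "(LINT x|lborel. ?f x) = (LINT x|lborel. iexp (x * k) * cr (deriv \<phi> x))
   + (\<i> * cr k) * (LINT x|lborel. iexp (x * k) * cr (\<phi> x))"
  using ft_integrable[OF I(1), of 1 k] ft_integrable[OF I(2), of 1 k] by simp
 ultimately have "(LINT x|lborel. iexp (x * k) * cr (deriv \<phi> x))
   = - (\<i> * cr k) * (LINT x|lborel. iexp (x * k) * cr (\<phi> x))"
  by (simp add: eq_neg_iff_add_eq_0)
 then show "ft 1 (\<lambda>x. cr (deriv \<phi> x)) k = - (\<i> * cr k) * ft 1 (\<lambda>x. cr (\<phi> x)) k"
  by (simp add: ft_def)
qed

lemma locally_integrable_ft:
 assumes "integrable lborel V"
 shows "locally_integrable (\<lambda>x. Re (ft 1 V x))"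
proof -
 have [measurable]: "V \<in> BM" using assms by auto
 let ?M = "LINT x|lborel. cmod (V x)"
 have "integrable lborel (\<lambda>x. indicator {-R..R} x *\<^sub>R Re (ft 1 V x))" for R
 proof (rule Bochner_Integration.integrable_bound)
  have "integrable lborel (indicator {-R..R} :: real \<Rightarrow> real)"
   by (rule integrable_real_indicator) (auto simp: emeasure_lborel_Icc_eq)
  then show "integrable lborel (\<lambda>x. ?M * indicator {-R..R} x)" by (rule integrable_mult_right)
  have "\<bar>Re (ft 1 V x)\<bar> \<le> ?M" for x
   using abs_Re_le_cmod[of "ft 1 V x"] ft_bound[OF assms, of 1 x] by linarith
  then show "AE x in lborel. norm (indicator {-R..R} x *\<^sub>R Re (ft 1 V x)) \<le> norm (?M * indicator {-R..R} x)"
   by (intro AE_I2) (auto simp: indicator_def intro: order_trans)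
 qed measurable
 then show ?thesis by (simp add: locally_integrable_def set_integrable_def)
qed

lemma ft_test_integrable:
 assumes V: "integrable lborel V" and \<phi>: "integrable lborel (\<lambda>x. cr (\<phi> x))"
 shows "integrable lborel (\<lambda>x. ft 1 V x * cr (\<phi> x))"
proof (rule Bochner_Integration.integrable_bound)
 have [measurable]: "V \<in> BM" "(\<lambda>x. cr (\<phi> x)) \<in> BM"
  using V \<phi> by auto
 show "integrable lborel (\<lambda>x. cr (LINT x|lborel. cmod (V x)) * cr (\<phi> x))"
  using \<phi> by (rule integrable_mult_right)
 show "AE x in lborel. norm (ft 1 V x * cr (\<phi> x)) \<le> norm (cr (LINT x|lborel. cmod (V x)) * cr (\<phi> x))"
  using ft_bound[OF V, of 1] by (intro AE_I2) (auto simp: norm_mult abs_of_nonneg intro!: mult_right_mono)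
 show "(\<lambda>x. ft 1 V x * cr (\<phi> x)) \<in> borel_measurable lborel" by measurable
qed

text \<open>The multiplication formula carries the derivative of the test function to the frequency
  side, where it is the factor -ik, and this factor is then carried back on
  \<open>V\<close>.\<close>

lemma weak_deriv_ft:
 assumes V: "integrable lborel V" and mV: "integrable lborel (mulx V)"
 shows "has_weak_deriv (\<lambda>x. Re (ft 1 V x)) (\<lambda>x. Re (ft 1 (mulx V) x))"
 unfolding has_weak_deriv_def
proof (intro conjI allI impI locally_integrable_ft V mV)
 fix \<phi> assume \<phi>: "test_function \<phi>"
 note t = ft_test_deriv[OF \<phi>]
 have "(LINT x|lborel. ft 1 V x * cr (deriv \<phi> x)) = (LINT k|lborel. V k * ft 1 (\<lambda>x. cr (deriv \<phi> x)) k)"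
  by (rule ft_swap[OF V t(2)])
 also have "\<dots> = (LINT k|lborel. - (mulx V k * ft 1 (\<lambda>x. cr (\<phi> x)) k))"
  unfolding t(1) mulx_def by (simp add: mult_ac)
 also have "\<dots> = - (LINT x|lborel. ft 1 (mulx V) x * cr (\<phi> x))"
  using ft_swap[OF mV t(3), of 1] by simp
 finally have eq: "(LINT x|lborel. ft 1 V x * cr (deriv \<phi> x)) = - (LINT x|lborel. ft 1 (mulx V) x * cr (\<phi> x))" .
 have re: "Re (ft 1 U x * cr r) = Re (ft 1 U x) * r" for U x r by simp
 have "(LINT x|lborel. Re (ft 1 V x * cr (deriv \<phi> x))) = - (LINT x|lborel. Re (ft 1 (mulx V) x * cr (\<phi> x)))"
  unfolding integral_Re[OF ft_test_integrable[OF V t(2)]] integral_Re[OF ft_test_integrable[OF mV t(3)]] eq by simp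
 then show "(LINT x|lborel. Re (ft 1 V x) * deriv \<phi> x) = - (LINT x|lborel. Re (ft 1 (mulx V) x) * \<phi> x)"
  unfolding re .
qed

text \<open>The fundamental theorem on [0, n] for exp(-(1 - ik)t), followed by dominated
  convergence.\<close>

lemma exp_halfline:
 "integrable lborel (\<lambda>t::real. indicator {0..} t *\<^sub>R (iexp (t * k) * cr (exp (-t))))"
 "(LINT t|lborel. indicator {0..} t *\<^sub>R (iexp (t * k) * cr (exp (-t)))) = 1 / (1 - \<i> * cr k)"
proof -
 have nn: "(\<integral>\<^sup>+t. ennreal (exp (-t)) * indicator {0..} t \<partial>lborel) = ennreal (0 - (- exp (-0)))"
 proof (rule nn_integral_FTC_atLeast[where F="\<lambda>t. - exp (-t)" and T=0 and a=0])
  show "((\<lambda>t::real. - exp (-t)) \<longlongrightarrow> 0) at_top"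
   using tendsto_minus[OF filterlim_compose[OF exp_at_bot filterlim_uminus_at_bot_at_top]] by simp
 qed (auto intro!: derivative_eq_intros)
 have ie: "integrable lborel (\<lambda>t::real. indicator {0..} t * exp (-t))"
 proof (rule integrableI_bounded)
  have "(\<integral>\<^sup>+t. ennreal (norm (indicator {0..} t * exp (-t) :: real)) \<partial>lborel) = (\<integral>\<^sup>+t. ennreal (exp (-t)) * indicator {0..} t \<partial>lborel)"
   by (intro nn_integral_cong) (auto simp: indicator_def)
  then show "(\<integral>\<^sup>+t. ennreal (norm (indicator {0..} t * exp (-t) :: real)) \<partial>lborel) < \<infinity>" unfolding nn by simp
 qed measurable
 let ?g = "\<lambda>t. iexp (t * k) * cr (exp (-t))"
 have m[measurable]: "?g \<in> BM" by measurable
 show "integrable lborel (\<lambda>t::real. indicator {0..} t *\<^sub>R ?g t)"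
  by (rule Bochner_Integration.integrable_bound[OF ie]) (auto simp: norm_mult indicator_def)
 define z where "z = 1 - \<i> * cr k"
 have z: "z \<noteq> 0" by (simp add: z_def complex_eq_iff)
 have g: "?g t = exp (- (z * cr t))" for t
  by (simp add: z_def exp_of_real[symmetric] mult_exp_exp algebra_simps)
 have fin: "(LINT t|lborel. indicator {0..real n} t *\<^sub>R ?g t) = - (1 / z) * ?g (real n) - - (1 / z) * ?g 0" for n
 proof (rule integral_FTC_atLeastAtMost)
  show "((\<lambda>t. - (1 / z) * ?g t) has_vector_derivative ?g t) (at t within {0..real n})" for t
  proof -
   have "((\<lambda>t. exp (- (z * t))) has_field_derivative exp (- (z * cr t)) * (- z)) (at (cr t))"
    by (auto intro!: derivative_eq_intros)
   then have "((\<lambda>t. exp (- (z * cr t))) has_vector_derivative exp (- (z * cr t)) * (- z)) (at t within {0..real n})"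
    by (rule has_vector_derivative_real_field)
   from has_vector_derivative_mult_right[OF this, of "- (1 / z)"]
   show ?thesis unfolding g using z by simp
  qed
  show "continuous_on {0..real n} ?g" by (intro continuous_intros)
 qed simp
 have "(\<lambda>n. LINT t|lborel. indicator {0..real n} t *\<^sub>R ?g t) \<longlonglongrightarrow> (LINT t|lborel. indicator {0..} t *\<^sub>R ?g t)"
 proof (rule integral_dominated_convergence[OF _ _ ie])
  show "AE t in lborel. (\<lambda>n. indicator {0..real n} t *\<^sub>R ?g t) \<longlonglongrightarrow> indicator {0..} t *\<^sub>R ?g t"
  proof (rule AE_I2, rule tendsto_scaleR[OF _ tendsto_const], rule tendsto_eventually)
   fix t :: real
   obtain N where "t \<le> real N" using real_arch_simple by blast
   then show "\<forall>\<^sub>F n in sequentially. indicator {0..real n} t = (indicator {0..} t :: real)"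
    unfolding eventually_sequentially by (intro exI[of _ N]) (auto simp: indicator_def)
  qed
  show "AE t in lborel. norm (indicator {0..real n} t *\<^sub>R ?g t) \<le> indicator {0..} t * exp (-t)" for n
   by (rule AE_I2) (auto simp: norm_mult indicator_def)
 qed measurable
 moreover have "(\<lambda>n. LINT t|lborel. indicator {0..real n} t *\<^sub>R ?g t) \<longlonglongrightarrow> - (1 / z) * 0 - - (1 / z) * ?g 0"
  unfolding fin
 proof (intro tendsto_diff tendsto_mult tendsto_const)
  have "(\<lambda>n. exp (- real n)) \<longlonglongrightarrow> 0"
   by (rule filterlim_compose[OF exp_at_bot]) (intro filterlim_compose[OF filterlim_uminus_at_bot_at_top] filterlim_real_sequentially)
  then have "(\<lambda>n. cmod (?g (real n))) \<longlonglongrightarrow> 0" by (simp only: norm_mult norm_exp_i_times norm_of_real abs_exp_cancel mult_1)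
  then show "(\<lambda>n. ?g (real n)) \<longlonglongrightarrow> 0" by (rule tendsto_norm_zero_cancel)
 qed
 ultimately have "(LINT t|lborel. indicator {0..} t *\<^sub>R ?g t) = - (1 / z) * 0 - - (1 / z) * ?g 0"
  by (rule LIMSEQ_unique)
 then show "(LINT t|lborel. indicator {0..} t *\<^sub>R ?g t) = 1 / (1 - \<i> * cr k)"
  by (simp add: z_def)
qed

lemma ft_peak_0:
 "integrable lborel (\<lambda>t. cr (peak_kernel t))"
 "(LINT t|lborel. iexp (t * k) * cr (peak_kernel t)) = cr (1 / (1 + k\<^sup>2))"
proof -
 let ?h = "\<lambda>k t. indicator {0..} t *\<^sub>R (iexp (t * k) * cr (exp (-t)))"
 have i2: "integrable lborel (\<lambda>t. ?h k (-t))" for k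
  using lborel_integrable_real_affine[OF exp_halfline(1), of "-1" 0] by simp
 have [measurable]: "peak_kernel \<in> BM" unfolding peak_kernel_def[abs_def] by measurable
 \<comment> \<open>At t = 0 both half-line indicators equal 1, so the splitting holds off one
   point.\<close>
 have sum: "AE t in lborel. iexp (t * k) * cr (peak_kernel t) = (?h k t + ?h (-k) (-t)) / 2" for k
  using AE_lborel_singleton[of 0] by eventually_elim (auto simp: peak_kernel_def indicator_def)
 have isum: "integrable lborel (\<lambda>t. (?h k t + ?h (-k) (-t)) / 2)" for k
  using exp_halfline(1)[of k] i2[of "-k"] by (intro integrable_divide Bochner_Integration.integrable_add)
 have "integrable lborel (\<lambda>t. iexp (t * 0) * cr (peak_kernel t))"
  by (rule integrable_cong_AE_imp[OF isum[of 0]]) (measurable, use sum[of 0] in \<open>auto elim!: eventually_mono\<close>)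
 then show "integrable lborel (\<lambda>t. cr (peak_kernel t))" by simp
 have "(LINT t|lborel. iexp (t * k) * cr (peak_kernel t)) = (LINT t|lborel. (?h k t + ?h (-k) (-t)) / 2)"
  by (rule integral_cong_AE) (measurable, rule sum)
 also have "\<dots> = ((LINT t|lborel. ?h k t) + (LINT t|lborel. ?h (-k) (-t))) / 2"
  using exp_halfline(1)[of k] i2[of "-k"] by simp
 also have "(LINT t|lborel. ?h (-k) (-t)) = (LINT t|lborel. ?h (-k) t)"
  using lborel_integral_real_affine[of "-1" "?h (-k)" 0] by simp
 also have "((LINT t|lborel. ?h k t) + (LINT t|lborel. ?h (-k) t)) / 2
   = (1 / (1 - \<i> * cr k) + 1 / (1 - \<i> * cr (-k))) / 2"
  by (simp only: exp_halfline(2))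
 also have "\<dots> = cr (1 / (1 + k\<^sup>2))"
 proof -
  have n: "1 - \<i> * cr k \<noteq> 0" "1 + \<i> * cr k \<noteq> 0" by (auto simp: complex_eq_iff)
  have p: "(1 - \<i> * cr k) * (1 + \<i> * cr k) = cr (1 + k\<^sup>2)"
   by (simp add: complex_eq_iff power2_eq_square)
  have "(1 / (1 - \<i> * cr k) + 1 / (1 - \<i> * cr (-k))) / 2
   = 1 / ((1 - \<i> * cr k) * (1 + \<i> * cr k))"
   using n by (simp add: divide_simps)
  also have "\<dots> = cr (1 / (1 + k\<^sup>2))" unfolding p by (simp only: of_real_divide of_real_1)
  finally show ?thesis .
 qed
 finally show "(LINT t|lborel. iexp (t * k) * cr (peak_kernel t)) = cr (1 / (1 + k\<^sup>2))" .
qed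

lemma ft_peak:
 "integrable lborel (\<lambda>y. cr (peak_kernel (x - y)))"
 "ft 1 (\<lambda>y. cr (peak_kernel (x - y))) k = iexp (x * k) * cr (1 / (1 + k\<^sup>2)) / cr (sqrt (2 * pi))"
proof -
 show "integrable lborel (\<lambda>y. cr (peak_kernel (x - y)))"
  using lborel_integrable_real_affine[OF ft_peak_0(1), of "-1" x] by simp
 have "(LINT y|lborel. iexp (1 * y * k) * cr (peak_kernel (x - y)))
   = (LINT t|lborel. iexp (x * k) * (iexp (t * (- k)) * cr (peak_kernel t)))"
 proof -
  have e: "iexp ((x + - t) * k) = iexp (x * k) * iexp (t * (- k))" for t
  proof -
   have "(x + - t) * k = x * k + t * (- k)" by (simp add: algebra_simps)
   then show ?thesis by (simp only: iexp_add)
  qed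
  have "(LINT y|lborel. iexp (1 * y * k) * cr (peak_kernel (x - y)))
    = \<bar>-1\<bar> *\<^sub>R (LINT t|lborel. iexp (1 * (x + -1 * t) * k) * cr (peak_kernel (x - (x + -1 * t))))"
   by (rule lborel_integral_real_affine) simp
  also have "\<dots> = (LINT t|lborel. iexp ((x + - t) * k) * cr (peak_kernel t))" by simp
  finally show ?thesis unfolding e by (simp only: mult.assoc)
 qed
 also have "\<dots> = iexp (x * k) * cr (1 / (1 + (- k)\<^sup>2))"
  by (simp only: integral_mult_right_zero ft_peak_0(2))
 finally show "ft 1 (\<lambda>y. cr (peak_kernel (x - y))) k = iexp (x * k) * cr (1 / (1 + k\<^sup>2)) / cr (sqrt (2 * pi))"
  unfolding ft_def by simp
qed

text \<open>The multiplication formula against the translated kernel, whose transform is explicit.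
  Hypothesis \<open>real\<close> replaces the real part under the integral by the transform
  itself.\<close>

lemma convolution_peak_ft:
 assumes \<Phi>: "integrable lborel \<Phi>" and real: "\<And>x. ft 1 \<Phi> x = cr (Re (ft 1 \<Phi> x))"
 shows "Defs.convolution peak_kernel (\<lambda>x. Re (ft 1 \<Phi> x)) x = Re (ft 1 (\<lambda>k. cr (1 / (1 + k\<^sup>2)) * \<Phi> k) x)"
proof -
 let ?h = "\<lambda>y. cr (peak_kernel (x - y))"
 have "cr (Defs.convolution peak_kernel (\<lambda>x. Re (ft 1 \<Phi> x)) x) = (LINT y|lborel. cr (peak_kernel (x - y) * Re (ft 1 \<Phi> y)))"
  unfolding Defs.convolution_def by (rule integral_complex_of_real[symmetric])
 also have "\<dots> = (LINT y|lborel. ft 1 \<Phi> y * ?h y)"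
  unfolding of_real_mult real[symmetric] by (simp only: mult.commute)
 also have "\<dots> = (LINT k|lborel. \<Phi> k * ft 1 ?h k)" by (rule ft_swap[OF \<Phi> ft_peak(1)])
 also have "\<dots> = (LINT k|lborel. iexp (1 * k * x) * (cr (1 / (1 + k\<^sup>2)) * \<Phi> k) / cr (sqrt (2 * pi)))"
  unfolding ft_peak(2) by (simp add: mult_ac)
 also have "\<dots> = ft 1 (\<lambda>k. cr (1 / (1 + k\<^sup>2)) * \<Phi> k) x"
  unfolding ft_def by (rule integral_divide_zero)
 finally show ?thesis by (metis Re_complex_of_real)
qed

section \<open>Weights and kernel inequalities\<close>

definition J :: "real \<Rightarrow> real" where "J k = sqrt (1 + k\<^sup>2)"

lemma J_measurable [measurable]: "J \<in> BM"
 unfolding J_def[abs_def] by measurable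

lemma J_ge_1: "1 \<le> J k" and J_ge_abs: "\<bar>k\<bar> \<le> J k" and J_minus: "J (- k) = J k" and J_sq: "(J k)\<^sup>2 = 1 + k\<^sup>2"
proof -
 show "1 \<le> J k" by (simp add: J_def)
 show "\<bar>k\<bar> \<le> J k" unfolding J_def by (rule real_le_rsqrt) simp
 show "J (- k) = J k" by (simp add: J_def)
 show "(J k)\<^sup>2 = 1 + k\<^sup>2" by (simp add: J_def)
qed

lemma J_pos: "0 < J k"
 using J_ge_1[of k] by linarith

lemma J_add: "J (a + b) \<le> J a + \<bar>b\<bar>"
proof (rule power2_le_imp_le)
 have "a * b \<le> J a * \<bar>b\<bar>"
  using mult_right_mono[OF J_ge_abs[of a], of "\<bar>b\<bar>"] by (simp add: abs_mult[symmetric])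
 then show "(J (a + b))\<^sup>2 \<le> (J a + \<bar>b\<bar>)\<^sup>2" by (simp add: power2_sum J_sq)
qed (use J_pos[of a] in simp)

lemma J_tri:
 "J k \<le> J (k - l) + J l" "J l \<le> J (k - l) + J k" "J (k - l) \<le> J k + J l"
 "J k \<le> J l + \<bar>k - l\<bar>" "J l \<le> J k + \<bar>k - l\<bar>"
 using J_add[of l "k - l"] J_add[of k "l - k"] J_add[of k "- l"] J_ge_abs[of "k - l"] J_ge_abs[of l]
 by (auto simp: abs_minus_commute)

lemma J_le_of_abs: "\<bar>k\<bar> \<le> real n \<Longrightarrow> J k \<le> real n + 1"
 using J_add[of 0 k] by (simp add: J_def)

text \<open>The constants of all estimates depend on the weight only through the exponent \<^term>\<open>m\<close>; this
 is what makes the energy estimates uniform over a family of weights.\<close>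

definition adm :: "nat \<Rightarrow> (real \<Rightarrow> real) \<Rightarrow> bool" where
 "adm m G \<longleftrightarrow> (\<forall>r r'. 1 \<le> r \<longrightarrow> r \<le> r' \<longrightarrow> 0 < G r \<and> G r \<le> G r' \<and> G r' \<le> (r' / r)^m * G r)"

lemma admD:
 assumes "adm m G" "1 \<le> r" "r \<le> r'"
 shows "0 < G r" "G r \<le> G r'" "G r' \<le> (r' / r)^m * G r"
 using assms by (auto simp: adm_def)

lemma adm_pos: "adm m G \<Longrightarrow> 1 \<le> r \<Longrightarrow> 0 < G r"
 using admD(1)[of m G r r] by simp

lemma adm_scale:
 assumes G: "adm m G" and r: "1 \<le> r" "1 \<le> r'" "r' \<le> c * r" "1 \<le> c"
 shows "G r' \<le> c^m * G r"
proof (cases "r \<le> r'")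
 case True
 have "G r' \<le> (r' / r)^m * G r" by (rule admD(3)[OF G r(1) True])
 also have "\<dots> \<le> c^m * G r"
  using r adm_pos[OF G r(1)] by (intro mult_right_mono power_mono) (auto simp: pos_divide_le_eq)
 finally show ?thesis .
next
 case False
 then have "G r' \<le> G r" by (intro admD(2)[OF G r(2)]) simp
 also have "\<dots> \<le> c^m * G r" using r adm_pos[OF G r(1)] by simp
 finally show ?thesis .
qed

text \<open>The larger of \<open>x\<close> and \<open>y\<close> is at least z/2, and doubling the
  argument costs at most 2^m.\<close>

lemma adm_sub:
 assumes G: "adm m G" and x: "1 \<le> x" "1 \<le> y" "1 \<le> z" "z \<le> x + y"
 shows "G z \<le> 2^m * (G x + G y)"
proof (cases "x \<le> y")
 case True
 have "G z \<le> 2^m * G y" by (rule adm_scale[OF G]) (use x True in auto)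
 also have "\<dots> \<le> 2^m * (G x + G y)" using adm_pos[OF G x(1)] by simp
 finally show ?thesis .
next
 case False
 have "G z \<le> 2^m * G x" by (rule adm_scale[OF G]) (use x False in auto)
 also have "\<dots> \<le> 2^m * (G x + G y)" using adm_pos[OF G x(2)] by simp
 finally show ?thesis .
qed

lemma adm_mult_id:
 assumes "adm m G" shows "adm (Suc m) (\<lambda>r. r * G r)"
 unfolding adm_def
proof (intro allI impI conjI)
 fix r r' :: real assume r: "1 \<le> r" "r \<le> r'"
 note d = admD[OF assms r]
 show "0 < r * G r" using d(1) r by simp
 show "r * G r \<le> r' * G r'" using d r by (intro mult_mono) auto
 have "r' * G r' \<le> r' * ((r' / r)^m * G r)" using d(3) r by (intro mult_left_mono) auto
 also have "\<dots> = (r' / r)^Suc m * (r * G r)" using r by simp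
 finally show "r' * G r' \<le> (r' / r)^Suc m * (r * G r)" .
qed

lemma power_minus_one_le:
 fixes t :: real
 assumes "1 \<le> t" "t \<le> 2" shows "t^m - 1 \<le> real m * 2^m * (t - 1)"
proof (induction m)
 case (Suc m)
 have "t^Suc m - 1 = t * (t^m - 1) + (t - 1)" by (simp add: algebra_simps)
 also have "\<dots> \<le> 2 * (real m * 2^m * (t - 1)) + (t - 1)"
 proof (intro add_mono mult_mono Suc)
  show "0 \<le> t^m - 1" using assms(1) one_le_power[of t m] by simp
 qed (use assms in auto)
 also have "\<dots> \<le> real m * 2^Suc m * (t - 1) + 2^Suc m * (t - 1)"
 proof -
  have "(1::real) \<le> 2^Suc m" by (rule one_le_power) simp
  then have "1 * (t - 1) \<le> 2^Suc m * (t - 1)" using assms(1) by (intro mult_right_mono) auto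
  then show ?thesis by simp
 qed
 also have "\<dots> = real (Suc m) * 2^Suc m * (t - 1)" by (simp add: algebra_simps)
 finally show ?case .
qed simp

text \<open>A finite difference version of r G'(r) \<le> m G(r), which \<open>adm\<close> encodes
  without derivatives. The restriction d \<le> y/2 keeps the ratio of \<open>y\<close> and
  \<open>z\<close> at most 2 in either order, so the power can be linearized; the \<open>min\<close>
  records that either weight may stand on the right.\<close>

lemma adm_diff:
 assumes G: "adm m G" and y: "1 \<le> y" "1 \<le> z" "z \<le> y + d" "y \<le> z + d" "d \<le> y / 2" "0 \<le> d"
 shows "y * \<bar>G z - G y\<bar> \<le> 2 * real m * 2^m * d * min (G y) (G z)"
proof (cases "y \<le> z")
 case True
 note D = admD[OF G y(1) True]
 have t: "1 \<le> z / y" "z / y \<le> 2" using True y by (auto simp: le_divide_eq divide_le_eq)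
 have "G z - G y \<le> ((z / y)^m - 1) * G y" using D(3) by (simp add: algebra_simps)
 also have "\<dots> \<le> (real m * 2^m * (z / y - 1)) * G y"
  using D(1) by (intro mult_right_mono power_minus_one_le t) auto
 finally have "y * (G z - G y) \<le> y * ((real m * 2^m * (z / y - 1)) * G y)"
  using y by (intro mult_left_mono) auto
 also have "\<dots> = real m * 2^m * (z - y) * G y" using y by (simp add: field_simps)
 also have "\<dots> \<le> real m * 2^m * (2 * d) * G y"
  using y D(1) by (intro mult_right_mono mult_left_mono) auto
 finally show ?thesis using D(2) y by (simp add: min_def algebra_simps)
next
 case False
 then have zy: "z \<le> y" by simp
 note D = admD[OF G y(2) zy]
 have y2: "y \<le> 2 * z" using y by simp
 have t: "1 \<le> y / z" "y / z \<le> 2" using zy y y2 by (auto simp: le_divide_eq divide_le_eq)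
 have "G y - G z \<le> ((y / z)^m - 1) * G z" using D(3) by (simp add: algebra_simps)
 also have "\<dots> \<le> (real m * 2^m * (y / z - 1)) * G z"
  using D(1) by (intro mult_right_mono power_minus_one_le t) auto
 finally have "y * (G y - G z) \<le> y * ((real m * 2^m * (y / z - 1)) * G z)"
  using y by (intro mult_left_mono) auto
 also have "\<dots> = (y / z) * (real m * 2^m * (y - z) * G z)" using y by (simp add: field_simps)
 also have "\<dots> \<le> 2 * (real m * 2^m * d * G z)"
  using y t D(1) zy by (intro mult_mono mult_nonneg_nonneg) auto
 finally have "y * (G y - G z) \<le> 2 * real m * 2^m * d * G z" by simp
 moreover have "min (G y) (G z) = G z" "\<bar>G z - G y\<bar> = G y - G z" using D(2) by auto
 ultimately show ?thesis by (simp only:)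
qed

text \<open>Two regimes. If k and l are close relative to J l, the weights nearly cancel by
  \<open>adm_diff\<close>. If they are far apart, J l and J k are at most 3 J(k - l), so one weight
  is moved to the difference frequency and no cancellation is used. The minima keep both readings of
  the second regime open: the H^s estimate bounds them by J l and J k, the H^(s-1) estimate by J(k -
  l).\<close>

lemma commutator_kernel:
 fixes k l :: real
 assumes G: "adm m G"
 defines "x \<equiv> J (k - l)" and "y \<equiv> J l" and "z \<equiv> J k"
 shows "\<bar>l * (G z)\<^sup>2 - k * (G y)\<^sup>2\<bar> \<le> ((4 * real m + 3) * 3^m) *
   (x * G y * G z + min x y * G x * G z + min x z * G x * G y)"
proof -
 let ?C = "(4 * real m + 3) * 3^m"
 have x1: "1 \<le> x" "1 \<le> y" "1 \<le> z" by (auto simp: x_def y_def z_def J_ge_1)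
 note P = adm_pos[OF G x1(1)] adm_pos[OF G x1(2)] adm_pos[OF G x1(3)]
 have ab: "\<bar>l\<bar> \<le> y" "\<bar>k\<bar> \<le> z" "\<bar>k - l\<bar> \<le> x" by (auto simp: x_def y_def z_def J_ge_abs)
 have tri: "z \<le> x + y" "z \<le> y + \<bar>k - l\<bar>" "y \<le> z + \<bar>k - l\<bar>" using J_tri by (auto simp: x_def y_def z_def)
 have m23: "(2::real)^m \<le> 3^m" by (rule power_mono) auto
 have nn: "0 \<le> min x y * G x * G z" "0 \<le> min x z * G x * G y" "0 \<le> x * G y * G z"
  using x1 P by (auto intro!: mult_nonneg_nonneg)
 show ?thesis
 proof (cases "\<bar>k - l\<bar> \<le> y / 2")
  case True
  let ?d = "\<bar>k - l\<bar>"
  have y2z: "y \<le> 2 * z" using tri True by simp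
  \<comment> \<open>The large factor l meets only a difference of weights; the remainder carries
    just k - l.\<close>
  have "l * (G z)\<^sup>2 - k * (G y)\<^sup>2 = l * ((G z - G y) * (G z + G y)) - (k - l) * (G y)\<^sup>2"
   by (simp add: power2_eq_square algebra_simps)
  also have "\<bar>\<dots>\<bar> \<le> \<bar>l * ((G z - G y) * (G z + G y))\<bar> + \<bar>(k - l) * (G y)\<^sup>2\<bar>" by (rule abs_triangle_ineq4)
  also have "\<bar>l * ((G z - G y) * (G z + G y))\<bar> \<le> (2 * real m * 2^m * ?d * min (G y) (G z)) * (2 * max (G y) (G z))"
  proof -
   have "\<bar>l * ((G z - G y) * (G z + G y))\<bar> = (\<bar>l\<bar> * \<bar>G z - G y\<bar>) * (G z + G y)"
    using P by (simp add: abs_mult)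
   also have "\<dots> \<le> (y * \<bar>G z - G y\<bar>) * (G z + G y)"
    using ab P by (intro mult_right_mono) auto
   also have "\<dots> \<le> (2 * real m * 2^m * ?d * min (G y) (G z)) * (2 * max (G y) (G z))"
    by (rule mult_mono[OF adm_diff[OF G x1(2,3) tri(2,3) True]]) (use P in \<open>auto intro!: mult_nonneg_nonneg\<close>)
   finally show ?thesis .
  qed
  also have "\<dots> = 4 * real m * 2^m * ?d * (G y * G z)" by (simp add: min_def max_def)
  also have "\<bar>(k - l) * (G y)\<^sup>2\<bar> \<le> ?d * (G y * (2^m * G z))"
   unfolding abs_mult using adm_scale[OF G x1(3,2) y2z] P by (auto simp: power2_eq_square intro!: mult_left_mono)
  finally have "\<bar>l * (G z)\<^sup>2 - k * (G y)\<^sup>2\<bar> \<le> (4 * real m + 1) * 2^m * (?d * (G y * G z))"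
   by (simp add: algebra_simps)
  also have "\<dots> \<le> ?C * (x * (G y * G z))"
   using ab P m23 by (intro mult_mono mult_nonneg_nonneg) auto
  also have "\<dots> \<le> ?C * (x * G y * G z + min x y * G x * G z + min x z * G x * G y)"
   using nn by (intro mult_left_mono) (auto simp: mult.assoc)
  finally show ?thesis .
 next
  case False
  then have y2: "y \<le> 2 * x" using ab by simp
  then have z3: "z \<le> 3 * x" using tri by simp
  have Gz: "G z \<le> 3^m * G x" by (rule adm_scale[OF G x1(1,3) z3]) simp
  have Gy: "G y \<le> 3^m * G x" by (rule adm_scale[OF G x1(1,2)]) (use y2 x1 in auto)
  have "\<bar>l * (G z)\<^sup>2 - k * (G y)\<^sup>2\<bar> \<le> \<bar>l * (G z)\<^sup>2\<bar> + \<bar>k * (G y)\<^sup>2\<bar>" by (rule abs_triangle_ineq4)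
  also have "\<bar>l * (G z)\<^sup>2\<bar> \<le> (2 * min x y) * ((3^m * G x) * G z)"
  proof -
   have "y \<le> 2 * min x y" using y2 x1 by (auto simp: min_def)
   then show ?thesis unfolding abs_mult power2_eq_square
    using ab P Gz by (intro mult_mono) auto
  qed
  also have "\<bar>k * (G y)\<^sup>2\<bar> \<le> (3 * min x z) * ((3^m * G x) * G y)"
  proof -
   have "z \<le> 3 * min x z" using z3 x1 by (auto simp: min_def)
   then show ?thesis unfolding abs_mult power2_eq_square
    using ab P Gy by (intro mult_mono) auto
  qed
  also have "(2 * min x y) * ((3^m * G x) * G z) + (3 * min x z) * ((3^m * G x) * G y)
   = 3^m * (2 * (min x y * G x * G z) + 3 * (min x z * G x * G y))" by (simp add: algebra_simps)
  also have "\<dots> \<le> 3^m * ((4 * real m + 3) * (x * G y * G z + min x y * G x * G z + min x z * G x * G y))"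
  proof (intro mult_left_mono)
   have "2 * (min x y * G x * G z) + 3 * (min x z * G x * G y) \<le> 3 * (x * G y * G z + min x y * G x * G z + min x z * G x * G y)"
    using nn unfolding distrib_left by linarith
   also have "\<dots> \<le> (4 * real m + 3) * (x * G y * G z + min x y * G x * G z + min x z * G x * G y)"
    using nn by (intro mult_right_mono) auto
   finally show "2 * (min x y * G x * G z) + 3 * (min x z * G x * G y) \<le> (4 * real m + 3) * (x * G y * G z + min x y * G x * G z + min x z * G x * G y)" .
  qed simp
  finally show ?thesis by (simp add: mult_ac)
 qed
qed

locale rod =
 fixes \<gamma> \<omega> \<sigma> :: real
 assumes \<sigma>: "1/2 < \<sigma>"
begin

text \<open>The ceiling pays for the growth of \<open>r powr \<sigma>\<close>, the added 1 for that
  of \<open>r / (R + r)\<close>; neither depends on R.\<close>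

definition m :: nat where "m = nat \<lceil>\<sigma>\<rceil> + 1"

text \<open>With \<open>\<sigma> = s - 1\<close>, \<open>kw R\<close> and \<open>gw R\<close> are the weights of \<open>H\<^bsup>s-1\<^esup>\<close> and \<open>H\<^sup>s\<close> for \<open>R = 0\<close>; for \<open>R > 0\<close> they
 only see frequencies that are not small compared with \<open>R\<close>.\<close>

definition K :: "real \<Rightarrow> real \<Rightarrow> real" where "K R r = r powr \<sigma> * (r / (R + r))"

definition kw :: "real \<Rightarrow> real \<Rightarrow> real" where "kw R k = K R (J k)"

definition gw :: "real \<Rightarrow> real \<Rightarrow> real" where "gw R k = J k * K R (J k)"

text \<open>Square integrable because \<sigma> > 1/2. As J = \<open>\<rho> * gw 0\<close>, a
  derivative can be exchanged for a full H^s weight together with one factor \<open>\<rho>\<close>,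
  which makes the function carrying it integrable.\<close>

definition \<rho> :: "real \<Rightarrow> real" where "\<rho> k = 1 / kw 0 k"

lemma adm_K: assumes R: "0 \<le> R" shows "adm m (K R)"
 unfolding adm_def
proof (intro allI impI conjI)
 fix r r' :: real assume r: "1 \<le> r" "r \<le> r'"
 have f: "r / (R + r) \<le> r' / (R + r')"
 proof -
  have e: "t / (R + t) = 1 - R / (R + t)" if "1 \<le> t" for t using that R by (simp add: field_simps)
  have "R / (R + r') \<le> R / (R + r)" using r R by (intro frac_le) auto
  then show ?thesis using r by (simp add: e)
 qed
 have f2: "r' / (R + r') \<le> (r' / r) * (r / (R + r))"
  using r R by (simp add: frac_le)
 show "0 < K R r" using r R by (simp add: K_def add_nonneg_pos)
 show "K R r \<le> K R r'" unfolding K_def using r R \<sigma> f by (intro mult_mono powr_mono2) auto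
 have "r' powr \<sigma> = (r' / r) powr \<sigma> * r powr \<sigma>" using r by (simp add: powr_mult[symmetric])
 also have "(r' / r) powr \<sigma> \<le> (r' / r) powr real (nat \<lceil>\<sigma>\<rceil>)"
  using r by (intro powr_mono) (auto simp: le_divide_eq, linarith)
 also have "\<dots> = (r' / r) ^ nat \<lceil>\<sigma>\<rceil>" using r by (intro powr_realpow) auto
 finally have p: "r' powr \<sigma> \<le> (r' / r) ^ nat \<lceil>\<sigma>\<rceil> * r powr \<sigma>" by (simp add: mult_right_mono)
 have "K R r' \<le> ((r' / r) ^ nat \<lceil>\<sigma>\<rceil> * r powr \<sigma>) * ((r' / r) * (r / (R + r)))"
  unfolding K_def using p f2 r R by (intro mult_mono) auto
 also have "\<dots> = (r' / r)^m * K R r" by (simp add: K_def m_def)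
 finally show "K R r' \<le> (r' / r)^m * K R r" .
qed

lemma K_0: "1 \<le> r \<Longrightarrow> K 0 r = r powr \<sigma>"
 by (simp add: K_def)

lemma K_le: "0 \<le> R \<Longrightarrow> 1 \<le> r \<Longrightarrow> K R r \<le> K 0 r"
 unfolding K_def by (intro mult_left_mono frac_le) auto

lemma K_measurable [measurable]: "K R \<in> BM"
 unfolding K_def[abs_def] by measurable

lemma weight_kw: "0 \<le> R \<Longrightarrow> weight (kw R)"
 using adm_pos[OF adm_K J_ge_1] by (simp add: weight_def kw_def[abs_def])

lemma weight_gw: "0 \<le> R \<Longrightarrow> weight (gw R)"
 using adm_pos[OF adm_K J_ge_1] J_pos by (simp add: weight_def gw_def[abs_def])

lemma gw_eq: "gw R k = J k * kw R k"
 by (simp add: gw_def kw_def)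

lemma kw_0: "kw 0 k = J k powr \<sigma>"
 by (simp add: kw_def K_0 J_ge_1)

lemma kw_le: "0 \<le> R \<Longrightarrow> kw R k \<le> kw 0 k"
 by (simp add: kw_def K_le J_ge_1)

lemma gw_le: "0 \<le> R \<Longrightarrow> gw R k \<le> gw 0 k"
 using kw_le[of R k] J_pos[of k] by (simp add: gw_eq)

lemma kw_0_ge_1: "1 \<le> kw 0 k"
 using J_ge_1[of k] \<sigma> by (simp add: kw_0 ge_one_powr_ge_zero)

lemma \<rho>_measurable [measurable]: "\<rho> \<in> BM"
 unfolding \<rho>_def[abs_def] kw_def[abs_def] by measurable

lemma \<rho>_pos: "0 < \<rho> k"
 using kw_0_ge_1[of k] by (simp add: \<rho>_def)

lemma \<rho>_L2: "\<rho> \<in> L2"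
proof -
 have "(\<rho> k)\<^sup>2 = (1 + k\<^sup>2) powr (-\<sigma>)" for k
 proof -
  have "J k powr 2 = 1 + k\<^sup>2" using J_sq[of k] J_pos[of k] by (simp add: powr_numeral)
  then have "(1 + k\<^sup>2) powr (-\<sigma>) = (J k powr 2) powr (-\<sigma>)" by simp
  also have "\<dots> = J k powr (2 * (-\<sigma>))" by (rule powr_powr)
  also have "2 * (-\<sigma>) = -\<sigma> + -\<sigma>" by simp
  also have "J k powr (-\<sigma> + -\<sigma>) = J k powr (-\<sigma>) * J k powr (-\<sigma>)" by (rule powr_add)
  finally show ?thesis by (simp add: \<rho>_def kw_0 powr_minus divide_inverse power2_eq_square)
 qed
 then show ?thesis using integrable_bracket[OF \<sigma>] by (simp add: L2_def)
qed

definition \<rho>n :: real where "\<rho>n = l2n \<rho>"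

text \<open>Serves the H^(s-1) estimate of the nonlocal term, where the gain 1/z at the output has
  to pay for the derivative y on one input. If y \<le> 2z the quotient is bounded. Otherwise y \<le>
  2x, and y/z is at most (y/z)^(2\<sigma>).\<close>

lemma high_low_kernel:
 assumes x: "1 \<le> x" "1 \<le> y" "1 \<le> z" and tri: "z \<le> x + y" "y \<le> x + z"
 shows "K 0 z * y / z \<le> 3 * 2^m * (K 0 y + K 0 x + K 0 x * K 0 y / K 0 z)"
proof -
 note adm = adm_K[of 0, simplified]
 note P = adm_pos[OF adm x(1)] adm_pos[OF adm x(2)] adm_pos[OF adm x(3)]
 have nn: "0 \<le> K 0 x * K 0 y / K 0 z" using P by simp
 show ?thesis
 proof (cases "y \<le> 2 * z")
  case True
  then have "y / z \<le> 2" using x by (simp add: divide_le_eq)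
  then have "K 0 z * (y / z) \<le> (2^m * (K 0 x + K 0 y)) * 2"
   using adm_sub[OF adm x tri(1)] P x by (intro mult_mono) auto
  also have "\<dots> \<le> 3 * 2^m * (K 0 y + K 0 x + K 0 x * K 0 y / K 0 z)"
  proof -
   have "2 * (a + b) \<le> 3 * (b + a + t)" if "0 < a" "0 < b" "0 \<le> t" for a b t :: real using that unfolding distrib_left by linarith
   from this[OF P(1,2) nn] have "2 * (K 0 x + K 0 y) \<le> 3 * (K 0 y + K 0 x + K 0 x * K 0 y / K 0 z)" .
   then have "2^m * (2 * (K 0 x + K 0 y)) \<le> 2^m * (3 * (K 0 y + K 0 x + K 0 x * K 0 y / K 0 z))"
    by (rule mult_left_mono) simp
   then show ?thesis by (simp add: mult_ac)
  qed
  finally show ?thesis by simp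
 next
  case False
  then have "y \<le> 2 * x" using tri by simp
  then have Ky: "K 0 y \<le> 2^m * K 0 x" by (intro adm_scale[OF adm x(1,2)]) auto
  \<comment> \<open>This is where 2\<sigma> \<ge> 1 is used: the excess y/z is absorbed by
    exchanging both weights at z for weights at y.\<close>
  have "K 0 z * y / z * K 0 z \<le> K 0 y * K 0 y"
  proof -
   have e: "K 0 z * y / z * K 0 z = (y / z) * (z powr (2 * \<sigma>))" "K 0 y * K 0 y = y powr (2 * \<sigma>)"
    using x by (auto simp: K_0 powr_add[symmetric])
   have "y / z = (y / z) powr 1" using x by simp
   also have "\<dots> \<le> (y / z) powr (2 * \<sigma>)"
    using x False \<sigma> by (intro powr_mono) (auto simp: le_divide_eq)
   also have "\<dots> = y powr (2 * \<sigma>) / z powr (2 * \<sigma>)" using x by (simp add: powr_divide)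
   finally show ?thesis unfolding e using x by (simp add: le_divide_eq)
  qed
  also have "\<dots> \<le> (2^m * K 0 x) * K 0 y" using Ky P by (intro mult_right_mono) auto
  finally have "K 0 z * y / z \<le> 2^m * (K 0 x * K 0 y / K 0 z)"
   using P by (simp add: le_divide_eq mult.assoc)
  also have "\<dots> \<le> 3 * 2^m * (K 0 y + K 0 x + K 0 x * K 0 y / K 0 z)"
  proof -
   have "t \<le> 3 * (b + a + t)" if "0 < a" "0 < b" "0 \<le> t" for a b t :: real using that unfolding distrib_left by linarith
   from this[OF P(1,2) nn] have "K 0 x * K 0 y / K 0 z \<le> 3 * (K 0 y + K 0 x + K 0 x * K 0 y / K 0 z)" .
   then have "2^m * (K 0 x * K 0 y / K 0 z) \<le> 2^m * (3 * (K 0 y + K 0 x + K 0 x * K 0 y / K 0 z))"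
    by (rule mult_left_mono) simp
   then show ?thesis by (simp only: mult_ac)
  qed
  finally show ?thesis .
 qed
qed

section \<open>Estimates for the nonlinearity\<close>


lemma \<rho>n_nonneg [simp]: "0 \<le> \<rho>n" by (simp add: \<rho>n_def)

lemma L1_of_weighted:
 assumes P: "P \<in> L2" shows "(\<integral>\<^sup>+x. ennreal \<bar>\<rho> x * P x\<bar> \<partial>lborel) \<le> ennreal (\<rho>n * l2n P)"
 unfolding \<rho>n_def by (rule nn_CS[OF \<rho>_L2 P])

text \<open>Each summand of the last factor places one \<open>\<rho>\<close> on one of the
  functions, which then is in L^1 by Cauchy-Schwarz while the other two stay in L^2.\<close>

lemma tri_rho:
 assumes P: "P \<in> L2" and Q: "Q \<in> L2" and R: "R \<in> L2" and nn: "\<And>x. 0 \<le> P x" "\<And>x. 0 \<le> Q x" "\<And>x. 0 \<le> R x"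
 shows "dint (\<lambda>v l. P (v - l) * Q l * R v * (\<rho> (v - l) + \<rho> l + \<rho> v))
  \<le> ennreal (3 * \<rho>n * l2n P * l2n Q * l2n R)"
proof -
 have [measurable]: "P \<in> BM" "Q \<in> BM" "R \<in> BM"
  using P Q R by (auto simp: L2_def)
 have m: "(\<lambda>x. \<rho> x * P x) \<in> BM" "(\<lambda>x. \<rho> x * Q x) \<in> BM" "(\<lambda>x. \<rho> x * R x) \<in> BM"
  by measurable
 have r0: "0 \<le> \<rho> x" for x using \<rho>_pos[of x] by simp
 let ?t1 = "\<lambda>v l. ennreal \<bar>(\<rho> (v - l) * P (v - l)) * Q l * R v\<bar>"
 let ?t2 = "\<lambda>v l. ennreal \<bar>P (v - l) * (\<rho> l * Q l) * R v\<bar>"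
 let ?t3 = "\<lambda>v l. ennreal \<bar>P (v - l) * Q l * (\<rho> v * R v)\<bar>"
 have e: "ennreal (P (v - l) * Q l * R v * (\<rho> (v - l) + \<rho> l + \<rho> v)) = (?t1 v l + ?t2 v l) + ?t3 v l" for v l
 proof -
  have "P (v - l) * Q l * R v * (\<rho> (v - l) + \<rho> l + \<rho> v)
   = ((\<rho> (v - l) * P (v - l)) * Q l * R v + P (v - l) * (\<rho> l * Q l) * R v) + P (v - l) * Q l * (\<rho> v * R v)"
   by (simp add: algebra_simps)
  then show ?thesis using nn r0 by (simp add: ennreal_plus[symmetric] del: ennreal_plus)
 qed
 have "dint (\<lambda>v l. P (v - l) * Q l * R v * (\<rho> (v - l) + \<rho> l + \<rho> v))
  = (\<integral>\<^sup>+v. \<integral>\<^sup>+l. ?t1 v l \<partial>lborel \<partial>lborel) + (\<integral>\<^sup>+v. \<integral>\<^sup>+l. ?t2 v l \<partial>lborel \<partial>lborel) + (\<integral>\<^sup>+v. \<integral>\<^sup>+l. ?t3 v l \<partial>lborel \<partial>lborel)"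
  unfolding e by (simp add: nn_integral_add)
 also have "\<dots> \<le> ennreal ((\<rho>n * l2n P) * l2n Q * l2n R) + ennreal (l2n P * (\<rho>n * l2n Q) * l2n R) + ennreal (l2n P * l2n Q * (\<rho>n * l2n R))"
  by (intro add_mono tri1[OF m(1) Q R] tri2[OF m(2) P R] tri3[OF m(3) P Q] L1_of_weighted P Q R) simp_all
 also have "\<dots> = ennreal (3 * \<rho>n * l2n P * l2n Q * l2n R)"
  by (simp add: ennreal_plus[symmetric] mult_ac del: ennreal_plus)
 finally show ?thesis .
qed

text \<open>After this, an energy estimate is a matter of verifying the kernel inequality
  \<open>le\<close>.\<close>

lemma tri_kernel:
 assumes w: "weight p" "weight q" "weight r" and H: "U \<in> H p" "V \<in> H q" "D \<in> H r" and C: "0 \<le> C"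
  and le: "\<And>v l. \<kappa> v l \<le> C * (p (v - l) * q l * r v * (\<rho> (v - l) + \<rho> l + \<rho> v))"
 shows "dint (\<lambda>v l. \<kappa> v l * (cmod (U (v - l)) * cmod (V l) * cmod (D v)))
  \<le> ennreal (C * (3 * \<rho>n * nm p U * nm q V * nm r D))"
proof -
 have [measurable]: "U \<in> BM" "V \<in> BM" "D \<in> BM"
  "p \<in> BM" "q \<in> BM" "r \<in> BM"
  using w H by (auto simp: H_def weight_def)
 let ?P = "\<lambda>x. p x * cmod (U x)" and ?Q = "\<lambda>x. q x * cmod (V x)" and ?R = "\<lambda>x. r x * cmod (D x)"
 have "dint (\<lambda>v l. \<kappa> v l * (cmod (U (v - l)) * cmod (V l) * cmod (D v)))
   \<le> (\<integral>\<^sup>+v. \<integral>\<^sup>+l. ennreal C * ennreal (?P (v - l) * ?Q l * ?R v * (\<rho> (v - l) + \<rho> l + \<rho> v)) \<partial>lborel \<partial>lborel)"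
 proof (intro nn_integral_mono)
  fix v l
  have "\<kappa> v l * (cmod (U (v - l)) * cmod (V l) * cmod (D v))
    \<le> (C * (p (v - l) * q l * r v * (\<rho> (v - l) + \<rho> l + \<rho> v))) * (cmod (U (v - l)) * cmod (V l) * cmod (D v))"
   by (intro mult_right_mono le) simp
  also have "\<dots> = C * (?P (v - l) * ?Q l * ?R v * (\<rho> (v - l) + \<rho> l + \<rho> v))" by (simp only: mult_ac)
  finally show "ennreal (\<kappa> v l * (cmod (U (v - l)) * cmod (V l) * cmod (D v)))
    \<le> ennreal C * ennreal (?P (v - l) * ?Q l * ?R v * (\<rho> (v - l) + \<rho> l + \<rho> v))"
   using C by (subst ennreal_mult'[symmetric]) (auto intro: ennreal_leI)
 qed
 also have "\<dots> = ennreal C * dint (\<lambda>v l. ?P (v - l) * ?Q l * ?R v * (\<rho> (v - l) + \<rho> l + \<rho> v))"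
  by (simp add: nn_integral_cmult)
 also have "\<dots> \<le> ennreal C * ennreal (3 * \<rho>n * l2n ?P * l2n ?Q * l2n ?R)"
  by (intro mult_left_mono tri_rho H_L2 H) (use w in \<open>auto simp: weight_nonneg\<close>)
 also have "\<dots> = ennreal (C * (3 * \<rho>n * nm p U * nm q V * nm r D))"
  using C by (simp add: nm_def ennreal_mult')
 finally show ?thesis .
qed

text \<open>The weight \<open>g\<close> sits on each of the three factors in turn, so the bound is
  linear in \<open>nm g U\<close> and quadratic in \<open>nm G U\<close>. With \<open>gw 0\<close>
  and \<open>gw R\<close> in these roles, the square of the R-norm grows at a rate proportional to
  itself.\<close>

lemma tri_kernel3:
 assumes w: "weight g" "weight G" and H: "U \<in> H g" "U \<in> H G" and C: "0 \<le> C"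
  and le: "\<And>v l. \<kappa> v l \<le> C * ((g (v - l) * G l * G v + G (v - l) * g l * G v + G (v - l) * G l * g v) * (\<rho> (v - l) + \<rho> l + \<rho> v))"
 shows "dint (\<lambda>v l. \<kappa> v l * (cmod (U (v - l)) * cmod (U l) * cmod (U v)))
  \<le> ennreal (C * (9 * \<rho>n * nm g U * (nm G U)\<^sup>2))"
proof -
 have [measurable]: "U \<in> BM" "g \<in> BM" "G \<in> BM"
  using w H by (auto simp: H_def weight_def)
 let ?u = "\<lambda>v l. cmod (U (v - l)) * cmod (U l) * cmod (U v)" and ?r = "\<lambda>v l. \<rho> (v - l) + \<rho> l + \<rho> v"
 let ?k1 = "\<lambda>v l. C * (g (v - l) * G l * G v * ?r v l)" and ?k2 = "\<lambda>v l. C * (G (v - l) * g l * G v * ?r v l)"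
  and ?k3 = "\<lambda>v l. C * (G (v - l) * G l * g v * ?r v l)"
 have r0: "0 \<le> ?r v l" for v l using \<rho>_pos[of "v - l"] \<rho>_pos[of l] \<rho>_pos[of v] by simp
 have g0: "0 \<le> g x" "0 \<le> G x" for x using w by (auto simp: weight_nonneg)
 have "dint (\<lambda>v l. \<kappa> v l * ?u v l)
  \<le> (\<integral>\<^sup>+v. \<integral>\<^sup>+l. (ennreal (?k1 v l * ?u v l) + ennreal (?k2 v l * ?u v l)) + ennreal (?k3 v l * ?u v l) \<partial>lborel \<partial>lborel)"
 proof (intro nn_integral_mono)
  fix v l
  have "\<kappa> v l * ?u v l \<le> (C * ((g (v - l) * G l * G v + G (v - l) * g l * G v + G (v - l) * G l * g v) * ?r v l)) * ?u v l"
   by (intro mult_right_mono le) simp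
  also have "\<dots> = (?k1 v l * ?u v l + ?k2 v l * ?u v l) + ?k3 v l * ?u v l"
   by (simp only: distrib_left distrib_right)
  finally show "ennreal (\<kappa> v l * ?u v l) \<le> (ennreal (?k1 v l * ?u v l) + ennreal (?k2 v l * ?u v l)) + ennreal (?k3 v l * ?u v l)"
   using C g0 r0 by (subst ennreal_plus[symmetric], simp, simp, subst ennreal_plus[symmetric], simp, simp) (rule ennreal_leI)
 qed
 also have "\<dots> = dint (\<lambda>v l. ?k1 v l * ?u v l) + dint (\<lambda>v l. ?k2 v l * ?u v l)
   + dint (\<lambda>v l. ?k3 v l * ?u v l)"
  by (simp add: nn_integral_add)
 also have "\<dots> \<le> ennreal (C * (3 * \<rho>n * nm g U * nm G U * nm G U)) + ennreal (C * (3 * \<rho>n * nm G U * nm g U * nm G U))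
   + ennreal (C * (3 * \<rho>n * nm G U * nm G U * nm g U))"
  by (intro add_mono tri_kernel w H C order_refl)
 also have "\<dots> = ennreal (C * (9 * \<rho>n * nm g U * (nm G U)\<^sup>2))"
  using C by (simp add: ennreal_plus[symmetric] power2_eq_square mult_ac del: ennreal_plus)
 finally show ?thesis .
qed

text \<open>The real symbol, up to the factor i, of the quadratic part for output frequency v and
  input frequencies v - l and l. The term \<open>\<gamma> * l\<close> is transport, with the
  derivative on the second input; the rest comes from u^2 and u_x^2 under the nonlocal operator, the
  minus sign being the product of two factors i.\<close>

definition br :: "real \<Rightarrow> real \<Rightarrow> real" where
 "br v l = - (\<gamma> * l + v / (1 + v\<^sup>2) * ((3 - \<gamma>) / 2 - \<gamma> / 2 * (v - l) * l)) / sqrt (2 * pi)"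

definition c1 :: real where "c1 = \<bar>3 - \<gamma>\<bar> + \<bar>\<gamma>\<bar>"

lemma br_measurable [measurable]: "case_prod br \<in> borel_measurable (borel \<Otimes>\<^sub>M borel)"
 unfolding br_def by measurable

lemma abs_div_bracket: "\<bar>v / (1 + v\<^sup>2)\<bar> \<le> 1 / J v"
proof -
 have "\<bar>v\<bar> / (J v)\<^sup>2 \<le> J v / (J v)\<^sup>2" by (intro divide_right_mono J_ge_abs) simp
 also have "\<dots> = 1 / J v" using J_pos[of v] by (simp add: power2_eq_square)
 finally show ?thesis by (simp add: J_sq abs_divide add_nonneg_nonneg abs_of_nonneg)
qed

text \<open>Without the transport term the symbol has order one in each input, but order minus one
  in the output.\<close>

lemma br_rem: "\<bar>br v l + \<gamma> * l / sqrt (2 * pi)\<bar> \<le> c1 * (J (v - l) * J l / J v)"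
proof -
 let ?x = "J (v - l)" and ?y = "J l"
 have xy: "1 \<le> ?x * ?y" using mult_mono[OF J_ge_1[of "v - l"] J_ge_1[of l]] J_pos[of "v - l"] by simp
 have "\<bar>(3 - \<gamma>) / 2 - \<gamma> / 2 * (v - l) * l\<bar> \<le> \<bar>(3 - \<gamma>) / 2\<bar> + \<bar>\<gamma> / 2 * (v - l) * l\<bar>" by (rule abs_triangle_ineq4)
 also have "\<dots> = \<bar>3 - \<gamma>\<bar> / 2 * 1 + \<bar>\<gamma>\<bar> / 2 * (\<bar>v - l\<bar> * \<bar>l\<bar>)" by (simp add: abs_mult)
 also have "\<dots> \<le> \<bar>3 - \<gamma>\<bar> / 2 * (?x * ?y) + \<bar>\<gamma>\<bar> / 2 * (?x * ?y)"
  using xy J_ge_abs[of "v - l"] J_ge_abs[of l] J_pos[of "v - l"] by (intro add_mono mult_left_mono mult_mono) auto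
 also have "\<dots> \<le> c1 * (?x * ?y)"
  unfolding c1_def distrib_right using xy by (intro add_mono mult_right_mono) auto
 finally have 1: "\<bar>(3 - \<gamma>) / 2 - \<gamma> / 2 * (v - l) * l\<bar> \<le> c1 * (?x * ?y)" .
 have "br v l + \<gamma> * l / sqrt (2 * pi) = - (v / (1 + v\<^sup>2) * ((3 - \<gamma>) / 2 - \<gamma> / 2 * (v - l) * l)) / sqrt (2 * pi)"
  unfolding br_def minus_divide_left[symmetric] add_divide_distrib by simp
 also have "\<bar>\<dots>\<bar> = \<bar>v / (1 + v\<^sup>2)\<bar> * \<bar>(3 - \<gamma>) / 2 - \<gamma> / 2 * (v - l) * l\<bar> / sqrt (2 * pi)"
  unfolding abs_divide abs_minus_cancel abs_mult using sqrt_2pi by simp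
 also have "\<dots> \<le> ((1 / J v) * (c1 * (?x * ?y))) / 1"
  by (rule frac_le[OF _ mult_mono[OF abs_div_bracket 1]]) (use sqrt_2pi in \<open>auto simp: c1_def intro!: divide_nonneg_pos mult_nonneg_nonneg add_nonneg_nonneg less_imp_le[OF J_pos] J_pos\<close>)
 finally show ?thesis by simp
qed

lemma br_bound1: "\<bar>br v l\<bar> \<le> \<bar>\<gamma>\<bar> * J l + c1 * (J (v - l) * J l / J v)"
proof -
 have "\<bar>br v l\<bar> \<le> \<bar>br v l + \<gamma> * l / sqrt (2 * pi)\<bar> + \<bar>\<gamma> * l / sqrt (2 * pi)\<bar>"
  using abs_triangle_ineq4[of "br v l + \<gamma> * l / sqrt (2 * pi)" "\<gamma> * l / sqrt (2 * pi)"] by simp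
 also have "\<bar>\<gamma> * l / sqrt (2 * pi)\<bar> \<le> \<bar>\<gamma>\<bar> * J l / 1"
  unfolding abs_divide abs_mult using sqrt_2pi J_ge_abs[of l] by (intro frac_le mult_left_mono) auto
 finally show ?thesis using br_rem[of v l] by simp
qed

definition c2 :: real where "c2 = \<bar>\<gamma>\<bar> + c1"

lemma c_nonneg [simp]: "0 \<le> c1" "0 \<le> c2"
 by (auto simp: c1_def c2_def)

lemma br_bound: "\<bar>br v l\<bar> \<le> c2 * (J (v - l) * J l)"
proof -
 let ?xy = "J (v - l) * J l"
 have y: "J l \<le> ?xy" using mult_right_mono[OF J_ge_1[of "v - l"], of "J l"] J_pos[of l] by simp
 have z: "?xy / J v \<le> ?xy"
 proof -
  have "?xy / J v \<le> ?xy / 1"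
   using J_ge_1[of v] J_pos[of "v - l"] J_pos[of l] by (intro divide_left_mono) auto
  then show ?thesis by simp
 qed
 have "\<bar>br v l\<bar> \<le> \<bar>\<gamma>\<bar> * ?xy + c1 * ?xy"
  using br_bound1[of v l] mult_left_mono[OF y, of "\<bar>\<gamma>\<bar>"] mult_left_mono[OF z, of c1] by simp
 then show ?thesis by (simp add: c2_def distrib_right)
qed

text \<open>\<open>Nl (fourier u)\<close> is the transform of \<open>- \<gamma> u u\<^sub>x - \<partial>\<^sub>x p * ((3 - \<gamma>) / 2 u\<^sup>2 + \<gamma> / 2 u\<^sub>x\<^sup>2 + 2 \<omega> u)\<close>, split into
 its quadratic and its linear part.\<close>

definition Bl :: "(real \<Rightarrow> complex) \<Rightarrow> (real \<Rightarrow> complex) \<Rightarrow> real \<Rightarrow> complex" where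
 "Bl U V v = \<i> * (LINT l|lborel. cr (br v l) * (U (v - l) * V l))"

definition Li :: "(real \<Rightarrow> complex) \<Rightarrow> real \<Rightarrow> complex" where
 "Li U v = \<i> * cr (- (2 * \<omega> * v / (1 + v\<^sup>2))) * U v"

definition Nl :: "(real \<Rightarrow> complex) \<Rightarrow> real \<Rightarrow> complex" where
 "Nl U v = Bl U U v + Li U v"

lemma Bl_measurable [measurable]:
 assumes [measurable]: "U \<in> BM" "V \<in> BM"
 shows "Bl U V \<in> BM"
 unfolding Bl_def[abs_def] by measurable

lemma Li_measurable [measurable]:
 assumes [measurable]: "U \<in> BM" shows "Li U \<in> BM"
 unfolding Li_def[abs_def] by measurable

lemma Nl_measurable [measurable]:
 assumes [measurable]: "U \<in> BM" shows "Nl U \<in> BM"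
 unfolding Nl_def[abs_def] by measurable

lemma H_gw: assumes R: "0 \<le> R" and U: "U \<in> H (gw 0)" shows "U \<in> H (gw R)" "nm (gw R) U \<le> nm (gw 0) U"
proof -
 have ae: "AE v in lborel. gw R v * cmod (U v) \<le> 1 * (gw 0 v * cmod (U v))"
  using gw_le[OF R] by (simp add: mult_right_mono)
 show "U \<in> H (gw R)" "nm (gw R) U \<le> nm (gw 0) U"
  using H_dom[OF weight_gw[OF R] H_measurable[OF U] U ae] by auto
qed

lemma kw_le_gw: "0 \<le> R \<Longrightarrow> kw R v \<le> gw R v"
 using mult_right_mono[OF J_ge_1[of v], of "kw R v"] weight_nonneg[OF weight_kw, of R v] by (simp add: gw_eq)

lemma H_kw: assumes R: "0 \<le> R" and U: "U \<in> H (gw R)" shows "U \<in> H (kw R)" "nm (kw R) U \<le> nm (gw R) U"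
proof -
 have ae: "AE v in lborel. kw R v * cmod (U v) \<le> 1 * (gw R v * cmod (U v))"
  using kw_le_gw[OF R] by (simp add: mult_right_mono)
 show "U \<in> H (kw R)" "nm (kw R) U \<le> nm (gw R) U"
  using H_dom[OF weight_kw[OF R] H_measurable[OF U] U ae] by auto
qed

lemma J_rho: "J v = \<rho> v * gw 0 v"
 using kw_0_ge_1[of v] by (simp add: \<rho>_def gw_eq)

text \<open>Cauchy-Schwarz with \<open>\<rho>\<close>: the Fourier form of the embedding of H^s into
  functions with bounded derivative.\<close>

lemma J_L1:
 assumes U: "U \<in> H (gw 0)" shows "(\<integral>\<^sup>+v. ennreal \<bar>J v * cmod (U v)\<bar> \<partial>lborel) \<le> ennreal (\<rho>n * nm (gw 0) U)"
 using L1_of_weighted[OF H_L2[OF U]] by (simp add: J_rho nm_def mult.assoc)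

lemma J_H_one: assumes U: "U \<in> H (gw 0)" shows "(\<lambda>v. J v * cmod (U v)) \<in> L2"
proof (rule L2_dom(1)[OF _ H_L2[OF U]])
 have [measurable]: "U \<in> BM" using U by (simp add: H_def)
 show "(\<lambda>v. J v * cmod (U v)) \<in> BM" by measurable
 have "J v \<le> gw 0 v" for v
  using mult_left_mono[OF kw_0_ge_1[of v], of "J v"] J_pos[of v] by (simp add: gw_eq)
 then show "AE v in lborel. \<bar>J v * cmod (U v)\<bar> \<le> gw 0 v * cmod (U v)"
  using J_pos by (simp add: abs_mult mult_right_mono abs_of_pos)
qed

lemma Bl_integrable:
 assumes U: "U \<in> H (gw 0)" and V: "V \<in> H (gw 0)"
 shows "integrable lborel (\<lambda>l. cr (br v l) * (U (v - l) * V l))"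
proof -
 have [measurable]: "U \<in> BM" "V \<in> BM" using U V by (auto simp: H_def)
 have "integrable lborel (\<lambda>l. c2 * ((J (v - l) * cmod (U (v - l))) * (J l * cmod (V l))))"
  by (intro integrable_mult_right L2_mult_integrable L2_reflect(1)[OF J_H_one[OF U]] J_H_one V)
 then show ?thesis
 proof (rule Bochner_Integration.integrable_bound)
  have "cmod (cr (br v l) * (U (v - l) * V l)) \<le> c2 * ((J (v - l) * cmod (U (v - l))) * (J l * cmod (V l)))" for l
   using mult_right_mono[OF br_bound[of v l], of "cmod (U (v - l)) * cmod (V l)"] by (simp add: norm_mult mult_ac)
  then show "AE l in lborel. cmod (cr (br v l) * (U (v - l) * V l)) \<le> norm (c2 * ((J (v - l) * cmod (U (v - l))) * (J l * cmod (V l))))"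
   by (intro AE_I2) (metis abs_ge_self order_trans real_norm_def)
 qed measurable
qed

lemma Bl_diff:
 assumes "U \<in> H (gw 0)" "V \<in> H (gw 0)"
 shows "Bl U U v - Bl V V v = Bl U (\<lambda>v. U v - V v) v + Bl (\<lambda>v. U v - V v) V v"
proof -
 have D: "(\<lambda>v. U v - V v) \<in> H (gw 0)" by (intro H_diff weight_gw assms) simp
 have "Bl U (\<lambda>v. U v - V v) v = Bl U U v - Bl U V v" "Bl (\<lambda>v. U v - V v) V v = Bl U V v - Bl V V v"
  unfolding Bl_def using Bl_integrable[OF assms(1,1), of v] Bl_integrable[OF assms(1,2), of v] Bl_integrable[OF assms(2,2), of v]
  by (simp_all add: right_diff_distrib left_diff_distrib)
 then show ?thesis by simp
qed

lemma Nl_diff: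
 assumes "U \<in> H (gw 0)" "V \<in> H (gw 0)"
 shows "Nl U v - Nl V v = (Bl U (\<lambda>v. U v - V v) v + Bl (\<lambda>v. U v - V v) V v) + Li (\<lambda>v. U v - V v) v"
proof -
 have "Li U v - Li V v = Li (\<lambda>v. U v - V v) v" unfolding Li_def by (rule right_diff_distrib[symmetric])
 moreover have "Nl U v - Nl V v = (Bl U U v - Bl V V v) + (Li U v - Li V v)" by (simp add: Nl_def)
 ultimately show ?thesis using Bl_diff[OF assms, of v] by simp
qed

definition cB :: real where "cB = 2 * (c2 * 2^m * \<rho>n)"

text \<open>The weight \<open>kw R\<close> is subadditive up to 2^m, so it lands on one input. The
  other input enters through the L^1 norm of \<open>J * cmod\<close>, and Young's inequality
  applies. Each term carries the R-weight exactly once: high frequencies of the product come from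
  those of an input.\<close>

theorem Bl_bound:
 assumes R: "0 \<le> R" and U: "U \<in> H (gw 0)" and V: "V \<in> H (gw 0)"
 shows "Bl U V \<in> H (kw R)"
  "nm (kw R) (Bl U V) \<le> cB * (nm (gw R) U * nm (gw 0) V + nm (gw 0) U * nm (gw R) V)"
proof -
 have [measurable]: "U \<in> BM" "V \<in> BM" using U V by (auto simp: H_def)
 note [measurable] = weight_measurable[OF weight_kw[OF R]] weight_measurable[OF weight_gw[OF R]]
 let ?gU = "\<lambda>x. gw R x * cmod (U x)" and ?gV = "\<lambda>x. gw R x * cmod (V x)"
 let ?JU = "\<lambda>x. J x * cmod (U x)" and ?JV = "\<lambda>x. J x * cmod (V x)"
 let ?A = "\<lambda>v. \<integral>\<^sup>+l. ennreal \<bar>?gU (v - l) * ?JV l\<bar> \<partial>lborel" and ?B = "\<lambda>v. \<integral>\<^sup>+l. ennreal \<bar>?JU (v - l) * ?gV l\<bar> \<partial>lborel"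
 let ?c = "c2 * 2^m"
 have pt: "ennreal (kw R v * cmod (Bl U V v)) \<le> ennreal ?c * (?A v + ?B v)" for v
 proof -
  have "ennreal (kw R v * cmod (Bl U V v)) = ennreal (kw R v) * ennreal (cmod (LINT l|lborel. cr (br v l) * (U (v - l) * V l)))"
   using weight_nonneg[OF weight_kw[OF R]] by (simp add: Bl_def norm_mult ennreal_mult)
  also have "\<dots> \<le> ennreal (kw R v) * (\<integral>\<^sup>+l. ennreal (cmod (cr (br v l) * (U (v - l) * V l))) \<partial>lborel)"
   by (intro mult_left_mono ennreal_norm_integral_le) simp
  also have "\<dots> = (\<integral>\<^sup>+l. ennreal (kw R v) * ennreal (cmod (cr (br v l) * (U (v - l) * V l))) \<partial>lborel)"
   by (rule nn_integral_cmult[symmetric]) measurable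
  also have "\<dots> \<le> (\<integral>\<^sup>+l. ennreal ?c * (ennreal \<bar>?gU (v - l) * ?JV l\<bar> + ennreal \<bar>?JU (v - l) * ?gV l\<bar>) \<partial>lborel)"
  proof (rule nn_integral_mono)
   fix l
   have k: "kw R v \<le> 2^m * (kw R (v - l) + kw R l)"
    unfolding kw_def by (rule adm_sub[OF adm_K[OF R]]) (auto simp: J_ge_1 J_tri)
   have nn: "0 \<le> kw R v" "0 \<le> kw R (v - l)" "0 \<le> kw R l" "0 \<le> J (v - l)" "0 \<le> J l"
    using weight_nonneg[OF weight_kw[OF R]] J_pos less_imp_le by auto
   have "kw R v * (\<bar>br v l\<bar> * (cmod (U (v - l)) * cmod (V l)))
     \<le> (2^m * (kw R (v - l) + kw R l)) * ((c2 * (J (v - l) * J l)) * (cmod (U (v - l)) * cmod (V l)))"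
    using nn by (intro mult_mono k br_bound mult_nonneg_nonneg add_nonneg_nonneg) auto
   also have "\<dots> = ?c * (?gU (v - l) * ?JV l + ?JU (v - l) * ?gV l)"
    by (simp add: gw_eq algebra_simps)
   finally have le: "kw R v * cmod (cr (br v l) * (U (v - l) * V l)) \<le> ?c * (?gU (v - l) * ?JV l + ?JU (v - l) * ?gV l)"
    by (simp add: norm_mult)
   have "ennreal (kw R v) * ennreal (cmod (cr (br v l) * (U (v - l) * V l)))
     = ennreal (kw R v * cmod (cr (br v l) * (U (v - l) * V l)))" using nn by (simp add: ennreal_mult)
   also have "\<dots> \<le> ennreal (?c * (?gU (v - l) * ?JV l + ?JU (v - l) * ?gV l))" by (rule ennreal_leI[OF le])
   also have "\<dots> = ennreal ?c * (ennreal \<bar>?gU (v - l) * ?JV l\<bar> + ennreal \<bar>?JU (v - l) * ?gV l\<bar>)"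
    using nn by (simp add: ennreal_mult[symmetric] ennreal_plus[symmetric] gw_eq del: ennreal_plus)
   finally show "ennreal (kw R v) * ennreal (cmod (cr (br v l) * (U (v - l) * V l)))
     \<le> ennreal ?c * (ennreal \<bar>?gU (v - l) * ?JV l\<bar> + ennreal \<bar>?JU (v - l) * ?gV l\<bar>)" .
  qed
  also have "\<dots> = ennreal ?c * (?A v + ?B v)"
   by (subst nn_integral_cmult, measurable, subst nn_integral_add, measurable)
  finally show ?thesis .
 qed
 have mJ: "?JU \<in> BM" "?JV \<in> BM" by measurable
 have A: "(\<integral>\<^sup>+v. (?A v)\<^sup>2 \<partial>lborel) \<le> ennreal ((\<rho>n * nm (gw 0) V * nm (gw R) U)\<^sup>2)"
 proof -
  have "?A v = (\<integral>\<^sup>+l. ennreal \<bar>?JV (v - l) * ?gU l\<bar> \<partial>lborel)" for v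
   using nn_reflect[of "\<lambda>l. ennreal \<bar>?gU (v - l) * ?JV l\<bar>" v] by (simp add: mult.commute)
  moreover have "(\<integral>\<^sup>+v. (\<integral>\<^sup>+l. ennreal \<bar>?JV (v - l) * ?gU l\<bar> \<partial>lborel)\<^sup>2 \<partial>lborel) \<le> ennreal ((\<rho>n * nm (gw 0) V * l2n ?gU)\<^sup>2)"
   by (rule young[OF mJ(2) H_L2[OF H_gw(1)[OF R U]] J_L1[OF V]]) simp
  ultimately show ?thesis by (simp add: nm_def)
 qed
 have B: "(\<integral>\<^sup>+v. (?B v)\<^sup>2 \<partial>lborel) \<le> ennreal ((\<rho>n * nm (gw 0) U * nm (gw R) V)\<^sup>2)"
  unfolding nm_def[of "gw R"] by (rule young[OF mJ(1) H_L2[OF H_gw(1)[OF R V]] J_L1[OF U]]) simp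
 let ?a = "\<rho>n * nm (gw 0) V * nm (gw R) U" and ?b = "\<rho>n * nm (gw 0) U * nm (gw R) V"
 have sq: "(x + y)\<^sup>2 \<le> 2 * x\<^sup>2 + 2 * y\<^sup>2" for x y :: ennreal
 proof (cases "x = \<top> \<or> y = \<top>")
  case True then show ?thesis by (auto simp: power2_eq_square ennreal_mult_top ennreal_top_mult)
 next
  case False
  then obtain r s where rs: "x = ennreal r" "0 \<le> r" "y = ennreal s" "0 \<le> s"
   by (metis ennreal_cases)
  have "0 \<le> (r - s)\<^sup>2" by simp
  then have "(r + s)\<^sup>2 \<le> 2 * r\<^sup>2 + 2 * s\<^sup>2" by (simp add: power2_sum power2_diff)
  then have "ennreal ((r + s)\<^sup>2) \<le> ennreal (2 * r\<^sup>2 + 2 * s\<^sup>2)" by (rule ennreal_leI)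
  then show ?thesis using rs by (simp add: ennreal_power[symmetric] ennreal_mult)
 qed
 have "(\<integral>\<^sup>+v. ennreal ((kw R v * cmod (Bl U V v))\<^sup>2) \<partial>lborel) \<le> (\<integral>\<^sup>+v. (ennreal ?c)\<^sup>2 * (2 * (?A v)\<^sup>2 + 2 * (?B v)\<^sup>2) \<partial>lborel)"
 proof (rule nn_integral_mono)
  fix v
  have "ennreal ((kw R v * cmod (Bl U V v))\<^sup>2) = (ennreal (kw R v * cmod (Bl U V v)))\<^sup>2"
   using weight_nonneg[OF weight_kw[OF R]] by (simp add: ennreal_power)
  also have "\<dots> \<le> (ennreal ?c * (?A v + ?B v))\<^sup>2" by (rule power_mono[OF pt]) simp
  also have "\<dots> = (ennreal ?c)\<^sup>2 * (?A v + ?B v)\<^sup>2" by (rule power_mult_distrib)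
  also have "\<dots> \<le> (ennreal ?c)\<^sup>2 * (2 * (?A v)\<^sup>2 + 2 * (?B v)\<^sup>2)" by (rule mult_left_mono[OF sq]) simp
  finally show "ennreal ((kw R v * cmod (Bl U V v))\<^sup>2) \<le> (ennreal ?c)\<^sup>2 * (2 * (?A v)\<^sup>2 + 2 * (?B v)\<^sup>2)" .
 qed
 also have "\<dots> = (ennreal ?c)\<^sup>2 * (2 * (\<integral>\<^sup>+v. (?A v)\<^sup>2 \<partial>lborel) + 2 * (\<integral>\<^sup>+v. (?B v)\<^sup>2 \<partial>lborel))"
  by (simp add: nn_integral_cmult nn_integral_add)
 also have "\<dots> \<le> (ennreal ?c)\<^sup>2 * (2 * ennreal (?a\<^sup>2) + 2 * ennreal (?b\<^sup>2))"
  by (intro mult_left_mono add_mono A B) simp_all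
 also have "\<dots> = ennreal (?c\<^sup>2 * (2 * ?a\<^sup>2 + 2 * ?b\<^sup>2))"
 proof -
  have c: "(ennreal ?c)\<^sup>2 = ennreal (?c\<^sup>2)" by (rule ennreal_power) simp
  have d: "2 * ennreal X + 2 * ennreal Y = ennreal (2 * X + 2 * Y)" if "0 \<le> X" "0 \<le> Y" for X Y
   using that by (simp add: ennreal_mult)
  show ?thesis unfolding c d[OF zero_le_power2 zero_le_power2] by (rule ennreal_mult[symmetric]) auto
 qed
 also have "\<dots> \<le> ennreal ((cB * (nm (gw R) U * nm (gw 0) V + nm (gw 0) U * nm (gw R) V))\<^sup>2)"
 proof (rule ennreal_leI)
  have "0 \<le> ?a * ?b" by (intro mult_nonneg_nonneg) auto
  then have "2 * ?a\<^sup>2 + 2 * ?b\<^sup>2 \<le> 4 * (?a + ?b)\<^sup>2" by (simp add: power2_sum)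
  then have "?c\<^sup>2 * (2 * ?a\<^sup>2 + 2 * ?b\<^sup>2) \<le> ?c\<^sup>2 * (4 * (?a + ?b)\<^sup>2)" by (rule mult_left_mono) simp
  also have "\<dots> = (2 * ?c * (?a + ?b))\<^sup>2" by (simp add: power_mult_distrib)
  also have "2 * ?c * (?a + ?b) = cB * (nm (gw R) U * nm (gw 0) V + nm (gw 0) U * nm (gw R) V)"
   by (simp add: cB_def algebra_simps)
  finally show "?c\<^sup>2 * (2 * ?a\<^sup>2 + 2 * ?b\<^sup>2) \<le> (cB * (nm (gw R) U * nm (gw 0) V + nm (gw 0) U * nm (gw R) V))\<^sup>2" .
 qed
 finally have *: "(\<integral>\<^sup>+v. ennreal ((kw R v * cmod (Bl U V v))\<^sup>2) \<partial>lborel) \<le> ennreal ((cB * (nm (gw R) U * nm (gw 0) V + nm (gw 0) U * nm (gw R) V))\<^sup>2)" .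
 have mB: "(\<lambda>v. kw R v * cmod (Bl U V v)) \<in> BM" by measurable
 have "0 \<le> cB * (nm (gw R) U * nm (gw 0) V + nm (gw 0) U * nm (gw R) V)"
  by (intro mult_nonneg_nonneg add_nonneg_nonneg) (auto simp: cB_def)
 from L2I_nn[OF mB * this]
 show "Bl U V \<in> H (kw R)" "nm (kw R) (Bl U V) \<le> cB * (nm (gw R) U * nm (gw 0) V + nm (gw 0) U * nm (gw R) V)"
  by (auto simp: H_def nm_def)
qed

end

section \<open>Energy integrals over two frequencies\<close>

lemma prod_integral_bound:
 fixes F :: "real \<times> real \<Rightarrow> complex"
 assumes [measurable]: "F \<in> borel_measurable (lborel \<Otimes>\<^sub>M lborel)"
  and le: "dint (\<lambda>v l. cmod (F (v, l))) \<le> ennreal B" and B: "0 \<le> B"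
 shows "integrable (lborel \<Otimes>\<^sub>M lborel) F" "cmod (integral\<^sup>L (lborel \<Otimes>\<^sub>M lborel) F) \<le> B"
proof -
 have eq: "(\<integral>\<^sup>+p. ennreal (cmod (F p)) \<partial>(lborel \<Otimes>\<^sub>M lborel)) = dint (\<lambda>v l. cmod (F (v, l)))"
  by (rule lborel.nn_integral_fst[symmetric]) measurable
 show i: "integrable (lborel \<Otimes>\<^sub>M lborel) F"
  by (rule integrableI_bounded) (use le in \<open>auto simp: eq intro: le_less_trans\<close>)
 have "ennreal (cmod (integral\<^sup>L (lborel \<Otimes>\<^sub>M lborel) F)) \<le> ennreal B"
  using integral_norm_bound_ennreal[OF i] le unfolding eq by (rule order_trans)
 then show "cmod (integral\<^sup>L (lborel \<Otimes>\<^sub>M lborel) F) \<le> B" using B by simp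
qed

definition tk :: "(real \<Rightarrow> real \<Rightarrow> real) \<Rightarrow> (real \<Rightarrow> complex) \<Rightarrow> (real \<Rightarrow> complex) \<Rightarrow> (real \<Rightarrow> complex) \<Rightarrow> real \<times> real \<Rightarrow> complex" where
 "tk k U V D = (\<lambda>(v, l). \<i> * cr (k v l) * (U (v - l) * V l * cnj (D v)))"

lemma tk_measurable [measurable]:
 assumes [measurable]: "case_prod k \<in> borel_measurable (borel \<Otimes>\<^sub>M borel)" "U \<in> BM" "V \<in> BM" "D \<in> BM"
 shows "tk k U V D \<in> borel_measurable (lborel \<Otimes>\<^sub>M lborel)"
proof -
 have [measurable]: "(\<lambda>x. k (fst x) (snd x)) \<in> borel_measurable (borel \<Otimes>\<^sub>M borel)"
  using assms(1) by (simp add: split_beta')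
 show ?thesis unfolding tk_def split_beta' by measurable
qed

lemma cmod_tk: "cmod (tk k U V D (v, l)) = \<bar>k v l\<bar> * (cmod (U (v - l)) * cmod (V l) * cmod (D v))"
 by (simp add: tk_def norm_mult)

text \<open>The transport term loses no derivative because, after symmetrizing in \<open>v\<close> and \<open>l\<close> (which is
 possible since \<open>U\<close> is the transform of a real function), its symbol is a commutator.\<close>

lemma transport_sym:
 assumes [measurable]: "U \<in> BM" "D \<in> BM" "G \<in> BM"
  and herm: "\<And>v. U (- v) = cnj (U v)"
  and fin: "dint (\<lambda>v l. \<bar>(G v)\<^sup>2 * l\<bar> * (cmod (U (v - l)) * cmod (D l) * cmod (D v))) \<le> ennreal B0" "0 \<le> B0"
  and bnd: "dint (\<lambda>v l. \<bar>l * (G v)\<^sup>2 - v * (G l)\<^sup>2\<bar> * (cmod (U (v - l)) * cmod (D l) * cmod (D v))) \<le> ennreal B" "0 \<le> B"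
 shows "integrable (lborel \<Otimes>\<^sub>M lborel) (tk (\<lambda>v l. (G v)\<^sup>2 * l) U D D)"
  "\<bar>Re (integral\<^sup>L (lborel \<Otimes>\<^sub>M lborel) (tk (\<lambda>v l. (G v)\<^sup>2 * l) U D D))\<bar> \<le> B"
proof -
 let ?L = "(lborel \<Otimes>\<^sub>M lborel) :: (real \<times> real) measure"
 let ?F = "tk (\<lambda>v l. (G v)\<^sup>2 * l) U D D"
 have [measurable]: "?F \<in> borel_measurable ?L" by measurable
 have i: "integrable ?L ?F"
  by (rule prod_integral_bound(1)[OF _ _ fin(2)]) (use fin(1) in \<open>simp_all only: cmod_tk, measurable\<close>)
 then show "integrable ?L ?F" .
 let ?S = "\<lambda>(v, l). cnj (?F (l, v))"
 have swap: "(LINT (v, l)|?L. ?F (l, v)) = integral\<^sup>L ?L ?F" and iswap: "integrable ?L (\<lambda>(v, l). ?F (l, v))"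
  using lborel_pair.integral_product_swap[of ?F] lborel_pair.integrable_product_swap[OF i] by auto
 have S_eq: "?S = (\<lambda>p. cnj ((\<lambda>(v, l). ?F (l, v)) p))" by auto
 have iS: "integrable ?L ?S" unfolding S_eq using iswap by simp
 have intS: "integral\<^sup>L ?L ?S = cnj (integral\<^sup>L ?L ?F)"
  unfolding S_eq using swap by (simp only: Bochner_Integration.integral_cnj)
 have sum: "?F p + ?S p = tk (\<lambda>v l. l * (G v)\<^sup>2 - v * (G l)\<^sup>2) U D D p" for p
 proof (cases p)
  case (Pair v l)
  have "U (v - l) = cnj (U (l - v))" using herm[of "l - v"] by simp
  then show ?thesis unfolding Pair by (simp add: tk_def algebra_simps)
 qed
 have "integral\<^sup>L ?L ?F + cnj (integral\<^sup>L ?L ?F) = integral\<^sup>L ?L (tk (\<lambda>v l. l * (G v)\<^sup>2 - v * (G l)\<^sup>2) U D D)"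
  unfolding intS[symmetric] sum[symmetric] by (rule Bochner_Integration.integral_add[symmetric, OF i iS])
 moreover have "cmod (integral\<^sup>L ?L (tk (\<lambda>v l. l * (G v)\<^sup>2 - v * (G l)\<^sup>2) U D D)) \<le> B"
  by (rule prod_integral_bound(2)[OF _ _ bnd(2)]) (use bnd(1) in \<open>simp_all only: cmod_tk, measurable\<close>)
 ultimately have "cmod (integral\<^sup>L ?L ?F + cnj (integral\<^sup>L ?L ?F)) \<le> B" by (simp only:)
 then have "\<bar>2 * Re (integral\<^sup>L ?L ?F)\<bar> \<le> B"
  using abs_Re_le_cmod[of "integral\<^sup>L ?L ?F + cnj (integral\<^sup>L ?L ?F)"] by simp
 then show "\<bar>Re (integral\<^sup>L ?L ?F)\<bar> \<le> B" by simp
qed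

definition herm :: "(real \<Rightarrow> complex) \<Rightarrow> bool" where
 "herm U \<longleftrightarrow> (AE v in lborel. U (- v) = cnj (U v))"

text \<open>\<open>herm\<close> holds almost everywhere, while the symmetrization of the double
  integral uses the identity at every point; \<open>symm U\<close> is a representative of a
  Hermitian \<open>U\<close> for which it does.\<close>

definition symm :: "(real \<Rightarrow> complex) \<Rightarrow> real \<Rightarrow> complex" where
 "symm U v = (U v + cnj (U (- v))) / 2"

lemma symm_herm: "symm U (- v) = cnj (symm U v)"
 by (simp add: symm_def add.commute)

lemma symm_measurable [measurable]:
 assumes [measurable]: "U \<in> BM" shows "symm U \<in> BM"
 unfolding symm_def[abs_def] by measurable

lemma symm_AE: "herm U \<Longrightarrow> aeq U (symm U)"
 unfolding herm_def by (erule eventually_mono) (simp add: symm_def)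

context rod
begin

text \<open>Equality at every point, because \<open>Bl\<close> sees its arguments only under an
  integral.\<close>

lemma Bl_cong_AE:
 assumes [measurable]: "U \<in> BM" "U' \<in> BM" "V \<in> BM" "V' \<in> BM"
  and ae: "aeq U U'" "aeq V V'"
 shows "Bl U V = Bl U' V'"
proof
 fix v
 have "AE l in lborel. U (v + - 1 * l) = U' (v + - 1 * l)"
  by (rule AE_borel_affine[OF _ _ ae(1)]) simp_all
 then have "AE l in lborel. cr (br v l) * (U (v - l) * V l) = cr (br v l) * (U' (v - l) * V' l)"
  using ae(2) by eventually_elim simp
 then have "(LINT l|lborel. cr (br v l) * (U (v - l) * V l)) = (LINT l|lborel. cr (br v l) * (U' (v - l) * V' l))"
  by (intro integral_cong_AE) measurable
 then show "Bl U V v = Bl U' V' v" by (simp add: Bl_def)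
qed

lemma ip_cong_AE:
 assumes "aeq f f'" "aeq g g'"
  and [measurable]: "f \<in> BM" "f' \<in> BM" "g \<in> BM" "g' \<in> BM" "w \<in> BM"
 shows "ip w f g = ip w f' g'"
 unfolding ip_def by (rule integral_cong_AE) (measurable, use assms(1,2) in \<open>eventually_elim, simp\<close>)

lemma ip_Bl:
 assumes [measurable]: "U \<in> BM" "V \<in> BM" "D \<in> BM" "G \<in> BM"
  and fin: "dint (\<lambda>v l. \<bar>(G v)\<^sup>2 * br v l\<bar> * (cmod (U (v - l)) * cmod (V l) * cmod (D v))) \<le> ennreal B" "0 \<le> B"
 shows "integrable (lborel \<Otimes>\<^sub>M lborel) (tk (\<lambda>v l. (G v)\<^sup>2 * br v l) U V D)"
  "ip G (Bl U V) D = Re (integral\<^sup>L (lborel \<Otimes>\<^sub>M lborel) (tk (\<lambda>v l. (G v)\<^sup>2 * br v l) U V D))"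
  "\<bar>ip G (Bl U V) D\<bar> \<le> B"
proof -
 let ?L = "(lborel \<Otimes>\<^sub>M lborel) :: (real \<times> real) measure"
 let ?F = "tk (\<lambda>v l. (G v)\<^sup>2 * br v l) U V D"
 have [measurable]: "?F \<in> borel_measurable ?L" by measurable
 have le: "dint (\<lambda>v l. cmod (?F (v, l))) \<le> ennreal B"
  unfolding cmod_tk by (rule fin(1))
 note b = prod_integral_bound[OF _ le fin(2)]
 show i: "integrable ?L ?F" by (rule b(1)) measurable
 have pt: "(G v)\<^sup>2 * Re (Bl U V v * cnj (D v)) = Re (LINT l|lborel. ?F (v, l))" for v
 proof -
  have "(LINT l|lborel. ?F (v, l)) = (LINT l|lborel. (cr ((G v)\<^sup>2) * \<i> * cnj (D v)) * (cr (br v l) * (U (v - l) * V l)))"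
   unfolding tk_def prod.case of_real_mult by (simp only: mult_ac)
  also have "\<dots> = cr ((G v)\<^sup>2) * (Bl U V v * cnj (D v))"
   unfolding Bl_def integral_mult_right_zero by (simp only: mult_ac)
  finally show ?thesis by (simp only: Re_complex_of_real times_complex.sel(1)[of "cr ((G v)\<^sup>2)"] Im_complex_of_real mult_zero_left diff_zero)
 qed
 have "ip G (Bl U V) D = Re (LINT v|lborel. (LINT l|lborel. ?F (v, l)))"
  unfolding ip_def pt using lborel_pair.integrable_fst'[OF i] by (rule integral_Re)
 also have "(LINT v|lborel. (LINT l|lborel. ?F (v, l))) = integral\<^sup>L ?L ?F"
  by (rule lborel_pair.integral_fst'[OF i])
 finally show eq: "ip G (Bl U V) D = Re (integral\<^sup>L ?L ?F)" .
 have c: "cmod (integral\<^sup>L ?L ?F) \<le> B" by (rule b(2)) measurable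
 show "\<bar>ip G (Bl U V) D\<bar> \<le> B" unfolding eq by (rule order_trans[OF abs_Re_le_cmod c])
qed

text \<open>The bounds \<open>B1\<close> and \<open>B0\<close> express finiteness: they may involve
  more derivatives than the estimate controls, and justify Fubini and the splitting of the symbol.
  The quantitative bound consists of \<open>BX\<close>, from the commutator of the transport part,
  and \<open>BY\<close>, from the nonlocal remainder.\<close>

lemma energy_split:
 assumes m[measurable]: "U \<in> BM" "D \<in> BM" "G \<in> BM"
  and herm: "\<And>v. U (- v) = cnj (U v)"
  and fin: "dint (\<lambda>v l. \<bar>(G v)\<^sup>2 * br v l\<bar> * (cmod (U (v - l)) * cmod (D l) * cmod (D v))) \<le> ennreal B1" "0 \<le> B1"
  and fin0: "dint (\<lambda>v l. \<bar>(G v)\<^sup>2 * l\<bar> * (cmod (U (v - l)) * cmod (D l) * cmod (D v))) \<le> ennreal B0" "0 \<le> B0"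
  and X: "dint (\<lambda>v l. \<bar>l * (G v)\<^sup>2 - v * (G l)\<^sup>2\<bar> * (cmod (U (v - l)) * cmod (D l) * cmod (D v))) \<le> ennreal BX" "0 \<le> BX"
  and Y: "dint (\<lambda>v l. \<bar>(G v)\<^sup>2 * (br v l + \<gamma> * l / sqrt (2 * pi))\<bar> * (cmod (U (v - l)) * cmod (D l) * cmod (D v))) \<le> ennreal BY" "0 \<le> BY"
 shows "\<bar>ip G (Bl U D) D\<bar> \<le> \<bar>\<gamma>\<bar> * BX + BY"
proof -
 let ?L = "(lborel \<Otimes>\<^sub>M lborel) :: (real \<times> real) measure"
 let ?g = "\<gamma> / sqrt (2 * pi)"
 let ?F = "tk (\<lambda>v l. (G v)\<^sup>2 * br v l) U D D" and ?Fz = "tk (\<lambda>v l. (G v)\<^sup>2 * l) U D D"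
  and ?Fy = "tk (\<lambda>v l. (G v)\<^sup>2 * (br v l + \<gamma> * l / sqrt (2 * pi))) U D D"
 note t = transport_sym[OF m herm fin0 X]
 have m1[measurable]: "?Fy \<in> borel_measurable ?L" by measurable
 have Y': "dint (\<lambda>v l. cmod (?Fy (v, l))) \<le> ennreal BY"
  unfolding cmod_tk by (rule Y(1))
 note b = prod_integral_bound[OF m1 Y' Y(2)]
 have y1: "\<bar>Re (integral\<^sup>L ?L ?Fy)\<bar> \<le> BY"
  using abs_Re_le_cmod[of "integral\<^sup>L ?L ?Fy"] b(2) by linarith
 have g: "\<bar>?g\<bar> \<le> \<bar>\<gamma>\<bar>"
 proof -
  have "\<bar>\<gamma>\<bar> / sqrt (2 * pi) \<le> \<bar>\<gamma>\<bar> / 1" using sqrt_2pi by (intro divide_left_mono) auto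
  moreover have "\<bar>?g\<bar> = \<bar>\<gamma>\<bar> / sqrt (2 * pi)" using sqrt_2pi by (simp only: abs_divide)
  ultimately show ?thesis by simp
 qed
 have y2: "\<bar>?g * Re (integral\<^sup>L ?L ?Fz)\<bar> \<le> \<bar>\<gamma>\<bar> * BX"
  unfolding abs_mult by (rule mult_mono[OF g t(2)]) simp_all
 have eqp: "?F p = ?Fy p - cr ?g * ?Fz p" for p
 proof (cases p)
  case (Pair v l)
  have "(G v)\<^sup>2 * br v l = (G v)\<^sup>2 * (br v l + \<gamma> * l / sqrt (2 * pi)) - ?g * ((G v)\<^sup>2 * l)"
   by (simp only: distrib_left) simp
  then have "cr ((G v)\<^sup>2 * br v l) = cr ((G v)\<^sup>2 * (br v l + \<gamma> * l / sqrt (2 * pi))) - cr ?g * cr ((G v)\<^sup>2 * l)"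
   by (simp only: of_real_diff of_real_mult)
  then show ?thesis unfolding Pair tk_def prod.case by (simp only: right_diff_distrib left_diff_distrib mult_ac)
 qed
 have "integral\<^sup>L ?L ?F = integral\<^sup>L ?L (\<lambda>p. ?Fy p - cr ?g * ?Fz p)"
  by (rule Bochner_Integration.integral_cong[OF refl]) (rule eqp)
 also have "\<dots> = integral\<^sup>L ?L ?Fy - cr ?g * integral\<^sup>L ?L ?Fz"
  using b(1) t(1) by simp
 finally have "ip G (Bl U D) D = Re (integral\<^sup>L ?L ?Fy) - ?g * Re (integral\<^sup>L ?L ?Fz)"
  unfolding ip_Bl(2)[OF m(1,2,2,3) fin] by (simp only: minus_complex.sel(1) times_complex.sel(1) Re_complex_of_real Im_complex_of_real mult_zero_left diff_zero)
 then have "\<bar>ip G (Bl U D) D\<bar> \<le> \<bar>Re (integral\<^sup>L ?L ?Fy)\<bar> + \<bar>?g * Re (integral\<^sup>L ?L ?Fz)\<bar>"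
  by (simp only: abs_triangle_ineq4)
 with y1 y2 show ?thesis by linarith
qed

text \<open>The weight of H^(s+1), strong enough for the energy integrals of the H^s estimate to
  converge absolutely. Frequency truncated functions have it.\<close>

definition g1 :: "real \<Rightarrow> real" where "g1 v = J v * gw 0 v"

lemma weight_g1: "weight g1"
proof -
 note [measurable] = weight_measurable[OF weight_gw[OF order_refl]]
 have "g1 \<in> BM" unfolding g1_def[abs_def] by measurable
 then show ?thesis using weight_pos[OF weight_gw[OF order_refl]] J_pos by (simp add: weight_def g1_def)
qed

definition Ck :: real where "Ck = (4 * real (Suc m) + 3) * 3 ^ Suc m"

lemma Ck_nonneg [simp]: "0 \<le> Ck" by (simp add: Ck_def)

lemma kw_sub: "0 \<le> R \<Longrightarrow> kw R v \<le> 2^m * (kw R (v - l) + kw R l)"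
 unfolding kw_def by (rule adm_sub[OF adm_K]) (auto simp: J_ge_1 J_tri)

lemma gw_sub: "0 \<le> R \<Longrightarrow> gw R v \<le> 2^Suc m * (gw R (v - l) + gw R l)"
 unfolding gw_def by (rule adm_sub[OF adm_mult_id[OF adm_K]]) (auto simp: J_ge_1 J_tri)

lemma kw_pos: "0 \<le> R \<Longrightarrow> 0 < kw R v" by (rule weight_pos[OF weight_kw])

lemma gw_pos: "0 \<le> R \<Longrightarrow> 0 < gw R v" by (rule weight_pos[OF weight_gw])

lemma kernel_expand:
 fixes a b c :: real
 assumes "0 < a" "0 < b" "0 < c"
 shows "P * a * b * c * (1 / a + 1 / b + 1 / c) = P * (b * c + a * c + a * b)"
 using assms by (simp add: field_simps)

text \<open>The weight \<open>gw R\<close> enters quadratically and the full H^s norm linearly, with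
  a constant free of R; the \<open>g1\<close> norm, used for convergence, leaves no trace in the
  bound.\<close>

lemma self_energy_Bl:
 assumes R: "0 \<le> R" and U: "U \<in> H g1" and h: "\<And>v. U (- v) = cnj (U v)"
 shows "\<bar>ip (gw R) (Bl U U) U\<bar> \<le> (\<bar>\<gamma>\<bar> * Ck + c1 * 2^m) * (9 * \<rho>n * nm (gw 0) U * (nm (gw R) U)\<^sup>2)"
proof -
 have le1: "gw 0 v \<le> g1 v" for v
  using mult_right_mono[OF J_ge_1[of v], of "gw 0 v"] gw_pos[of 0 v] by (simp add: g1_def)
 have ae: "AE v in lborel. gw 0 v * cmod (U v) \<le> 1 * (g1 v * cmod (U v))"
  using le1 by (simp add: mult_right_mono)
 have U0: "U \<in> H (gw 0)" by (rule H_dom(1)[OF weight_gw H_measurable[OF U] U ae]) simp_all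
 note UR = H_gw(1)[OF R U0]
 note m = H_measurable[OF U] H_measurable[OF U] weight_measurable[OF weight_gw[OF R]]
 have r0: "0 < \<rho> v" for v by (rule \<rho>_pos)
 have J0: "0 < J v" for v by (rule J_pos)
 \<comment> \<open>For finiteness: the factors J(v - l) and J l are absorbed by the two weights
   \<open>g1\<close>.\<close>
 have Gsq: "(gw R v)\<^sup>2 * J (v - l) * J l \<le> 2^Suc m * (g1 (v - l) * g1 l * gw 0 v * (\<rho> (v - l) + \<rho> l + \<rho> v))" for v l
 proof -
  let ?x = "J (v - l)" and ?y = "J l"
  have "(gw R v)\<^sup>2 \<le> gw 0 v * gw 0 v"
   unfolding power2_eq_square using gw_le[OF R, of v] gw_pos[OF R, of v] by (intro mult_mono) auto
  also have "\<dots> \<le> (2^Suc m * (gw 0 (v - l) + gw 0 l)) * gw 0 v"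
   using gw_sub[of 0 v l] gw_pos[of 0 v] by (intro mult_right_mono) auto
  finally have "(gw R v)\<^sup>2 * (?x * ?y) \<le> ((2^Suc m * (gw 0 (v - l) + gw 0 l)) * gw 0 v) * (?x * ?y)"
   using J0[of "v - l"] J0[of l] by (intro mult_right_mono) auto
  also have "\<dots> = 2^Suc m * ((g1 (v - l) * (gw 0 l * \<rho> l) + (gw 0 (v - l) * \<rho> (v - l)) * g1 l) * gw 0 v)"
   using J_rho[of l] J_rho[of "v - l"] by (simp add: g1_def algebra_simps)
  also have "\<dots> \<le> 2^Suc m * ((g1 (v - l) * (g1 l * \<rho> l) + (g1 (v - l) * \<rho> (v - l)) * g1 l) * gw 0 v)"
   using le1 weight_pos[OF weight_g1] r0 gw_pos[of 0]
   by (intro mult_left_mono mult_right_mono add_mono) (auto intro!: less_imp_le)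
  also have "\<dots> = 2^Suc m * (g1 (v - l) * g1 l * gw 0 v * (\<rho> (v - l) + \<rho> l))" by (simp add: algebra_simps)
  also have "\<dots> \<le> 2^Suc m * (g1 (v - l) * g1 l * gw 0 v * (\<rho> (v - l) + \<rho> l + \<rho> v))"
   using weight_pos[OF weight_g1] r0 gw_pos[of 0] by (intro mult_left_mono mult_nonneg_nonneg) (auto intro!: less_imp_le)
  finally show ?thesis by (simp only: mult.assoc)
 qed
 have fin: "dint (\<lambda>v l. \<bar>(gw R v)\<^sup>2 * br v l\<bar> * (cmod (U (v - l)) * cmod (U l) * cmod (U v)))
   \<le> ennreal (c2 * 2^Suc m * (3 * \<rho>n * nm g1 U * nm g1 U * nm (gw 0) U))"
 proof (rule tri_kernel[OF weight_g1 weight_g1 weight_gw U U U0])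
  fix v l
  have "\<bar>(gw R v)\<^sup>2 * br v l\<bar> \<le> (gw R v)\<^sup>2 * (c2 * (J (v - l) * J l))"
   unfolding abs_mult using br_bound[of v l] by (auto intro!: mult_left_mono)
  also have "\<dots> = c2 * ((gw R v)\<^sup>2 * J (v - l) * J l)" by (simp only: mult_ac)
  also have "\<dots> \<le> c2 * (2^Suc m * (g1 (v - l) * g1 l * gw 0 v * (\<rho> (v - l) + \<rho> l + \<rho> v)))"
   by (rule mult_left_mono[OF Gsq]) simp
  finally show "\<bar>(gw R v)\<^sup>2 * br v l\<bar> \<le> c2 * 2^Suc m * (g1 (v - l) * g1 l * gw 0 v * (\<rho> (v - l) + \<rho> l + \<rho> v))"
   by (simp only: mult.assoc)
 qed simp_all
 have fin0: "dint (\<lambda>v l. \<bar>(gw R v)\<^sup>2 * l\<bar> * (cmod (U (v - l)) * cmod (U l) * cmod (U v)))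
   \<le> ennreal (2^Suc m * (3 * \<rho>n * nm g1 U * nm g1 U * nm (gw 0) U))"
 proof (rule tri_kernel[OF weight_g1 weight_g1 weight_gw U U U0])
  fix v l
  have "\<bar>l\<bar> \<le> J (v - l) * J l"
   using mult_mono[OF J_ge_1[of "v - l"] J_ge_abs[of l]] J0[of "v - l"] by simp
  then have "\<bar>(gw R v)\<^sup>2 * l\<bar> \<le> (gw R v)\<^sup>2 * (J (v - l) * J l)"
   unfolding abs_mult by (auto intro!: mult_left_mono)
  then show "\<bar>(gw R v)\<^sup>2 * l\<bar> \<le> 2^Suc m * (g1 (v - l) * g1 l * gw 0 v * (\<rho> (v - l) + \<rho> l + \<rho> v))"
   using Gsq[of v l] by (simp only: mult.assoc)
 qed simp_all
 let ?S = "\<lambda>v l. gw 0 (v - l) * gw R l * gw R v + gw R (v - l) * gw 0 l * gw R v + gw R (v - l) * gw R l * gw 0 v"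
 let ?r = "\<lambda>v l. \<rho> (v - l) + \<rho> l + \<rho> v"
 \<comment> \<open>Each single J is written as \<open>\<rho> * gw 0\<close>, so the H^s weight
   appears on exactly that factor which \<open>\<rho>\<close> makes integrable.\<close>
 have S: "J (v - l) * gw R l * gw R v + J l * gw R (v - l) * gw R v + J v * gw R (v - l) * gw R l \<le> ?S v l * ?r v l" for v l
 proof -
  have e: "J (v - l) * gw R l * gw R v + J l * gw R (v - l) * gw R v + J v * gw R (v - l) * gw R l
   = (gw 0 (v - l) * gw R l * gw R v) * \<rho> (v - l) + (gw R (v - l) * gw 0 l * gw R v) * \<rho> l + (gw R (v - l) * gw R l * gw 0 v) * \<rho> v"
   unfolding J_rho by (simp only: mult_ac)
  have le: "A * \<rho> (v - l) + B * \<rho> l + C * \<rho> v \<le> (A + B + C) * ?r v l" if "0 \<le> A" "0 \<le> B" "0 \<le> C" for A B C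
  proof -
   have "A * \<rho> (v - l) \<le> A * ?r v l" "B * \<rho> l \<le> B * ?r v l" "C * \<rho> v \<le> C * ?r v l"
    using that r0[of v] r0[of l] r0[of "v - l"] by (auto intro!: mult_left_mono)
   then show ?thesis unfolding distrib_right by linarith
  qed
  show ?thesis unfolding e
   by (rule le) (use gw_pos[of 0] gw_pos[OF R] in \<open>auto intro!: mult_nonneg_nonneg less_imp_le\<close>)
 qed
 have X: "dint (\<lambda>v l. \<bar>l * (gw R v)\<^sup>2 - v * (gw R l)\<^sup>2\<bar> * (cmod (U (v - l)) * cmod (U l) * cmod (U v)))
   \<le> ennreal (Ck * (9 * \<rho>n * nm (gw 0) U * (nm (gw R) U)\<^sup>2))"
 proof (rule tri_kernel3[OF weight_gw weight_gw[OF R] U0 UR])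
  fix v l
  have nn: "0 \<le> gw R v" "0 \<le> gw R l" "0 \<le> gw R (v - l)" using gw_pos[OF R] by (auto intro: less_imp_le)
  have "\<bar>l * (gw R v)\<^sup>2 - v * (gw R l)\<^sup>2\<bar> \<le> Ck * (J (v - l) * gw R l * gw R v + min (J (v - l)) (J l) * gw R (v - l) * gw R v
    + min (J (v - l)) (J v) * gw R (v - l) * gw R l)"
   using commutator_kernel[OF adm_mult_id[OF adm_K[OF R]], of l v] unfolding Ck_def gw_def .
  also have "\<dots> \<le> Ck * (J (v - l) * gw R l * gw R v + J l * gw R (v - l) * gw R v + J v * gw R (v - l) * gw R l)"
   using nn by (intro mult_left_mono add_mono mult_right_mono) auto
  also have "\<dots> \<le> Ck * (?S v l * ?r v l)" by (rule mult_left_mono[OF S]) simp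
  finally show "\<bar>l * (gw R v)\<^sup>2 - v * (gw R l)\<^sup>2\<bar> \<le> Ck * (?S v l * ?r v l)" .
 qed simp_all
 have Y: "dint (\<lambda>v l. \<bar>(gw R v)\<^sup>2 * (br v l + \<gamma> * l / sqrt (2 * pi))\<bar> * (cmod (U (v - l)) * cmod (U l) * cmod (U v)))
   \<le> ennreal (c1 * 2^m * (9 * \<rho>n * nm (gw 0) U * (nm (gw R) U)\<^sup>2))"
 proof (rule tri_kernel3[OF weight_gw weight_gw[OF R] U0 UR])
  fix v l
  let ?x = "J (v - l)" and ?y = "J l" and ?z = "J v"
  have nn: "0 \<le> gw R v" "0 \<le> gw R l" "0 \<le> gw R (v - l)" using gw_pos[OF R] by (auto intro: less_imp_le)
  have "\<bar>(gw R v)\<^sup>2 * (br v l + \<gamma> * l / sqrt (2 * pi))\<bar> \<le> (gw R v)\<^sup>2 * (c1 * (?x * ?y / ?z))"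
   unfolding abs_mult abs_power2 by (intro mult_left_mono br_rem) simp
  \<comment> \<open>The smoothing 1/J v lowers one of the two \<open>gw R v\<close> to
    \<open>kw R v\<close>. Distributing that over the inputs restores \<open>gw R\<close> on one of
    them and leaves a single J on the other.\<close>
  also have "\<dots> = c1 * (gw R v * kw R v * (?x * ?y))"
   using J0[of v] by (simp add: gw_eq power2_eq_square)
  also have "\<dots> \<le> c1 * (gw R v * (2^m * (kw R (v - l) + kw R l)) * (?x * ?y))"
   using nn kw_sub[OF R, of v l] J0[of "v - l"] J0[of l] by (intro mult_left_mono mult_right_mono) auto
  also have "\<dots> = c1 * 2^m * (?x * gw R l * gw R v + ?y * gw R (v - l) * gw R v)"
   by (simp add: gw_eq algebra_simps)
  also have "\<dots> \<le> c1 * 2^m * (?x * gw R l * gw R v + ?y * gw R (v - l) * gw R v + ?z * gw R (v - l) * gw R l)"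
   using nn J0[of v] by (intro mult_left_mono) auto
  also have "\<dots> \<le> c1 * 2^m * (?S v l * ?r v l)" by (rule mult_left_mono[OF S]) simp
  finally show "\<bar>(gw R v)\<^sup>2 * (br v l + \<gamma> * l / sqrt (2 * pi))\<bar> \<le> c1 * 2^m * (?S v l * ?r v l)" .
 qed simp_all
 have "\<bar>ip (gw R) (Bl U U) U\<bar> \<le> \<bar>\<gamma>\<bar> * (Ck * (9 * \<rho>n * nm (gw 0) U * (nm (gw R) U)\<^sup>2)) + c1 * 2^m * (9 * \<rho>n * nm (gw 0) U * (nm (gw R) U)\<^sup>2)"
  by (rule energy_split[OF m h fin _ fin0 _ X _ Y]) (auto intro!: mult_nonneg_nonneg)
 then show ?thesis by (simp add: algebra_simps)
qed

text \<open>Here the derivative falls on \<open>D\<close>, which the bound measures in H^(s-1) only,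
  so the commutator is essential. That \<open>D\<close> actually lies in H^s makes the integrals
  converge.\<close>

lemma diff_energy_Bl1:
 assumes U: "U \<in> H (gw 0)" and D: "D \<in> H (gw 0)" and h: "\<And>v. U (- v) = cnj (U v)"
 shows "\<bar>ip (kw 0) (Bl U D) D\<bar> \<le> (\<bar>\<gamma>\<bar> * Ck + c1 * (3 * 2^m)) * (3 * \<rho>n * nm (gw 0) U * nm (kw 0) D * nm (kw 0) D)"
proof -
 note DK = H_kw(1)[OF order_refl D]
 note m = H_measurable[OF U] H_measurable[OF D] weight_measurable[OF weight_kw[OF order_refl]]
 have J0: "0 < J v" for v by (rule J_pos)
 have w0: "0 < kw 0 v" for v by (rule kw_pos) simp
 have sq: "(kw 0 v)\<^sup>2 * J (v - l) * J l \<le> 2^m * (gw 0 (v - l) * gw 0 l * kw 0 v * (\<rho> (v - l) + \<rho> l + \<rho> v))" for v l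
 proof -
  let ?x = "J (v - l)" and ?y = "J l" and ?a = "kw 0 (v - l)" and ?b = "kw 0 l" and ?c = "kw 0 v"
  have "?c * (?c * (?x * ?y)) \<le> (2^m * (?a + ?b)) * (?c * (?x * ?y))"
   using kw_sub[of 0 v l] w0[of v] J0[of "v - l"] J0[of l] by (intro mult_right_mono) auto
  also have "\<dots> = 2^m * ((?x * ?y) * (?b * ?c + ?a * ?c))" by (simp add: algebra_simps)
  also have "\<dots> \<le> 2^m * ((?x * ?y) * (?b * ?c + ?a * ?c + ?a * ?b))"
   using w0[of "v - l"] w0[of l] J0[of "v - l"] J0[of l] by (intro mult_left_mono) auto
  also have "\<dots> = 2^m * ((?x * ?y) * ?a * ?b * ?c * (1 / ?a + 1 / ?b + 1 / ?c))"
   by (simp only: kernel_expand[OF w0 w0 w0])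
  finally show ?thesis by (simp only: \<rho>_def gw_eq power2_eq_square mult_ac)
 qed
 have fin: "dint (\<lambda>v l. \<bar>(kw 0 v)\<^sup>2 * br v l\<bar> * (cmod (U (v - l)) * cmod (D l) * cmod (D v)))
   \<le> ennreal (c2 * 2^m * (3 * \<rho>n * nm (gw 0) U * nm (gw 0) D * nm (kw 0) D))"
 proof (rule tri_kernel[OF weight_gw weight_gw weight_kw U D DK])
  fix v l
  have "\<bar>(kw 0 v)\<^sup>2 * br v l\<bar> \<le> (kw 0 v)\<^sup>2 * (c2 * (J (v - l) * J l))"
   unfolding abs_mult using br_bound[of v l] by (auto intro!: mult_left_mono)
  also have "\<dots> = c2 * ((kw 0 v)\<^sup>2 * J (v - l) * J l)" by (simp only: mult_ac)
  also have "\<dots> \<le> c2 * (2^m * (gw 0 (v - l) * gw 0 l * kw 0 v * (\<rho> (v - l) + \<rho> l + \<rho> v)))"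
   by (rule mult_left_mono[OF sq]) simp
  finally show "\<bar>(kw 0 v)\<^sup>2 * br v l\<bar> \<le> c2 * 2^m * (gw 0 (v - l) * gw 0 l * kw 0 v * (\<rho> (v - l) + \<rho> l + \<rho> v))"
   by (simp only: mult.assoc)
 qed simp_all
 have fin0: "dint (\<lambda>v l. \<bar>(kw 0 v)\<^sup>2 * l\<bar> * (cmod (U (v - l)) * cmod (D l) * cmod (D v)))
   \<le> ennreal (2^m * (3 * \<rho>n * nm (gw 0) U * nm (gw 0) D * nm (kw 0) D))"
 proof (rule tri_kernel[OF weight_gw weight_gw weight_kw U D DK])
  fix v l
  have "\<bar>l\<bar> \<le> J (v - l) * J l"
   using mult_mono[OF J_ge_1[of "v - l"] J_ge_abs[of l]] J0[of "v - l"] by simp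
  then have "\<bar>(kw 0 v)\<^sup>2 * l\<bar> \<le> (kw 0 v)\<^sup>2 * (J (v - l) * J l)"
   unfolding abs_mult by (auto intro!: mult_left_mono)
  then show "\<bar>(kw 0 v)\<^sup>2 * l\<bar> \<le> 2^m * (gw 0 (v - l) * gw 0 l * kw 0 v * (\<rho> (v - l) + \<rho> l + \<rho> v))"
   using sq[of v l] by (simp only: mult.assoc)
 qed simp_all
 have X: "dint (\<lambda>v l. \<bar>l * (kw 0 v)\<^sup>2 - v * (kw 0 l)\<^sup>2\<bar> * (cmod (U (v - l)) * cmod (D l) * cmod (D v)))
   \<le> ennreal (Ck * (3 * \<rho>n * nm (gw 0) U * nm (kw 0) D * nm (kw 0) D))"
 proof (rule tri_kernel[OF weight_gw weight_kw weight_kw U DK DK])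
  fix v l
  let ?x = "J (v - l)" and ?a = "kw 0 (v - l)" and ?b = "kw 0 l" and ?c = "kw 0 v"
  have nn: "0 \<le> ?a" "0 \<le> ?b" "0 \<le> ?c" using w0 by (auto intro: less_imp_le)
  have S: "0 \<le> ?x * ?b * ?c + min ?x (J l) * ?a * ?c + min ?x (J v) * ?a * ?b"
   using nn J0 by (intro add_nonneg_nonneg mult_nonneg_nonneg) (auto intro: less_imp_le)
  have "\<bar>l * (kw 0 v)\<^sup>2 - v * (kw 0 l)\<^sup>2\<bar> \<le> ((4 * real m + 3) * 3^m) * (?x * ?b * ?c + min ?x (J l) * ?a * ?c + min ?x (J v) * ?a * ?b)"
   using commutator_kernel[OF adm_K[OF order_refl], of l v] unfolding kw_def .
  also have "\<dots> \<le> Ck * (?x * ?b * ?c + min ?x (J l) * ?a * ?c + min ?x (J v) * ?a * ?b)"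
  proof (rule mult_right_mono[OF _ S])
   have "(3::real)^m \<le> 3^Suc m" by simp
   then show "(4 * real m + 3) * 3^m \<le> Ck" unfolding Ck_def by (intro mult_mono) auto
  qed
  also have "\<dots> \<le> Ck * (?x * ?b * ?c + ?x * ?a * ?c + ?x * ?a * ?b)"
   using nn by (intro mult_left_mono add_mono mult_right_mono) auto
  also have "?x * ?b * ?c + ?x * ?a * ?c + ?x * ?a * ?b = ?x * ?a * ?b * ?c * (1 / ?a + 1 / ?b + 1 / ?c)"
   unfolding kernel_expand[OF w0 w0 w0] by (simp add: algebra_simps)
  finally show "\<bar>l * (kw 0 v)\<^sup>2 - v * (kw 0 l)\<^sup>2\<bar> \<le> Ck * (gw 0 (v - l) * kw 0 l * kw 0 v * (\<rho> (v - l) + \<rho> l + \<rho> v))"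
   by (simp only: \<rho>_def gw_eq)
 qed simp_all
 have Y: "dint (\<lambda>v l. \<bar>(kw 0 v)\<^sup>2 * (br v l + \<gamma> * l / sqrt (2 * pi))\<bar> * (cmod (U (v - l)) * cmod (D l) * cmod (D v)))
   \<le> ennreal (c1 * (3 * 2^m) * (3 * \<rho>n * nm (gw 0) U * nm (kw 0) D * nm (kw 0) D))"
 proof (rule tri_kernel[OF weight_gw weight_kw weight_kw U DK DK])
  fix v l
  let ?x = "J (v - l)" and ?y = "J l" and ?z = "J v" and ?a = "kw 0 (v - l)" and ?b = "kw 0 l" and ?c = "kw 0 v"
  have hl: "?c * ?y / ?z \<le> 3 * 2^m * (?b + ?a + ?a * ?b / ?c)"
   unfolding kw_def by (rule high_low_kernel) (auto simp: J_ge_1 J_tri)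
  have "\<bar>(kw 0 v)\<^sup>2 * (br v l + \<gamma> * l / sqrt (2 * pi))\<bar> \<le> ?c\<^sup>2 * (c1 * (?x * ?y / ?z))"
   unfolding abs_mult abs_power2 by (intro mult_left_mono br_rem) simp
  also have "\<dots> = c1 * ((?x * ?c) * (?c * ?y / ?z))" by (simp add: power2_eq_square)
  also have "\<dots> \<le> c1 * ((?x * ?c) * (3 * 2^m * (?b + ?a + ?a * ?b / ?c)))"
   using hl J0[of "v - l"] w0[of v] by (intro mult_left_mono) auto
  also have "\<dots> = c1 * (3 * 2^m) * (?x * (?b * ?c + ?a * ?c + ?a * ?b))"
   using w0[of v] by (simp add: field_simps)
  also have "?x * (?b * ?c + ?a * ?c + ?a * ?b) = ?x * ?a * ?b * ?c * (1 / ?a + 1 / ?b + 1 / ?c)"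
   by (rule kernel_expand[OF w0 w0 w0, symmetric])
  finally show "\<bar>(kw 0 v)\<^sup>2 * (br v l + \<gamma> * l / sqrt (2 * pi))\<bar> \<le> c1 * (3 * 2^m) * (gw 0 (v - l) * kw 0 l * kw 0 v * (\<rho> (v - l) + \<rho> l + \<rho> v))"
   by (simp only: \<rho>_def gw_eq)
 qed simp_all
 have "\<bar>ip (kw 0) (Bl U D) D\<bar> \<le> \<bar>\<gamma>\<bar> * (Ck * (3 * \<rho>n * nm (gw 0) U * nm (kw 0) D * nm (kw 0) D)) + c1 * (3 * 2^m) * (3 * \<rho>n * nm (gw 0) U * nm (kw 0) D * nm (kw 0) D)"
  by (rule energy_split[OF m h fin _ fin0 _ X _ Y]) (auto intro!: mult_nonneg_nonneg)
 then show ?thesis by (simp add: algebra_simps)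
qed

text \<open>Here the derivative falls on \<open>V\<close>, which has it to spare, so the kernel is
  bounded directly; the nonlocal part uses \<open>high_low_kernel\<close> with the two inputs
  exchanged.\<close>

lemma diff_energy_Bl2:
 assumes V: "V \<in> H (gw 0)" and D: "D \<in> H (gw 0)"
 shows "\<bar>ip (kw 0) (Bl D V) D\<bar> \<le> (\<bar>\<gamma>\<bar> * 2^m + c1 * (3 * 2^m)) * (3 * \<rho>n * nm (kw 0) D * nm (gw 0) V * nm (kw 0) D)"
proof -
 note DK = H_kw(1)[OF order_refl D]
 have J0: "0 < J v" for v by (rule J_pos)
 have w0: "0 < kw 0 v" for v by (rule kw_pos) simp
 show ?thesis
 proof (rule ip_Bl(3)[OF H_measurable[OF D] H_measurable[OF V] H_measurable[OF D] weight_measurable[OF weight_kw[OF order_refl]]])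
  show "dint (\<lambda>v l. \<bar>(kw 0 v)\<^sup>2 * br v l\<bar> * (cmod (D (v - l)) * cmod (V l) * cmod (D v)))
   \<le> ennreal ((\<bar>\<gamma>\<bar> * 2^m + c1 * (3 * 2^m)) * (3 * \<rho>n * nm (kw 0) D * nm (gw 0) V * nm (kw 0) D))"
  proof (rule tri_kernel[OF weight_kw weight_gw weight_kw DK V DK])
   fix v l
   let ?x = "J (v - l)" and ?y = "J l" and ?z = "J v" and ?a = "kw 0 (v - l)" and ?b = "kw 0 l" and ?c = "kw 0 v"
   let ?T = "?y * (?b * ?c + ?a * ?c + ?a * ?b)"
   have hl: "?c * ?x / ?z \<le> 3 * 2^m * (?a + ?b + ?b * ?a / ?c)"
    unfolding kw_def by (rule high_low_kernel) (use J_tri[of v l] in \<open>auto simp: J_ge_1\<close>)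
   have 1: "?c\<^sup>2 * ?y \<le> 2^m * ?T"
   proof -
    have "?c * (?c * ?y) \<le> (2^m * (?a + ?b)) * (?c * ?y)"
     using kw_sub[of 0 v l] w0[of v] J0[of l] by (intro mult_right_mono) auto
    also have "\<dots> = 2^m * (?y * (?b * ?c + ?a * ?c))" by (simp add: algebra_simps)
    also have "\<dots> \<le> 2^m * ?T" using w0[of "v - l"] w0[of l] J0[of l] by (intro mult_left_mono) auto
    finally show ?thesis by (simp only: power2_eq_square mult_ac)
   qed
   have 2: "?c\<^sup>2 * (?x * ?y / ?z) \<le> 3 * 2^m * ?T"
   proof -
    have "?c\<^sup>2 * (?x * ?y / ?z) = (?y * ?c) * (?c * ?x / ?z)" by (simp add: power2_eq_square)
    also have "\<dots> \<le> (?y * ?c) * (3 * 2^m * (?a + ?b + ?b * ?a / ?c))"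
     using hl J0[of l] w0[of v] by (intro mult_left_mono) auto
    also have "\<dots> = 3 * 2^m * ?T" using w0[of v] by (simp add: field_simps)
    finally show ?thesis .
   qed
   have "\<bar>(kw 0 v)\<^sup>2 * br v l\<bar> \<le> ?c\<^sup>2 * (\<bar>\<gamma>\<bar> * ?y + c1 * (?x * ?y / ?z))"
    unfolding abs_mult using br_bound1[of v l] by (auto intro!: mult_left_mono)
   also have "\<dots> = \<bar>\<gamma>\<bar> * (?c\<^sup>2 * ?y) + c1 * (?c\<^sup>2 * (?x * ?y / ?z))" by (simp add: algebra_simps)
   also have "\<dots> \<le> \<bar>\<gamma>\<bar> * (2^m * ?T) + c1 * (3 * 2^m * ?T)"
    by (intro add_mono mult_left_mono 1 2) auto
   also have "\<dots> = (\<bar>\<gamma>\<bar> * 2^m + c1 * (3 * 2^m)) * ?T" by (simp add: algebra_simps)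
   also have "?T = ?y * ?a * ?b * ?c * (1 / ?a + 1 / ?b + 1 / ?c)"
    by (rule kernel_expand[OF w0 w0 w0, symmetric])
   finally show "\<bar>(kw 0 v)\<^sup>2 * br v l\<bar> \<le> (\<bar>\<gamma>\<bar> * 2^m + c1 * (3 * 2^m)) * (kw 0 (v - l) * gw 0 l * kw 0 v * (\<rho> (v - l) + \<rho> l + \<rho> v))"
    by (simp only: \<rho>_def gw_eq mult_ac)
  qed (auto intro!: add_nonneg_nonneg)
 qed (auto intro!: mult_nonneg_nonneg add_nonneg_nonneg)
qed

end

text \<open>Comparison with a supersolution \<open>\<phi>\<close> whose slope exceeds the permitted
  one by a margin. If \<open>f\<close> were ever above \<open>\<phi>\<close>, let T be the infimum
  of such times; then \<open>f\<close> is not above \<open>\<phi>\<close> at T, and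
  \<open>dini\<close> keeps it from rising above immediately afterwards.\<close>

lemma dini_gronwall:
 fixes f :: "real \<Rightarrow> real"
 assumes cont: "continuous_on {0..a} f" and C: "0 \<le> C" and e: "0 \<le> e"
  and dini: "\<And>t \<epsilon>. 0 \<le> t \<Longrightarrow> t < a \<Longrightarrow> 0 < \<epsilon> \<Longrightarrow> \<forall>\<^sub>F \<tau> in at_right t. f \<tau> \<le> f t + (\<tau> - t) * (C * f t + e + \<epsilon>)"
  and t: "0 \<le> t" "t \<le> a"
 shows "f t \<le> exp (C * t) * (f 0 + e * t)"
proof -
 have main: "f t \<le> exp (C * t) * (f 0 + (e + 2 * \<epsilon>) * t)" if \<epsilon>: "0 < \<epsilon>" for \<epsilon>
 proof (rule ccontr)
  define \<phi> where "\<phi> s = exp (C * s) * (f 0 + (e + 2 * \<epsilon>) * s)" for s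
  define h where "h s = f s - \<phi> s" for s
  assume "\<not> ?thesis"
  then have ht: "0 < h t" by (simp add: h_def \<phi>_def)
  define B where "B = {s. 0 \<le> s \<and> s \<le> a \<and> 0 < h s}"
  have tB: "t \<in> B" using ht t by (simp add: B_def)
  have bd: "bdd_below B" by (rule bdd_belowI[of _ 0]) (simp add: B_def)
  define T where "T = Inf B"
  have T0: "0 \<le> T" unfolding T_def by (rule cInf_greatest) (use tB in \<open>auto simp: B_def\<close>)
  have Tle: "T \<le> s" if "s \<in> B" for s unfolding T_def using that bd by (rule cInf_lower)
  have cont\<phi>: "continuous_on {0..a} \<phi>" unfolding \<phi>_def by (intro continuous_intros)
  have conth: "continuous_on {0..a} h" unfolding h_def by (intro continuous_intros cont cont\<phi>)
  have Ta: "T \<le> a" using Tle[OF tB] t by simp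
  have hT: "h T \<le> 0"
  proof (rule ccontr)
   assume "\<not> h T \<le> 0"
   then have pos: "0 < h T" by simp
   have "h 0 = 0" by (simp add: h_def \<phi>_def)
   then have T1: "0 < T" using pos T0 by (cases "T = 0") auto
   obtain d where d: "0 < d" "\<And>s. s \<in> {0..a} \<Longrightarrow> dist s T < d \<Longrightarrow> dist (h s) (h T) < h T"
    using conth pos T0 Ta unfolding continuous_on_iff by (metis atLeastAtMost_iff)
   define s where "s = max 0 (T - d / 2)"
   have s: "0 \<le> s" "s < T" "s \<le> a" "dist s T < d" using T1 d(1) Ta by (auto simp: s_def dist_real_def)
   then have "0 < h s" using d(2)[of s] by (auto simp: dist_real_def)
   then have "s \<in> B" using s by (simp add: B_def)
   then show False using Tle[of s] s by simp
  qed
  then have "T \<notin> B" by (auto simp: B_def)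
  then have Tt: "T < t" using Tle[OF tB] tB by (cases "T = t") auto
  have Ta': "T < a" using Tt t by simp
  have "\<forall>\<^sub>F \<tau> in at_right T. h \<tau> \<le> 0"
  proof (cases "h T = 0")
   case True
   have D: "(\<phi> has_real_derivative C * \<phi> T + exp (C * T) * (e + 2 * \<epsilon>)) (at T)"
    unfolding \<phi>_def by (auto intro!: derivative_eq_intros simp: algebra_simps)
   \<comment> \<open>The slack 2 \<epsilon> in \<open>\<phi>\<close> against the \<epsilon> allowed
     in \<open>dini\<close> makes the inequality between the slopes at T strict.\<close>
   have ge: "e + 2 * \<epsilon> \<le> exp (C * T) * (e + 2 * \<epsilon>)"
    using C T0 e \<epsilon> mult_right_mono[of 1 "exp (C * T)" "e + 2 * \<epsilon>"] by simp
   have "((\<lambda>\<tau>. (\<phi> \<tau> - \<phi> T) / (\<tau> - T)) \<longlongrightarrow> C * \<phi> T + exp (C * T) * (e + 2 * \<epsilon>)) (at_right T)"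
    using D unfolding has_field_derivative_iff by (rule tendsto_mono[OF at_le, rotated]) simp
   then have "\<forall>\<^sub>F \<tau> in at_right T. C * \<phi> T + e + \<epsilon> < (\<phi> \<tau> - \<phi> T) / (\<tau> - T)"
    by (rule order_tendstoD(1)) (use ge \<epsilon> in linarith)
   moreover have "\<forall>\<^sub>F \<tau> in at_right T. f \<tau> \<le> f T + (\<tau> - T) * (C * f T + e + \<epsilon>)" by (rule dini[OF T0 Ta' \<epsilon>])
   moreover have "\<forall>\<^sub>F \<tau> in at_right T. T < \<tau>" by (rule eventually_at_right_less)
   ultimately show ?thesis
   proof eventually_elim
    fix \<tau> assume a: "C * \<phi> T + e + \<epsilon> < (\<phi> \<tau> - \<phi> T) / (\<tau> - T)" "f \<tau> \<le> f T + (\<tau> - T) * (C * f T + e + \<epsilon>)" "T < \<tau>"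
    have "(C * \<phi> T + e + \<epsilon>) * (\<tau> - T) < \<phi> \<tau> - \<phi> T" using a by (simp add: pos_less_divide_eq)
    moreover have "f T = \<phi> T" using True by (simp add: h_def)
    ultimately show "h \<tau> \<le> 0" using a(2) by (simp add: h_def mult.commute)
   qed
  next
   case False
   then have neg: "h T < 0" using hT by simp
   have "(h \<longlongrightarrow> h T) (at T within {0..a})" using conth T0 Ta by (auto simp: continuous_on_def)
   then have "(h \<longlongrightarrow> h T) (at T within {T..a})" by (rule tendsto_within_subset) (use T0 in auto)
   then have "(h \<longlongrightarrow> h T) (at_right T)" unfolding at_within_Icc_at_right[OF Ta'] .
   from order_tendstoD(2)[OF this neg] show ?thesis by (rule eventually_mono) simp
  qed
  then obtain b where b: "T < b" "\<And>\<tau>. T < \<tau> \<Longrightarrow> \<tau> < b \<Longrightarrow> h \<tau> \<le> 0"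
   unfolding eventually_at_right_field by blast
  have "\<exists>s\<in>B. s < b" using b(1) tB bd unfolding T_def by (subst (asm) cInf_less_iff) auto
  then obtain s where s: "s \<in> B" "s < b" by blast
  then have "T < s" using Tle[OF s(1)] \<open>T \<notin> B\<close> by (cases "s = T") auto
  then have "h s \<le> 0" using b(2) s by simp
  then show False using s(1) by (simp add: B_def)
 qed
 show ?thesis
 proof (rule tendsto_lowerbound[of "\<lambda>n. exp (C * t) * (f 0 + (e + 2 * (1 / real (Suc n))) * t)" _ sequentially])
  have "(\<lambda>n. exp (C * t) * (f 0 + (e + 2 * (1 / real (Suc n))) * t)) \<longlonglongrightarrow> exp (C * t) * (f 0 + (e + 2 * 0) * t)"
   by (intro tendsto_intros LIMSEQ_Suc[OF lim_1_over_n])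
  then show "(\<lambda>n. exp (C * t) * (f 0 + (e + 2 * (1 / real (Suc n))) * t)) \<longlonglongrightarrow> exp (C * t) * (f 0 + e * t)" by simp
  show "\<forall>\<^sub>F n in sequentially. f t \<le> exp (C * t) * (f 0 + (e + 2 * (1 / real (Suc n))) * t)"
   by (intro always_eventually allI main) simp
 qed simp
qed

context rod
begin

definition cE :: real where "cE = (\<bar>\<gamma>\<bar> * Ck + c1 * 2^m) * (9 * \<rho>n)"
definition cD :: real where "cD = (\<bar>\<gamma>\<bar> * Ck + \<bar>\<gamma>\<bar> * 2^m + c1 * (3 * 2^m)) * (3 * \<rho>n)"
definition cN :: real where "cN = 2 * cB + 2 * \<bar>\<omega>\<bar>"

lemma cE_nonneg [simp]: "0 \<le> cE" and cD_nonneg [simp]: "0 \<le> cD" and cB_nonneg [simp]: "0 \<le> cB" and cN_nonneg [simp]: "0 \<le> cN"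
 by (auto simp: cE_def cD_def cN_def cB_def intro!: mult_nonneg_nonneg add_nonneg_nonneg)

text \<open>The linear term acts by a purely imaginary multiplier and drops out of the energy
  identities.\<close>

lemma Li_orth: "Re (Li U k * cnj (U k)) = 0"
proof -
 have "Li U k * cnj (U k) = \<i> * cr (- (2 * \<omega> * k / (1 + k\<^sup>2)) * (cmod (U k))\<^sup>2)"
  unfolding Li_def of_real_mult complex_norm_square by (simp only: mult_ac)
 then show ?thesis by (simp only: times_complex.sel(1) Re_complex_of_real Im_complex_of_real imaginary_unit.sel mult_zero_left mult_zero_right diff_zero)
qed

lemma ip_Nl: "ip w (Nl U) U = ip w (Bl U U) U"
 unfolding ip_def Nl_def distrib_right plus_complex.sel(1) Li_orth by simp

theorem self_energy:
 assumes R: "0 \<le> R" and U: "U \<in> H g1" and h: "herm U"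
 shows "\<bar>ip (gw R) (Nl U) U\<bar> \<le> cE * (nm (gw 0) U * (nm (gw R) U)\<^sup>2)"
proof -
 note [measurable] = H_measurable[OF U] weight_measurable[OF weight_gw[OF R]]
 note ae = symm_AE[OF h]
 have U': "symm U \<in> H g1" by (rule H_cong_AE[OF weight_g1 U _ ae]) simp
 have Beq: "Bl U U = Bl (symm U) (symm U)" by (rule Bl_cong_AE) (use ae in simp_all)
 have "ip (gw R) (Nl U) U = ip (gw R) (Bl (symm U) (symm U)) (symm U)"
  unfolding ip_Nl Beq by (rule ip_cong_AE) (use ae in simp_all)
 moreover have "nm (gw R) (symm U) = nm (gw R) U" "nm (gw 0) (symm U) = nm (gw 0) U"
  using ae by (auto intro!: nm_cong_AE weight_gw R elim: eventually_mono)
 ultimately show ?thesis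
  using self_energy_Bl[OF R U' symm_herm] unfolding cE_def by (simp only: mult.assoc)
qed

lemma Li_bound:
 assumes R: "0 \<le> R" and U: "U \<in> H (kw R)"
 shows "Li U \<in> H (kw R)" "nm (kw R) (Li U) \<le> 2 * \<bar>\<omega>\<bar> * nm (kw R) U"
proof -
 note [measurable] = H_measurable[OF U]
 have "\<bar>k / (1 + k\<^sup>2)\<bar> \<le> 1" for k :: real
 proof (rule order_trans[OF abs_div_bracket])
  show "1 / J k \<le> 1" using J_ge_1[of k] by simp
 qed
 then have "\<bar>2 * \<omega>\<bar> * \<bar>k / (1 + k\<^sup>2)\<bar> \<le> \<bar>2 * \<omega>\<bar> * 1" for k by (rule mult_left_mono) simp
 moreover have "cmod (Li U k) = (\<bar>2 * \<omega>\<bar> * \<bar>k / (1 + k\<^sup>2)\<bar>) * cmod (U k)" for k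
  unfolding Li_def norm_mult norm_of_real by (simp add: abs_mult abs_divide)
 ultimately have "cmod (Li U k) \<le> 2 * \<bar>\<omega>\<bar> * cmod (U k)" for k
  using mult_right_mono[of "\<bar>2 * \<omega>\<bar> * \<bar>k / (1 + k\<^sup>2)\<bar>" "2 * \<bar>\<omega>\<bar>" "cmod (U k)"] by (simp add: abs_mult)
 then have le: "kw R k * cmod (Li U k) \<le> kw R k * (2 * \<bar>\<omega>\<bar> * cmod (U k))" for k
  by (rule mult_left_mono) (simp add: weight_nonneg weight_kw R)
 have ae: "AE k in lborel. kw R k * cmod (Li U k) \<le> 2 * \<bar>\<omega>\<bar> * (kw R k * cmod (U k))"
  using le by (intro AE_I2) (simp add: mult_ac)
 show "Li U \<in> H (kw R)" "nm (kw R) (Li U) \<le> 2 * \<bar>\<omega>\<bar> * nm (kw R) U"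
  using H_dom[OF weight_kw[OF R] Li_measurable[OF H_measurable[OF U]] U ae] by auto
qed

theorem Nl_bound:
 assumes R: "0 \<le> R" and U: "U \<in> H (gw 0)"
 shows "Nl U \<in> H (kw R)" "nm (kw R) (Nl U) \<le> cN * (1 + nm (gw 0) U) * nm (gw R) U"
proof -
 note UR = H_gw(1)[OF R U]
 note b = Bl_bound[OF R U U] and l = Li_bound[OF R H_kw(1)[OF R UR]]
 note a = H_add[OF weight_kw[OF R] b(1) l(1)]
 show "Nl U \<in> H (kw R)" using a(1) unfolding Nl_def[abs_def] .
 have "nm (kw R) (Nl U) \<le> nm (kw R) (Bl U U) + nm (kw R) (Li U)" using a(2) unfolding Nl_def[abs_def] .
 also have "\<dots> \<le> cB * (nm (gw R) U * nm (gw 0) U + nm (gw 0) U * nm (gw R) U) + 2 * \<bar>\<omega>\<bar> * nm (gw R) U"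
 proof (rule add_mono[OF b(2)])
  show "nm (kw R) (Li U) \<le> 2 * \<bar>\<omega>\<bar> * nm (gw R) U"
   using l(2) mult_left_mono[OF H_kw(2)[OF R UR], of "2 * \<bar>\<omega>\<bar>"] by simp
 qed
 also have "\<dots> = (2 * cB * nm (gw 0) U + 2 * \<bar>\<omega>\<bar> * 1) * nm (gw R) U" by (simp add: algebra_simps)
 also have "\<dots> \<le> (cN * nm (gw 0) U + cN * 1) * nm (gw R) U"
  by (intro mult_right_mono add_mono) (auto simp: cN_def)
 finally show "nm (kw R) (Nl U) \<le> cN * (1 + nm (gw 0) U) * nm (gw R) U" by (simp add: algebra_simps)
qed

text \<open>Lipschitz with the loss of one derivative. This is too weak for a fixed point argument
  in H^s, but suffices to pass to the limit in the equation and to compare time derivatives.\<close>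

theorem Nl_lipschitz:
 assumes U: "U \<in> H (gw 0)" and V: "V \<in> H (gw 0)"
 shows "nd (kw 0) (Nl U) (Nl V) \<le> cN * (1 + nm (gw 0) U + nm (gw 0) V) * nd (gw 0) U V"
proof -
 let ?D = "\<lambda>k. U k - V k"
 have w: "weight (kw 0)" by (rule weight_kw) simp
 have D: "?D \<in> H (gw 0)" by (intro H_diff weight_gw U V) simp
 note b1 = Bl_bound[OF order_refl U D] and b2 = Bl_bound[OF order_refl D V] and l = Li_bound[OF order_refl H_kw(1)[OF order_refl D]]
 have "nd (kw 0) (Nl U) (Nl V) \<le> nm (kw 0) (Bl U ?D) + nm (kw 0) (Bl ?D V) + nm (kw 0) (Li ?D)"
  unfolding Nl_diff[OF U V]
  using H_add(2)[OF w H_add(1)[OF w b1(1) b2(1)] l(1)] H_add(2)[OF w b1(1) b2(1)] by linarith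
 also have "\<dots> \<le> cB * (nm (gw 0) U * nm (gw 0) ?D + nm (gw 0) U * nm (gw 0) ?D)
   + cB * (nm (gw 0) ?D * nm (gw 0) V + nm (gw 0) ?D * nm (gw 0) V) + 2 * \<bar>\<omega>\<bar> * nm (gw 0) ?D"
 proof (intro add_mono b1(2) b2(2))
  show "nm (kw 0) (Li ?D) \<le> 2 * \<bar>\<omega>\<bar> * nm (gw 0) ?D"
   using l(2) mult_left_mono[OF H_kw(2)[OF order_refl D], of "2 * \<bar>\<omega>\<bar>"] by simp
 qed
 also have "\<dots> = (2 * cB * nm (gw 0) U + 2 * cB * nm (gw 0) V + 2 * \<bar>\<omega>\<bar> * 1) * nm (gw 0) ?D" by (simp add: algebra_simps)
 also have "\<dots> \<le> (cN * nm (gw 0) U + cN * nm (gw 0) V + cN * 1) * nm (gw 0) ?D"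
  by (intro mult_right_mono add_mono) (auto simp: cN_def)
 finally show ?thesis by (simp add: algebra_simps)
qed

text \<open>The difference of the quadratic terms is \<open>Bl U D + Bl D V\<close>. The first has
  its derivative on D and uses that U is Hermitian; the second has it on V.\<close>

theorem diff_energy:
 assumes U: "U \<in> H (gw 0)" and V: "V \<in> H (gw 0)" and h: "herm U"
 shows "\<bar>ip (kw 0) (\<lambda>k. Nl U k - Nl V k) (\<lambda>k. U k - V k)\<bar>
  \<le> cD * (nm (gw 0) U + nm (gw 0) V) * (nd (kw 0) U V)\<^sup>2"
proof -
 define D where "D = (\<lambda>k. U k - V k)"
 have w: "weight (kw 0)" by (rule weight_kw) simp
 have D: "D \<in> H (gw 0)" unfolding D_def by (intro H_diff weight_gw U V) simp
 note DK = H_kw(1)[OF order_refl D]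
 note [measurable] = H_measurable[OF U] H_measurable[OF D]
 note ae = symm_AE[OF h]
 have U': "symm U \<in> H (gw 0)" by (rule H_cong_AE[OF weight_gw U _ ae]) simp_all
 have Beq: "Bl U D = Bl (symm U) D" by (rule Bl_cong_AE) (use ae in simp_all)
 have nmU: "nm (gw 0) (symm U) = nm (gw 0) U"
  using ae by (auto intro!: nm_cong_AE weight_gw elim: eventually_mono)
 have "ip (kw 0) (\<lambda>k. Nl U k - Nl V k) D = ip (kw 0) (\<lambda>k. Bl U D k + Bl D V k) D"
  unfolding Nl_diff[OF U V] D_def[symmetric] ip_def distrib_right[of _ "Li D _"] plus_complex.sel(1)[of _ "Li D _ * _"] Li_orth by simp
 also have "\<dots> = ip (kw 0) (Bl U D) D + ip (kw 0) (Bl D V) D"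
  by (rule ip_add[OF Bl_bound(1)[OF order_refl U D] Bl_bound(1)[OF order_refl D V] DK w])
 finally have "\<bar>ip (kw 0) (\<lambda>k. Nl U k - Nl V k) D\<bar> \<le> \<bar>ip (kw 0) (Bl (symm U) D) D\<bar> + \<bar>ip (kw 0) (Bl D V) D\<bar>"
  unfolding Beq by simp
 also have "\<dots> \<le> (\<bar>\<gamma>\<bar> * Ck + c1 * (3 * 2^m)) * (3 * \<rho>n * nm (gw 0) U * nm (kw 0) D * nm (kw 0) D)
   + (\<bar>\<gamma>\<bar> * 2^m + c1 * (3 * 2^m)) * (3 * \<rho>n * nm (kw 0) D * nm (gw 0) V * nm (kw 0) D)"
  using diff_energy_Bl1[OF U' D symm_herm] diff_energy_Bl2[OF V D] unfolding nmU by (rule add_mono)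
 also have "\<dots> \<le> (\<bar>\<gamma>\<bar> * Ck + \<bar>\<gamma>\<bar> * 2^m + c1 * (3 * 2^m)) * (3 * \<rho>n * nm (gw 0) U * nm (kw 0) D * nm (kw 0) D)
   + (\<bar>\<gamma>\<bar> * Ck + \<bar>\<gamma>\<bar> * 2^m + c1 * (3 * 2^m)) * (3 * \<rho>n * nm (kw 0) D * nm (gw 0) V * nm (kw 0) D)"
  by (intro add_mono mult_right_mono) (auto intro!: mult_nonneg_nonneg)
 also have "\<dots> = cD * (nm (gw 0) U + nm (gw 0) V) * (nm (kw 0) D)\<^sup>2"
  unfolding cD_def power2_eq_square distrib_left distrib_right by (simp only: mult_ac)
 finally show ?thesis unfolding D_def .
qed

text \<open>\<open>br\<close> is odd under reflection of both frequencies, and conjugation turns i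
  into -i; the two signs cancel.\<close>

lemma herm_Nl:
 assumes [measurable]: "U \<in> BM" and h: "herm U" shows "herm (Nl U)"
proof -
 have brm: "br (- k) (- j) = - br k j" for k j
 proof -
  have "(- k - - j) * (- j) = (k - j) * j" by (simp add: algebra_simps)
  then have "\<gamma> / 2 * (- k - - j) * (- j) = \<gamma> / 2 * (k - j) * j" by (simp only: mult.assoc)
  then show ?thesis unfolding br_def by (simp only: power2_minus minus_divide_left[symmetric] minus_mult_left[symmetric] mult_minus_right minus_add_distrib[symmetric])
 qed
 have "Bl (symm U) (symm U) (- k) = cnj (Bl (symm U) (symm U) k)" for k
 proof -
  let ?u = "symm U"
  have "(LINT j|lborel. cr (br (- k) j) * (?u (- k - j) * ?u j))
    = (LINT j|lborel. cr (br (- k) (0 + -1 * j)) * (?u (- k - (0 + -1 * j)) * ?u (0 + -1 * j)))"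
   using lborel_integral_real_affine[of "-1" "\<lambda>j. cr (br (- k) j) * (?u (- k - j) * ?u j)" 0] by simp
  also have "\<dots> = (LINT j|lborel. - cnj (cr (br k j) * (?u (k - j) * ?u j)))"
  proof (rule Bochner_Integration.integral_cong[OF refl])
   fix j
   have 1: "?u (- k - (0 + -1 * j)) = cnj (?u (k - j))" using symm_herm[of U "k - j"] by simp
   have 2: "?u (0 + -1 * j) = cnj (?u j)" using symm_herm[of U j] by simp
   have 3: "br (- k) (0 + -1 * j) = - br k j" using brm[of k j] by simp
   show "cr (br (- k) (0 + -1 * j)) * (?u (- k - (0 + -1 * j)) * ?u (0 + -1 * j))
     = - cnj (cr (br k j) * (?u (k - j) * ?u j))" unfolding 1 2 3 by simp
  qed
  also have "\<dots> = - cnj (LINT j|lborel. cr (br k j) * (?u (k - j) * ?u j))"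
   by (simp only: Bochner_Integration.integral_minus Bochner_Integration.integral_cnj)
  finally show ?thesis unfolding Bl_def by (simp only: complex_cnj_mult complex_cnj_i mult_minus_left mult_minus_right)
 qed
 moreover have "Bl U U = Bl (symm U) (symm U)" by (rule Bl_cong_AE) (use symm_AE[OF h] in simp_all)
 ultimately have B: "Bl U U (- k) = cnj (Bl U U k)" for k by simp
 show ?thesis using h unfolding herm_def by eventually_elim (simp add: Nl_def Li_def B)
qed

section \<open>Stability of approximate solutions\<close>


lemma weight_w [simp]: "weight (kw 0)" and weight_g [simp]: "weight (gw 0)"
 by (simp_all add: weight_kw weight_gw)

lemma H_gk: "U \<in> H (gw 0) \<Longrightarrow> U \<in> H (kw 0)"
 by (rule H_kw(1)) simp

text \<open>\<open>U\<close> solves the equation on \<open>[0,a]\<close> up to an error \<^term>\<open>\<epsilon>\<close>; only a right derivative is required,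
 so that Euler polygons qualify.\<close>

definition asol :: "real \<Rightarrow> real \<Rightarrow> real \<Rightarrow> (real \<Rightarrow> real \<Rightarrow> complex) \<Rightarrow> bool" where
 "asol a M \<epsilon> U \<longleftrightarrow>
  (\<forall>t\<in>{0..a}. U t \<in> H (gw 0) \<and> nm (gw 0) (U t) \<le> M \<and> herm (U t)) \<and>
  (\<forall>t\<in>{0..a}. ((\<lambda>\<tau>. nd (kw 0) (U \<tau>) (U t)) \<longlongrightarrow> 0) (at t within {0..a})) \<and>
  (\<forall>t\<in>{0..<a}. \<exists>V. V \<in> H (kw 0) \<and> nd (kw 0) V (Nl (U t)) \<le> \<epsilon> \<and>
    ((\<lambda>\<tau>. dq (kw 0) U \<tau> t V) \<longlongrightarrow> 0) (at_right t))"

lemma H_divide: "weight w \<Longrightarrow> f \<in> H w \<Longrightarrow> (\<lambda>k. f k / c) \<in> H w"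
 using H_scale(1)[of w f "1 / c"] by simp

lemma nm_continuous:
 assumes w: "weight w" and U: "\<And>t. t \<in> S \<Longrightarrow> U t \<in> H w" and t: "t \<in> S"
  and c: "((\<lambda>\<tau>. nd w (U \<tau>) (U t)) \<longlongrightarrow> 0) (at t within S)"
 shows "((\<lambda>\<tau>. nm w (U \<tau>)) \<longlongrightarrow> nm w (U t)) (at t within S)"
proof (rule LIM_zero_cancel, rule tendsto_norm_zero_cancel, rule Lim_null_comparison[OF _ c])
 show "\<forall>\<^sub>F \<tau> in at t within S. norm (norm (nm w (U \<tau>) - nm w (U t))) \<le> nd w (U \<tau>) (U t)"
  unfolding eventually_at_filter
 proof (intro always_eventually allI impI)
  fix \<tau> assume "\<tau> \<in> S"
  then show "norm (norm (nm w (U \<tau>) - nm w (U t))) \<le> nd w (U \<tau>) (U t)"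
   using nm_tri_diff[OF w U U, of \<tau> t] nm_tri_diff[OF w U U, of t \<tau>] t nm_minus_commute[of w "U \<tau>" "U t"]
   by (simp add: abs_le_iff)
 qed
qed

text \<open>The difference quotient of D is, up to \<open>?r\<close>, the difference of the two
  right derivatives; expanding the square reduces the growth rate to \<open>diff_energy\<close> and
  the errors. The exponent collects twice 2 * cD * M from the energy and 1 from splitting 2 (e1 +
  e2) d into d^2 + (e1 + e2)^2.\<close>

theorem stability:
 assumes U: "asol a M e1 U" and V: "asol a M e2 V" and e: "0 \<le> e1" "0 \<le> e2" and t: "0 \<le> t" "t \<le> a"
 shows "(nd (kw 0) (U t) (V t))\<^sup>2
  \<le> exp ((4 * cD * M + 1) * t) * ((nd (kw 0) (U 0) (V 0))\<^sup>2 + (e1 + e2)\<^sup>2 * t)"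
proof (rule dini_gronwall[where f="\<lambda>t. (nd (kw 0) (U t) (V t))\<^sup>2" and a=a, OF _ _ _ _ t])
 have UH: "U s \<in> H (gw 0)" "nm (gw 0) (U s) \<le> M" "herm (U s)" if "0 \<le> s" "s \<le> a" for s using U that by (auto simp: asol_def)
 have VH: "V s \<in> H (gw 0)" "nm (gw 0) (V s) \<le> M" if "0 \<le> s" "s \<le> a" for s using V that by (auto simp: asol_def)
 have M0: "0 \<le> M" by (rule order_trans[OF nm_nonneg UH(2)[OF t]])
 show "0 \<le> 4 * cD * M + 1" using M0 by simp
 let ?D = "\<lambda>s k. U s k - V s k"
 have DH: "?D s \<in> H (kw 0)" if "0 \<le> s" "s \<le> a" for s by (intro H_diff H_gk UH VH that) simp
 show "continuous_on {0..a} (\<lambda>s. (nm (kw 0) (?D s))\<^sup>2)"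
  unfolding continuous_on_def
 proof (rule ballI, rule tendsto_power, rule nm_continuous[OF weight_w])
  fix s assume s: "s \<in> {0..a}"
  show "s \<in> {0..a}" by (rule s)
  show "((\<lambda>\<tau>. nd (kw 0) (?D \<tau>) (?D s)) \<longlongrightarrow> 0) (at s within {0..a})"
  proof (rule Lim_null_comparison)
   have "((\<lambda>\<tau>. nd (kw 0) (U \<tau>) (U s) + nd (kw 0) (V \<tau>) (V s)) \<longlongrightarrow> 0 + 0) (at s within {0..a})"
    using U V s by (intro tendsto_add) (auto simp: asol_def)
   then show "((\<lambda>\<tau>. nd (kw 0) (U \<tau>) (U s) + nd (kw 0) (V \<tau>) (V s)) \<longlongrightarrow> 0) (at s within {0..a})" by simp
   show "\<forall>\<^sub>F \<tau> in at s within {0..a}. norm (nd (kw 0) (?D \<tau>) (?D s)) \<le> nd (kw 0) (U \<tau>) (U s) + nd (kw 0) (V \<tau>) (V s)"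
    unfolding eventually_at_filter
   proof (intro always_eventually allI impI)
    fix \<tau> assume \<tau>: "\<tau> \<in> {0..a}"
    have A: "(\<lambda>k. U \<tau> k - U s k) \<in> H (kw 0)" "(\<lambda>k. V \<tau> k - V s k) \<in> H (kw 0)"
     using \<tau> s by (auto intro!: H_diff(1) H_gk UH VH)
    have "(\<lambda>k. ?D \<tau> k - ?D s k) = (\<lambda>k. (U \<tau> k - U s k) - (V \<tau> k - V s k))" by auto
    then show "norm (nd (kw 0) (?D \<tau>) (?D s)) \<le> nd (kw 0) (U \<tau>) (U s) + nd (kw 0) (V \<tau>) (V s)"
     using H_diff(2)[OF weight_w A] by simp
   qed
  qed
 qed (use DH in simp)
 fix s \<epsilon> :: real assume s: "0 \<le> s" "s < a" and \<epsilon>: "0 < \<epsilon>"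
 let ?f = "(nm (kw 0) (?D s))\<^sup>2" and ?d = "nm (kw 0) (?D s)"
 obtain A where A: "A \<in> H (kw 0)" "nd (kw 0) A (Nl (U s)) \<le> e1"
  "((\<lambda>\<tau>. dq (kw 0) U \<tau> s A) \<longlongrightarrow> 0) (at_right s)"
  using U s unfolding asol_def by (meson atLeastLessThan_iff)
 obtain B where B: "B \<in> H (kw 0)" "nd (kw 0) B (Nl (V s)) \<le> e2"
  "((\<lambda>\<tau>. dq (kw 0) V \<tau> s B) \<longlongrightarrow> 0) (at_right s)"
  using V s unfolding asol_def by (meson atLeastLessThan_iff)
 let ?r = "\<lambda>\<tau>. dq (kw 0) U \<tau> s A + dq (kw 0) V \<tau> s B"
 let ?n = "nd (kw 0) A B"
 have sa: "s \<le> a" using s by simp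
 note NU = Nl_bound(1)[OF order_refl UH(1)[OF s(1) sa]] and NV = Nl_bound(1)[OF order_refl VH(1)[OF s(1) sa]]
 have AB: "(\<lambda>k. A k - B k) \<in> H (kw 0)" by (intro H_diff A B weight_w)
 have eA: "(\<lambda>k. A k - Nl (U s) k) \<in> H (kw 0)" "(\<lambda>k. B k - Nl (V s) k) \<in> H (kw 0)" "(\<lambda>k. Nl (U s) k - Nl (V s) k) \<in> H (kw 0)"
  by (intro H_diff A B weight_w NU NV)+
 have ipAB: "ip (kw 0) (\<lambda>k. A k - B k) (?D s) \<le> 2 * cD * M * ?f + (e1 + e2) * ?d"
 proof -
  have "(\<lambda>k. A k - B k) = (\<lambda>k. (Nl (U s) k - Nl (V s) k) + ((A k - Nl (U s) k) - (B k - Nl (V s) k)))" by auto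
  then have "ip (kw 0) (\<lambda>k. A k - B k) (?D s) = ip (kw 0) (\<lambda>k. Nl (U s) k - Nl (V s) k) (?D s)
    + ip (kw 0) (\<lambda>k. (A k - Nl (U s) k) - (B k - Nl (V s) k)) (?D s)"
   using ip_add[OF eA(3) H_diff(1)[OF weight_w eA(1,2)] DH[OF s(1) sa] weight_w] by simp
  moreover have "ip (kw 0) (\<lambda>k. Nl (U s) k - Nl (V s) k) (?D s) \<le> 2 * cD * M * ?f"
  proof -
   have "ip (kw 0) (\<lambda>k. Nl (U s) k - Nl (V s) k) (?D s) \<le> cD * (nm (gw 0) (U s) + nm (gw 0) (V s)) * ?f"
    using diff_energy[OF UH(1)[OF s(1) sa] VH(1)[OF s(1) sa] UH(3)[OF s(1) sa]] by (simp add: abs_le_iff)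
   also have "\<dots> \<le> cD * (M + M) * ?f"
    using UH(2)[OF s(1) sa] VH(2)[OF s(1) sa] by (intro mult_right_mono mult_left_mono add_mono) auto
   finally show ?thesis by (simp add: algebra_simps)
  qed
  moreover have "ip (kw 0) (\<lambda>k. (A k - Nl (U s) k) - (B k - Nl (V s) k)) (?D s) \<le> (e1 + e2) * ?d"
  proof -
   have "ip (kw 0) (\<lambda>k. (A k - Nl (U s) k) - (B k - Nl (V s) k)) (?D s) \<le> nm (kw 0) (\<lambda>k. (A k - Nl (U s) k) - (B k - Nl (V s) k)) * ?d"
    using ip_CS[OF H_diff(1)[OF weight_w eA(1,2)] DH[OF s(1) sa] weight_w] by (simp add: abs_le_iff)
   also have "\<dots> \<le> (e1 + e2) * ?d"
    using H_diff(2)[OF weight_w eA(1,2)] A(2) B(2) by (intro mult_right_mono) auto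
   finally show ?thesis .
  qed
  ultimately show ?thesis by linarith
 qed
 have r0: "(?r \<longlongrightarrow> 0) (at_right s)" using tendsto_add[OF A(3) B(3)] by simp
 have "((\<lambda>\<tau>. 2 * (?r \<tau> * ?d) + (\<tau> - s) * (?n + ?r \<tau>)\<^sup>2) \<longlongrightarrow> 2 * (0 * ?d) + (s - s) * (?n + 0)\<^sup>2) (at_right s)"
  by (intro tendsto_intros r0)
 then have "((\<lambda>\<tau>. 2 * (?r \<tau> * ?d) + (\<tau> - s) * (?n + ?r \<tau>)\<^sup>2) \<longlongrightarrow> 0) (at_right s)" by simp
 from order_tendstoD(2)[OF this \<epsilon>]
 have small: "\<forall>\<^sub>F \<tau> in at_right s. 2 * (?r \<tau> * ?d) + (\<tau> - s) * (?n + ?r \<tau>)\<^sup>2 < \<epsilon>" .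
 moreover have "\<forall>\<^sub>F \<tau> in at_right s. s < \<tau> \<and> \<tau> < a"
  using s(2) unfolding eventually_at_right_field by auto
 ultimately show "\<forall>\<^sub>F \<tau> in at_right s. (nm (kw 0) (?D \<tau>))\<^sup>2 \<le> ?f + (\<tau> - s) * ((4 * cD * M + 1) * ?f + (e1 + e2)\<^sup>2 + \<epsilon>)"
 proof eventually_elim
  fix \<tau> assume sm: "2 * (?r \<tau> * ?d) + (\<tau> - s) * (?n + ?r \<tau>)\<^sup>2 < \<epsilon>" and \<tau>: "s < \<tau> \<and> \<tau> < a"
  define h where "h = \<tau> - s"
  have h: "0 < h" using \<tau> by (simp add: h_def)
  define q where "q = (\<lambda>k. (?D \<tau> k - ?D s k) / cr h)"
  have \<tau>0: "0 \<le> \<tau>" "\<tau> \<le> a" using \<tau> s by auto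
  have qH: "q \<in> H (kw 0)" unfolding q_def by (intro H_divide H_diff(1) DH s(1) sa \<tau>0 weight_w)
  have uA: "(\<lambda>k. (U \<tau> k - U s k) / cr h - A k) \<in> H (kw 0)" "(\<lambda>k. (V \<tau> k - V s k) / cr h - B k) \<in> H (kw 0)"
   by (intro H_diff(1) H_divide weight_w A B H_gk UH VH s(1) sa \<tau>0)+
  have qr: "nm (kw 0) (\<lambda>k. q k - (A k - B k)) \<le> ?r \<tau>"
  proof -
   have "(\<lambda>k. q k - (A k - B k)) = (\<lambda>k. ((U \<tau> k - U s k) / cr h - A k) - ((V \<tau> k - V s k) / cr h - B k))"
    unfolding q_def by (auto simp: diff_divide_distrib)
   then show ?thesis using H_diff(2)[OF weight_w uA] by (simp add: h_def)
  qed
  have qAB: "(\<lambda>k. q k - (A k - B k)) \<in> H (kw 0)" by (intro H_diff(1) weight_w qH AB)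
  have ipq: "ip (kw 0) q (?D s) \<le> 2 * cD * M * ?f + (e1 + e2) * ?d + ?r \<tau> * ?d"
  proof -
   have "ip (kw 0) q (?D s) = ip (kw 0) (\<lambda>k. A k - B k) (?D s) + ip (kw 0) (\<lambda>k. q k - (A k - B k)) (?D s)"
    using ip_add[OF AB qAB DH[OF s(1) sa] weight_w] by simp
   moreover have "ip (kw 0) (\<lambda>k. q k - (A k - B k)) (?D s) \<le> ?r \<tau> * ?d"
    using ip_CS[OF qAB DH[OF s(1) sa] weight_w] mult_right_mono[OF qr, of ?d] by (simp add: abs_le_iff)
   ultimately show ?thesis using ipAB by linarith
  qed
  have nq: "nm (kw 0) q \<le> ?n + ?r \<tau>"
   using nm_tri_diff[OF weight_w qH AB] qr by linarith
  have "?D \<tau> = (\<lambda>k. ?D s k + cr h * q k)" unfolding q_def using h by auto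
  then have "(nm (kw 0) (?D \<tau>))\<^sup>2 = ?f + 2 * h * ip (kw 0) q (?D s) + h\<^sup>2 * (nm (kw 0) q)\<^sup>2"
   using nm_sq_add[OF DH[OF s(1) sa] qH weight_w, of h] by simp
  also have "\<dots> \<le> ?f + 2 * h * (2 * cD * M * ?f + (e1 + e2) * ?d + ?r \<tau> * ?d) + h\<^sup>2 * (?n + ?r \<tau>)\<^sup>2"
   using ipq nq h by (intro add_mono mult_left_mono power_mono order_refl) auto
  also have "\<dots> = ?f + h * (4 * cD * M * ?f + 2 * ((e1 + e2) * ?d) + (2 * (?r \<tau> * ?d) + h * (?n + ?r \<tau>)\<^sup>2))"
   by (simp add: algebra_simps power2_eq_square)
  also have "\<dots> \<le> ?f + h * (4 * cD * M * ?f + (?f + (e1 + e2)\<^sup>2) + \<epsilon>)"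
  proof (intro add_mono mult_left_mono order_refl)
   show "2 * ((e1 + e2) * ?d) \<le> ?f + (e1 + e2)\<^sup>2"
    using sum_squares_bound[of "e1 + e2" ?d, unfolded mult.assoc] by (simp only: add.commute)
   show "2 * (?r \<tau> * ?d) + h * (?n + ?r \<tau>)\<^sup>2 \<le> \<epsilon>" using sm by (simp add: h_def)
  qed (use h M0 in auto)
  finally show "(nm (kw 0) (?D \<tau>))\<^sup>2 \<le> ?f + (\<tau> - s) * ((4 * cD * M + 1) * ?f + (e1 + e2)\<^sup>2 + \<epsilon>)"
   by (simp add: h_def algebra_simps)
 qed
qed simp

section \<open>Euler polygons\<close>

definition cut :: "nat \<Rightarrow> (real \<Rightarrow> complex) \<Rightarrow> real \<Rightarrow> complex" where
 "cut n f k = (if \<bar>k\<bar> \<le> real n then f k else 0)"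

lemma cut_measurable [measurable]:
 assumes [measurable]: "f \<in> BM" shows "cut n f \<in> BM"
 unfolding cut_def[abs_def] by measurable

lemma cut_le: assumes w: "weight w" and f: "f \<in> H w" shows "cut n f \<in> H w" "nm w (cut n f) \<le> nm w f"
proof -
 have ae: "AE k in lborel. w k * cmod (cut n f k) \<le> 1 * (w k * cmod (f k))"
  using weight_nonneg[OF w] by (auto simp: cut_def)
 show "cut n f \<in> H w" "nm w (cut n f) \<le> nm w f"
  using H_dom[OF w cut_measurable[OF H_measurable[OF f]] f ae] by auto
qed

lemma cut_gain:
 assumes w: "weight w" and w': "weight w'" and e: "\<And>k. w' k = J k * w k" and f: "f \<in> H w"
 shows "cut n f \<in> H w'" "nm w' (cut n f) \<le> (real n + 1) * nm w f"
proof -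
 have ae: "AE k in lborel. w' k * cmod (cut n f k) \<le> (real n + 1) * (w k * cmod (f k))"
 proof (rule AE_I2)
  fix k
  show "w' k * cmod (cut n f k) \<le> (real n + 1) * (w k * cmod (f k))"
  proof (cases "\<bar>k\<bar> \<le> real n")
   case True
   have "J k * (w k * cmod (f k)) \<le> (real n + 1) * (w k * cmod (f k))"
    using J_le_of_abs[OF True] weight_nonneg[OF w, of k] by (intro mult_right_mono) auto
   then show ?thesis using True by (simp add: cut_def e mult.assoc)
  next
   case False then show ?thesis using weight_nonneg[OF w, of k] by (simp add: cut_def)
  qed
 qed
 show "cut n f \<in> H w'" "nm w' (cut n f) \<le> (real n + 1) * nm w f"
  using H_dom[OF w' cut_measurable[OF H_measurable[OF f]] f ae] by auto
qed

lemma cut_gain_kg: "0 \<le> R \<Longrightarrow> f \<in> H (kw R) \<Longrightarrow> cut n f \<in> H (gw R)"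
 "0 \<le> R \<Longrightarrow> f \<in> H (kw R) \<Longrightarrow> nm (gw R) (cut n f) \<le> (real n + 1) * nm (kw R) f"
 using cut_gain[OF weight_kw weight_gw gw_eq] by auto

text \<open>Above frequency n the quotient J / (n + J) is at least 1/2; hence the factor 2, and
  hence \<open>kw (real n)\<close> as a measure of what the truncation discards.\<close>

lemma cut_high:
 assumes f: "f \<in> H (kw 0)"
 shows "nd (kw 0) (cut n f) f \<le> 2 * nm (kw (real n)) f"
proof -
 note [measurable] = H_measurable[OF f]
 have fn: "f \<in> H (kw (real n))"
  by (rule H_dom(1)[OF weight_kw H_measurable[OF f] f, of _ 1]) (auto intro!: mult_right_mono kw_le)
 have ae: "AE k in lborel. kw 0 k * cmod (cut n f k - f k) \<le> 2 * (kw (real n) k * cmod (f k))"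
 proof (rule AE_I2)
  fix k
  show "kw 0 k * cmod (cut n f k - f k) \<le> 2 * (kw (real n) k * cmod (f k))"
  proof (cases "\<bar>k\<bar> \<le> real n")
   case True then show ?thesis using weight_nonneg[OF weight_kw, of "real n" k] by (simp add: cut_def)
  next
   case False
   then have n: "real n \<le> J k" using J_ge_abs[of k] by simp
   then have "1 \<le> 2 * (J k / (real n + J k))" using J_pos[of k] by (simp add: field_simps)
   then have "J k powr \<sigma> * 1 \<le> J k powr \<sigma> * (2 * (J k / (real n + J k)))" by (intro mult_left_mono) auto
   then have "kw 0 k \<le> 2 * kw (real n) k" unfolding kw_0 by (simp only: kw_def K_def mult_1_right mult.left_commute)
   then have "kw 0 k * cmod (f k) \<le> 2 * kw (real n) k * cmod (f k)" by (rule mult_right_mono) simp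
   then show ?thesis using False by (simp add: cut_def mult.assoc)
  qed
 qed
 show ?thesis by (rule H_dom(2)[OF weight_w _ fn ae]) simp_all
qed

text \<open>Dominated convergence. Combined with bounds by the data that are uniform in R, it makes
  the high frequencies of a whole trajectory small.\<close>

lemma gw_tendsto_0:
 assumes U: "U \<in> H (gw 0)" shows "(\<lambda>n. nm (gw (real n)) U) \<longlonglongrightarrow> 0"
proof -
 note [measurable] = H_measurable[OF U] weight_measurable[OF weight_gw[of "real n" for n]]
 have i: "integrable lborel (\<lambda>k. (gw 0 k * cmod (U k))\<^sup>2)" using H_L2[OF U] by (simp add: L2_def)
 have "(\<lambda>n. LINT k|lborel. (gw (real n) k * cmod (U k))\<^sup>2) \<longlonglongrightarrow> (LINT (k::real)|lborel. 0)"
 proof (rule integral_dominated_convergence[OF _ _ i])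
  show "AE k in lborel. (\<lambda>n. (gw (real n) k * cmod (U k))\<^sup>2) \<longlonglongrightarrow> 0"
  proof (rule AE_I2)
   fix k
   have "(\<lambda>n. J k / (real n + J k)) \<longlonglongrightarrow> 0"
    using filterlim_tendsto_add_at_top[OF tendsto_const[of "J k"] filterlim_real_sequentially]
    by (intro tendsto_divide_0[OF tendsto_const] filterlim_at_top_imp_at_infinity) (simp add: add.commute)
   then have "(\<lambda>n. (J k * (J k powr \<sigma> * (J k / (real n + J k))) * cmod (U k))\<^sup>2) \<longlonglongrightarrow> (J k * (J k powr \<sigma> * 0) * cmod (U k))\<^sup>2"
    by (intro tendsto_power tendsto_mult tendsto_const)
   then show "(\<lambda>n. (gw (real n) k * cmod (U k))\<^sup>2) \<longlonglongrightarrow> 0" by (simp add: gw_def K_def)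
  qed
  show "AE k in lborel. norm ((gw (real n) k * cmod (U k))\<^sup>2) \<le> (gw 0 k * cmod (U k))\<^sup>2" for n
  proof (rule AE_I2)
   fix k
   have "gw (real n) k * cmod (U k) \<le> gw 0 k * cmod (U k)" by (intro mult_right_mono gw_le) auto
   then have "(gw (real n) k * cmod (U k))\<^sup>2 \<le> (gw 0 k * cmod (U k))\<^sup>2"
    by (rule power_mono) (simp add: weight_nonneg[OF weight_gw])
   then show "norm ((gw (real n) k * cmod (U k))\<^sup>2) \<le> (gw 0 k * cmod (U k))\<^sup>2" by simp
  qed
 qed measurable
 then have "(\<lambda>n. sqrt (LINT k|lborel. (gw (real n) k * cmod (U k))\<^sup>2)) \<longlonglongrightarrow> sqrt (LINT (k::real)|lborel. 0)" by (rule tendsto_real_sqrt)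
 then show ?thesis by (simp add: nm_def l2n_def)
qed


lemma herm_cut: "herm U \<Longrightarrow> herm (cut n U)"
 unfolding herm_def by (elim eventually_mono) (simp add: cut_def)

lemma herm_add_scale: "herm U \<Longrightarrow> herm V \<Longrightarrow> herm (\<lambda>y. U y + cr c * V y)"
proof -
 assume "herm U" "herm V"
 then have "AE y in lborel. U (- y) = cnj (U y)" "AE y in lborel. V (- y) = cnj (V y)" by (simp_all add: herm_def)
 then show ?thesis unfolding herm_def by eventually_elim simp
qed

text \<open>The truncation \<open>cut n\<close> costs a factor \<open>n + 1\<close>; with a time step of \<open>(n + 1)\<^bsup>-2\<^esup>\<close> the quadratic term of an
 Euler step still contributes only to first order in the step.\<close>

definition hs :: "nat \<Rightarrow> real" where "hs n = 1 / (real n + 1)\<^sup>2"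

definition step :: "nat \<Rightarrow> (real \<Rightarrow> complex) \<Rightarrow> real \<Rightarrow> real \<Rightarrow> complex" where
 "step n E \<tau> = (\<lambda>y. E y + cr \<tau> * cut n (Nl E) y)"

definition good :: "nat \<Rightarrow> (real \<Rightarrow> complex) \<Rightarrow> bool" where
 "good n E \<longleftrightarrow> E \<in> H (gw 0) \<and> cut n E = E \<and> herm E"

text \<open>The first summand is the growth rate from \<open>self_energy\<close>; the second bounds
  the quadratic term of an Euler step, which \<open>hs\<close> makes linear in the step.\<close>

definition \<kappa> :: "real \<Rightarrow> real" where "\<kappa> A = 2 * cE * A + (cN * (1 + A))\<^sup>2"

lemma hs_pos: "0 < hs n" by (simp add: hs_def)

lemma cut_Nl: assumes E: "E \<in> H (gw 0)" and R: "0 \<le> R"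
 shows "cut n (Nl E) \<in> H (gw R)" "nm (gw R) (cut n (Nl E)) \<le> (real n + 1) * (cN * (1 + nm (gw 0) E) * nm (gw R) E)"
proof -
 note N = Nl_bound[OF R E]
 show "cut n (Nl E) \<in> H (gw R)" by (rule cut_gain_kg(1)[OF R N(1)])
 show "nm (gw R) (cut n (Nl E)) \<le> (real n + 1) * (cN * (1 + nm (gw 0) E) * nm (gw R) E)"
  by (rule order_trans[OF cut_gain_kg(2)[OF R N(1)]]) (rule mult_left_mono[OF N(2)], simp)
qed

lemma good_step: assumes g: "good n E" shows "good n (step n E \<tau>)"
proof -
 have E: "E \<in> H (gw 0)" "cut n E = E" "herm E" using g by (auto simp: good_def)
 have "step n E \<tau> \<in> H (gw 0)" unfolding step_def by (intro H_add(1) H_scale(1) weight_g E cut_Nl(1)) simp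
 moreover have "cut n (step n E \<tau>) = step n E \<tau>"
 proof
  fix y show "cut n (step n E \<tau>) y = step n E \<tau> y"
   using fun_cong[OF E(2), of y] by (auto simp: cut_def step_def split: if_splits)
 qed
 moreover have "herm (step n E \<tau>)"
  unfolding step_def by (intro herm_add_scale herm_cut herm_Nl H_measurable[OF E(1)] E)
 ultimately show ?thesis by (simp add: good_def)
qed

text \<open>\<open>A\<close> bounds the norm for R = 0 only, yet the growth factor is the same for
  every R; this lets the tail of the data control the tail of the polygon.\<close>

lemma step_energy:
 assumes g: "good n E" and R: "0 \<le> R" and \<tau>: "0 \<le> \<tau>" "\<tau> \<le> hs n" and A: "nm (gw 0) E \<le> A"
 shows "(nm (gw R) (step n E \<tau>))\<^sup>2 \<le> exp (\<kappa> A * \<tau>) * (nm (gw R) E)\<^sup>2"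
proof -
 have E: "E \<in> H (gw 0)" "cut n E = E" "herm E" using g by (auto simp: good_def)
 have ER: "E \<in> H (gw R)" by (rule H_gw(1)[OF R E(1)])
 \<comment> \<open>A truncated function has one derivative more, at a cost in n that does not enter
   the bound.\<close>
 have E1: "E \<in> H g1" using cut_gain(1)[OF weight_g weight_g1 _ E(1), of n] E(2) by (simp add: g1_def)
 have A0: "0 \<le> A" by (rule order_trans[OF nm_nonneg A])
 let ?x = "nm (gw R) E" and ?V = "cut n (Nl E)"
 note V = cut_Nl[OF E(1) R, of n]
 \<comment> \<open>E vanishes above frequency n, so the pairing with E does not see the truncation
   of \<open>Nl E\<close>.\<close>
 have "ip (gw R) ?V E = ip (gw R) (Nl E) E"
  unfolding ip_def
 proof (rule Bochner_Integration.integral_cong[OF refl])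
  fix y show "(gw R y)\<^sup>2 * Re (?V y * cnj (E y)) = (gw R y)\<^sup>2 * Re (Nl E y * cnj (E y))"
   using fun_cong[OF E(2), of y] by (auto simp: cut_def split: if_splits)
 qed
 also have "\<dots> \<le> cE * (nm (gw 0) E * ?x\<^sup>2)" using self_energy[OF R E1 E(3)] by (simp add: abs_le_iff)
 also have "\<dots> \<le> cE * (A * ?x\<^sup>2)" by (intro mult_left_mono mult_right_mono A) auto
 finally have ip: "ip (gw R) ?V E \<le> cE * (A * ?x\<^sup>2)" .
 have "nm (gw R) ?V \<le> (real n + 1) * (cN * (1 + A) * ?x)"
  by (rule order_trans[OF V(2)], intro mult_left_mono mult_right_mono add_mono order_refl A) auto
 then have "(nm (gw R) ?V)\<^sup>2 \<le> ((real n + 1) * (cN * (1 + A) * ?x))\<^sup>2" by (rule power_mono) simp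
 then have "\<tau>\<^sup>2 * (nm (gw R) ?V)\<^sup>2 \<le> \<tau>\<^sup>2 * ((real n + 1) * (cN * (1 + A) * ?x))\<^sup>2" by (rule mult_left_mono) simp
 also have "\<dots> = (\<tau> * (real n + 1)\<^sup>2) * (\<tau> * (cN * (1 + A) * ?x)\<^sup>2)" by (simp add: power2_eq_square mult_ac)
 also have "\<dots> \<le> 1 * (\<tau> * (cN * (1 + A) * ?x)\<^sup>2)"
 proof (rule mult_right_mono)
  show "\<tau> * (real n + 1)\<^sup>2 \<le> 1" using \<tau>(2) by (simp add: hs_def pos_le_divide_eq)
 qed (use \<tau>(1) in simp)
 finally have sq: "\<tau>\<^sup>2 * (nm (gw R) ?V)\<^sup>2 \<le> \<tau> * ((cN * (1 + A))\<^sup>2 * ?x\<^sup>2)" by (simp add: power_mult_distrib)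
 have "(nm (gw R) (step n E \<tau>))\<^sup>2 = ?x\<^sup>2 + 2 * \<tau> * ip (gw R) ?V E + \<tau>\<^sup>2 * (nm (gw R) ?V)\<^sup>2"
  unfolding step_def by (rule nm_sq_add[OF ER V(1) weight_gw[OF R]])
 also have "\<dots> \<le> ?x\<^sup>2 + 2 * \<tau> * (cE * (A * ?x\<^sup>2)) + \<tau> * ((cN * (1 + A))\<^sup>2 * ?x\<^sup>2)"
  using \<tau>(1) by (intro add_mono order_refl mult_left_mono ip sq) auto
 also have "\<dots> = (1 + \<kappa> A * \<tau>) * ?x\<^sup>2" by (simp add: \<kappa>_def algebra_simps)
 also have "\<dots> \<le> exp (\<kappa> A * \<tau>) * ?x\<^sup>2" by (intro mult_right_mono exp_ge_add_one_self) simp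
 finally show ?thesis .
qed

primrec eul :: "nat \<Rightarrow> (real \<Rightarrow> complex) \<Rightarrow> nat \<Rightarrow> real \<Rightarrow> complex" where
 "eul n U0 0 = cut n U0"
| "eul n U0 (Suc k) = step n (eul n U0 k) (hs n)"

text \<open>Linear interpolation between the nodes \<open>eul n U0 k\<close> at the times
  \<open>real k * hs n\<close>: inside a cell the Euler step is taken with the elapsed time.\<close>

definition pol :: "nat \<Rightarrow> (real \<Rightarrow> complex) \<Rightarrow> real \<Rightarrow> real \<Rightarrow> complex" where
 "pol n U0 t = step n (eul n U0 (nat \<lfloor>t / hs n\<rfloor>)) (t - real (nat \<lfloor>t / hs n\<rfloor>) * hs n)"

text \<open>Chosen so that exp(\<kappa>(2M) t) \<le> 4. Norms then stay below twice those of the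
  data, which closes the assumption A = 2M under which \<kappa> is evaluated; the 1 keeps the
  denominator positive.\<close>

definition life :: "real \<Rightarrow> real" where "life M = ln 4 / (\<kappa> (2 * M) + 1)"

text \<open>The first summand is what truncation discards from \<open>Nl\<close>, measured by the
  tail of the data. The second is a Lipschitz constant of \<open>Nl\<close> times the distance to
  the last node, which is \<open>hs n\<close> times a slope of size n + 1.\<close>

definition res :: "nat \<Rightarrow> (real \<Rightarrow> complex) \<Rightarrow> real \<Rightarrow> real" where
 "res n U0 M = 4 * cN * (1 + 2 * M) * nm (gw (real n)) U0 + cN * (1 + 4 * M) * (cN * (1 + 2 * M) * (2 * M)) / (real n + 1)"

lemma kappa_nonneg: "0 \<le> A \<Longrightarrow> 0 \<le> \<kappa> A" by (simp add: \<kappa>_def)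

lemma life_pos: "0 \<le> M \<Longrightarrow> 0 < life M"
 using kappa_nonneg[of "2 * M"] unfolding life_def by (intro divide_pos_pos) auto

lemma exp_life:
 assumes M: "0 \<le> M" and t: "t \<le> life M" shows "exp (\<kappa> (2 * M) * t) \<le> 4"
proof -
 have k: "0 \<le> \<kappa> (2 * M)" using M by (intro kappa_nonneg) simp
 have "\<kappa> (2 * M) * t \<le> \<kappa> (2 * M) * life M" by (rule mult_left_mono[OF t k])
 also have "\<dots> \<le> (\<kappa> (2 * M) + 1) * life M" using life_pos[OF M] by (intro mult_right_mono) auto
 also have "\<dots> = ln 4" using k by (simp add: life_def)
 finally have "exp (\<kappa> (2 * M) * t) \<le> exp (ln 4)" by (simp only: exp_le_cancel_iff)
 then show ?thesis by simp
qed

lemma step_0: "step n E 0 = E" by (simp add: step_def)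

lemma cell:
 assumes "0 \<le> t" obtains k where "k = nat \<lfloor>t / hs n\<rfloor>" "real k * hs n \<le> t" "t < (real k + 1) * hs n"
proof -
 define k where "k = nat \<lfloor>t / hs n\<rfloor>"
 have p: "0 < hs n" by (rule hs_pos)
 have f: "0 \<le> \<lfloor>t / hs n\<rfloor>" using assms p by simp
 have "real k \<le> t / hs n" "t / hs n < real k + 1" using f unfolding k_def by linarith+
 then have "real k * hs n \<le> t" "t < (real k + 1) * hs n" using p by (auto simp: pos_le_divide_eq pos_divide_less_eq)
 then show ?thesis using that k_def by blast
qed

text \<open>Valid on the closed cell: at its right end the floor already selects the next node, but
  a step of length 0 from there equals a full step from here.\<close>

lemma pol_cell:
 assumes t: "real k * hs n \<le> t" "t \<le> (real k + 1) * hs n"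
 shows "pol n U0 t = step n (eul n U0 k) (t - real k * hs n)"
proof -
 have p: "0 < hs n" by (rule hs_pos)
 show ?thesis
 proof (cases "t = (real k + 1) * hs n")
  case True
  then have e: "t / hs n = real (Suc k)" using p by simp
  have "nat \<lfloor>t / hs n\<rfloor> = Suc k" unfolding e by simp
  moreover have "t - real (Suc k) * hs n = 0" "t - real k * hs n = hs n" using True by (simp_all add: algebra_simps)
  ultimately show ?thesis by (simp add: pol_def step_0)
 next
  case False
  then have "real k \<le> t / hs n" "t / hs n < real k + 1" using t p by (auto simp: pos_le_divide_eq pos_divide_less_eq)
  then have "\<lfloor>t / hs n\<rfloor> = int k" by (simp add: floor_eq_iff)
  then show ?thesis by (simp add: pol_def)
 qed
qed

context
 fixes n :: nat and U0 :: "real \<Rightarrow> complex" and M :: real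
 assumes U0: "U0 \<in> H (gw 0)" "herm U0" "nm (gw 0) U0 \<le> M"
begin

lemma M_nonneg: "0 \<le> M" by (rule order_trans[OF nm_nonneg U0(3)])

lemma good_eul: "good n (eul n U0 k)"
proof (induction k)
 case 0 then show ?case using cut_le(1)[OF weight_g U0(1)] herm_cut[OF U0(2)] by (auto simp: good_def cut_def[abs_def])
next
 case (Suc k) then show ?case by (simp add: good_step)
qed

lemma sq_life:
 assumes "0 \<le> R" "t \<le> life M" "(nm (gw R) E)\<^sup>2 \<le> exp (\<kappa> (2 * M) * t) * (nm (gw R) U0)\<^sup>2"
 shows "nm (gw R) E \<le> 2 * nm (gw R) U0"
proof -
 have "(nm (gw R) E)\<^sup>2 \<le> 4 * (nm (gw R) U0)\<^sup>2"
  by (rule order_trans[OF assms(3)], intro mult_right_mono exp_life[OF M_nonneg] assms) simp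
 then have "(nm (gw R) E)\<^sup>2 \<le> (2 * nm (gw R) U0)\<^sup>2" by (simp add: power_mult_distrib)
 then show ?thesis by (rule power2_le_imp_le) simp
qed

text \<open>The induction carries all R together, since the step for any R uses the bound 2M for R =
  0 at the previous node.\<close>

lemma eul_energy:
 "real k * hs n \<le> life M \<Longrightarrow> \<forall>R\<ge>0. (nm (gw R) (eul n U0 k))\<^sup>2 \<le> exp (\<kappa> (2 * M) * (real k * hs n)) * (nm (gw R) U0)\<^sup>2"
proof (induction k)
 case 0
 show ?case
 proof (intro allI impI)
  fix R :: real assume R: "0 \<le> R"
  show "(nm (gw R) (eul n U0 0))\<^sup>2 \<le> exp (\<kappa> (2 * M) * (real 0 * hs n)) * (nm (gw R) U0)\<^sup>2"
   using power_mono[OF cut_le(2)[OF weight_gw[OF R] H_gw(1)[OF R U0(1)], of n], of 2] by simp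
 qed
next
 case (Suc k)
 have le: "real k * hs n \<le> life M" using Suc.prems hs_pos[of n] by (simp add: algebra_simps)
 note IH = Suc.IH[OF le]
 have A: "nm (gw 0) (eul n U0 k) \<le> 2 * M"
  using sq_life[OF order_refl le IH[rule_format, OF order_refl]] U0(3) by linarith
 show ?case
 proof (intro allI impI)
  fix R :: real assume R: "0 \<le> R"
  have "(nm (gw R) (eul n U0 (Suc k)))\<^sup>2 \<le> exp (\<kappa> (2 * M) * hs n) * (nm (gw R) (eul n U0 k))\<^sup>2"
   unfolding eul.simps by (rule step_energy[OF good_eul R _ order_refl A]) (simp add: hs_def)
  also have "\<dots> \<le> exp (\<kappa> (2 * M) * hs n) * (exp (\<kappa> (2 * M) * (real k * hs n)) * (nm (gw R) U0)\<^sup>2)"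
   by (intro mult_left_mono IH[rule_format] R) simp
  also have "\<dots> = exp (\<kappa> (2 * M) * (real (Suc k) * hs n)) * (nm (gw R) U0)\<^sup>2"
   by (simp add: mult.assoc[symmetric] exp_add[symmetric]) (simp add: algebra_simps)
  finally show "(nm (gw R) (eul n U0 (Suc k)))\<^sup>2 \<le> exp (\<kappa> (2 * M) * (real (Suc k) * hs n)) * (nm (gw R) U0)\<^sup>2" .
 qed
qed

lemma eul_bound: "real k * hs n \<le> life M \<Longrightarrow> 0 \<le> R \<Longrightarrow> nm (gw R) (eul n U0 k) \<le> 2 * nm (gw R) U0"
 using sq_life eul_energy by simp

lemma eul_bound_M: "real k * hs n \<le> life M \<Longrightarrow> nm (gw 0) (eul n U0 k) \<le> 2 * M"
 using eul_bound[of k 0] U0(3) by simp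

lemma good_pol: "good n (pol n U0 t)" unfolding pol_def by (intro good_step good_eul)

lemma pol_bound:
 assumes t: "0 \<le> t" "t \<le> life M" and R: "0 \<le> R"
 shows "nm (gw R) (pol n U0 t) \<le> 2 * nm (gw R) U0"
proof -
 obtain k where k: "k = nat \<lfloor>t / hs n\<rfloor>" "real k * hs n \<le> t" "t < (real k + 1) * hs n" using cell[OF t(1)] by blast
 have le: "real k * hs n \<le> life M" using k t by linarith
 have "(nm (gw R) (pol n U0 t))\<^sup>2 \<le> exp (\<kappa> (2 * M) * (t - real k * hs n)) * (nm (gw R) (eul n U0 k))\<^sup>2"
  unfolding pol_def k(1)[symmetric]
  by (rule step_energy[OF good_eul R _ _ eul_bound_M[OF le]]) (use k in \<open>auto simp: algebra_simps\<close>)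
 also have "\<dots> \<le> exp (\<kappa> (2 * M) * (t - real k * hs n)) * (exp (\<kappa> (2 * M) * (real k * hs n)) * (nm (gw R) U0)\<^sup>2)"
  by (intro mult_left_mono eul_energy[rule_format] R le) simp
 also have "\<dots> = exp (\<kappa> (2 * M) * t) * (nm (gw R) U0)\<^sup>2"
  by (simp add: mult.assoc[symmetric] exp_add[symmetric]) (simp add: algebra_simps)
 finally show ?thesis by (rule sq_life[OF R t(2)])
qed

lemma pol_residual:
 assumes k: "real k * hs n \<le> t" "t \<le> (real k + 1) * hs n" and t: "t \<le> life M"
 shows "nd (kw 0) (cut n (Nl (eul n U0 k))) (Nl (pol n U0 t)) \<le> res n U0 M"
proof -
 let ?E = "eul n U0 k" and ?P = "pol n U0 t"
 have le: "real k * hs n \<le> life M" using k t by linarith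
 have t0: "0 \<le> t" using k(1) hs_pos[of n] by (intro order_trans[OF _ k(1)]) simp
 have E: "?E \<in> H (gw 0)" "?P \<in> H (gw 0)" using good_eul good_pol by (auto simp: good_def)
 note EM = eul_bound_M[OF le]
 have PM: "nm (gw 0) ?P \<le> 2 * M" using pol_bound[OF t0 t order_refl] U0(3) by linarith
 note M0 = M_nonneg
 note NE = Nl_bound(1)[OF order_refl E(1)] and NP = Nl_bound(1)[OF order_refl E(2)]
 have 1: "nd (kw 0) (cut n (Nl ?E)) (Nl ?E) \<le> 4 * cN * (1 + 2 * M) * nm (gw (real n)) U0"
 proof -
  have "nd (kw 0) (cut n (Nl ?E)) (Nl ?E) \<le> 2 * nm (kw (real n)) (Nl ?E)" by (rule cut_high[OF NE])
  also have "nm (kw (real n)) (Nl ?E) \<le> cN * (1 + nm (gw 0) ?E) * nm (gw (real n)) ?E"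
   by (rule Nl_bound(2)[OF _ E(1)]) simp
  also have "\<dots> \<le> cN * (1 + 2 * M) * (2 * nm (gw (real n)) U0)"
   using M0 by (intro mult_mono add_mono order_refl EM eul_bound le) auto
  finally show ?thesis by (simp add: mult_ac)
 qed
 have 2: "nd (gw 0) ?E ?P \<le> cN * (1 + 2 * M) * (2 * M) / (real n + 1)"
 proof -
  have e: "(\<lambda>y. ?E y - ?P y) = (\<lambda>y. cr (real k * hs n - t) * cut n (Nl ?E) y)"
   unfolding pol_cell[OF k] step_def by (auto simp: algebra_simps)
  have "nd (gw 0) ?E ?P = \<bar>real k * hs n - t\<bar> * nm (gw 0) (cut n (Nl ?E))"
   unfolding e H_scale(2)[OF weight_g cut_Nl(1)[OF E(1) order_refl]] norm_of_real by simp
  also have "\<dots> \<le> hs n * ((real n + 1) * (cN * (1 + 2 * M) * (2 * M)))"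
  proof (rule mult_mono)
   show "\<bar>real k * hs n - t\<bar> \<le> hs n" using k by (simp add: algebra_simps)
   show "nm (gw 0) (cut n (Nl ?E)) \<le> (real n + 1) * (cN * (1 + 2 * M) * (2 * M))"
    by (rule order_trans[OF cut_Nl(2)[OF E(1) order_refl]], intro mult_left_mono mult_mono add_mono order_refl EM)
     (use M0 in auto)
  qed (auto simp: hs_def)
  also have "\<dots> = cN * (1 + 2 * M) * (2 * M) / (real n + 1)" by (simp add: hs_def power2_eq_square)
  finally show ?thesis .
 qed
 have 3: "nd (kw 0) (Nl ?E) (Nl ?P) \<le> cN * (1 + 4 * M) * (cN * (1 + 2 * M) * (2 * M)) / (real n + 1)"
 proof -
  have "nd (kw 0) (Nl ?E) (Nl ?P) \<le> cN * (1 + nm (gw 0) ?E + nm (gw 0) ?P) * nd (gw 0) ?E ?P"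
   by (rule Nl_lipschitz[OF E])
  also have "\<dots> \<le> cN * (1 + 4 * M) * (cN * (1 + 2 * M) * (2 * M) / (real n + 1))"
   using EM PM M0 by (intro mult_mono[OF mult_left_mono 2]) auto
  finally show ?thesis by simp
 qed
 show ?thesis unfolding res_def
  by (rule order_trans[OF nm_tri[OF weight_w cut_le(1)[OF weight_w NE] NE NP] add_mono[OF 1 3]])
qed

lemma pol_diff:
 assumes k: "real k * hs n \<le> t" "t \<le> (real k + 1) * hs n" "real k * hs n \<le> \<tau>" "\<tau> \<le> (real k + 1) * hs n"
 shows "pol n U0 \<tau> y - pol n U0 t y = cr (\<tau> - t) * cut n (Nl (eul n U0 k)) y"
 unfolding pol_cell[OF k(1,2)] pol_cell[OF k(3,4)] step_def by (simp add: algebra_simps)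

lemma pol_asol: "asol (life M) (2 * M) (res n U0 M) (pol n U0)"
 unfolding asol_def
proof (intro conjI ballI)
 fix t assume t: "t \<in> {0..life M}"
 show "pol n U0 t \<in> H (gw 0)" "herm (pol n U0 t)" using good_pol by (auto simp: good_def)
 show "nm (gw 0) (pol n U0 t) \<le> 2 * M" using pol_bound[of t 0] U0(3) t by simp
 have V: "cut n (Nl (eul n U0 k)) \<in> H (kw 0)" for k
  using good_eul by (intro cut_le(1) weight_w Nl_bound(1)) (auto simp: good_def)
 obtain k where k: "k = nat \<lfloor>t / hs n\<rfloor>" "real k * hs n \<le> t" "t < (real k + 1) * hs n" using cell[of t] t by auto
 \<comment> \<open>A node is approached from the left in the preceding cell, so the Lipschitz bound
   near t needs the slopes of both cells.\<close>
 define k' where "k' = (if real k * hs n < t then k else k - 1)"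
 let ?L = "nm (kw 0) (cut n (Nl (eul n U0 k))) + nm (kw 0) (cut n (Nl (eul n U0 k')))"
 have k': "real k' * hs n < t \<and> t \<le> (real k' + 1) * hs n" if t0: "0 < t"
 proof (cases "real k * hs n < t")
  case True then show ?thesis using k by (simp add: k'_def)
 next
  case False
  then have e: "real k * hs n = t" using k by simp
  then obtain j where "k = Suc j" using t0 by (cases k) auto
  then show ?thesis using False e hs_pos[of n] by (auto simp: k'_def algebra_simps)
 qed
 have lip: "nd (kw 0) (pol n U0 \<tau>) (pol n U0 t) \<le> \<bar>\<tau> - t\<bar> * ?L"
  if "real j * hs n \<le> t" "t \<le> (real j + 1) * hs n" "real j * hs n \<le> \<tau>" "\<tau> \<le> (real j + 1) * hs n" "j = k \<or> j = k'" for j \<tau>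
 proof -
  have "nd (kw 0) (pol n U0 \<tau>) (pol n U0 t) = \<bar>\<tau> - t\<bar> * nm (kw 0) (cut n (Nl (eul n U0 j)))"
   unfolding pol_diff[OF that(1-4)] H_scale(2)[OF weight_w V] norm_of_real by simp
  also have "\<dots> \<le> \<bar>\<tau> - t\<bar> * ?L" using that(5) by (intro mult_left_mono) auto
  finally show ?thesis .
 qed
 show "((\<lambda>\<tau>. nd (kw 0) (pol n U0 \<tau>) (pol n U0 t)) \<longlongrightarrow> 0) (at t within {0..life M})"
 proof (rule Lim_null_comparison)
  have "((\<lambda>\<tau>. \<bar>\<tau> - t\<bar> * ?L) \<longlongrightarrow> \<bar>t - t\<bar> * ?L) (at t within {0..life M})" by (intro tendsto_intros)
  then show "((\<lambda>\<tau>. \<bar>\<tau> - t\<bar> * ?L) \<longlongrightarrow> 0) (at t within {0..life M})" by simp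
  define d where "d = (if 0 < t then min ((real k + 1) * hs n - t) (t - real k' * hs n) else (real k + 1) * hs n - t)"
  have d: "0 < d" using k k' by (auto simp: d_def)
  show "\<forall>\<^sub>F \<tau> in at t within {0..life M}. norm (nd (kw 0) (pol n U0 \<tau>) (pol n U0 t)) \<le> \<bar>\<tau> - t\<bar> * ?L"
   unfolding eventually_at
  proof (intro exI[of _ d] conjI d ballI impI)
   fix \<tau> assume \<tau>: "\<tau> \<in> {0..life M}" "\<tau> \<noteq> t \<and> dist \<tau> t < d"
   show "norm (nd (kw 0) (pol n U0 \<tau>) (pol n U0 t)) \<le> \<bar>\<tau> - t\<bar> * ?L"
   proof (cases "t \<le> \<tau>")
    case True
    have "\<tau> \<le> (real k + 1) * hs n" using \<tau>(2) True by (auto simp: d_def dist_real_def split: if_splits)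
    then show ?thesis using lip[of k \<tau>] k True by simp
   next
    case False
    then have t0: "0 < t" using \<tau>(1) by simp
    have "real k' * hs n \<le> \<tau>" using \<tau>(2) False t0 by (auto simp: d_def dist_real_def)
    then show ?thesis using lip[of k' \<tau>] k'[OF t0] False by simp
   qed
  qed
 qed
next
 fix t assume t: "t \<in> {0..<life M}"
 obtain k where k: "k = nat \<lfloor>t / hs n\<rfloor>" "real k * hs n \<le> t" "t < (real k + 1) * hs n" using cell[of t] t by auto
 let ?V = "cut n (Nl (eul n U0 k))"
 show "\<exists>V. V \<in> H (kw 0) \<and> nd (kw 0) V (Nl (pol n U0 t)) \<le> res n U0 M \<and>
    ((\<lambda>\<tau>. nm (kw 0) (\<lambda>y. (pol n U0 \<tau> y - pol n U0 t y) / cr (\<tau> - t) - V y)) \<longlongrightarrow> 0) (at_right t)"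
 proof (intro exI[of _ ?V] conjI)
  show "?V \<in> H (kw 0)" using good_eul by (intro cut_le(1) weight_w Nl_bound(1)) (auto simp: good_def)
  show "nd (kw 0) ?V (Nl (pol n U0 t)) \<le> res n U0 M"
   using k t by (intro pol_residual) auto
  have "\<forall>\<^sub>F \<tau> in at_right t. nm (kw 0) (\<lambda>y. (pol n U0 \<tau> y - pol n U0 t y) / cr (\<tau> - t) - ?V y) = 0"
   unfolding eventually_at_right_field
  proof (intro exI[of _ "(real k + 1) * hs n"] conjI k(3) allI impI)
   fix \<tau> assume \<tau>: "t < \<tau>" "\<tau> < (real k + 1) * hs n"
   have "(pol n U0 \<tau> y - pol n U0 t y) / cr (\<tau> - t) - ?V y = 0" for y
    using \<tau> k by (subst pol_diff[of k]) auto
   then show "nm (kw 0) (\<lambda>y. (pol n U0 \<tau> y - pol n U0 t y) / cr (\<tau> - t) - ?V y) = 0" by simp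
  qed
  then show "((\<lambda>\<tau>. nm (kw 0) (\<lambda>y. (pol n U0 \<tau> y - pol n U0 t y) / cr (\<tau> - t) - ?V y)) \<longlongrightarrow> 0) (at_right t)"
   by (rule tendsto_eventually)
 qed
qed

lemma pol_0: "pol n U0 0 = cut n U0" by (simp add: pol_def step_0)

end

end

section \<open>Local solutions\<close>

lemma shift_lim:
 fixes f :: "real \<Rightarrow> real"
 assumes f: "(f \<longlongrightarrow> l) (at (t + s) within S)" and S: "\<And>x. x \<in> S' \<Longrightarrow> t + x \<in> S"
 shows "((\<lambda>\<tau>. f (t + \<tau>)) \<longlongrightarrow> l) (at s within S')"
proof (rule filterlim_compose[OF f])
 have "((\<lambda>\<tau>. t + \<tau>) \<longlongrightarrow> t + s) (at s within S')" by (intro tendsto_intros)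
 then show "LIM \<tau> at s within S'. t + \<tau> :> at (t + s) within S"
  unfolding filterlim_at using S by (auto simp: eventually_at_filter)
qed

context rod
begin

text \<open>Split at J = R. Below, the missing derivative costs at most R; above, J / (R + J) is at
  least 1/2. This converts smallness in H^(s-1) together with small tails into smallness in
  H^s.\<close>

lemma interp:
 assumes R: "0 \<le> R" and D: "D \<in> H (gw 0)"
 shows "nm (gw 0) D \<le> R * nm (kw 0) D + 2 * nm (gw R) D"
proof -
 note [measurable] = H_measurable[OF D]
 define L where "L k = (if J k \<le> R then D k else 0)" for k
 define T where "T k = (if J k \<le> R then 0 else D k)" for k
 have [measurable]: "L \<in> BM" "T \<in> BM"
  unfolding L_def[abs_def] T_def[abs_def] by measurable
 have aeL: "AE k in lborel. gw 0 k * cmod (L k) \<le> R * (kw 0 k * cmod (D k))"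
  using weight_nonneg[OF weight_w] R by (auto simp: L_def gw_eq mult.assoc intro!: mult_right_mono AE_I2)
 have aeT: "AE k in lborel. gw 0 k * cmod (T k) \<le> 2 * (gw R k * cmod (D k))"
 proof (rule AE_I2)
  fix k
  show "gw 0 k * cmod (T k) \<le> 2 * (gw R k * cmod (D k))"
  proof (cases "J k \<le> R")
   case True then show ?thesis using weight_nonneg[OF weight_gw[OF R], of k] by (simp add: T_def)
  next
   case False
   then have "1 \<le> 2 * (J k / (R + J k))" using J_pos[of k] R by (simp add: field_simps)
   then have "J k powr \<sigma> * 1 \<le> J k powr \<sigma> * (2 * (J k / (R + J k)))" by (intro mult_left_mono) auto
   then have "kw 0 k \<le> 2 * kw R k" unfolding kw_0 by (simp only: kw_def K_def mult_1_right mult.left_commute)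
   then have "(J k * cmod (D k)) * kw 0 k \<le> (J k * cmod (D k)) * (2 * kw R k)"
    using J_pos[of k] by (intro mult_left_mono) auto
   then show ?thesis using False by (simp add: T_def gw_eq mult_ac)
  qed
 qed
 note L = H_dom[OF weight_g _ H_gk[OF D] aeL R] and T = H_dom[OF weight_g _ H_gw(1)[OF R D] aeT]
 have LT: "(\<lambda>k. L k + T k) = D" by (auto simp: L_def T_def)
 have "nm (gw 0) (\<lambda>k. L k + T k) \<le> nm (gw 0) L + nm (gw 0) T" by (rule H_add(2)) (simp_all add: L T)
 also have "\<dots> \<le> R * nm (kw 0) D + 2 * nm (gw R) D" by (intro add_mono L(2) T(2)) simp_all
 finally show ?thesis unfolding LT .
qed

text \<open>A mean value inequality, from \<open>dini_gronwall\<close> with C = 0 applied to the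
  increment minus its linear model. It involves \<open>Nl\<close> along U but no derivative of U,
  and so survives the limit of the polygons, whose differentiability is not known
  beforehand.\<close>

lemma asol_mvt:
 assumes U: "asol a M \<epsilon> U" and \<epsilon>: "0 \<le> \<epsilon>" and t: "0 \<le> t" "t \<le> t'" "t' \<le> a" and G: "G \<in> H (kw 0)"
  and B: "\<And>s. t \<le> s \<Longrightarrow> s \<le> t' \<Longrightarrow> nd (kw 0) (Nl (U s)) G \<le> B"
 shows "nm (kw 0) (\<lambda>k. U t' k - U t k - cr (t' - t) * G k) \<le> (t' - t) * (\<epsilon> + B)"
proof -
 define W where "W \<tau> = (\<lambda>k. U (t + \<tau>) k - U t k - cr \<tau> * G k)" for \<tau>
 have UH: "U s \<in> H (gw 0)" if "0 \<le> s" "s \<le> a" for s using U that by (auto simp: asol_def)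
 have B0: "0 \<le> B" using order_trans[OF nm_nonneg B[of t]] t by simp
 have WH: "W \<tau> \<in> H (kw 0)" if "0 \<le> \<tau>" "\<tau> \<le> t' - t" for \<tau>
  unfolding W_def using that t by (intro H_diff(1) H_scale(1) weight_w G H_gk UH) auto
 have "nm (kw 0) (W (t' - t)) \<le> exp (0 * (t' - t)) * (nm (kw 0) (W 0) + (\<epsilon> + B) * (t' - t))"
 proof (rule dini_gronwall[where a="t' - t"])
  show "continuous_on {0..t' - t} (\<lambda>\<tau>. nm (kw 0) (W \<tau>))"
   unfolding continuous_on_def
  proof (rule ballI, rule nm_continuous[OF weight_w])
   fix s assume s: "s \<in> {0..t' - t}"
   show "s \<in> {0..t' - t}" by (rule s)
   have lim: "((\<lambda>\<tau>. nd (kw 0) (U \<tau>) (U (t + s))) \<longlongrightarrow> 0) (at (t + s) within {0..a})"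
    using U s t by (auto simp: asol_def)
   have lim': "((\<lambda>\<tau>. nd (kw 0) (U (t + \<tau>)) (U (t + s))) \<longlongrightarrow> 0) (at s within {0..t' - t})"
    by (rule shift_lim[OF lim]) (use t in auto)
   have "((\<lambda>\<tau>. \<bar>\<tau> - s\<bar> * nm (kw 0) G) \<longlongrightarrow> \<bar>s - s\<bar> * nm (kw 0) G) (at s within {0..t' - t})" by (intro tendsto_intros)
   from tendsto_add[OF lim' this]
   have sum: "((\<lambda>\<tau>. nd (kw 0) (U (t + \<tau>)) (U (t + s)) + \<bar>\<tau> - s\<bar> * nm (kw 0) G) \<longlongrightarrow> 0) (at s within {0..t' - t})" by simp
   show "((\<lambda>\<tau>. nd (kw 0) (W \<tau>) (W s)) \<longlongrightarrow> 0) (at s within {0..t' - t})"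
   proof (rule Lim_null_comparison[OF _ sum], unfold eventually_at_filter, intro always_eventually allI impI)
    fix \<tau> assume \<tau>: "\<tau> \<in> {0..t' - t}"
    have e: "(\<lambda>k. W \<tau> k - W s k) = (\<lambda>k. (U (t + \<tau>) k - U (t + s) k) - cr (\<tau> - s) * G k)"
     by (auto simp: W_def algebra_simps)
    have "nm (kw 0) (\<lambda>k. (U (t + \<tau>) k - U (t + s) k) - cr (\<tau> - s) * G k)
     \<le> nd (kw 0) (U (t + \<tau>)) (U (t + s)) + nm (kw 0) (\<lambda>k. cr (\<tau> - s) * G k)"
     using \<tau> s t by (intro H_diff H_scale(1) weight_w G H_gk UH) auto
    then show "norm (nd (kw 0) (W \<tau>) (W s)) \<le> nd (kw 0) (U (t + \<tau>)) (U (t + s)) + \<bar>\<tau> - s\<bar> * nm (kw 0) G"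
     unfolding e H_scale(2)[OF weight_w G] norm_of_real by simp
   qed
  qed (use WH in simp)
  fix s \<epsilon>' :: real assume s: "0 \<le> s" "s < t' - t" and \<epsilon>': "0 < \<epsilon>'"
  have ts: "0 \<le> t + s" "t + s \<le> a" "t + s < a" using s t by auto
  obtain V where V: "V \<in> H (kw 0)" "nd (kw 0) V (Nl (U (t + s))) \<le> \<epsilon>"
   "((\<lambda>\<tau>. nm (kw 0) (\<lambda>k. (U \<tau> k - U (t + s) k) / cr (\<tau> - (t + s)) - V k)) \<longlongrightarrow> 0) (at_right (t + s))"
   using U ts unfolding asol_def by (meson atLeastLessThan_iff)
  have NU: "Nl (U (t + s)) \<in> H (kw 0)" by (rule Nl_bound(1)[OF order_refl UH[OF ts(1,2)]])
  have "((\<lambda>\<tau>. nm (kw 0) (\<lambda>k. (U (t + \<tau>) k - U (t + s) k) / cr (t + \<tau> - (t + s)) - V k)) \<longlongrightarrow> 0) (at_right s)"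
   by (rule shift_lim[OF V(3)]) auto
  from order_tendstoD(2)[OF this \<epsilon>']
  have "\<forall>\<^sub>F \<tau> in at_right s. nm (kw 0) (\<lambda>k. (U (t + \<tau>) k - U (t + s) k) / cr (t + \<tau> - (t + s)) - V k) < \<epsilon>'" .
  moreover have "\<forall>\<^sub>F \<tau> in at_right s. s < \<tau> \<and> \<tau> < t' - t" using s(2) unfolding eventually_at_right_field by auto
  ultimately show "\<forall>\<^sub>F \<tau> in at_right s. nm (kw 0) (W \<tau>) \<le> nm (kw 0) (W s) + (\<tau> - s) * (0 * nm (kw 0) (W s) + (\<epsilon> + B) + \<epsilon>')"
  proof eventually_elim
   fix \<tau> assume q: "nm (kw 0) (\<lambda>k. (U (t + \<tau>) k - U (t + s) k) / cr (t + \<tau> - (t + s)) - V k) < \<epsilon>'"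
    and \<tau>: "s < \<tau> \<and> \<tau> < t' - t"
   define Q where "Q = (\<lambda>k. (U (t + \<tau>) k - U (t + s) k) / cr (\<tau> - s) - V k)"
   have Q: "nm (kw 0) Q \<le> \<epsilon>'" using q by (simp add: Q_def)
   have QH: "Q \<in> H (kw 0)"
    unfolding Q_def using \<tau> s t by (intro H_diff(1) H_divide weight_w V(1) H_gk UH) auto
   have VG: "(\<lambda>k. V k - G k) \<in> H (kw 0)" by (intro H_diff(1) weight_w V G)
   have nVG: "nd (kw 0) V G \<le> \<epsilon> + B"
    by (rule order_trans[OF nm_tri[OF weight_w V(1) NU G] add_mono[OF V(2) B]]) (use s in auto)
   have QVG: "(\<lambda>k. Q k + (V k - G k)) \<in> H (kw 0)" by (intro H_add(1) weight_w QH VG)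
   have e: "W \<tau> = (\<lambda>k. W s k + cr (\<tau> - s) * (Q k + (V k - G k)))"
   proof
    fix k
    have "cr (\<tau> - s) * Q k = U (t + \<tau>) k - U (t + s) k - cr (\<tau> - s) * V k"
     using \<tau> unfolding Q_def right_diff_distrib by (simp del: of_real_diff)
    then show "W \<tau> k = W s k + cr (\<tau> - s) * (Q k + (V k - G k))"
     unfolding W_def distrib_left by (simp add: algebra_simps)
   qed
   have "nm (kw 0) (W \<tau>) \<le> nm (kw 0) (W s) + nm (kw 0) (\<lambda>k. cr (\<tau> - s) * (Q k + (V k - G k)))"
    unfolding e using s \<tau> by (intro H_add(2) weight_w WH H_scale(1) QVG) auto
   also have "nm (kw 0) (\<lambda>k. cr (\<tau> - s) * (Q k + (V k - G k))) = (\<tau> - s) * nm (kw 0) (\<lambda>k. Q k + (V k - G k))"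
    unfolding H_scale(2)[OF weight_w QVG] norm_of_real using \<tau> by simp
   also have "\<dots> \<le> (\<tau> - s) * (\<epsilon>' + (\<epsilon> + B))"
    using \<tau> by (intro mult_left_mono order_trans[OF H_add(2)[OF weight_w QH VG]] add_mono Q nVG) auto
   finally show "nm (kw 0) (W \<tau>) \<le> nm (kw 0) (W s) + (\<tau> - s) * (0 * nm (kw 0) (W s) + (\<epsilon> + B) + \<epsilon>')" by (simp add: add.commute)
  qed
 qed (use \<epsilon> B0 t in auto)
 then show ?thesis by (simp add: W_def mult.commute)
qed

text \<open>Both limits are relative to \<open>S\<close>, so an endpoint belonging to
  \<open>S\<close> carries a one-sided derivative, and the equation is imposed there as
  well.\<close>

definition sol :: "real set \<Rightarrow> (real \<Rightarrow> real \<Rightarrow> complex) \<Rightarrow> bool" where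
 "sol S U \<longleftrightarrow> (\<forall>t\<in>S. U t \<in> H (gw 0) \<and> herm (U t) \<and>
   ((\<lambda>\<tau>. nd (gw 0) (U \<tau>) (U t)) \<longlongrightarrow> 0) (at t within S) \<and>
   ((\<lambda>\<tau>. dq (kw 0) U \<tau> t (Nl (U t))) \<longlongrightarrow> 0) (at t within S))"

lemma solD:
 assumes "sol S U" "t \<in> S"
 shows "U t \<in> H (gw 0)" "herm (U t)" "((\<lambda>\<tau>. nd (gw 0) (U \<tau>) (U t)) \<longlongrightarrow> 0) (at t within S)"
  "((\<lambda>\<tau>. dq (kw 0) U \<tau> t (Nl (U t))) \<longlongrightarrow> 0) (at t within S)"
 using assms by (auto simp: sol_def)

lemma sol_mono:
 assumes "sol S U" "S' \<subseteq> S" shows "sol S' U"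
 using assms unfolding sol_def by (meson subsetD tendsto_within_subset)

lemma sol_shift:
 assumes U: "sol S U" and S: "\<And>x. x \<in> S' \<Longrightarrow> t + x \<in> S"
 shows "sol S' (\<lambda>\<tau>. U (t + \<tau>))"
 unfolding sol_def
proof (intro ballI conjI)
 fix s assume "s \<in> S'"
 note D = solD[OF U S[OF this]]
 show "U (t + s) \<in> H (gw 0)" "herm (U (t + s))" by (fact D)+
 show "((\<lambda>\<tau>. nd (gw 0) (U (t + \<tau>)) (U (t + s))) \<longlongrightarrow> 0) (at s within S')"
  by (rule shift_lim[OF D(3) S])
 show "((\<lambda>\<tau>. nm (kw 0) (\<lambda>k. (U (t + \<tau>) k - U (t + s) k) / cr (\<tau> - s) - Nl (U (t + s)) k)) \<longlongrightarrow> 0) (at s within S')"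
  using shift_lim[OF D(4) S] by simp
qed

lemma sol_nm_continuous: "sol S U \<Longrightarrow> continuous_on S (\<lambda>t. nm (gw 0) (U t))"
 unfolding continuous_on_def by (intro ballI nm_continuous[OF weight_g] solD)

lemma sol_bounded:
 assumes "sol {a..b} U" obtains M where "0 \<le> M" "\<And>t. t \<in> {a..b} \<Longrightarrow> nm (gw 0) (U t) \<le> M"
proof -
 have "bounded ((\<lambda>t. nm (gw 0) (U t)) ` {a..b})"
  by (intro compact_imp_bounded compact_continuous_image sol_nm_continuous assms compact_Icc)
 then obtain M where "0 < M" "\<forall>x\<in>(\<lambda>t. nm (gw 0) (U t)) ` {a..b}. norm x \<le> M" unfolding bounded_pos by blast
 then show ?thesis using that[of M] by auto
qed

lemma asol_of_sol:
 assumes U: "sol {0..a} U" and M: "\<And>t. t \<in> {0..a} \<Longrightarrow> nm (gw 0) (U t) \<le> M"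
 shows "asol a M 0 U"
 unfolding asol_def
proof (intro conjI ballI)
 fix t assume t: "t \<in> {0..a}"
 show "U t \<in> H (gw 0)" "herm (U t)" "nm (gw 0) (U t) \<le> M" using solD[OF U t] M t by auto
 show "((\<lambda>\<tau>. nd (kw 0) (U \<tau>) (U t)) \<longlongrightarrow> 0) (at t within {0..a})"
 proof (rule Lim_null_comparison[OF _ solD(3)[OF U t]], unfold eventually_at_filter, intro always_eventually allI impI)
  fix \<tau> assume "\<tau> \<in> {0..a}"
  then show "norm (nd (kw 0) (U \<tau>) (U t)) \<le> nd (gw 0) (U \<tau>) (U t)"
   using H_kw(2)[OF order_refl H_diff(1)[OF weight_g solD(1)[OF U] solD(1)[OF U t]]] by simp
 qed
next
 fix t assume t: "t \<in> {0..<a}"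
 then have t': "t \<in> {0..a}" by simp
 have "((\<lambda>\<tau>. dq (kw 0) U \<tau> t (Nl (U t))) \<longlongrightarrow> 0) (at t within {t..a})"
  by (rule tendsto_within_subset[OF solD(4)[OF U t']]) (use t in auto)
 then have "((\<lambda>\<tau>. dq (kw 0) U \<tau> t (Nl (U t))) \<longlongrightarrow> 0) (at_right t)"
  using t by (simp add: at_within_Icc_at_right)
 then show "\<exists>V. V \<in> H (kw 0) \<and> nd (kw 0) V (Nl (U t)) \<le> 0 \<and>
    ((\<lambda>\<tau>. dq (kw 0) U \<tau> t V) \<longlongrightarrow> 0) (at_right t)"
  using Nl_bound(1)[OF order_refl solD(1)[OF U t']] by (intro exI[of _ "Nl (U t)"]) simp
qed

lemma sol_unique:
 assumes U: "sol {0..a} U" and V: "sol {0..a} V" and 0: "aeq (U 0) (V 0)" and t: "t \<in> {0..a}"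
 shows "aeq (U t) (V t)"
proof -
 obtain M1 where M1: "\<And>t. t \<in> {0..a} \<Longrightarrow> nm (gw 0) (U t) \<le> M1" using sol_bounded[OF U] by blast
 obtain M2 where M2: "\<And>t. t \<in> {0..a} \<Longrightarrow> nm (gw 0) (V t) \<le> M2" using sol_bounded[OF V] by blast
 have A: "asol a (max M1 M2) 0 U" "asol a (max M1 M2) 0 V"
  by (rule asol_of_sol[OF U], rule order_trans[OF M1], simp_all) (rule asol_of_sol[OF V], rule order_trans[OF M2], simp_all)
 have t0: "0 \<in> {0..a}" using t by simp
 have D: "(\<lambda>k. U s k - V s k) \<in> H (kw 0)" if "s \<in> {0..a}" for s
  by (intro H_diff(1) weight_w H_gk solD(1)[OF U that] solD(1)[OF V that])
 have "nd (kw 0) (U 0) (V 0) = nm (kw 0) (\<lambda>k. 0)"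
  by (rule nm_cong_AE[OF weight_w H_measurable[OF D[OF t0]]]) (use 0 in auto)
 then have "(nd (kw 0) (U t) (V t))\<^sup>2 \<le> 0"
  using stability[OF A order_refl order_refl, of t] t by simp
 then have "nd (kw 0) (U t) (V t) = 0" by simp
 from nm_eq_0[OF D[OF t] weight_w this] show ?thesis by simp
qed

end

lemma AE_minus:
 assumes "AE v in lborel. P (v::real)" shows "AE v in lborel. P (- v)"
proof -
 obtain N where N: "N \<in> null_sets lborel" "{v \<in> space lborel. \<not> P v} \<subseteq> N"
  using assms unfolding eventually_ae_filter by blast
 have [measurable]: "N \<in> sets borel" using N(1) by auto
 have "AE v in lborel. 0 + - 1 * v \<notin> N"
  by (rule AE_borel_affine[OF _ _ AE_not_in[OF N(1)]]) simp_all
 then show ?thesis using N(2) by (elim eventually_mono) auto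
qed

context rod
begin

section \<open>Passage to the limit in the Euler polygons\<close>

context
 fixes U0 :: "real \<Rightarrow> complex" and M :: real
 assumes U0: "U0 \<in> H (gw 0)" "herm U0" "nm (gw 0) U0 \<le> M"
begin

lemma res_tendsto_0: "(\<lambda>n. res n U0 M) \<longlonglongrightarrow> 0"
proof -
 let ?c = "4 * cN * (1 + 2 * M)" and ?d = "cN * (1 + 4 * M) * (cN * (1 + 2 * M) * (2 * M))"
 have "(\<lambda>n. ?c * nm (gw (real n)) U0 + ?d * inverse (real (Suc n))) \<longlonglongrightarrow> ?c * 0 + ?d * 0"
  by (intro tendsto_add tendsto_mult tendsto_const gw_tendsto_0 U0 LIMSEQ_inverse_real_of_nat)
 then show ?thesis unfolding res_def by (simp add: divide_inverse add.commute)
qed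

lemma res_nonneg: "0 \<le> res n U0 M"
 using M_nonneg[OF U0] unfolding res_def by (intro add_nonneg_nonneg mult_nonneg_nonneg divide_nonneg_nonneg) auto

lemma polH: "pol n U0 t \<in> H (gw 0)" "herm (pol n U0 t)"
 using good_pol[OF U0] by (auto simp: good_def)

lemma cut_high_gw: "nd (kw 0) (cut n U0) U0 \<le> 2 * nm (gw (real n)) U0"
 using cut_high[OF H_gk[OF U0(1)], of n] H_kw(2)[OF _ H_gw(1)[OF _ U0(1)], of "real n"] by simp

definition Cw :: real where "Cw = sqrt (exp ((4 * cD * (2 * M) + 1) * life M) * (1 + life M))"
definition qn :: "nat \<Rightarrow> real" where "qn n = 2 * nm (gw (real n)) U0 + res n U0 M"

text \<open>\<open>stability\<close> for two polygons. \<open>qn\<close> dominates both the initial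
  error and the residual, and \<open>Cw\<close> freezes the growth factor at the end of the life
  span.\<close>

lemma pol_weak:
 assumes t: "0 \<le> t" "t \<le> life M"
 shows "nd (kw 0) (pol j U0 t) (pol n U0 t) \<le> Cw * (qn j + qn n)"
proof -
 let ?L = "life M" and ?c = "4 * cD * (2 * M) + 1"
 let ?x = "nd (kw 0) (cut j U0) (cut n U0)" and ?y = "res j U0 M + res n U0 M"
 have L: "0 \<le> ?L" using t by simp
 have M0: "0 \<le> M" by (rule M_nonneg[OF U0])
 have q: "0 \<le> qn j + qn n" unfolding qn_def by (intro add_nonneg_nonneg mult_nonneg_nonneg res_nonneg) auto
 note c = cut_le(1)[OF weight_w H_gk[OF U0(1)]] H_gk[OF U0(1)]
 have "?x \<le> nd (kw 0) (cut j U0) U0 + nd (kw 0) U0 (cut n U0)"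
  by (rule nm_tri[OF weight_w c c(1)])
 also have "\<dots> \<le> 2 * nm (gw (real j)) U0 + 2 * nm (gw (real n)) U0"
  by (rule add_mono[OF cut_high_gw]) (subst nm_minus_commute, rule cut_high_gw)
 finally have x: "?x \<le> qn j + qn n" unfolding qn_def using res_nonneg[of j] res_nonneg[of n] by linarith
 have y: "?y \<le> qn j + qn n" unfolding qn_def by simp
 have y0: "0 \<le> ?y" by (intro add_nonneg_nonneg res_nonneg)
 have "(nd (kw 0) (pol j U0 t) (pol n U0 t))\<^sup>2 \<le> exp (?c * t) * (?x\<^sup>2 + ?y\<^sup>2 * t)"
  using stability[OF pol_asol[OF U0, of j] pol_asol[OF U0, of n] res_nonneg res_nonneg t]
  by (simp only: pol_0[OF U0])
 also have "\<dots> \<le> exp (?c * ?L) * ((qn j + qn n)\<^sup>2 + (qn j + qn n)\<^sup>2 * ?L)"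
 proof (rule mult_mono[OF _ add_mono])
  have "?c * t \<le> ?c * ?L" using M0 by (intro mult_left_mono t) simp
  then show "exp (?c * t) \<le> exp (?c * ?L)" by (simp only: exp_le_cancel_iff)
  show "?x\<^sup>2 \<le> (qn j + qn n)\<^sup>2" by (rule power_mono[OF x nm_nonneg])
  show "?y\<^sup>2 * t \<le> (qn j + qn n)\<^sup>2 * ?L" by (rule mult_mono[OF power_mono[OF y y0] t(2)]) (use t in simp_all)
 qed (use t in simp_all)
 also have "\<dots> = (Cw * (qn j + qn n))\<^sup>2"
 proof -
  have "Cw\<^sup>2 = exp (?c * ?L) * (1 + ?L)" using L by (simp add: Cw_def)
  then show ?thesis unfolding power_mult_distrib by (simp only: distrib_left distrib_right mult_1_left mult_1_right mult_ac)
 qed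
 finally show ?thesis by (rule power2_le_imp_le) (use q L in \<open>simp add: Cw_def\<close>)
qed

lemma Cw_nonneg: "0 \<le> Cw" unfolding Cw_def using life_pos[OF M_nonneg[OF U0]] by simp

lemma qn_tendsto_0: "qn \<longlonglongrightarrow> 0"
 using tendsto_add[OF tendsto_mult[OF tendsto_const[of 2] gw_tendsto_0[OF U0(1)]] res_tendsto_0] by (simp add: qn_def[abs_def])

text \<open>R is fixed first, by the tail of the data and uniformly in m, n and t; only then are the
  polygons brought close in H^(s-1), against the factor R in \<open>interp\<close>.\<close>

lemma pol_Cauchy:
 assumes e: "0 < e"
 shows "\<exists>N. \<forall>m\<ge>N. \<forall>n\<ge>N. \<forall>t\<in>{0..life M}. nd (gw 0) (pol m U0 t) (pol n U0 t) < e"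
proof -
 \<comment> \<open>Each polygon has at most twice the tail of the data, the difference four times,
   and \<open>interp\<close> doubles this; with e / 16 the tail uses up e / 2.\<close>
 from order_tendstoD(2)[OF gw_tendsto_0[OF U0(1)], of "e / 16"] e
 obtain R where R: "nm (gw (real R)) U0 < e / 16" by (auto simp: eventually_sequentially)
 let ?C = "real R * Cw + 1"
 have C: "0 < ?C" using Cw_nonneg by (simp add: add_nonneg_pos)
 have "0 < e / (4 * ?C)" using e C by simp
 from order_tendstoD(2)[OF qn_tendsto_0 this]
 obtain N where N: "\<And>n. N \<le> n \<Longrightarrow> qn n < e / (4 * ?C)" by (auto simp: eventually_sequentially)
 have "nd (gw 0) (pol m U0 t) (pol n U0 t) < e" if mn: "N \<le> m" "N \<le> n" and t: "t \<in> {0..life M}" for m n t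
 proof -
  let ?D = "\<lambda>v. pol m U0 t v - pol n U0 t v"
  have t: "0 \<le> t" "t \<le> life M" using t by auto
  have q0: "0 \<le> qn m + qn n" unfolding qn_def by (intro add_nonneg_nonneg mult_nonneg_nonneg res_nonneg) auto
  have q: "qn m + qn n \<le> e / (2 * ?C)"
  proof -
   have eq: "e / (4 * c) + e / (4 * c) = e / (2 * c)" for c by (cases "c = 0") (auto simp: field_simps)
   show ?thesis unfolding eq[of ?C, symmetric] by (intro add_mono less_imp_le N mn)
  qed
  have DH: "?D \<in> H (gw 0)" by (intro H_diff(1) weight_g polH)
  have R0: "0 \<le> real R" by simp
  have "nm (gw (real R)) ?D \<le> nm (gw (real R)) (pol m U0 t) + nm (gw (real R)) (pol n U0 t)"
   by (rule H_diff(2)[OF weight_gw[OF R0] H_gw(1)[OF R0 polH(1)] H_gw(1)[OF R0 polH(1)]])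
  also have "\<dots> \<le> 4 * nm (gw (real R)) U0"
   using pol_bound[OF U0 t R0, of m] pol_bound[OF U0 t R0, of n] by simp
  finally have hi: "2 * nm (gw (real R)) ?D < e / 2" using R by linarith
  have "real R * nm (kw 0) ?D \<le> real R * (Cw * (qn m + qn n))" by (rule mult_left_mono[OF pol_weak[OF t] R0])
  also have "\<dots> \<le> ?C * (qn m + qn n)" using q0 by (simp add: algebra_simps)
  also have "\<dots> \<le> ?C * (e / (2 * ?C))" using C by (intro mult_left_mono q) simp
  also have "\<dots> = e / 2" using C by (simp add: field_simps)
  finally show ?thesis using interp[OF R0 DH] hi by linarith
 qed
 then show ?thesis by blast
qed

lemma limit_exists:
 obtains U where "\<And>t. t \<in> {0..life M} \<Longrightarrow> U t \<in> H (gw 0)"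
  "\<And>e. 0 < e \<Longrightarrow> \<exists>N. \<forall>n\<ge>N. \<forall>t\<in>{0..life M}. nd (gw 0) (pol n U0 t) (U t) < e"
proof -
 have "\<forall>t\<in>{0..life M}. \<exists>g. g \<in> H (gw 0) \<and> (\<lambda>n. nd (gw 0) (pol n U0 t) g) \<longlonglongrightarrow> 0"
 proof
  fix t assume t: "t \<in> {0..life M}"
  have C: "\<exists>N. \<forall>m\<ge>N. \<forall>n\<ge>N. nd (gw 0) (pol m U0 t) (pol n U0 t) < e" if "0 < e" for e
   using pol_Cauchy[OF that] t by meson
  show "\<exists>g. g \<in> H (gw 0) \<and> (\<lambda>n. nd (gw 0) (pol n U0 t) g) \<longlonglongrightarrow> 0"
   by (rule H_complete[OF weight_g polH(1) C]) (assumption, rule exI, rule conjI)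
 qed
 from bchoice[OF this] obtain U where
  "\<forall>t\<in>{0..life M}. U t \<in> H (gw 0) \<and> (\<lambda>n. nd (gw 0) (pol n U0 t) (U t)) \<longlonglongrightarrow> 0" ..
 then have U: "U t \<in> H (gw 0)" and lim: "(\<lambda>n. nd (gw 0) (pol n U0 t) (U t)) \<longlonglongrightarrow> 0"
  if "t \<in> {0..life M}" for t using that by auto
 have "\<exists>N. \<forall>n\<ge>N. \<forall>t\<in>{0..life M}. nd (gw 0) (pol n U0 t) (U t) < e" if e: "0 < e" for e
 proof -
  have "0 < e / 2" using e by simp
  from pol_Cauchy[OF this] obtain N where
   N: "\<And>m n t. N \<le> m \<Longrightarrow> N \<le> n \<Longrightarrow> t \<in> {0..life M} \<Longrightarrow> nd (gw 0) (pol m U0 t) (pol n U0 t) < e / 2" by blast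
  have "nd (gw 0) (pol n U0 t) (U t) < e" if n: "N \<le> n" and t: "t \<in> {0..life M}" for n t
  proof -
   from order_tendstoD(2)[OF lim[OF t] \<open>0 < e / 2\<close>]
   obtain N' where N': "\<And>m. N' \<le> m \<Longrightarrow> nd (gw 0) (pol m U0 t) (U t) < e / 2" by (auto simp: eventually_sequentially)
   have "nd (gw 0) (pol n U0 t) (U t) \<le> nd (gw 0) (pol n U0 t) (pol (max N N') U0 t) + nd (gw 0) (pol (max N N') U0 t) (U t)"
    by (intro nm_tri weight_g polH U t)
   also have "\<dots> < e / 2 + e / 2" by (intro add_strict_mono N N' n t) auto
   finally show ?thesis by simp
  qed
  then show ?thesis by blast
 qed
 then show ?thesis using that U by blast
qed

text \<open>The tail bound, inherited by lower semicontinuity, belongs to the conclusion because it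
  is used again: it makes the limit continuous in H^s although increments are controlled in H^(s-1)
  only, and it later gives continuous dependence.\<close>

theorem local_existence:
 obtains U where "sol {0..life M} U" "aeq (U 0) U0"
  "\<And>t R. t \<in> {0..life M} \<Longrightarrow> 0 \<le> R \<Longrightarrow> nm (gw R) (U t) \<le> 2 * nm (gw R) U0"
proof -
 let ?a = "life M"
 have M0: "0 \<le> M" by (rule M_nonneg[OF U0])
 have a0: "0 < ?a" by (rule life_pos[OF M0])
 obtain U where UH: "\<And>t. t \<in> {0..?a} \<Longrightarrow> U t \<in> H (gw 0)"
  and conv: "\<And>e. 0 < e \<Longrightarrow> \<exists>N. \<forall>n\<ge>N. \<forall>t\<in>{0..?a}. nd (gw 0) (pol n U0 t) (U t) < e"
  using limit_exists by blast
 have lim: "(\<lambda>n. nd (gw 0) (pol n U0 t) (U t)) \<longlonglongrightarrow> 0" if t: "t \<in> {0..?a}" for t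
 proof (rule LIMSEQ_I)
  fix e :: real assume "0 < e"
  from conv[OF this] obtain N where N: "\<forall>n\<ge>N. \<forall>t\<in>{0..?a}. nd (gw 0) (pol n U0 t) (U t) < e" ..
  show "\<exists>N. \<forall>n\<ge>N. norm (nd (gw 0) (pol n U0 t) (U t) - 0) < e"
   using N t by (intro exI[of _ N]) simp
 qed
 have tail: "nm (gw R) (U t) \<le> 2 * nm (gw R) U0" if t: "t \<in> {0..?a}" and R: "0 \<le> R" for t R
  by (rule nm_lsc(2)[OF weight_g weight_gw[OF R] polH(1) H_gw(1)[OF R polH(1)] UH[OF t] lim[OF t]])
   (use pol_bound[OF U0 _ _ R] t in auto)
 have UM: "nm (gw 0) (U t) \<le> 2 * M" if t: "t \<in> {0..?a}" for t using tail[OF t order_refl] U0(3) by linarith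
 have PM: "nm (gw 0) (pol n U0 t) \<le> 2 * M" if t: "t \<in> {0..?a}" for t n
  using pol_bound[OF U0 _ _ order_refl, of t n] U0(3) t by auto
 have Uherm: "herm (U t)" if t: "t \<in> {0..?a}" for t
 proof -
  obtain r where "AE v in lborel. (\<lambda>n. pol (r n) U0 t v) \<longlonglongrightarrow> U t v"
   using nm_conv_subseq[OF weight_g polH(1) UH[OF t] lim[OF t]] by blast
  moreover from this have "AE v in lborel. (\<lambda>n. pol (r n) U0 t (- v)) \<longlonglongrightarrow> U t (- v)"
   by (rule AE_minus)
  moreover have "AE v in lborel. \<forall>n. pol (r n) U0 t (- v) = cnj (pol (r n) U0 t v)"
   unfolding AE_all_countable using polH(2) by (simp add: herm_def)
  ultimately show ?thesis
   unfolding herm_def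
  proof eventually_elim
   fix v assume 1: "(\<lambda>n. pol (r n) U0 t v) \<longlonglongrightarrow> U t v" and 2: "(\<lambda>n. pol (r n) U0 t (- v)) \<longlonglongrightarrow> U t (- v)"
    and 3: "\<forall>n. pol (r n) U0 t (- v) = cnj (pol (r n) U0 t v)"
   have "(\<lambda>n. pol (r n) U0 t (- v)) \<longlonglongrightarrow> cnj (U t v)" unfolding 3[rule_format] by (rule tendsto_cnj[OF 1])
   then show "U t (- v) = cnj (U t v)" by (rule LIMSEQ_unique[OF 2])
  qed
 qed
 \<comment> \<open>The mean value inequality of the polygons passes to the limit: the residual and
   the approximation errors tend to 0 while G and B stay fixed.\<close>
 have mvt: "nm (kw 0) (\<lambda>v. U t' v - U t v - cr (t' - t) * G v) \<le> (t' - t) * B"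
  if t: "0 \<le> t" "t \<le> t'" "t' \<le> ?a" and G: "G \<in> H (kw 0)"
   and B: "\<And>s. t \<le> s \<Longrightarrow> s \<le> t' \<Longrightarrow> nd (kw 0) (Nl (U s)) G \<le> B" for t t' G B
 proof (rule field_le_epsilon)
  fix e' :: real assume e': "0 < e'"
  let ?c = "cN * (1 + 4 * M)"
  define k where "k = (t' - t) * (1 + ?c) + 2"
  have k: "0 < k" unfolding k_def using t M0 by (intro add_nonneg_pos mult_nonneg_nonneg add_nonneg_nonneg) auto
  define e where "e = e' / k"
  have e: "0 < e" using e' k by (simp add: e_def)
  from conv[OF e] obtain N where N: "\<And>n t. N \<le> n \<Longrightarrow> t \<in> {0..?a} \<Longrightarrow> nd (gw 0) (pol n U0 t) (U t) < e" by blast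
  from order_tendstoD(2)[OF res_tendsto_0 e] obtain N' where N': "\<And>n. N' \<le> n \<Longrightarrow> res n U0 M < e" by (auto simp: eventually_sequentially)
  define n where "n = max N N'"
  have n: "N \<le> n" "N' \<le> n" by (auto simp: n_def)
  have close: "nd (kw 0) (pol n U0 s) (U s) \<le> e" if s: "s \<in> {0..?a}" for s
   using H_kw(2)[OF order_refl H_diff(1)[OF weight_g polH(1) UH[OF s]], of n s] N[OF n(1) s] by linarith
  have P: "nm (kw 0) (\<lambda>v. pol n U0 t' v - pol n U0 t v - cr (t' - t) * G v) \<le> (t' - t) * (res n U0 M + (?c * e + B))"
  proof (rule asol_mvt[OF pol_asol[OF U0] res_nonneg t G])
   fix s assume s: "t \<le> s" "s \<le> t'"
   then have s': "s \<in> {0..?a}" using t by auto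
   have "nd (kw 0) (Nl (pol n U0 s)) (Nl (U s))
    \<le> cN * (1 + nm (gw 0) (pol n U0 s) + nm (gw 0) (U s)) * nd (gw 0) (pol n U0 s) (U s)"
    by (rule Nl_lipschitz[OF polH(1) UH[OF s']])
   also have "\<dots> \<le> ?c * e"
    using UM[OF s'] PM[OF s', of n] N[OF n(1) s'] M0 by (intro mult_mono mult_left_mono) auto
   finally have "nd (kw 0) (Nl (pol n U0 s)) (Nl (U s)) \<le> ?c * e" .
   then show "nd (kw 0) (Nl (pol n U0 s)) G \<le> ?c * e + B"
    using nm_tri[OF weight_w Nl_bound(1)[OF order_refl polH(1)] Nl_bound(1)[OF order_refl UH[OF s']] G, of n s] B[OF s] by linarith
  qed
  have tt: "t \<in> {0..?a}" "t' \<in> {0..?a}" using t by auto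
  let ?X = "\<lambda>v. pol n U0 t' v - pol n U0 t v - cr (t' - t) * G v"
  let ?Y = "\<lambda>v. (pol n U0 t' v - U t' v) - (pol n U0 t v - U t v)"
  have XH: "?X \<in> H (kw 0)" "?Y \<in> H (kw 0)"
   by (intro H_diff(1) H_scale(1) weight_w G H_gk polH UH tt)+
  have "(\<lambda>v. U t' v - U t v - cr (t' - t) * G v) = (\<lambda>v. ?X v - ?Y v)" by auto
  then have "nm (kw 0) (\<lambda>v. U t' v - U t v - cr (t' - t) * G v) \<le> nm (kw 0) ?X + nm (kw 0) ?Y"
   using H_diff(2)[OF weight_w XH] by simp
  also have "nm (kw 0) ?Y \<le> nd (kw 0) (pol n U0 t') (U t') + nd (kw 0) (pol n U0 t) (U t)"
   by (intro H_diff weight_w H_gk polH UH tt)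
  also have "\<dots> \<le> e + e" by (intro add_mono close tt)
  also have "nm (kw 0) ?X \<le> (t' - t) * (e + (?c * e + B))"
   by (rule order_trans[OF P], rule mult_left_mono) (use N'[OF n(2)] t in auto)
  also have "(t' - t) * (e + (?c * e + B)) + (e + e) = (t' - t) * B + k * e" unfolding k_def by (simp add: algebra_simps)
  also have "k * e = e'" using k by (simp add: e_def)
  finally show "nm (kw 0) (\<lambda>v. U t' v - U t v - cr (t' - t) * G v) \<le> (t' - t) * B + e'" by simp
 qed
 have NU: "Nl (U t) \<in> H (kw 0)" if "t \<in> {0..?a}" for t by (rule Nl_bound(1)[OF order_refl UH[OF that]])
 have mvt2: "nm (kw 0) (\<lambda>v. U t' v - U t v - cr (t' - t) * G v) \<le> \<bar>t' - t\<bar> * B"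
  if t: "t \<in> {0..?a}" "t' \<in> {0..?a}" and G: "G \<in> H (kw 0)"
   and B: "\<And>s. s \<in> {0..?a} \<Longrightarrow> \<bar>s - t\<bar> \<le> \<bar>t' - t\<bar> \<Longrightarrow> nd (kw 0) (Nl (U s)) G \<le> B" for t t' G B
 proof (cases "t \<le> t'")
  case True
  then show ?thesis using mvt[of t t' G B] t G B by auto
 next
  case False
  have "nm (kw 0) (\<lambda>v. U t' v - U t v - cr (t' - t) * G v)
    = nm (kw 0) (\<lambda>v. - 1 * (U t v - U t' v - cr (t - t') * G v))"
   by (rule arg_cong[where f="nm (kw 0)"]) (auto simp: algebra_simps)
  also have "\<dots> = cmod (- 1) * nm (kw 0) (\<lambda>v. U t v - U t' v - cr (t - t') * G v)"
   by (intro H_scale(2) weight_w H_diff(1) H_scale(1) G H_gk UH t)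
  also have "\<dots> \<le> (t - t') * B" using mvt[of t' t G B] False t G B by auto
  finally show ?thesis using False by simp
 qed
 let ?L = "cN * (1 + 2 * M) * (2 * M)"
 have NL: "nm (kw 0) (Nl (U s)) \<le> ?L" if s: "s \<in> {0..?a}" for s
  by (rule order_trans[OF Nl_bound(2)[OF order_refl UH[OF s]]], intro mult_mono mult_left_mono add_mono order_refl UM[OF s]) (use M0 in auto)
 have cont_w: "((\<lambda>\<tau>. nd (kw 0) (U \<tau>) (U t)) \<longlongrightarrow> 0) (at t within {0..?a})" if t: "t \<in> {0..?a}" for t
 proof (rule Lim_null_comparison)
  have "((\<lambda>\<tau>. \<bar>\<tau> - t\<bar> * ?L) \<longlongrightarrow> \<bar>t - t\<bar> * ?L) (at t within {0..?a})" by (intro tendsto_intros)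
  then show "((\<lambda>\<tau>. \<bar>\<tau> - t\<bar> * ?L) \<longlongrightarrow> 0) (at t within {0..?a})" by simp
  show "\<forall>\<^sub>F \<tau> in at t within {0..?a}. norm (nd (kw 0) (U \<tau>) (U t)) \<le> \<bar>\<tau> - t\<bar> * ?L"
   unfolding eventually_at_filter
  proof (intro always_eventually allI impI)
   fix \<tau> assume \<tau>: "\<tau> \<in> {0..?a}"
   show "norm (nd (kw 0) (U \<tau>) (U t)) \<le> \<bar>\<tau> - t\<bar> * ?L"
    using mvt2[OF t \<tau> H_zero(1), of ?L] NL by simp
  qed
 qed
 \<comment> \<open>Low frequencies are handled by Lipschitz continuity in H^(s-1), high ones by the
   tails of both values, which are bounded by that of the data.\<close>
 have cont: "((\<lambda>\<tau>. nd (gw 0) (U \<tau>) (U t)) \<longlongrightarrow> 0) (at t within {0..?a})" if t: "t \<in> {0..?a}" for t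
 proof (rule order_tendstoI)
  fix y :: real assume "y < 0"
  then show "\<forall>\<^sub>F \<tau> in at t within {0..?a}. y < nd (gw 0) (U \<tau>) (U t)"
   by (intro always_eventually allI order_less_le_trans[OF _ nm_nonneg])
 next
  fix e :: real assume e: "0 < e"
  from order_tendstoD(2)[OF gw_tendsto_0[OF U0(1)], of "e / 16"] e
  obtain R where R: "nm (gw (real R)) U0 < e / 16" by (auto simp: eventually_sequentially)
  have "0 < e / (2 * (real R + 1))" using e by simp
  from order_tendstoD(2)[OF cont_w[OF t] this]
  have "\<forall>\<^sub>F \<tau> in at t within {0..?a}. nd (kw 0) (U \<tau>) (U t) < e / (2 * (real R + 1))" .
  moreover have "\<forall>\<^sub>F \<tau> in at t within {0..?a}. \<tau> \<in> {0..?a}" by (simp add: eventually_at_filter)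
  ultimately show "\<forall>\<^sub>F \<tau> in at t within {0..?a}. nd (gw 0) (U \<tau>) (U t) < e"
  proof eventually_elim
   fix \<tau> assume w: "nd (kw 0) (U \<tau>) (U t) < e / (2 * (real R + 1))" and \<tau>: "\<tau> \<in> {0..?a}"
   have R0: "0 \<le> real R" by simp
   have "(real R + 1) * nd (kw 0) (U \<tau>) (U t) < e / 2" using w by (simp add: field_simps)
   then have 1: "real R * nd (kw 0) (U \<tau>) (U t) < e / 2"
    using nm_nonneg[of "kw 0" "\<lambda>v. U \<tau> v - U t v"] unfolding distrib_right by linarith
   have "nd (gw (real R)) (U \<tau>) (U t) \<le> nm (gw (real R)) (U \<tau>) + nm (gw (real R)) (U t)"
    by (rule H_diff(2)[OF weight_gw[OF R0] H_gw(1)[OF R0 UH[OF \<tau>]] H_gw(1)[OF R0 UH[OF t]]])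
   then have "2 * nd (gw (real R)) (U \<tau>) (U t) < e / 2"
    using tail[OF \<tau> R0] tail[OF t R0] R by linarith
   with 1 show "nd (gw 0) (U \<tau>) (U t) < e"
    using interp[OF R0 H_diff(1)[OF weight_g UH[OF \<tau>] UH[OF t]]] by linarith
  qed
 qed
 \<comment> \<open>With G = \<open>Nl (U t)\<close>, the constant B of the mean value inequality is
   the oscillation of \<open>Nl\<close> along U near t, small by continuity in H^s.\<close>
 have deriv: "((\<lambda>\<tau>. dq (kw 0) U \<tau> t (Nl (U t))) \<longlongrightarrow> 0) (at t within {0..?a})"
  if t: "t \<in> {0..?a}" for t
 proof (rule order_tendstoI)
  fix y :: real assume "y < 0"
  then show "\<forall>\<^sub>F \<tau> in at t within {0..?a}. y < dq (kw 0) U \<tau> t (Nl (U t))"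
   by (intro always_eventually allI order_less_le_trans[OF _ nm_nonneg])
 next
  fix e :: real assume e: "0 < e"
  let ?c = "cN * (1 + 4 * M) + 1"
  have c: "0 < ?c" using M0 by (simp add: add_nonneg_pos)
  have "0 < e / (2 * ?c)" using e c by simp
  from order_tendstoD(2)[OF cont[OF t] this]
  obtain d where d: "0 < d" and dd: "\<And>\<tau>. \<tau> \<in> {0..?a} \<Longrightarrow> \<tau> \<noteq> t \<Longrightarrow> dist \<tau> t < d \<Longrightarrow> nd (gw 0) (U \<tau>) (U t) < e / (2 * ?c)"
   unfolding eventually_at by blast
  have small: "nd (kw 0) (Nl (U s)) (Nl (U t)) \<le> e / 2" if s: "s \<in> {0..?a}" "dist s t < d" for s
  proof -
   have D: "nd (gw 0) (U s) (U t) \<le> e / (2 * ?c)"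
    using dd[OF s(1) _ s(2)] e c by (cases "s = t") auto
   have "nd (kw 0) (Nl (U s)) (Nl (U t)) \<le> cN * (1 + nm (gw 0) (U s) + nm (gw 0) (U t)) * nd (gw 0) (U s) (U t)"
    by (rule Nl_lipschitz[OF UH[OF s(1)] UH[OF t]])
   also have "\<dots> \<le> (cN * (1 + 4 * M)) * (e / (2 * ?c))"
    using UM[OF s(1)] UM[OF t] D M0 by (intro mult_mono mult_left_mono) auto
   also have "\<dots> \<le> ?c * (e / (2 * ?c))" using e c by (intro mult_right_mono) auto
   also have "\<dots> = e / 2" using c by (simp add: field_simps)
   finally show ?thesis .
  qed
  show "\<forall>\<^sub>F \<tau> in at t within {0..?a}. dq (kw 0) U \<tau> t (Nl (U t)) < e"
   unfolding eventually_at
  proof (intro exI[of _ d] conjI d ballI impI)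
   fix \<tau> assume \<tau>: "\<tau> \<in> {0..?a}" "\<tau> \<noteq> t \<and> dist \<tau> t < d"
   let ?X = "\<lambda>v. U \<tau> v - U t v - cr (\<tau> - t) * Nl (U t) v"
   have X: "nm (kw 0) ?X \<le> \<bar>\<tau> - t\<bar> * (e / 2)"
    using \<tau>(2) by (intro mvt2[OF t \<tau>(1) NU[OF t]] small) (auto simp: dist_real_def)
   have XH: "?X \<in> H (kw 0)" by (intro H_diff(1) H_scale(1) weight_w NU H_gk UH t \<tau>)
   have ne: "cr (\<tau> - t) \<noteq> 0" using \<tau>(2) by simp
   have "(\<lambda>v. (U \<tau> v - U t v) / cr (\<tau> - t) - Nl (U t) v) = (\<lambda>v. (1 / cr (\<tau> - t)) * ?X v)"

   proof
    have "x / d - N = (1 / d) * (x - d * N)" if "d \<noteq> 0" for x d N :: complex using that by (simp add: field_simps)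
    from this[OF ne] show "(U \<tau> v - U t v) / cr (\<tau> - t) - Nl (U t) v = (1 / cr (\<tau> - t)) * ?X v" for v .
   qed
   then have "dq (kw 0) U \<tau> t (Nl (U t)) = nm (kw 0) ?X / \<bar>\<tau> - t\<bar>"
    using H_scale(2)[OF weight_w XH, of "1 / cr (\<tau> - t)"] by (simp add: norm_divide del: of_real_diff)
   also have "\<dots> \<le> e / 2" using X \<tau>(2) by (simp add: pos_divide_le_eq mult.commute)
   finally show "dq (kw 0) U \<tau> t (Nl (U t)) < e" using e by simp
  qed
 qed
 have sol: "sol {0..?a} U" unfolding sol_def using UH Uherm cont deriv by blast
 have z: "0 \<in> {0..?a}" using a0 by simp
 \<comment> \<open>The polygons start at \<open>cut n U0\<close>, so this constant sequence is
   bounded by two errors that tend to 0.\<close>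
 have "(\<lambda>n. nd (kw 0) (U 0) U0) \<longlonglongrightarrow> 0"
 proof (rule Lim_null_comparison)
  have "(\<lambda>n. nd (gw 0) (pol n U0 0) (U 0) + 2 * nm (gw (real n)) U0) \<longlonglongrightarrow> 0 + 2 * 0"
   by (intro tendsto_add tendsto_mult tendsto_const lim z gw_tendsto_0 U0)
  then show "(\<lambda>n. nd (gw 0) (pol n U0 0) (U 0) + 2 * nm (gw (real n)) U0) \<longlonglongrightarrow> 0" by simp
  show "\<forall>\<^sub>F n in sequentially. norm (nd (kw 0) (U 0) U0) \<le> nd (gw 0) (pol n U0 0) (U 0) + 2 * nm (gw (real n)) U0"
  proof (intro always_eventually allI)
   fix n
   have "nd (kw 0) (U 0) U0 \<le> nd (kw 0) (U 0) (pol n U0 0) + nd (kw 0) (pol n U0 0) U0"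
    by (intro nm_tri weight_w H_gk polH UH z U0)
   also have "nd (kw 0) (pol n U0 0) U0 \<le> 2 * nm (gw (real n)) U0" unfolding pol_0[OF U0] by (rule cut_high_gw)
   also have "nd (kw 0) (U 0) (pol n U0 0) \<le> nd (gw 0) (U 0) (pol n U0 0)"
    by (intro H_kw(2) order_refl H_diff(1) weight_g UH z polH)
   finally show "norm (nd (kw 0) (U 0) U0) \<le> nd (gw 0) (pol n U0 0) (U 0) + 2 * nm (gw (real n)) U0"
    by (simp add: nm_minus_commute[of "gw 0" "U 0"])
  qed
 qed
 then have "nd (kw 0) (U 0) U0 = 0" by (simp add: LIMSEQ_const_iff)
 from nm_eq_0[OF H_diff(1)[OF weight_w H_gk[OF UH[OF z]] H_gk[OF U0(1)]] weight_w this]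
 have "aeq (U 0) U0" by simp
 from that[OF sol this tail] show ?thesis .
qed

end

text \<open>The bound is available for the limit of polygons; uniqueness hands it to every solution
  with the same data.\<close>

lemma sol_tail:
 assumes U: "sol {0..life M} U" and M: "nm (gw 0) (U 0) \<le> M" and t: "t \<in> {0..life M}" and R: "0 \<le> R"
 shows "nm (gw R) (U t) \<le> 2 * nm (gw R) (U 0)"
proof -
 have z: "0 \<in> {0..life M}" using t by simp
 obtain V where V: "sol {0..life M} V" "aeq (V 0) (U 0)"
  "\<And>t R. t \<in> {0..life M} \<Longrightarrow> 0 \<le> R \<Longrightarrow> nm (gw R) (V t) \<le> 2 * nm (gw R) (U 0)"
  using local_existence[OF solD(1,2)[OF U z] M] by blast
 have "aeq (V t) (U t)" by (rule sol_unique[OF V(1) U V(2) t])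
 then have "nm (gw R) (V t) = nm (gw R) (U t)"
  by (rule nm_cong_AE[OF weight_gw[OF R] H_measurable[OF solD(1)[OF V(1) t]] H_measurable[OF solD(1)[OF U t]]])
 then show ?thesis using V(3)[OF t R] by simp
qed

text \<open>The tail of V(t) is bounded by that of V(0), hence by that of U(0) and the distance of
  the data, so a single R serves all V near U. \<open>stability\<close> takes care of the remaining
  frequencies.\<close>

theorem local_dependence:
 assumes U: "sol {0..life M} U" and M: "nm (gw 0) (U 0) \<le> M" and e: "0 < e"
 shows "\<exists>\<delta>>0. \<forall>V. sol {0..life M} V \<longrightarrow> nm (gw 0) (V 0) \<le> M \<longrightarrow> nd (gw 0) (V 0) (U 0) < \<delta> \<longrightarrow>
  (\<forall>t\<in>{0..life M}. nd (gw 0) (V t) (U t) < e)"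
proof -
 let ?a = "life M"
 have M0: "0 \<le> M" by (rule order_trans[OF nm_nonneg M])
 have z: "0 \<in> {0..?a}" using life_pos[OF M0] by simp
 from order_tendstoD(2)[OF gw_tendsto_0[OF solD(1)[OF U z]], of "e / 16"] e
 obtain R where R: "nm (gw (real R)) (U 0) < e / 16" by (auto simp: eventually_sequentially)
 have R0: "0 \<le> real R" by simp
 define C where "C = sqrt (exp ((4 * cD * (2 * M) + 1) * ?a))"
 have C: "0 \<le> C" by (simp add: C_def)
 \<comment> \<open>Balanced for the last inequality: the terms proportional to the distance of the
   data add up to (R C + 4) d, less than e/2, and eight times the tail of U(0) stays below
   e/2.\<close>
 define \<delta> where "\<delta> = e / (2 * (real R * C + 4))"
 have den: "0 < real R * C + 4" using C by (simp add: add_nonneg_pos)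
 have \<delta>: "0 < \<delta>" unfolding \<delta>_def using e den by simp
 have bM: "nm (gw 0) (V t) \<le> 2 * M" if "sol {0..?a} V" "nm (gw 0) (V 0) \<le> M" "t \<in> {0..?a}" for V t
  using sol_tail[OF that order_refl] that(2) by linarith
 have "nd (gw 0) (V t) (U t) < e"
  if V: "sol {0..?a} V" "nm (gw 0) (V 0) \<le> M" and d: "nd (gw 0) (V 0) (U 0) < \<delta>" and t: "t \<in> {0..?a}" for V t
 proof -
  let ?d = "nd (gw 0) (V 0) (U 0)"
  note V0 = solD(1)[OF V(1) z] and U0 = solD(1)[OF U z] and Vt = solD(1)[OF V(1) t] and Ut = solD(1)[OF U t]
  have d0: "nd (kw 0) (V 0) (U 0) \<le> ?d" by (rule H_kw(2)[OF order_refl H_diff(1)[OF weight_g V0 U0]])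
  have "(nd (kw 0) (V t) (U t))\<^sup>2 \<le> exp ((4 * cD * (2 * M) + 1) * t) * (nd (kw 0) (V 0) (U 0))\<^sup>2"
   using stability[OF asol_of_sol[OF V(1) bM[OF V]] asol_of_sol[OF U bM[OF U M]] order_refl order_refl, of t] t by simp
  also have "\<dots> \<le> exp ((4 * cD * (2 * M) + 1) * ?a) * ?d\<^sup>2"
   using t M0 d0 by (intro mult_mono power_mono iffD2[OF exp_le_cancel_iff] mult_left_mono) auto
  also have "\<dots> = (C * ?d)\<^sup>2" by (simp add: C_def power_mult_distrib)
  finally have w: "nd (kw 0) (V t) (U t) \<le> C * ?d" by (rule power2_le_imp_le) (use C in simp)
  have "nm (gw (real R)) (V 0) \<le> nm (gw (real R)) (U 0) + nd (gw (real R)) (V 0) (U 0)"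
   by (rule nm_tri_diff[OF weight_gw[OF R0] H_gw(1)[OF R0 V0] H_gw(1)[OF R0 U0]])
  then have V0R: "nm (gw (real R)) (V 0) \<le> nm (gw (real R)) (U 0) + ?d"
   using H_gw(2)[OF R0 H_diff(1)[OF weight_g V0 U0]] by linarith
  have "nd (gw (real R)) (V t) (U t) \<le> nm (gw (real R)) (V t) + nm (gw (real R)) (U t)"
   by (rule H_diff(2)[OF weight_gw[OF R0] H_gw(1)[OF R0 Vt] H_gw(1)[OF R0 Ut]])
  then have hi: "nd (gw (real R)) (V t) (U t) \<le> 4 * nm (gw (real R)) (U 0) + 2 * ?d"
   using sol_tail[OF V t R0] sol_tail[OF U M t R0] V0R by linarith
  have "nd (gw 0) (V t) (U t) \<le> real R * (C * ?d) + 2 * (4 * nm (gw (real R)) (U 0) + 2 * ?d)"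
   by (rule order_trans[OF interp[OF R0 H_diff(1)[OF weight_g Vt Ut]]], intro add_mono mult_left_mono w hi) auto
  also have "\<dots> = (real R * C + 4) * ?d + 8 * nm (gw (real R)) (U 0)" by (simp add: algebra_simps)
  also have "\<dots> < (real R * C + 4) * \<delta> + e / 2"
   using d R den by (intro add_strict_mono mult_strict_left_mono) auto
  also have "(real R * C + 4) * \<delta> = e / 2" using den by (simp add: \<delta>_def field_simps)
  finally show ?thesis by simp
 qed
 then show ?thesis using \<delta> by blast
qed

end

section \<open>The equation on the Fourier side\<close>

lemma has_weak_deriv_cong:
 assumes D: "has_weak_deriv f g" and ae: "AE x in lborel. f x = f' x" and [measurable]: "f' \<in> BM"
 shows "has_weak_deriv f' g"
proof -
 have l: "locally_integrable f" "locally_integrable g" using D by (auto simp: has_weak_deriv_def)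
 have [measurable]: "f \<in> BM" using l(1) by (simp add: locally_integrable_def)
 have "locally_integrable f'"
  unfolding locally_integrable_def
 proof (intro conjI allI)
  show "f' \<in> borel_measurable lborel" by simp
  fix R :: real
  have i: "integrable lborel (\<lambda>x. indicator {-R..R} x *\<^sub>R f x)"
   using l(1) by (simp add: locally_integrable_def set_integrable_def)
  have ae': "AE x in lborel. indicator {-R..R} x *\<^sub>R f x = indicator {-R..R} x *\<^sub>R f' x"
   using ae by eventually_elim simp
  show "set_integrable lborel {-R..R} f'"
   unfolding set_integrable_def by (rule Bochner_Integration.integrable_cong_AE_imp[OF i _ ae']) measurable
 qed
 moreover have "(LINT x|lborel. f' x * deriv \<phi> x) = - (LINT x|lborel. g x * \<phi> x)" if \<phi>: "test_function \<phi>" for \<phi>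
 proof -
  note [measurable] = test_function_measurable[OF \<phi>]
  have "(LINT x|lborel. f' x * deriv \<phi> x) = (LINT x|lborel. f x * deriv \<phi> x)"
   by (rule integral_cong_AE) (measurable, use ae in \<open>eventually_elim, simp\<close>)
  then show ?thesis using D \<phi> by (simp add: has_weak_deriv_def)
 qed
 ultimately show ?thesis using l(2) by (simp add: has_weak_deriv_def)
qed

lemma H_one_reflect:
 assumes f: "f \<in> H one" shows "(\<lambda>y. f (k - y)) \<in> H one"
proof -
 note [measurable] = H_measurable[OF f]
 have "(\<lambda>x. cmod (f x)) \<in> L2" using f by (simp add: cmod_in_L2)
 from L2_reflect(1)[OF this, of k] show ?thesis by (simp add: cmod_in_L2)
qed

context rod
begin

lemma J_le_gw: "J k \<le> gw 0 k"
 using mult_left_mono[OF kw_0_ge_1[of k], of "J k"] J_pos[of k] by (simp add: gw_eq)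

lemma H_kw_one: assumes U: "U \<in> H (kw 0)" shows "U \<in> H one"
 by (rule H_dom(1)[OF weight_one H_measurable[OF U] U, of 1]) (auto intro!: AE_I2 mult_right_mono[OF kw_0_ge_1, of "cmod z" for z, simplified])

lemma
 assumes V: "V \<in> H (gw 0)"
 shows mulx_H_one: "mulx V \<in> H one"
  and H_gw_integrable: "integrable lborel V"
  and mulx_integrable: "integrable lborel (mulx V)"
proof -
 note [measurable] = H_measurable[OF V]
 have le: "\<bar>k\<bar> * cmod (V k) \<le> J k * cmod (V k)" "cmod (V k) \<le> J k * cmod (V k)" "J k * cmod (V k) \<le> gw 0 k * cmod (V k)" for k
  using mult_right_mono[OF J_ge_1[of k], of "cmod (V k)"]
  by (intro mult_right_mono J_ge_abs J_le_gw norm_ge_zero | simp)+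
 show "mulx V \<in> H one"
 proof (rule H_dom(1)[OF weight_one _ V, of _ 1])
  show "AE k in lborel. one k * cmod (mulx V k) \<le> 1 * (gw 0 k * cmod (V k))"
   using order_trans[OF le(1) le(3)] by (auto simp: mulx_def norm_mult)
 qed simp_all
 have "(\<integral>\<^sup>+k. ennreal \<bar>J k * cmod (V k)\<bar> \<partial>lborel) < \<infinity>"
  using J_L1[OF V] by (rule le_less_trans) simp
 then have i: "integrable lborel (\<lambda>k. J k * cmod (V k))" by (intro integrableI_bounded) simp_all
 have n: "norm (J k * cmod (V k)) = J k * cmod (V k)" for k using J_pos[of k] by simp
 have "norm (V k) \<le> norm (J k * cmod (V k))" "norm (mulx V k) \<le> norm (J k * cmod (V k))" for k
  using le(1,2)[of k] unfolding n by (simp_all add: mulx_def norm_mult)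
 note b = AE_I2[OF this(1)] AE_I2[OF this(2)]
 show "integrable lborel V" by (rule Bochner_Integration.integrable_bound[OF i _ b(1)]) measurable
 show "integrable lborel (mulx V)" by (rule Bochner_Integration.integrable_bound[OF i _ b(2)]) measurable
qed

text \<open>\<open>Ph\<close> is the transform of the flux and \<open>Ps\<close> that of its
  convolution with the kernel. Products of functions are convolutions of transforms, whence the
  factors 1 / sqrt(2 pi).\<close>

definition Ph :: "(real \<Rightarrow> complex) \<Rightarrow> real \<Rightarrow> complex" where
 "Ph V k = cr ((3 - \<gamma>) / 2 * (1 / sqrt (2 * pi))) * cv V V k
  + cr (\<gamma> / 2 * (1 / sqrt (2 * pi))) * cv (mulx V) (mulx V) k + cr (2 * \<omega>) * V k"

definition Ps :: "(real \<Rightarrow> complex) \<Rightarrow> real \<Rightarrow> complex" where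
 "Ps V k = cr (1 / (1 + k\<^sup>2)) * Ph V k"

lemma symbol_identity:
 fixes k y q a c :: real and P Q :: complex
 shows "\<i> * (cr (- (a * y + q * ((3 - a) / 2 - a / 2 * (k - y) * y)) * c) * (P * Q))
  = - cr (a * c) * (P * (\<i> * cr y * Q))
   - \<i> * cr q * (cr ((3 - a) / 2 * c) * (P * Q)
     + cr (a / 2 * c) * ((\<i> * cr (k - y) * P) * (\<i> * cr y * Q)))"
proof -
 have "\<i> * (cr r * (P * Q)) = (\<i> * cr r) * (P * Q)" for r by simp
 moreover have "- cr (a * c) * (P * (\<i> * cr y * Q))
   - \<i> * cr q * (cr ((3 - a) / 2 * c) * (P * Q)
     + cr (a / 2 * c) * ((\<i> * cr (k - y) * P) * (\<i> * cr y * Q)))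
  = (- cr (a * c) * (\<i> * cr y)
   - \<i> * cr q * (cr ((3 - a) / 2 * c)
     + cr (a / 2 * c) * ((\<i> * cr (k - y)) * (\<i> * cr y)))) * (P * Q)"
  by (simp only: ring_distribs mult_minus_left mult_minus_right mult_ac)
 moreover have "\<i> * cr (- (a * y + q * ((3 - a) / 2 - a / 2 * (k - y) * y)) * c)
  = - cr (a * c) * (\<i> * cr y)
   - \<i> * cr q * (cr ((3 - a) / 2 * c)
     + cr (a / 2 * c) * ((\<i> * cr (k - y)) * (\<i> * cr y)))"
  by (simp add: complex_eq_iff) (simp add: algebra_simps)
 ultimately show ?thesis by simp
qed

text \<open>Reads \<open>br\<close> summand by summand: each frequency factor turns an input from
  \<open>V\<close> into \<open>mulx V\<close>, and the integral becomes a sum of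
  convolutions.\<close>

lemma Nl_symbol:
 assumes V: "V \<in> H (gw 0)"
 shows "Nl V k = - cr (\<gamma> * (1 / sqrt (2 * pi))) * cv V (mulx V) k - mulx (Ps V) k"
proof -
 let ?c = "1 / sqrt (2 * pi)" and ?q = "k / (1 + k\<^sup>2)"
 note o = H_kw_one[OF H_gk[OF V]] mulx_H_one[OF V]
 have i: "integrable lborel (\<lambda>y. V (k - y) * V y)" "integrable lborel (\<lambda>y. V (k - y) * mulx V y)"
  "integrable lborel (\<lambda>y. mulx V (k - y) * mulx V y)"
  by (intro pair_CS(1) H_one_reflect o)+
 have br: "br k y = - (\<gamma> * y + ?q * ((3 - \<gamma>) / 2 - \<gamma> / 2 * (k - y) * y)) * ?c" for y
  by (simp only: br_def divide_inverse mult_1_left)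
 have "Bl V V k = (LINT y|lborel. \<i> * (cr (br k y) * (V (k - y) * V y)))"
  unfolding Bl_def by simp
 also have "\<dots> = (LINT y|lborel. - cr (\<gamma> * ?c) * (V (k - y) * mulx V y)
   - \<i> * cr ?q * (cr ((3 - \<gamma>) / 2 * ?c) * (V (k - y) * V y)
     + cr (\<gamma> / 2 * ?c) * (mulx V (k - y) * mulx V y)))"
  unfolding br symbol_identity mulx_def ..
 also have "\<dots> = - cr (\<gamma> * ?c) * cv V (mulx V) k
   - \<i> * cr ?q * (cr ((3 - \<gamma>) / 2 * ?c) * cv V V k
     + cr (\<gamma> / 2 * ?c) * cv (mulx V) (mulx V) k)"
  unfolding cv_def using i by (simp only: Bochner_Integration.integral_diff Bochner_Integration.integral_add
    integral_mult_right_zero integrable_mult_right Bochner_Integration.integrable_add Bochner_Integration.integrable_diff)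
 finally have B: "Bl V V k = \<dots>" .
 have q: "\<i> * cr k * (cr (1 / (1 + k\<^sup>2)) * X) = \<i> * cr ?q * X" for X by simp
 have L: "Li V k = - (\<i> * cr ?q * (cr (2 * \<omega>) * V k))" by (simp add: Li_def)
 show ?thesis unfolding Nl_def B L mulx_def[of "Ps V"] Ps_def q Ph_def distrib_left[of "\<i> * cr ?q"] by (simp only: diff_conv_add_uminus minus_add_distrib add_ac)
qed

lemma integrable_damp:
 assumes P: "integrable lborel P"
 shows "integrable lborel (\<lambda>k. cr (1 / (1 + k\<^sup>2)) * P k)" (is ?a)
  and "integrable lborel (mulx (\<lambda>k. cr (1 / (1 + k\<^sup>2)) * P k))" (is ?b)
proof -
 have [measurable]: "P \<in> BM" using P by auto
 have p: "0 < 1 + k\<^sup>2" for k :: real by (simp add: add_pos_nonneg)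
 have 1: "cmod (cr (1 / (1 + k\<^sup>2)) * P k) \<le> cmod (P k)" for k
 proof -
  have "\<bar>1 / (1 + k\<^sup>2)\<bar> \<le> 1" using p[of k] by (simp add: abs_of_pos)
  from mult_right_mono[OF this, of "cmod (P k)"] show ?thesis unfolding norm_mult norm_of_real by simp
 qed
 have 2: "cmod (mulx (\<lambda>k. cr (1 / (1 + k\<^sup>2)) * P k) k) \<le> cmod (P k)" for k
 proof -
  have "\<bar>k / (1 + k\<^sup>2)\<bar> \<le> 1 / J k" by (rule abs_div_bracket)
  also have "\<dots> \<le> 1" using J_ge_1[of k] by simp
  finally have "\<bar>k / (1 + k\<^sup>2)\<bar> * cmod (P k) \<le> 1 * cmod (P k)" by (rule mult_right_mono) simp
  moreover have "\<bar>k / (1 + k\<^sup>2)\<bar> = \<bar>k\<bar> * \<bar>1 / (1 + k\<^sup>2)\<bar>" by (simp add: abs_mult[symmetric])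
  ultimately show ?thesis unfolding mulx_def norm_mult norm_of_real norm_ii by (simp only: mult_1_left mult.assoc)
 qed
 show ?a by (rule Bochner_Integration.integrable_bound[OF P]) (measurable, use 1 in simp)
 show ?b by (rule Bochner_Integration.integrable_bound[OF P]) (measurable, use 2 in simp)
qed

context
 fixes V :: "real \<Rightarrow> complex"
 assumes V: "V \<in> H (gw 0)" "herm V"
begin

private abbreviation (input) "a \<equiv> \<lambda>x. Re (ft 1 V x)"
private abbreviation (input) "b \<equiv> \<lambda>x. Re (ft 1 (mulx V) x)"

lemma ft_real: "ft 1 V x = cr (a x)" "ft 1 (mulx V) x = cr (b x)"
proof -
 have h: "AE k in lborel. V (- k) = cnj (V k)" using V(2) by (simp add: herm_def)
 then have h': "AE k in lborel. mulx V (- k) = cnj (mulx V k)" by eventually_elim (simp add: mulx_def)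
 note [measurable] = H_measurable[OF V(1)]
 show "ft 1 V x = cr (a x)" by (rule ft_hermitian_real[OF _ h]) simp
 show "ft 1 (mulx V) x = cr (b x)" by (rule ft_hermitian_real[OF _ h']) simp
qed

lemma sqrt_cancel: "cr (p * (1 / sqrt (2 * pi))) * (cr (sqrt (2 * pi)) * X) = cr p * X"
proof -
 have "cr (p * (1 / r)) * (cr r * X) = cr p * X" if "r \<noteq> 0" for r using that by simp
 from this[of "sqrt (2 * pi)"] show ?thesis by simp
qed

lemma Ph_integrable: "integrable lborel (Ph V)"
 unfolding Ph_def[abs_def]
 by (intro Bochner_Integration.integrable_add integrable_mult_right cv_integrable H_gw_integrable mulx_integrable V)

lemma ft_Ph: "ft 1 (Ph V) x = cr (rod_flux \<omega> \<gamma> a b x)"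
proof -
 note i = cv_integrable[OF H_gw_integrable H_gw_integrable, OF V(1) V(1)] cv_integrable[OF mulx_integrable mulx_integrable, OF V(1) V(1)]
 have "ft 1 (Ph V) x = cr ((3 - \<gamma>) / 2 * (1 / sqrt (2 * pi))) * ft 1 (cv V V) x
  + cr (\<gamma> / 2 * (1 / sqrt (2 * pi))) * ft 1 (cv (mulx V) (mulx V)) x + cr (2 * \<omega>) * ft 1 V x"
 proof -
  have "ft 1 (\<lambda>k. p * f k + q * g k + r * h k) x = p * ft 1 f x + q * ft 1 g x + r * ft 1 h x"
   if "integrable lborel f" "integrable lborel g" "integrable lborel h" for p q r f g h
   using ft_add[of "\<lambda>k. p * f k + q * g k" "\<lambda>k. r * h k" 1 x] ft_add[of "\<lambda>k. p * f k" "\<lambda>k. q * g k" 1 x] that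
   by (simp add: ft_cmult)
  from this[OF i H_gw_integrable[OF V(1)]] show ?thesis unfolding Ph_def[abs_def] .
 qed
 also have "ft 1 (cv V V) x = cr (sqrt (2 * pi)) * (ft 1 V x * ft 1 V x)"
  by (intro ft_cv H_gw_integrable V)
 also have "ft 1 (cv (mulx V) (mulx V)) x = cr (sqrt (2 * pi)) * (ft 1 (mulx V) x * ft 1 (mulx V) x)"
  by (intro ft_cv mulx_integrable V)
 finally have e: "ft 1 (Ph V) x = cr ((3 - \<gamma>) / 2) * (ft 1 V x * ft 1 V x)
   + cr (\<gamma> / 2) * (ft 1 (mulx V) x * ft 1 (mulx V) x) + cr (2 * \<omega>) * ft 1 V x"
  unfolding sqrt_cancel .
 obtain p q where pq: "ft 1 V x = cr p" "ft 1 (mulx V) x = cr q" using ft_real[of x] by blast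
 show ?thesis unfolding e rod_flux_def pq Re_complex_of_real by (simp add: power2_eq_square)
qed

lemma convolution_flux: "Defs.convolution peak_kernel (rod_flux \<omega> \<gamma> a b) = (\<lambda>x. Re (ft 1 (Ps V) x))"
proof
 fix x
 have e: "rod_flux \<omega> \<gamma> a b = (\<lambda>x. Re (ft 1 (Ph V) x))" by (simp add: ft_Ph)
 show "Defs.convolution peak_kernel (rod_flux \<omega> \<gamma> a b) x = Re (ft 1 (Ps V) x)"
  unfolding e Ps_def[abs_def] by (rule convolution_peak_ft[OF Ph_integrable]) (simp add: ft_Ph)
qed

lemma Ps_integrable: "integrable lborel (Ps V)" "integrable lborel (mulx (Ps V))"
 unfolding Ps_def[abs_def] by (rule integrable_damp[OF Ph_integrable])+

lemma Nl_eq: "Nl V = (\<lambda>k. - cr (\<gamma> * (1 / sqrt (2 * pi))) * cv V (mulx V) k - mulx (Ps V) k)"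
 using Nl_symbol[OF V(1)] by blast

lemma Nl_integrable: "integrable lborel (Nl V)"
 unfolding Nl_eq
 by (intro Bochner_Integration.integrable_diff integrable_mult_right cv_integrable H_gw_integrable mulx_integrable V Ps_integrable)

lemma ft_Nl: "Re (ft 1 (Nl V) x) = - (\<gamma> * a x * b x + Re (ft 1 (mulx (Ps V)) x))"
proof -
 have i: "integrable lborel (cv V (mulx V))" by (intro cv_integrable H_gw_integrable mulx_integrable V)
 have "ft 1 (Nl V) x = - cr (\<gamma> * (1 / sqrt (2 * pi))) * ft 1 (cv V (mulx V)) x - ft 1 (mulx (Ps V)) x"
  unfolding Nl_eq by (subst ft_diff[OF integrable_mult_right[OF i] Ps_integrable(2)]) (simp only: ft_cmult)
 also have "ft 1 (cv V (mulx V)) x = cr (sqrt (2 * pi)) * (ft 1 V x * ft 1 (mulx V) x)"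
  by (intro ft_cv H_gw_integrable mulx_integrable V)
 finally have e: "ft 1 (Nl V) x = - cr \<gamma> * (ft 1 V x * ft 1 (mulx V) x) - ft 1 (mulx (Ps V)) x"
  unfolding sqrt_cancel mult_minus_left .
 obtain p q where pq: "ft 1 V x = cr p" "ft 1 (mulx V) x = cr q" using ft_real[of x] by blast
 show ?thesis unfolding e pq Re_complex_of_real by simp
qed

end

text \<open>The bridge between the two formulations. By uniqueness of weak derivatives the witnesses
  in \<open>rod_equation\<close> may be taken as inverse transforms; equality of functions and
  equality of transforms are then equivalent by \<open>fourier_inversion\<close> and
  \<open>has_fourier_ft\<close>.\<close>

theorem rod_equation_iff:
 assumes v: "v \<in> L2" and V: "fourier v \<in> H (gw 0)" and vt: "vt \<in> L2"
 shows "rod_equation \<omega> \<gamma> v vt \<longleftrightarrow> (aeq (fourier vt) (Nl (fourier v)))"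
proof -
 define V where "V = fourier v"
 have VH: "V \<in> H (gw 0)" using V by (simp add: V_def)
 have fv: "has_fourier v V" unfolding V_def by (rule has_fourier_fourier[OF v])
 have Vh: "herm V" using has_fourier_hermitian[OF v fv] by (simp add: herm_def)
 note [measurable] = H_measurable[OF VH]
 have [measurable]: "v \<in> BM" "vt \<in> BM" using v vt by (auto simp: L2_def)
 note Vi = H_gw_integrable[OF VH] mulx_integrable[OF VH]
 let ?a = "\<lambda>x. Re (ft 1 V x)" and ?b = "\<lambda>x. Re (ft 1 (mulx V) x)" and ?w = "\<lambda>x. Re (ft 1 (mulx (Ps V)) x)"
 have av: "AE x in lborel. v x = ?a x"
  using fourier_inversion[OF v fv Vi(1)] by eventually_elim (metis Re_complex_of_real)
 have Dv: "has_weak_deriv v ?b"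
  by (rule has_weak_deriv_cong[OF weak_deriv_ft[OF Vi]]) (use av in \<open>eventually_elim, simp\<close>, simp)
 have Dw: "has_weak_deriv (\<lambda>x. Re (ft 1 (Ps V) x)) ?w" by (rule weak_deriv_ft[OF Ps_integrable[OF VH Vh]])
 \<comment> \<open>The convolution is an integral, so it depends on v and vx only up to null sets,
   and the identity holds at every x.\<close>
 have conv: "Defs.convolution peak_kernel (rod_flux \<omega> \<gamma> v vx) = (\<lambda>x. Re (ft 1 (Ps V) x))"
  if [measurable]: "vx \<in> BM" and ae: "AE x in lborel. vx x = ?b x" for vx
 proof -
  have [measurable]: "peak_kernel \<in> BM" unfolding peak_kernel_def[abs_def] by measurable
  have "Defs.convolution peak_kernel (rod_flux \<omega> \<gamma> v vx) x = Defs.convolution peak_kernel (rod_flux \<omega> \<gamma> ?a ?b) x" for x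
   unfolding Defs.convolution_def rod_flux_def
   by (rule integral_cong_AE) (measurable, use av ae in \<open>eventually_elim, simp\<close>)
  then show ?thesis unfolding convolution_flux[OF VH Vh, symmetric] by blast
 qed
 have "rod_equation \<omega> \<gamma> v vt \<longleftrightarrow> (AE x in lborel. vt x = Re (ft 1 (Nl V) x))"
 proof
  assume "rod_equation \<omega> \<gamma> v vt"
  then obtain vx w where D: "has_weak_deriv v vx" "has_weak_deriv (Defs.convolution peak_kernel (rod_flux \<omega> \<gamma> v vx)) w"
   and eq: "AE x in lborel. vt x + \<gamma> * v x * vx x + w x = 0" unfolding rod_equation_def by blast
  have vx: "AE x in lborel. vx x = ?b x" by (rule weak_deriv_unique[OF D(1) Dv])
  have "vx \<in> BM" using D(1) by (simp add: has_weak_deriv_def locally_integrable_def)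
  from D(2)[unfolded conv[OF this vx]] have w: "AE x in lborel. w x = ?w x" by (rule weak_deriv_unique[OF _ Dw])
  show "AE x in lborel. vt x = Re (ft 1 (Nl V) x)"
   using eq av vx w unfolding ft_Nl[OF VH Vh] by eventually_elim simp
 next
  assume vt: "AE x in lborel. vt x = Re (ft 1 (Nl V) x)"
  have c: "Defs.convolution peak_kernel (rod_flux \<omega> \<gamma> v ?b) = (\<lambda>x. Re (ft 1 (Ps V) x))" by (rule conv) simp_all
  have "AE x in lborel. vt x + \<gamma> * v x * ?b x + ?w x = 0"
   using vt av unfolding ft_Nl[OF VH Vh] by eventually_elim simp
  then show "rod_equation \<omega> \<gamma> v vt" unfolding rod_equation_def using Dv Dw[folded c] by blast
 qed
 also have "\<dots> \<longleftrightarrow> (aeq (fourier vt) (Nl V))"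
 proof -
  have NH: "Nl V \<in> H one" by (rule H_kw_one[OF Nl_bound(1)[OF order_refl VH]])
  have Nm: "Nl V \<in> BM" by simp
  have h: "AE k in lborel. Nl V (- k) = cnj (Nl V k)" using herm_Nl[OF _ Vh] by (simp add: herm_def)
  note n = has_fourier_ft[OF NH Nl_integrable[OF VH Vh] h]
  show ?thesis
  proof
   assume ae: "AE x in lborel. vt x = Re (ft 1 (Nl V) x)"
   then have "AE x in lborel. Re (ft 1 (Nl V) x) = vt x" by eventually_elim simp
   from has_fourier_cong[OF n(1) vt this n(2) Nm] have "has_fourier vt (Nl V)" by simp
   then show "aeq (fourier vt) (Nl V)" by (rule has_fourier_unique[OF vt has_fourier_fourier[OF vt]])
  next
   assume ae: "aeq (fourier vt) (Nl V)"
   have "has_fourier vt (Nl V)" by (rule has_fourier_cong[OF vt vt _ has_fourier_fourier[OF vt] Nm ae]) simp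
   from fourier_inversion[OF vt this Nl_integrable[OF VH Vh]]
   show "AE x in lborel. vt x = Re (ft 1 (Nl V) x)" by eventually_elim (metis Re_complex_of_real)
  qed
 qed
 finally show ?thesis by (simp add: V_def)
qed

end

section \<open>Sobolev functions and their transforms\<close>

lemma L2_lincomb: "f \<in> L2 \<Longrightarrow> g \<in> L2 \<Longrightarrow> (\<lambda>x. c * f x + d * g x) \<in> L2"
 using H_add(1)[OF weight_one H_scale(1)[OF weight_one] H_scale(1)[OF weight_one], of "\<lambda>x. cr (f x)" "\<lambda>x. cr (g x)" "cr c" "cr d"]
  H_of_real[of "\<lambda>x. c * f x + d * g x"] H_of_real[of f] H_of_real[of g] by simp

lemma fourier_measurable: "f \<in> L2 \<Longrightarrow> fourier f \<in> BM"
 by (rule H_measurable[OF has_fourier_H[OF _ has_fourier_fourier]])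

lemma fourier_herm: "f \<in> L2 \<Longrightarrow> herm (fourier f)"
 using has_fourier_hermitian[OF _ has_fourier_fourier] by (simp add: herm_def)

lemma fourier_lincomb:
 assumes f: "f \<in> L2" and g: "g \<in> L2"
 shows "AE k in lborel. fourier (\<lambda>x. c * f x + d * g x) k = cr c * fourier f k + cr d * fourier g k"
 by (intro has_fourier_unique[OF L2_lincomb[OF f g] has_fourier_fourier[OF L2_lincomb[OF f g]]] has_fourier_lincomb has_fourier_fourier f g)

lemma
 assumes f: "f \<in> L2" and g: "g \<in> L2"
 shows L2_diff: "(\<lambda>x. f x - g x) \<in> L2"
  and fourier_diff: "AE k in lborel. fourier (\<lambda>x. f x - g x) k = fourier f k - fourier g k"
 using L2_lincomb[OF f g, of 1 "- 1"] fourier_lincomb[OF f g, of 1 "- 1"] by simp_all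

lemma fourier_diff_quotient:
 assumes f: "f \<in> L2" and g: "g \<in> L2" and h: "h \<in> L2"
 shows "(\<lambda>x. (f x - g x) / c - h x) \<in> L2"
  and "AE k in lborel. fourier (\<lambda>x. (f x - g x) / c - h x) k = (fourier f k - fourier g k) / cr c - fourier h k"
proof -
 note d = L2_diff[OF f g] fourier_diff[OF f g]
 have e: "(\<lambda>x. (f x - g x) / c - h x) = (\<lambda>x. (1 / c) * (f x - g x) + (- 1) * h x)" by auto
 show "(\<lambda>x. (f x - g x) / c - h x) \<in> L2" unfolding e by (rule L2_lincomb[OF d(1) h])
 show "AE k in lborel. fourier (\<lambda>x. (f x - g x) / c - h x) k = (fourier f k - fourier g k) / cr c - fourier h k"
  unfolding e using fourier_lincomb[OF d(1) h, of "1 / c" "- 1"] d(2) by eventually_elim simp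
qed

lemma sobolev_weight:
 assumes w: "weight w" and sq: "\<And>k. (w k)\<^sup>2 = (1 + k\<^sup>2) powr s"
 shows "f \<in> sobolev s \<longleftrightarrow> f \<in> L2 \<and> fourier f \<in> H w" "sobolev_norm s f = nm w (fourier f)"
proof -
 have e: "(1 + k\<^sup>2) powr s * (cmod (fourier f k))\<^sup>2 = (w k * cmod (fourier f k))\<^sup>2" for k
  by (simp add: power_mult_distrib sq)
 show "f \<in> sobolev s \<longleftrightarrow> f \<in> L2 \<and> fourier f \<in> H w"
 proof (cases "f \<in> L2")
  case True
  note [measurable] = fourier_measurable[OF True] weight_measurable[OF w]
  have "(\<lambda>k. w k * cmod (fourier f k)) \<in> BM" by measurable
  then show ?thesis using True unfolding sobolev_def mem_Collect_eq e by (simp add: square_integrable_real H_def L2_def)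
 next
  case False then show ?thesis by (simp add: sobolev_def square_integrable_real)
 qed
 show "sobolev_norm s f = nm w (fourier f)" unfolding sobolev_norm_def e nm_def l2n_def ..
qed

text \<open>No time of the interval is isolated, so limits along it, one-sided at 0, are
  unique.\<close>

lemma at_within_time_interval:
 assumes "t \<in> time_interval T"
 shows "at t within time_interval T \<noteq> bot"
proof -
 obtain r where r: "t < r" "ereal r \<le> T"
  using assms by (cases T) (auto simp: time_interval_def intro: gt_ex[THEN exE])
 have "{t<..<r} \<subseteq> time_interval T"
  using assms r by (auto simp: time_interval_def intro: less_le_trans[of "ereal x" "ereal r" for x])
 then have "at t within {t..r} \<le> at t within insert r (time_interval T)"
 proof (intro at_le subsetI)
  fix x assume "x \<in> {t..r}"
  then have "x = t \<or> x = r \<or> x \<in> {t<..<r}" by auto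
  then show "x \<in> insert r (time_interval T)" using \<open>{t<..<r} \<subseteq> time_interval T\<close> assms by blast
 qed
 moreover have "at t within insert r (time_interval T) = at t within time_interval T"
  using r(1) by (intro at_within_nhd[of t "{..<r}"]) auto
 ultimately show ?thesis using r(1) by (auto simp: at_within_Icc_at_right bot_unique trivial_limit_at_right_real)
qed

context rod
begin

lemma J_powr_sq: "(J k powr a)\<^sup>2 = (1 + k\<^sup>2) powr a"
 unfolding J_sq[of k, symmetric] using J_pos[of k] by (simp add: power2_eq_square powr_mult)

lemma gw_0: "gw 0 k = J k powr (\<sigma> + 1)"
 using J_pos[of k] by (simp add: gw_eq kw_0 powr_add)

lemma sobolev_g: "f \<in> sobolev (\<sigma> + 1) \<longleftrightarrow> f \<in> L2 \<and> fourier f \<in> H (gw 0)" "sobolev_norm (\<sigma> + 1) f = nm (gw 0) (fourier f)"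
 by (rule sobolev_weight[OF weight_g], simp only: gw_0 J_powr_sq)+

lemma sobolev_k: "f \<in> sobolev \<sigma> \<longleftrightarrow> f \<in> L2 \<and> fourier f \<in> H (kw 0)" "sobolev_norm \<sigma> f = nm (kw 0) (fourier f)"
 by (rule sobolev_weight[OF weight_w], simp only: kw_0 J_powr_sq)+

lemma nm_fourier_diff:
 assumes w: "weight w" and f: "f \<in> L2" and g: "g \<in> L2"
 shows "nm w (fourier (\<lambda>x. f x - g x)) = nd w (fourier f) (fourier g)"
proof -
 note [measurable] = fourier_measurable[OF f] fourier_measurable[OF g]
 show ?thesis by (rule nm_cong_AE[OF w fourier_measurable[OF L2_diff[OF f g]] _ fourier_diff[OF f g]]) measurable
qed

lemma nm_fourier_diff_quotient:
 assumes w: "weight w" and f: "f \<in> L2" and g: "g \<in> L2" and h: "h \<in> L2"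
 shows "nm w (fourier (\<lambda>x. (f x - g x) / c - h x)) = nm w (\<lambda>k. (fourier f k - fourier g k) / cr c - fourier h k)"
proof -
 note [measurable] = fourier_measurable[OF f] fourier_measurable[OF g] fourier_measurable[OF h]
 note q = fourier_diff_quotient[OF f g h, of c]
 show ?thesis by (rule nm_cong_AE[OF w fourier_measurable[OF q(1)] _ q(2)]) measurable
qed

lemma Nl_cong_AE:
 assumes [measurable]: "U \<in> BM" "V \<in> BM" and ae: "aeq U V"
 shows "aeq (Nl U) (Nl V)"
 using ae unfolding Nl_def Li_def Bl_cong_AE[OF assms(1,2,1,2) ae ae] by eventually_elim simp

lemma herm_cong_AE: "herm U \<Longrightarrow> AE k in lborel. U k = V k \<Longrightarrow> herm V"
proof -
 assume h: "herm U" and ae: "aeq U V"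
 from h have "AE k in lborel. U (- k) = cnj (U k)" by (simp add: herm_def)
 with ae AE_minus[OF ae] show "herm V" unfolding herm_def by eventually_elim simp
qed

lemma sol_cong:
 assumes U: "sol S U" and ae: "\<And>t. t \<in> S \<Longrightarrow> aeq (U t) (V t)" and V: "\<And>t. t \<in> S \<Longrightarrow> V t \<in> BM"
 shows "sol S V"
 unfolding sol_def
proof (intro ballI conjI)
 fix t assume t: "t \<in> S"
 note D = solD[OF U t]
 note [measurable] = V[OF t] H_measurable[OF D(1)]
 show VH: "V t \<in> H (gw 0)" by (rule H_cong_AE[OF weight_g D(1) V[OF t] ae[OF t]])
 show "herm (V t)" by (rule herm_cong_AE[OF D(2) ae[OF t]])
 have e1: "nd (gw 0) (U \<tau>) (U t) = nd (gw 0) (V \<tau>) (V t)" if \<tau>: "\<tau> \<in> S" for \<tau>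
 proof -
  note [measurable] = V[OF \<tau>] H_measurable[OF solD(1)[OF U \<tau>]]
  have "AE k in lborel. U \<tau> k - U t k = V \<tau> k - V t k" using ae[OF t] ae[OF \<tau>] by eventually_elim simp
  from nm_cong_AE[OF weight_g _ _ this] show ?thesis by simp
 qed
 show "((\<lambda>\<tau>. nd (gw 0) (V \<tau>) (V t)) \<longlongrightarrow> 0) (at t within S)"
  by (rule Lim_transform_within[OF D(3) zero_less_one]) (rule e1)
 have e2: "dq (kw 0) U \<tau> t (Nl (U t)) = dq (kw 0) V \<tau> t (Nl (V t))" if \<tau>: "\<tau> \<in> S" for \<tau>
 proof -
  note [measurable] = V[OF \<tau>] H_measurable[OF solD(1)[OF U \<tau>]]
  have "AE k in lborel. (U \<tau> k - U t k) / cr (\<tau> - t) - Nl (U t) k = (V \<tau> k - V t k) / cr (\<tau> - t) - Nl (V t) k"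
   using ae[OF t] ae[OF \<tau>] Nl_cong_AE[OF H_measurable[OF D(1)] V[OF t] ae[OF t]] by eventually_elim simp
  from nm_cong_AE[OF weight_w _ _ this] show ?thesis by simp
 qed
 show "((\<lambda>\<tau>. dq (kw 0) V \<tau> t (Nl (V t))) \<longlongrightarrow> 0) (at t within S)"
  by (rule Lim_transform_within[OF D(4) zero_less_one]) (rule e2)
qed

lemma nm_limit_unique:
 assumes w: "weight w" and F: "F \<noteq> bot" and f: "\<forall>\<^sub>F \<tau> in F. f \<tau> \<in> H w" and g: "g \<in> H w" and h: "h \<in> H w"
  and lim: "((\<lambda>\<tau>. nd w (f \<tau>) g) \<longlongrightarrow> 0) F" "((\<lambda>\<tau>. nd w (f \<tau>) h) \<longlongrightarrow> 0) F"
 shows "aeq g h"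
proof -
 have "((\<lambda>\<tau>. nd w g h) \<longlongrightarrow> 0) F"
 proof (rule Lim_null_comparison)
  show "((\<lambda>\<tau>. nd w (f \<tau>) g + nd w (f \<tau>) h) \<longlongrightarrow> 0) F" using tendsto_add[OF lim] by simp
  show "\<forall>\<^sub>F \<tau> in F. norm (nd w g h) \<le> nd w (f \<tau>) g + nd w (f \<tau>) h"
   using f
  proof eventually_elim
   fix \<tau> assume "f \<tau> \<in> H w"
   from nm_tri[OF w g this h] show "norm (nd w g h) \<le> nd w (f \<tau>) g + nd w (f \<tau>) h"
    by (simp add: nm_minus_commute[of w g])
  qed
 qed
 then have "nd w g h = 0" using tendsto_unique[OF F tendsto_const] by blast
 from nm_eq_0[OF H_diff(1)[OF w g h] w this] show ?thesis by simp
qed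

lemma Nl_tendsto:
 assumes U: "((\<lambda>\<tau>. nd (gw 0) (U \<tau>) (U t)) \<longlongrightarrow> 0) (at t within S)" and S: "\<And>\<tau>. \<tau> \<in> S \<Longrightarrow> U \<tau> \<in> H (gw 0)" and t: "t \<in> S"
 shows "((\<lambda>\<tau>. nd (kw 0) (Nl (U \<tau>)) (Nl (U t))) \<longlongrightarrow> 0) (at t within S)"
proof (rule Lim_null_comparison)
 have c: "((\<lambda>\<tau>. nm (gw 0) (U \<tau>)) \<longlongrightarrow> nm (gw 0) (U t)) (at t within S)" by (rule nm_continuous[OF weight_g S t U])
 have "((\<lambda>\<tau>. cN * (1 + nm (gw 0) (U \<tau>) + nm (gw 0) (U t)) * nd (gw 0) (U \<tau>) (U t)) \<longlongrightarrow> cN * (1 + nm (gw 0) (U t) + nm (gw 0) (U t)) * 0) (at t within S)"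
  by (intro tendsto_mult tendsto_add tendsto_const c U)
 then show "((\<lambda>\<tau>. cN * (1 + nm (gw 0) (U \<tau>) + nm (gw 0) (U t)) * nd (gw 0) (U \<tau>) (U t)) \<longlongrightarrow> 0) (at t within S)" by simp
 show "\<forall>\<^sub>F \<tau> in at t within S. norm (nd (kw 0) (Nl (U \<tau>)) (Nl (U t))) \<le> cN * (1 + nm (gw 0) (U \<tau>) + nm (gw 0) (U t)) * nd (gw 0) (U \<tau>) (U t)"
  unfolding eventually_at_filter
 proof (intro always_eventually allI impI)
  fix \<tau> assume "\<tau> \<in> S"
  from Nl_lipschitz[OF S[OF this] S[OF t]]
  show "norm (nd (kw 0) (Nl (U \<tau>)) (Nl (U t))) \<le> cN * (1 + nm (gw 0) (U \<tau>) + nm (gw 0) (U t)) * nd (gw 0) (U \<tau>) (U t)" by simp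
 qed
qed

lemma sobolev_continuous_g:
 "sobolev_continuous (\<sigma> + 1) T u \<longleftrightarrow> (\<forall>t\<in>time_interval T. u t \<in> L2 \<and> fourier (u t) \<in> H (gw 0) \<and>
   ((\<lambda>\<tau>. nd (gw 0) (fourier (u \<tau>)) (fourier (u t))) \<longlongrightarrow> 0) (at t within time_interval T))" (is "_ \<longleftrightarrow> ?R")
proof -
 have e: "((\<lambda>\<tau>. sobolev_norm (\<sigma> + 1) (\<lambda>x. u \<tau> x - u t x)) \<longlongrightarrow> 0) (at t within time_interval T)
  \<longleftrightarrow> ((\<lambda>\<tau>. nd (gw 0) (fourier (u \<tau>)) (fourier (u t))) \<longlongrightarrow> 0) (at t within time_interval T)"
  if "\<forall>t\<in>time_interval T. u t \<in> L2" "t \<in> time_interval T" for t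
  unfolding sobolev_g
  by (rule Lim_cong_within) (use that nm_fourier_diff[OF weight_g] in auto)
 show ?thesis unfolding sobolev_continuous_def sobolev_g(1) using e by blast
qed

lemma sobolev_continuous_k:
 "sobolev_continuous \<sigma> T u \<longleftrightarrow> (\<forall>t\<in>time_interval T. u t \<in> L2 \<and> fourier (u t) \<in> H (kw 0) \<and>
   ((\<lambda>\<tau>. nd (kw 0) (fourier (u \<tau>)) (fourier (u t))) \<longlongrightarrow> 0) (at t within time_interval T))" (is "_ \<longleftrightarrow> ?R")
proof -
 have e: "((\<lambda>\<tau>. sobolev_norm \<sigma> (\<lambda>x. u \<tau> x - u t x)) \<longlongrightarrow> 0) (at t within time_interval T)
  \<longleftrightarrow> ((\<lambda>\<tau>. nd (kw 0) (fourier (u \<tau>)) (fourier (u t))) \<longlongrightarrow> 0) (at t within time_interval T)"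
  if "\<forall>t\<in>time_interval T. u t \<in> L2" "t \<in> time_interval T" for t
  unfolding sobolev_k
  by (rule Lim_cong_within) (use that nm_fourier_diff[OF weight_w] in auto)
 show ?thesis unfolding sobolev_continuous_def sobolev_k(1) using e by blast
qed

lemma sobolev_C1_k:
 assumes C: "sobolev_C1 \<sigma> T u u'" and t: "t \<in> time_interval T"
 shows "u t \<in> L2" "u' t \<in> L2" "fourier (u t) \<in> H (kw 0)" "fourier (u' t) \<in> H (kw 0)"
  "((\<lambda>\<tau>. nd (kw 0) (fourier (u' \<tau>)) (fourier (u' t))) \<longlongrightarrow> 0) (at t within time_interval T)"
  "((\<lambda>\<tau>. nm (kw 0) (\<lambda>k. (fourier (u \<tau>) k - fourier (u t) k) / cr (\<tau> - t) - fourier (u' t) k)) \<longlongrightarrow> 0) (at t within time_interval T)"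
proof -
 have u: "\<And>t. t \<in> time_interval T \<Longrightarrow> u t \<in> L2 \<and> fourier (u t) \<in> H (kw 0)"
  and u': "\<And>t. t \<in> time_interval T \<Longrightarrow> u' t \<in> L2 \<and> fourier (u' t) \<in> H (kw 0)"
  using C unfolding sobolev_C1_def sobolev_continuous_k by auto
 show "u t \<in> L2" "u' t \<in> L2" "fourier (u t) \<in> H (kw 0)" "fourier (u' t) \<in> H (kw 0)" using u[OF t] u'[OF t] by auto
 show "((\<lambda>\<tau>. nd (kw 0) (fourier (u' \<tau>)) (fourier (u' t))) \<longlongrightarrow> 0) (at t within time_interval T)"
  using C t unfolding sobolev_C1_def sobolev_continuous_k by auto
 have "((\<lambda>\<tau>. nm (kw 0) (fourier (\<lambda>x. (u \<tau> x - u t x) / (\<tau> - t) - u' t x))) \<longlongrightarrow> 0) (at t within time_interval T)"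
  using C t unfolding sobolev_C1_def sobolev_k(2) by auto
 then show "((\<lambda>\<tau>. nm (kw 0) (\<lambda>k. (fourier (u \<tau>) k - fourier (u t) k) / cr (\<tau> - t) - fourier (u' t) k)) \<longlongrightarrow> 0) (at t within time_interval T)"
  by (rule Lim_transform_within[OF _ zero_less_one]) (rule nm_fourier_diff_quotient[OF weight_w]; use u u' t in simp)
qed

text \<open>\<open>rod_equation\<close> is imposed at positive times; continuity of
  \<open>u'\<close> and of \<open>Nl\<close> along the solution extends the identity to t = 0. By
  the last claim every admissible time derivative is \<open>Nl\<close> of the solution, because the
  difference quotients have only one limit.\<close>

theorem rod_solution_sol:
 assumes R: "rod_solution \<omega> \<gamma> (\<sigma> + 1) u0 T u"
 shows "sol (time_interval T) (\<lambda>t. fourier (u t))"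
  and "t \<in> time_interval T \<Longrightarrow> u t \<in> L2"
  and "sobolev_C1 \<sigma> T u v \<Longrightarrow> t \<in> time_interval T \<Longrightarrow> aeq (fourier (v t)) (Nl (fourier (u t)))"
proof -
 let ?I = "time_interval T" and ?U = "\<lambda>t. fourier (u t)"
 from R have S: "sobolev_continuous (\<sigma> + 1) T u" and "\<exists>u'. sobolev_C1 (\<sigma> + 1 - 1) T u u' \<and> (\<forall>t\<in>?I. 0 < t \<longrightarrow> rod_equation \<omega> \<gamma> (u t) (u' t))"
  by (auto simp: rod_solution_def)
 then obtain u' where C: "sobolev_C1 \<sigma> T u u'" and eq: "\<And>t. t \<in> ?I \<Longrightarrow> 0 < t \<Longrightarrow> rod_equation \<omega> \<gamma> (u t) (u' t)" by auto
 have u: "u t \<in> L2" "?U t \<in> H (gw 0)" "((\<lambda>\<tau>. nd (gw 0) (?U \<tau>) (?U t)) \<longlongrightarrow> 0) (at t within ?I)" if "t \<in> ?I" for t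
  using S that unfolding sobolev_continuous_g by auto
 note c = sobolev_C1_k[OF C]
 have NH: "Nl (?U t) \<in> H (kw 0)" if "t \<in> ?I" for t by (rule Nl_bound(1)[OF order_refl u(2)[OF that]])
 have pos: "aeq (fourier (u' t)) (Nl (?U t))" if "t \<in> ?I" "0 < t" for t
  using eq[OF that] rod_equation_iff[OF u(1,2)[OF that(1)] c(2)[OF that(1)]] by simp
 have E: "aeq (fourier (u' t)) (Nl (?U t))" if t: "t \<in> ?I" for t
 proof (cases "0 < t")
  case True then show ?thesis by (rule pos[OF t])
 next
  case False
  then have t0: "t = 0" using t by (simp add: time_interval_def)
  have "((\<lambda>\<tau>. nd (kw 0) (fourier (u' \<tau>)) (Nl (?U t))) \<longlongrightarrow> 0) (at t within ?I)"
  proof (rule Lim_transform_within[OF Nl_tendsto[OF u(3)[OF t] u(2) t] zero_less_one])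
   fix \<tau> assume \<tau>: "\<tau> \<in> ?I" "0 < dist \<tau> t"
   then have "0 < \<tau>" using t0 by (auto simp: time_interval_def)
   note ae = pos[OF \<tau>(1) this]
   note [measurable] = H_measurable[OF u(2)[OF t]] H_measurable[OF u(2)[OF \<tau>(1)]] H_measurable[OF c(4)[OF \<tau>(1)]]
   show "nd (kw 0) (Nl (?U \<tau>)) (Nl (?U t)) = nd (kw 0) (fourier (u' \<tau>)) (Nl (?U t))"
    by (rule nm_cong_AE[OF weight_w]) (measurable, use ae in \<open>eventually_elim, simp\<close>)
  qed
  from nm_limit_unique[OF weight_w at_within_time_interval[OF t] _ c(4)[OF t] NH[OF t] c(5)[OF t] this]
  show ?thesis using c(4) by (simp add: eventually_at_filter)
 qed
 have D: "((\<lambda>\<tau>. dq (kw 0) ?U \<tau> t (Nl (?U t))) \<longlongrightarrow> 0) (at t within ?I)" if t: "t \<in> ?I" for t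
 proof (rule Lim_transform_within[OF c(6)[OF t] zero_less_one])
  fix \<tau> assume \<tau>: "\<tau> \<in> ?I"
  note [measurable] = H_measurable[OF NH[OF t]] H_measurable[OF c(3)[OF \<tau>]] H_measurable[OF c(3)[OF t]] H_measurable[OF c(4)[OF t]]
  show "dq (kw 0) ?U \<tau> t (fourier (u' t)) = dq (kw 0) ?U \<tau> t (Nl (?U t))"
   by (rule nm_cong_AE[OF weight_w]) (measurable, use E[OF t] in \<open>eventually_elim, simp\<close>)
 qed
 show "sol ?I ?U" unfolding sol_def using u D fourier_herm by auto
 show "u t \<in> L2" if "t \<in> ?I" by (rule u(1)[OF that])
 show "aeq (fourier (v t)) (Nl (?U t))" if V: "sobolev_C1 \<sigma> T u v" and t: "t \<in> ?I"
 proof (rule nm_limit_unique[OF weight_w at_within_time_interval[OF t] _ sobolev_C1_k(4)[OF V t] NH[OF t] sobolev_C1_k(6)[OF V t] D[OF t]])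
  show "\<forall>\<^sub>F \<tau> in at t within ?I. (\<lambda>k. (?U \<tau> k - ?U t k) / cr (\<tau> - t)) \<in> H (kw 0)"
   using c(3) t by (auto simp: eventually_at_filter intro!: always_eventually H_divide H_diff(1))
 qed
qed

text \<open>The solution and its time derivative are the inverse transforms of U and of
  \<open>Nl U\<close>. The transform selected by \<open>fourier\<close> agrees with U almost
  everywhere only, so the solution property is first moved by \<open>sol_cong\<close>.\<close>

theorem sol_rod_solution:
 assumes U: "sol (time_interval T) U" and T: "0 < T" and u0: "u0 \<in> sobolev (\<sigma> + 1)" and U0: "aeq (U 0) (fourier u0)"
 shows "rod_solution \<omega> \<gamma> (\<sigma> + 1) u0 T (\<lambda>t x. Re (ft 1 (U t) x))"
  and "t \<in> time_interval T \<Longrightarrow> aeq (fourier (\<lambda>x. Re (ft 1 (U t) x))) (U t)"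
proof -
 let ?I = "time_interval T"
 define u where "u t x = Re (ft 1 (U t) x)" for t x
 define u' where "u' t x = Re (ft 1 (Nl (U t)) x)" for t x
 note D = solD[OF U]
 have NH: "Nl (U t) \<in> H (kw 0)" if "t \<in> ?I" for t by (rule Nl_bound(1)[OF order_refl D(1)[OF that]])
 have hU: "AE k in lborel. U t (- k) = cnj (U t k)" if "t \<in> ?I" for t using D(2)[OF that] by (simp add: herm_def)
 have hN: "AE k in lborel. Nl (U t) (- k) = cnj (Nl (U t) k)" if "t \<in> ?I" for t
  using herm_Nl[OF H_measurable[OF D(1)[OF that]] D(2)[OF that]] by (simp add: herm_def)
 have uf: "u t \<in> L2" "aeq (fourier (u t)) (U t)" if "t \<in> ?I" for t
  using has_fourier_ft[OF H_kw_one[OF H_gk[OF D(1)[OF that]]] H_gw_integrable[OF D(1)[OF that]] hU[OF that]]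
  unfolding u_def[abs_def] by (auto intro: has_fourier_unique has_fourier_fourier)
 have uf': "u' t \<in> L2" "aeq (fourier (u' t)) (Nl (U t))" if "t \<in> ?I" for t
  using has_fourier_ft[OF H_kw_one[OF NH[OF that]] Nl_integrable[OF D(1,2)[OF that]] hN[OF that]]
  unfolding u'_def[abs_def] by (auto intro: has_fourier_unique has_fourier_fourier)
 have "aeq (U t) (fourier (u t))" if "t \<in> ?I" for t using uf(2)[OF that] by eventually_elim simp
 then have F: "sol ?I (\<lambda>t. fourier (u t))" by (rule sol_cong[OF U _ fourier_measurable[OF uf(1)]])
 have Nf: "aeq (fourier (u' t)) (Nl (fourier (u t)))" if "t \<in> ?I" for t
  using uf'(2)[OF that] Nl_cong_AE[OF fourier_measurable[OF uf(1)[OF that]] H_measurable[OF D(1)[OF that]] uf(2)[OF that]]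
  by eventually_elim simp
 note E = solD[OF F]
 have NH': "Nl (fourier (u t)) \<in> H (kw 0)" if "t \<in> ?I" for t by (rule Nl_bound(1)[OF order_refl E(1)[OF that]])
 have fm: "fourier (u t) \<in> BM" "fourier (u' t) \<in> BM" if "t \<in> ?I" for t
  by (intro fourier_measurable uf(1) uf'(1) that)+
 have u'H: "fourier (u' t) \<in> H (kw 0)" if "t \<in> ?I" for t
  by (rule H_cong_AE[OF weight_w NH'[OF that] fm(2)[OF that]]) (use Nf[OF that] in \<open>eventually_elim, simp\<close>)
 have z: "0 \<in> ?I" using T by (simp add: time_interval_def zero_ereal_def[symmetric])
 have S: "sobolev_continuous (\<sigma> + 1) T u" unfolding sobolev_continuous_g using uf(1) E(1,3) by blast
 have kE: "((\<lambda>\<tau>. nd (kw 0) (fourier (u \<tau>)) (fourier (u t))) \<longlongrightarrow> 0) (at t within ?I)" if t: "t \<in> ?I" for t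
 proof (rule Lim_null_comparison[OF _ E(3)[OF t]], unfold eventually_at_filter, intro always_eventually allI impI)
  fix \<tau> assume "\<tau> \<in> ?I"
  then show "norm (nd (kw 0) (fourier (u \<tau>)) (fourier (u t))) \<le> nd (gw 0) (fourier (u \<tau>)) (fourier (u t))"
   using H_kw(2)[OF order_refl H_diff(1)[OF weight_g E(1) E(1)[OF t]]] by simp
 qed
 have Sk: "sobolev_continuous \<sigma> T u" unfolding sobolev_continuous_k using uf(1) H_gk[OF E(1)] kE by blast
 have kN: "((\<lambda>\<tau>. nd (kw 0) (fourier (u' \<tau>)) (fourier (u' t))) \<longlongrightarrow> 0) (at t within ?I)" if t: "t \<in> ?I" for t
 proof (rule Lim_transform_within[OF Nl_tendsto[OF E(3)[OF t] E(1) t] zero_less_one])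
  fix \<tau> assume \<tau>: "\<tau> \<in> ?I"
  note [measurable] = H_measurable[OF NH'[OF t]] H_measurable[OF NH'[OF \<tau>]] fm[OF t] fm[OF \<tau>]
  show "nd (kw 0) (Nl (fourier (u \<tau>))) (Nl (fourier (u t))) = nd (kw 0) (fourier (u' \<tau>)) (fourier (u' t))"
   by (rule nm_cong_AE[OF weight_w]) (measurable, use Nf[OF t] Nf[OF \<tau>] in \<open>eventually_elim, simp\<close>)
 qed
 have Sk': "sobolev_continuous \<sigma> T u'" unfolding sobolev_continuous_k using uf'(1) u'H kN by blast
 have q: "((\<lambda>\<tau>. sobolev_norm \<sigma> (\<lambda>x. (u \<tau> x - u t x) / (\<tau> - t) - u' t x)) \<longlongrightarrow> 0) (at t within ?I)" if t: "t \<in> ?I" for t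
  unfolding sobolev_k(2)
 proof (rule Lim_transform_within[OF E(4)[OF t] zero_less_one])
  fix \<tau> assume \<tau>: "\<tau> \<in> ?I"
  note [measurable] = H_measurable[OF NH'[OF t]] H_measurable[OF NH'[OF \<tau>]] fm[OF t] fm[OF \<tau>]
  have "nm (kw 0) (\<lambda>k. (fourier (u \<tau>) k - fourier (u t) k) / cr (\<tau> - t) - Nl (fourier (u t)) k)
   = nm (kw 0) (\<lambda>k. (fourier (u \<tau>) k - fourier (u t) k) / cr (\<tau> - t) - fourier (u' t) k)"
   by (rule nm_cong_AE[OF weight_w]) (measurable, use Nf[OF t] in \<open>eventually_elim, simp\<close>)
  then show "nm (kw 0) (\<lambda>k. (fourier (u \<tau>) k - fourier (u t) k) / cr (\<tau> - t) - Nl (fourier (u t)) k)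
   = nm (kw 0) (fourier (\<lambda>x. (u \<tau> x - u t x) / (\<tau> - t) - u' t x))"
   using nm_fourier_diff_quotient[OF weight_w uf(1)[OF \<tau>] uf(1)[OF t] uf'(1)[OF t]] by simp
 qed
 have C: "sobolev_C1 (\<sigma> + 1 - 1) T u u'" unfolding sobolev_C1_def using Sk Sk' q by simp
 have eq: "rod_equation \<omega> \<gamma> (u t) (u' t)" if t: "t \<in> ?I" for t
  using rod_equation_iff[OF uf(1)[OF t] E(1)[OF t] uf'(1)[OF t]] Nf[OF t] by simp
 have u0': "u0 \<in> L2" "fourier u0 \<in> H (gw 0)" using u0 by (auto simp: sobolev_g)
 have ft0: "ft 1 (U 0) = ft 1 (fourier u0)"
  by (rule ext, rule ft_cong_AE[OF H_measurable[OF D(1)[OF z]] H_measurable[OF u0'(2)] U0])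
 have "AE x in lborel. u 0 x = u0 x"
  using fourier_inversion[OF u0'(1) has_fourier_fourier[OF u0'(1)] H_gw_integrable[OF u0'(2)]]
  unfolding u_def ft0 by eventually_elim (metis Re_complex_of_real)
 then have "rod_solution \<omega> \<gamma> (\<sigma> + 1) u0 T u" unfolding rod_solution_def using S C eq by blast
 then show "rod_solution \<omega> \<gamma> (\<sigma> + 1) u0 T (\<lambda>t x. Re (ft 1 (U t) x))" by (simp add: u_def[abs_def])
 show "aeq (fourier (\<lambda>x. Re (ft 1 (U t) x))) (U t)" if "t \<in> ?I"
  using uf(2)[OF that] by (simp add: u_def[abs_def])
qed

end

section \<open>Maximal solutions\<close>

lemma time_interval_nhd:
 assumes "t \<in> time_interval T"
 obtains r where "t < r" "\<And>x. 0 \<le> x \<Longrightarrow> x < r \<Longrightarrow> x \<in> time_interval T"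
proof -
 obtain r where r: "t < r" "ereal r \<le> T"
  using assms by (cases T) (auto simp: time_interval_def intro: gt_ex[THEN exE])
 have "x \<in> time_interval T" if "0 \<le> x" "x < r" for x
  using that less_le_trans[of "ereal x" "ereal r" T] r(2) by (simp add: time_interval_def)
 then show ?thesis using that r(1) by blast
qed

lemma time_interval_Icc: "t \<in> time_interval T \<Longrightarrow> {0..t} \<subseteq> time_interval T"
proof
 fix x assume "t \<in> time_interval T" "x \<in> {0..t}"
 then show "x \<in> time_interval T" using le_less_trans[of "ereal x" "ereal t" T] by (simp add: time_interval_def)
qed

lemma zero_in_time_interval: "0 < T \<Longrightarrow> 0 \<in> time_interval T"
 by (simp add: time_interval_def zero_ereal_def[symmetric])

context rod
begin

text \<open>Being a solution is local in time, and the local pieces need to agree with U only almost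
  everywhere in frequency.\<close>

lemma sol_glue:
 assumes loc: "\<And>t. t \<in> S \<Longrightarrow> \<exists>V A. open A \<and> t \<in> A \<and> sol (S \<inter> A) V \<and> (\<forall>\<tau>\<in>S \<inter> A. aeq (V \<tau>) (U \<tau>))"
  and m: "\<And>t. t \<in> S \<Longrightarrow> U t \<in> BM"
 shows "sol S U"
 unfolding sol_def
proof
 fix t assume t: "t \<in> S"
 obtain V A where A: "open A" "t \<in> A" "sol (S \<inter> A) V" "\<forall>\<tau>\<in>S \<inter> A. aeq (V \<tau>) (U \<tau>)" using loc[OF t] by blast
 have U: "sol (S \<inter> A) U" by (rule sol_cong[OF A(3)]) (use A(4) m in auto)
 have e: "at t within S = at t within S \<inter> A" by (rule at_within_nhd[OF A(2,1)]) auto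
 show "U t \<in> H (gw 0) \<and> herm (U t) \<and> ((\<lambda>\<tau>. nd (gw 0) (U \<tau>) (U t)) \<longlongrightarrow> 0) (at t within S) \<and>
   ((\<lambda>\<tau>. dq (kw 0) U \<tau> t (Nl (U t))) \<longlongrightarrow> 0) (at t within S)"
  unfolding e using solD[OF U, of t] t A(2) by blast
qed

lemma sol_unique_interval:
 assumes U: "sol (time_interval T) U" and V: "sol (time_interval S) V" and 0: "aeq (U 0) (V 0)"
  and t: "t \<in> time_interval T" "t \<in> time_interval S"
 shows "aeq (U t) (V t)"
 by (rule sol_unique[OF sol_mono[OF U time_interval_Icc[OF t(1)]] sol_mono[OF V time_interval_Icc[OF t(2)]] 0])
  (use t in \<open>simp add: time_interval_def\<close>)

text \<open>The equation is autonomous, so a local solution started from U(t0) follows the shifted U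
  as long as both live.\<close>

lemma restart:
 assumes U: "sol (time_interval T) U" and t: "0 \<le> t0" "t0 \<le> t" "t \<in> time_interval T" "t \<le> t0 + a"
  and L: "sol {0..a} L" "aeq (L 0) (U t0)"
 shows "aeq (L (t - t0)) (U t)"
proof -
 have "sol {0..t - t0} (\<lambda>s. U (t0 + s))" by (rule sol_shift[OF U]) (use t time_interval_Icc[OF t(3)] in auto)
 moreover have "sol {0..t - t0} L" by (rule sol_mono[OF L(1)]) (use t in auto)
 ultimately show ?thesis using sol_unique[of "t - t0" L "\<lambda>s. U (t0 + s)" "t - t0"] L(2) t by simp
qed

text \<open>V up to t0, and a local solution from then on. Both live on (t0, r), where uniqueness
  makes them agree, so the relatively open pieces below r and above t0 cover the new interval and
  can be glued.\<close>

lemma extend: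
 assumes V: "sol (time_interval S) V" and t0: "t0 \<in> time_interval S" and M: "nm (gw 0) (V t0) \<le> M"
  and S: "S < ereal (t0 + life M)"
 obtains W where "sol (time_interval (ereal (t0 + life M))) W" "\<And>t. t \<in> time_interval S \<Longrightarrow> aeq (W t) (V t)"
proof -
 let ?T = "time_interval (ereal (t0 + life M))"
 obtain L where L: "sol {0..life M} L" "aeq (L 0) (V t0)"
  by (rule local_existence[OF solD(1,2)[OF V t0] M], rule that)
 obtain r where r: "S = ereal r" using S t0 by (cases S) (auto simp: time_interval_def)
 have tr: "0 \<le> t0" "t0 < r" "r < t0 + life M" using t0 S by (auto simp: r time_interval_def)
 define W where "W t = (if t \<le> t0 then V t else L (- t0 + t))" for t
 have agree: "aeq (W t) (V t)" if t: "t \<in> time_interval S" for t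
 proof (cases "t \<le> t0")
  case False
  then have "aeq (L (t - t0)) (V t)"
   by (intro restart[OF V tr(1) _ t _ L]) (use t tr in \<open>auto simp: r time_interval_def\<close>)
  then show ?thesis using False by (simp add: W_def)
 qed (simp add: W_def)
 have "sol ?T W"
 proof (rule sol_glue)
  fix t assume t: "t \<in> ?T"
  show "W t \<in> BM"
  proof (cases "t \<le> t0")
   case True then show ?thesis using t tr by (auto simp: W_def time_interval_def r intro!: H_measurable[OF solD(1)[OF V]])
  next
   case False then show ?thesis using t tr by (auto simp: W_def time_interval_def intro!: H_measurable[OF solD(1)[OF L(1)]])
  qed
  show "\<exists>X A. open A \<and> t \<in> A \<and> sol (?T \<inter> A) X \<and> (\<forall>\<tau>\<in>?T \<inter> A. aeq (X \<tau>) (W \<tau>))"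
  proof (cases "t < r")
   case True
   have sub: "?T \<inter> {..<r} \<subseteq> time_interval S" by (auto simp: time_interval_def r)
   have "aeq (V \<tau>) (W \<tau>)" if "\<tau> \<in> ?T \<inter> {..<r}" for \<tau>
   proof -
    have "aeq (W \<tau>) (V \<tau>)" by (rule agree) (use sub that in blast)
    then show ?thesis by eventually_elim simp
   qed
   then show ?thesis using sol_mono[OF V sub] True by (intro exI[of _ V] exI[of _ "{..<r}"]) auto
  next
   case False
   have "sol (?T \<inter> {t0<..}) (\<lambda>\<tau>. L (- t0 + \<tau>))"
    by (rule sol_shift[OF L(1)]) (auto simp: time_interval_def)
   then show ?thesis using False tr by (intro exI[of _ "\<lambda>\<tau>. L (- t0 + \<tau>)"] exI[of _ "{t0<..}"]) (auto simp: W_def)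
  qed
 qed
 then show ?thesis using that agree by blast
qed

definition msol :: "ereal \<Rightarrow> (real \<Rightarrow> real \<Rightarrow> complex) \<Rightarrow> bool" where
 "msol T U \<longleftrightarrow> 0 < T \<and> sol (time_interval T) U \<and>
   \<not> (\<exists>T' W. T < T' \<and> sol (time_interval T') W \<and> (\<forall>t\<in>time_interval T. aeq (W t) (U t)))"

text \<open>T is the supremum of the possible life spans. For each t some solution living beyond t
  is chosen, and uniqueness makes the choices coherent; a proper extension would itself contribute
  to the supremum.\<close>

theorem msol_exists:
 assumes U0: "U0 \<in> H (gw 0)" "herm U0"
 obtains T U where "msol T U" "aeq (U 0) U0"
proof -
 define E where "E = {T. 0 < T \<and> (\<exists>U. sol (time_interval T) U \<and> (aeq (U 0) U0))}"
 define T where "T = Sup E"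
 let ?l = "life (nm (gw 0) U0)"
 obtain L where L: "sol {0..?l} L" "aeq (L 0) U0" by (rule local_existence[OF U0 order_refl], rule that)
 have "sol (time_interval (ereal ?l)) L" by (rule sol_mono[OF L(1)]) (auto simp: time_interval_def)
 then have "ereal ?l \<in> E" using L(2) life_pos[OF nm_nonneg, of "gw 0" U0] unfolding E_def by auto
 then have T0: "0 < T" using life_pos[OF nm_nonneg, of "gw 0" U0] less_le_trans[OF _ Sup_upper, of 0 "ereal ?l" E] by (simp add: T_def)
 have "\<forall>t\<in>time_interval T. \<exists>p. t \<in> time_interval (fst p) \<and> sol (time_interval (fst p)) (snd p) \<and> (aeq (snd p 0) U0)"
 proof
  fix t assume t: "t \<in> time_interval T"
  then obtain T' where "T' \<in> E" "ereal t < T'" unfolding T_def time_interval_def by (auto simp: less_Sup_iff)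
  then show "\<exists>p. t \<in> time_interval (fst p) \<and> sol (time_interval (fst p)) (snd p) \<and> (aeq (snd p 0) U0)"
   using t unfolding E_def by (force simp: time_interval_def)
 qed
 from bchoice[OF this] obtain p where p: "\<forall>t\<in>time_interval T. t \<in> time_interval (fst (p t)) \<and> sol (time_interval (fst (p t))) (snd (p t)) \<and> (aeq (snd (p t) 0) U0)" ..
 define U where "U t = snd (p t) t" for t
 have agree: "aeq (W t) (U t)"
  if W: "sol (time_interval R) W" "aeq (W 0) U0" and t: "t \<in> time_interval R" "t \<in> time_interval T" for W R t
 proof -
  have P: "sol (time_interval (fst (p t))) (snd (p t))" "t \<in> time_interval (fst (p t))" "aeq (snd (p t) 0) U0"
   using p t(2) by auto
  have "aeq (W 0) (snd (p t) 0)" using W(2) P(3) by eventually_elim simp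
  from sol_unique_interval[OF W(1) P(1) this t(1) P(2)] show ?thesis by (simp add: U_def)
 qed
 have sol: "sol (time_interval T) U"
 proof (rule sol_glue)
  fix t assume t: "t \<in> time_interval T"
  have P: "sol (time_interval (fst (p t))) (snd (p t))" "t \<in> time_interval (fst (p t))" "aeq (snd (p t) 0) U0"
   using p t by auto
  show "U t \<in> BM" unfolding U_def by (rule H_measurable[OF solD(1)[OF P(1,2)]])
  obtain r where r: "t < r" "\<And>x. 0 \<le> x \<Longrightarrow> x < r \<Longrightarrow> x \<in> time_interval (fst (p t))" using time_interval_nhd[OF P(2)] by blast
  have sub: "time_interval T \<inter> {..<r} \<subseteq> time_interval (fst (p t))" using r(2) by (auto simp: time_interval_def[of T])
  show "\<exists>V A. open A \<and> t \<in> A \<and> sol (time_interval T \<inter> A) V \<and> (\<forall>\<tau>\<in>time_interval T \<inter> A. aeq (V \<tau>) (U \<tau>))"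
   using sol_mono[OF P(1) sub] agree[OF P(1,3)] sub r(1) by (intro exI[of _ "snd (p t)"] exI[of _ "{..<r}"]) auto
 qed
 have U0': "aeq (U 0) U0"
  using p zero_in_time_interval[OF T0] by (simp add: U_def)
 have "msol T U"
  unfolding msol_def
 proof (intro conjI T0 sol notI)
  assume "\<exists>T' W. T < T' \<and> sol (time_interval T') W \<and> (\<forall>t\<in>time_interval T. aeq (W t) (U t))"
  then obtain T' W where W: "T < T'" "sol (time_interval T') W" "aeq (W 0) (U 0)"
   using zero_in_time_interval[OF T0] by auto
  have "aeq (W 0) U0" using W(3) U0' by eventually_elim simp
  then have "T' \<in> E" using W T0 unfolding E_def by auto
  then have "T' \<le> T" unfolding T_def by (rule Sup_upper)
  then show False using W(1) by simp
 qed
 from that[OF this U0'] show ?thesis .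
qed

text \<open>Induction over steps of length a/2, where a is the life span for data of norm at most M.
  At each node V is so close to U that its norm is at most M; if V ended before t0 + a,
  \<open>extend\<close> would contradict its maximality. Since a depends on the norm alone, finitely
  many steps reach \<tau>.\<close>

theorem dependence:
 assumes U: "sol (time_interval T) U" and \<tau>: "\<tau> \<in> time_interval T" and e: "0 < e"
 shows "\<exists>\<delta>>0. \<forall>S V. msol S V \<longrightarrow> nd (gw 0) (V 0) (U 0) < \<delta> \<longrightarrow>
  \<tau> \<in> time_interval S \<and> (\<forall>t\<in>{0..\<tau>}. nd (gw 0) (V t) (U t) < e)"
proof -
 have sub: "{0..\<tau>} \<subseteq> time_interval T" by (rule time_interval_Icc[OF \<tau>])
 have \<tau>0: "0 \<le> \<tau>" using \<tau> by (simp add: time_interval_def)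
 obtain B where B: "0 \<le> B" "\<And>t. t \<in> {0..\<tau>} \<Longrightarrow> nm (gw 0) (U t) \<le> B" by (rule sol_bounded[OF sol_mono[OF U sub]], rule that)
 \<comment> \<open>The margin 1 admits every V that is closer than 1 to U.\<close>
 define M where "M = B + 1"
 define a where "a = life M"
 have a: "0 < a" unfolding a_def using B(1) by (intro life_pos) (simp add: M_def)
 have steps: "\<forall>e>0. \<exists>\<delta>>0. \<forall>S V. msol S V \<longrightarrow> nd (gw 0) (V 0) (U 0) < \<delta> \<longrightarrow>
  (\<forall>t\<in>{0..\<tau>}. t \<le> real k * (a / 2) \<longrightarrow> t \<in> time_interval S \<and> nd (gw 0) (V t) (U t) < e)" for k
 proof (induction k)
  case 0
  show ?case
  proof (intro allI impI)
   fix e :: real assume e: "0 < e"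
   show "\<exists>\<delta>>0. \<forall>S V. msol S V \<longrightarrow> nd (gw 0) (V 0) (U 0) < \<delta> \<longrightarrow>
    (\<forall>t\<in>{0..\<tau>}. t \<le> real 0 * (a / 2) \<longrightarrow> t \<in> time_interval S \<and> nd (gw 0) (V t) (U t) < e)"
   proof (intro exI[of _ e] conjI e allI impI ballI)
    fix S V t assume "msol S V" "nd (gw 0) (V 0) (U 0) < e" "t \<in> {0..\<tau>}" "t \<le> real 0 * (a / 2)"
    then show "t \<in> time_interval S" "nd (gw 0) (V t) (U t) < e"
     using zero_in_time_interval[of S] by (auto simp: msol_def)
   qed
  qed
 next
  case (Suc k)
  show ?case
  proof (intro allI impI)
   fix e :: real assume e: "0 < e"
   define t0 where "t0 = min \<tau> (real k * (a / 2))"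
   have t0: "t0 \<in> {0..\<tau>}" using \<tau>0 a by (simp add: t0_def)
   then have t0T: "t0 \<in> time_interval T" using sub by blast
   note Ut0 = solD[OF U t0T]
   have UM: "nm (gw 0) (U t0) \<le> M" using B(2)[OF t0] by (simp add: M_def)
   obtain L where L: "sol {0..a} L" "aeq (L 0) (U t0)" by (rule local_existence[OF Ut0(1,2) UM, folded a_def], rule that)
   have z: "0 \<in> {0..a}" using a by simp
   have "nm (gw 0) (L 0) = nm (gw 0) (U t0)" by (rule nm_cong_AE[OF weight_g H_measurable[OF solD(1)[OF L(1) z]] H_measurable[OF Ut0(1)] L(2)])
   then have LM: "nm (gw 0) (L 0) \<le> M" using UM by simp
   obtain \<delta>1 where \<delta>1: "0 < \<delta>1" "\<And>V t. sol {0..a} V \<Longrightarrow> nm (gw 0) (V 0) \<le> M \<Longrightarrow> nd (gw 0) (V 0) (L 0) < \<delta>1 \<Longrightarrow> t \<in> {0..a} \<Longrightarrow> nd (gw 0) (V t) (L t) < e"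
    using local_dependence[OF L(1)[unfolded a_def] LM e] unfolding a_def by blast
   \<comment> \<open>Required of V at the previous node: the target e itself, the closeness
     \<open>\<delta>1\<close> that \<open>local_dependence\<close> asks of its data, and the margin
     1 in M.\<close>
   have "0 < min e (min \<delta>1 1)" using e \<delta>1(1) by simp
   with Suc.IH obtain \<delta> where \<delta>: "0 < \<delta>" and IH: "\<And>S V t. msol S V \<Longrightarrow> nd (gw 0) (V 0) (U 0) < \<delta> \<Longrightarrow> t \<in> {0..\<tau>} \<Longrightarrow>
     t \<le> real k * (a / 2) \<Longrightarrow> t \<in> time_interval S \<and> nd (gw 0) (V t) (U t) < min e (min \<delta>1 1)" by meson
   show "\<exists>\<delta>>0. \<forall>S V. msol S V \<longrightarrow> nd (gw 0) (V 0) (U 0) < \<delta> \<longrightarrow>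
    (\<forall>t\<in>{0..\<tau>}. t \<le> real (Suc k) * (a / 2) \<longrightarrow> t \<in> time_interval S \<and> nd (gw 0) (V t) (U t) < e)"
   proof (rule exI[of _ \<delta>], rule conjI[OF \<delta>], intro allI impI ballI)
    fix S V t assume V: "msol S V" "nd (gw 0) (V 0) (U 0) < \<delta>" and t: "t \<in> {0..\<tau>}" "t \<le> real (Suc k) * (a / 2)"
    show "t \<in> time_interval S \<and> nd (gw 0) (V t) (U t) < e"
    proof (cases "t \<le> real k * (a / 2)")
     case True then show ?thesis using IH[OF V t(1)] by simp
    next
     case False
     then have t0e: "t0 = real k * (a / 2)" using t(1) by (auto simp: t0_def)
     \<comment> \<open>Half a life span per step keeps t strictly inside the interval on which V is
       shown to exist.\<close>
     have tt: "t0 \<le> t" "t \<le> t0 + a / 2" "t < t0 + a" using False t a unfolding t0e by (auto simp: algebra_simps)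
     have t0S: "t0 \<in> time_interval S" and close: "nd (gw 0) (V t0) (U t0) < min e (min \<delta>1 1)"
      using IH[OF V t0 eq_refl[OF t0e]] by auto
     have VS: "sol (time_interval S) V" using V(1) by (simp add: msol_def)
     note Vt0 = solD[OF VS t0S]
     have VM: "nm (gw 0) (V t0) \<le> M"
      using nm_tri_diff[OF weight_g Vt0(1) Ut0(1)] close B(2)[OF t0] by (simp add: M_def)
     have Sa: "ereal (t0 + a) \<le> S"
     proof (rule ccontr)
      assume "\<not> ereal (t0 + a) \<le> S"
      then have lt: "S < ereal (t0 + life M)" by (simp add: a_def)
      obtain W where "sol (time_interval (ereal (t0 + life M))) W" "\<And>t. t \<in> time_interval S \<Longrightarrow> aeq (W t) (V t)"
       by (rule extend[OF VS t0S VM lt], rule that)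
      then show False using V(1) lt unfolding msol_def by blast
     qed
     have tS: "t \<in> time_interval S"
      using t(1) less_le_trans[of "ereal t" "ereal (t0 + a)", OF _ Sa] tt(3) by (simp add: time_interval_def)
     have tT: "t \<in> time_interval T" using t(1) sub by blast
     obtain K where K: "sol {0..a} K" "aeq (K 0) (V t0)" by (rule local_existence[OF Vt0(1,2) VM, folded a_def], rule that)
     have s: "t - t0 \<in> {0..a}" using tt by simp
     have z0: "0 \<le> t0" using t0 by simp
     have ta: "t \<le> t0 + a" using tt by simp
     note m = H_measurable[OF solD(1)[OF K(1) z]] H_measurable[OF Vt0(1)] H_measurable[OF solD(1)[OF L(1) z]] H_measurable[OF Ut0(1)]
     have KM: "nm (gw 0) (K 0) \<le> M" using nm_cong_AE[OF weight_g m(1,2) K(2)] VM by simp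
     have "nd (gw 0) (K 0) (L 0) = nd (gw 0) (V t0) (U t0)"
      by (rule nm_cong_AE[OF weight_g borel_measurable_diff[OF m(1,3)] borel_measurable_diff[OF m(2,4)]]) (use K(2) L(2) in \<open>eventually_elim, simp\<close>)
     then have "nd (gw 0) (K 0) (L 0) < \<delta>1" using close by simp
     from \<delta>1(2)[OF K(1) KM this s] have fin: "nd (gw 0) (K (t - t0)) (L (t - t0)) < e" .
     note n = H_measurable[OF solD(1)[OF K(1) s]] H_measurable[OF solD(1)[OF VS tS]] H_measurable[OF solD(1)[OF L(1) s]] H_measurable[OF solD(1)[OF U tT]]
     have "nd (gw 0) (K (t - t0)) (L (t - t0)) = nd (gw 0) (V t) (U t)"
      by (rule nm_cong_AE[OF weight_g borel_measurable_diff[OF n(1,3)] borel_measurable_diff[OF n(2,4)]])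
       (use restart[OF VS z0 tt(1) tS ta K] restart[OF U z0 tt(1) tT ta L] in \<open>eventually_elim, simp\<close>)
     then show ?thesis using fin tS by simp
    qed
   qed
  qed
 qed
 obtain k :: nat where "\<tau> / (a / 2) < real k" using reals_Archimedean2 by blast
 then have k: "\<tau> \<le> real k * (a / 2)" using a by (simp add: pos_divide_less_eq)
 from steps[of k] e obtain \<delta> where \<delta>: "0 < \<delta>" and D: "\<And>S V t. msol S V \<Longrightarrow> nd (gw 0) (V 0) (U 0) < \<delta> \<Longrightarrow> t \<in> {0..\<tau>} \<Longrightarrow>
     t \<le> real k * (a / 2) \<Longrightarrow> t \<in> time_interval S \<and> nd (gw 0) (V t) (U t) < e" by meson
 show ?thesis
 proof (rule exI[of _ \<delta>], rule conjI[OF \<delta>], intro allI impI conjI ballI)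
  fix S V assume V: "msol S V" "nd (gw 0) (V 0) (U 0) < \<delta>"
  show "\<tau> \<in> time_interval S" using D[OF V, of \<tau>] \<tau>0 k by simp
  fix t assume "t \<in> {0..\<tau>}"
  then show "nd (gw 0) (V t) (U t) < e" using D[OF V, of t] k by simp
 qed
qed

section \<open>Return to functions on the line\<close>

lemma fourier_cong_AE:
 assumes "f \<in> L2" "g \<in> L2" "AE x in lborel. f x = g x" shows "aeq (fourier f) (fourier g)"
 using has_fourier_unique[OF assms(2) _ has_fourier_fourier[OF assms(2)]]
  has_fourier_cong[OF assms has_fourier_fourier[OF assms(1)] fourier_measurable[OF assms(1)]] by simp

lemma fourier_inj:
 assumes f: "f \<in> L2" "fourier f \<in> H (gw 0)" and g: "g \<in> L2" and ae: "aeq (fourier f) (fourier g)"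
 shows "AE x in lborel. f x = g x"
proof -
 have "fourier g \<in> H (gw 0)" by (rule H_cong_AE[OF weight_g f(2) fourier_measurable[OF g] ae])
 from fourier_inversion[OF g has_fourier_fourier[OF g] H_gw_integrable[OF this]]
 have "AE x in lborel. cr (g x) = ft 1 (fourier f) x"
  using ft_cong_AE[OF fourier_measurable[OF f(1)] fourier_measurable[OF g] ae] by simp
 with fourier_inversion[OF f(1) has_fourier_fourier[OF f(1)] H_gw_integrable[OF f(2)]]
 show ?thesis by eventually_elim (metis of_real_eq_iff)
qed

lemma rod_solution_initial:
 assumes R: "rod_solution \<omega> \<gamma> (\<sigma> + 1) u0 T u" and u0: "u0 \<in> L2" and T: "0 < T"
 shows "aeq (fourier (u 0)) (fourier u0)"
 by (rule fourier_cong_AE[OF rod_solution_sol(2)[OF R zero_in_time_interval[OF T]] u0])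
  (use R in \<open>simp add: rod_solution_def\<close>)

text \<open>Maximality has to be transferred as well: a longer extension in frequency would invert
  to an extension in physical space that agrees almost everywhere with u.\<close>

lemma maximal_msol:
 assumes u0: "u0 \<in> sobolev (\<sigma> + 1)" and max: "maximal_rod_solution \<omega> \<gamma> (\<sigma> + 1) u0 T u"
 shows "msol T (\<lambda>t. fourier (u t))"
 unfolding msol_def
proof (intro conjI notI)
 show T: "0 < T" using max by (simp add: maximal_rod_solution_def)
 have R: "rod_solution \<omega> \<gamma> (\<sigma> + 1) u0 T u" using max by (simp add: maximal_rod_solution_def)
 note r = rod_solution_sol(1,2)[OF R]
 show "sol (time_interval T) (\<lambda>t. fourier (u t))" by (rule r(1))
 have u0': "u0 \<in> L2" using u0 by (simp add: sobolev_g)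
 assume "\<exists>T' W. T < T' \<and> sol (time_interval T') W \<and> (\<forall>t\<in>time_interval T. aeq (W t) (fourier (u t)))"
 then obtain T' W where W: "T < T'" "sol (time_interval T') W" and ae: "\<And>t. t \<in> time_interval T \<Longrightarrow> aeq (W t) (fourier (u t))" by blast
 have T': "0 < T'" using T W(1) by simp
 have W0: "aeq (W 0) (fourier u0)"
  using ae[OF zero_in_time_interval[OF T]] rod_solution_initial[OF R u0' T] by eventually_elim simp
 define v where "v = (\<lambda>t x. Re (ft 1 (W t) x))"
 note s = sol_rod_solution[OF W(2) T' u0 W0]
 have V: "rod_solution \<omega> \<gamma> (\<sigma> + 1) u0 T' v" using s(1) by (simp add: v_def)
 have "AE x in lborel. v t x = u t x" if t: "t \<in> time_interval T" for t
 proof -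
  have t': "t \<in> time_interval T'" using t W(1) by (auto simp: time_interval_def)
  note q = rod_solution_sol(1,2)[OF V]
  have "aeq (fourier (v t)) (fourier (u t))"
   using s(2)[OF t'] ae[OF t] unfolding v_def by eventually_elim simp
  then show ?thesis by (rule fourier_inj[OF q(2)[OF t'] solD(1)[OF q(1) t'] r(2)[OF t]])
 qed
 then show False using max V W(1) unfolding maximal_rod_solution_def by blast
qed

text \<open>The opposite transfer of maximality: the transform of a longer solution would extend U.
  Uniqueness is read off in frequency and brought back by injectivity of the transform.\<close>

theorem rod_existence:
 assumes u0: "u0 \<in> sobolev (\<sigma> + 1)"
 obtains T u where "maximal_rod_solution \<omega> \<gamma> (\<sigma> + 1) u0 T u"
  "\<And>S v t. rod_solution \<omega> \<gamma> (\<sigma> + 1) u0 S v \<Longrightarrow> t \<in> time_interval T \<Longrightarrow> t \<in> time_interval S \<Longrightarrow> AE x in lborel. v t x = u t x"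
proof -
 have u0': "u0 \<in> L2" "fourier u0 \<in> H (gw 0)" using u0 by (auto simp: sobolev_g)
 obtain T U where M: "msol T U" and U0: "aeq (U 0) (fourier u0)"
  by (rule msol_exists[OF u0'(2) fourier_herm[OF u0'(1)]], rule that)
 have T: "0 < T" and S: "sol (time_interval T) U" using M by (auto simp: msol_def)
 define u where "u = (\<lambda>t x. Re (ft 1 (U t) x))"
 have R: "rod_solution \<omega> \<gamma> (\<sigma> + 1) u0 T u" and f: "\<And>t. t \<in> time_interval T \<Longrightarrow> aeq (fourier (u t)) (U t)"
  using sol_rod_solution[OF S T u0 U0] by (auto simp: u_def)
 note r = rod_solution_sol(1,2)[OF R]
 have "maximal_rod_solution \<omega> \<gamma> (\<sigma> + 1) u0 T u"
  unfolding maximal_rod_solution_def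
 proof (intro conjI T R notI)
  assume "\<exists>T' v. T < T' \<and> rod_solution \<omega> \<gamma> (\<sigma> + 1) u0 T' v \<and> (\<forall>t\<in>time_interval T. AE x in lborel. v t x = u t x)"
  then obtain T' v where v: "T < T'" "rod_solution \<omega> \<gamma> (\<sigma> + 1) u0 T' v" and ae: "\<And>t. t \<in> time_interval T \<Longrightarrow> AE x in lborel. v t x = u t x" by blast
  note q = rod_solution_sol(1,2)[OF v(2)]
  have "aeq (fourier (v t)) (U t)" if t: "t \<in> time_interval T" for t
  proof -
   have t': "t \<in> time_interval T'" using t v(1) by (auto simp: time_interval_def)
   show ?thesis using fourier_cong_AE[OF q(2)[OF t'] r(2)[OF t] ae[OF t]] f[OF t] by eventually_elim simp
  qed
  then show False using M v(1) q(1) unfolding msol_def by blast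
 qed
 moreover have "AE x in lborel. v t x = u t x"
  if v: "rod_solution \<omega> \<gamma> (\<sigma> + 1) u0 S v" and t: "t \<in> time_interval T" "t \<in> time_interval S" for S v t
 proof -
  note q = rod_solution_sol(1,2)[OF v]
  have S0: "0 < S" using t(2) le_less_trans[of 0 "ereal t" S] by (simp add: time_interval_def)
  have "aeq (fourier (v 0)) (fourier (u 0))"
   using rod_solution_initial[OF v u0'(1) S0] rod_solution_initial[OF R u0'(1) T] by eventually_elim simp
  from sol_unique_interval[OF q(1) r(1) this t(2,1)]
  show ?thesis by (rule fourier_inj[OF q(2)[OF t(2)] solD(1)[OF q(1) t(2)] r(2)[OF t(1)]])
 qed
 ultimately show ?thesis using that by blast
qed

text \<open>The time derivative is \<open>Nl\<close> of the solution, so its dependence follows from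
  that of the solution by \<open>Nl_lipschitz\<close>; the lost derivative is the one by which the
  two norms differ.\<close>

theorem rod_dependence:
 assumes u0: "u0 \<in> sobolev (\<sigma> + 1)" and max: "maximal_rod_solution \<omega> \<gamma> (\<sigma> + 1) u0 T u" and u': "sobolev_C1 \<sigma> T u u'"
  and \<tau>: "\<tau> \<in> time_interval T" and \<epsilon>: "0 < \<epsilon>"
 shows "\<exists>\<delta>>0. \<forall>v0 \<in> sobolev (\<sigma> + 1). \<forall>S v v'. sobolev_norm (\<sigma> + 1) (\<lambda>x. v0 x - u0 x) < \<delta> \<longrightarrow>
   maximal_rod_solution \<omega> \<gamma> (\<sigma> + 1) v0 S v \<longrightarrow> sobolev_C1 \<sigma> S v v' \<longrightarrow> \<tau> \<in> time_interval S \<and>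
   (\<forall>t \<in> {0..\<tau>}. sobolev_norm (\<sigma> + 1) (\<lambda>x. v t x - u t x) < \<epsilon> \<and> sobolev_norm \<sigma> (\<lambda>x. v' t x - u' t x) < \<epsilon>)"
proof -
 have T: "0 < T" and R: "rod_solution \<omega> \<gamma> (\<sigma> + 1) u0 T u" using max by (auto simp: maximal_rod_solution_def)
 note r = rod_solution_sol[OF R]
 have u0': "u0 \<in> L2" using u0 by (simp add: sobolev_g)
 obtain B where B: "0 \<le> B" "\<And>t. t \<in> {0..\<tau>} \<Longrightarrow> nm (gw 0) (fourier (u t)) \<le> B"
  by (rule sol_bounded[OF sol_mono[OF r(1) time_interval_Icc[OF \<tau>]]], rule that)
 let ?c = "cN * (2 + 2 * B) + 1"
 have c: "0 < ?c" using B(1) by (simp add: add_nonneg_pos)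
 \<comment> \<open>e \<le> 1 bounds the norm of V by B + 1, so \<open>cN * (2 + 2 * B)\<close> is a
   Lipschitz factor for all nearby V; \<open>?c\<close> is larger by 1, which makes it positive and
   the final inequality strict.\<close>
 define e where "e = min (min \<epsilon> 1) (\<epsilon> / ?c)"
 have e: "0 < e" "e \<le> \<epsilon>" "e \<le> 1" "e \<le> \<epsilon> / ?c" using \<epsilon> c by (auto simp: e_def)
 obtain \<delta> where \<delta>: "0 < \<delta>" and D: "\<And>S V. msol S V \<Longrightarrow> nd (gw 0) (V 0) (fourier (u 0)) < \<delta> \<Longrightarrow>
   \<tau> \<in> time_interval S \<and> (\<forall>t\<in>{0..\<tau>}. nd (gw 0) (V t) (fourier (u t)) < e)"
  using dependence[OF r(1) \<tau> e(1)] by blast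
 show ?thesis
 proof (rule exI[of _ \<delta>], rule conjI[OF \<delta>], intro ballI allI impI)
  fix v0 S v v' assume v0: "v0 \<in> sobolev (\<sigma> + 1)" and near: "sobolev_norm (\<sigma> + 1) (\<lambda>x. v0 x - u0 x) < \<delta>"
   and mv: "maximal_rod_solution \<omega> \<gamma> (\<sigma> + 1) v0 S v" and v': "sobolev_C1 \<sigma> S v v'"
  have S: "0 < S" and Q: "rod_solution \<omega> \<gamma> (\<sigma> + 1) v0 S v" using mv by (auto simp: maximal_rod_solution_def)
  note q = rod_solution_sol[OF Q]
  have v0': "v0 \<in> L2" using v0 by (simp add: sobolev_g)
  note z = zero_in_time_interval[OF T] zero_in_time_interval[OF S]
  have "nd (gw 0) (fourier (v 0)) (fourier (u 0)) = nd (gw 0) (fourier v0) (fourier u0)"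
   by (rule nm_cong_AE[OF weight_g borel_measurable_diff[OF fourier_measurable[OF q(2)[OF z(2)]] fourier_measurable[OF r(2)[OF z(1)]]]
      borel_measurable_diff[OF fourier_measurable[OF v0'] fourier_measurable[OF u0']]])
    (use rod_solution_initial[OF Q v0' S] rod_solution_initial[OF R u0' T] in \<open>eventually_elim, simp\<close>)
  also have "\<dots> < \<delta>" using near unfolding sobolev_g(2) nm_fourier_diff[OF weight_g v0' u0'] .
  finally have \<tau>S: "\<tau> \<in> time_interval S" and cl: "\<And>t. t \<in> {0..\<tau>} \<Longrightarrow> nd (gw 0) (fourier (v t)) (fourier (u t)) < e"
   using D[OF maximal_msol[OF v0 mv]] by auto
  show "\<tau> \<in> time_interval S \<and> (\<forall>t \<in> {0..\<tau>}. sobolev_norm (\<sigma> + 1) (\<lambda>x. v t x - u t x) < \<epsilon> \<and> sobolev_norm \<sigma> (\<lambda>x. v' t x - u' t x) < \<epsilon>)"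
  proof (intro conjI \<tau>S ballI)
   fix t assume t: "t \<in> {0..\<tau>}"
   have tT: "t \<in> time_interval T" and tS: "t \<in> time_interval S"
    using t time_interval_Icc[OF \<tau>] time_interval_Icc[OF \<tau>S] by auto
   let ?V = "fourier (v t)" and ?U = "fourier (u t)"
   have VH: "?V \<in> H (gw 0)" and UH: "?U \<in> H (gw 0)" using solD(1)[OF q(1) tS] solD(1)[OF r(1) tT] by auto
   show "sobolev_norm (\<sigma> + 1) (\<lambda>x. v t x - u t x) < \<epsilon>"
    unfolding sobolev_g(2) nm_fourier_diff[OF weight_g q(2)[OF tS] r(2)[OF tT]] using cl[OF t] e(2) by simp
   have VB: "nm (gw 0) ?V \<le> B + 1" using nm_tri_diff[OF weight_g VH UH] cl[OF t] e(3) B(2)[OF t] by linarith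
   note v'2 = sobolev_C1_k(2)[OF v' tS] and u'2 = sobolev_C1_k(2)[OF u' tT]
   have "sobolev_norm \<sigma> (\<lambda>x. v' t x - u' t x) = nd (kw 0) (fourier (v' t)) (fourier (u' t))"
    unfolding sobolev_k(2) by (rule nm_fourier_diff[OF weight_w v'2 u'2])
   also have "\<dots> = nd (kw 0) (Nl ?V) (Nl ?U)"
    by (rule nm_cong_AE[OF weight_w borel_measurable_diff[OF fourier_measurable[OF v'2] fourier_measurable[OF u'2]]
       borel_measurable_diff[OF Nl_measurable[OF H_measurable[OF VH]] Nl_measurable[OF H_measurable[OF UH]]]])
     (use q(3)[OF v' tS] r(3)[OF u' tT] in \<open>eventually_elim, simp\<close>)
   also have "\<dots> \<le> cN * (1 + nm (gw 0) ?V + nm (gw 0) ?U) * nd (gw 0) ?V ?U" by (rule Nl_lipschitz[OF VH UH])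
   also have "\<dots> \<le> cN * (2 + 2 * B) * e"
    using VB B(2)[OF t] B(1) cl[OF t] by (intro mult_mono mult_left_mono) auto
   also have "\<dots> < ?c * e" using e(1) by simp
   also have "\<dots> \<le> ?c * (\<epsilon> / ?c)" using e(4) c by (intro mult_left_mono) auto
   also have "\<dots> = \<epsilon>" using c by simp
   finally show "sobolev_norm \<sigma> (\<lambda>x. v' t x - u' t x) < \<epsilon>" .
  qed
 qed
qed

end

theorem theorem1:
  fixes \<omega> \<gamma> s :: real
  assumes "0 \<le> \<omega>" and "3 / 2 < s"
  shows "(\<forall>u\<^sub>0 \<in> sobolev s. \<exists>T u.
            maximal_rod_solution \<omega> \<gamma> s u\<^sub>0 T u \<and>
            (\<forall>S v. rod_solution \<omega> \<gamma> s u\<^sub>0 S v \<longrightarrow>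
               (\<forall>t \<in> time_interval T \<inter> time_interval S. AE x in lborel. v t x = u t x))) \<and>
         (\<forall>u\<^sub>0 \<in> sobolev s. \<forall>T u u'.
            maximal_rod_solution \<omega> \<gamma> s u\<^sub>0 T u \<longrightarrow> sobolev_C1 (s - 1) T u u' \<longrightarrow>
            (\<forall>\<tau> \<in> time_interval T. \<forall>\<epsilon>>0. \<exists>\<delta>>0. \<forall>v\<^sub>0 \<in> sobolev s. \<forall>S v v'.
               sobolev_norm s (\<lambda>x. v\<^sub>0 x - u\<^sub>0 x) < \<delta> \<longrightarrow>
               maximal_rod_solution \<omega> \<gamma> s v\<^sub>0 S v \<longrightarrow> sobolev_C1 (s - 1) S v v' \<longrightarrow>
               \<tau> \<in> time_interval S \<and>
               (\<forall>t \<in> {0..\<tau>}. sobolev_norm s (\<lambda>x. v t x - u t x) < \<epsilon> \<and>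
                  sobolev_norm (s - 1) (\<lambda>x. v' t x - u' t x) < \<epsilon>)))"
proof -
  \<comment> \<open>The estimates live in the locale at \<sigma> = s - 1;
    \<open>diff_add_cancel\<close> rewrites \<sigma> + 1 to s.\<close>
  interpret rod \<gamma> \<omega> "s - 1" by unfold_locales (use assms(2) in simp)
  note existence = rod_existence[unfolded diff_add_cancel] and dependence = rod_dependence[unfolded diff_add_cancel]
  show ?thesis
  proof (intro conjI ballI)
    fix u\<^sub>0 assume u0: "u\<^sub>0 \<in> sobolev s"
    obtain T u where "maximal_rod_solution \<omega> \<gamma> s u\<^sub>0 T u"
      "\<And>S v t. rod_solution \<omega> \<gamma> s u\<^sub>0 S v \<Longrightarrow> t \<in> time_interval T \<Longrightarrow> t \<in> time_interval S \<Longrightarrow> AE x in lborel. v t x = u t x"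
      by (rule existence[OF u0], rule that)
    then show "\<exists>T u. maximal_rod_solution \<omega> \<gamma> s u\<^sub>0 T u \<and>
            (\<forall>S v. rod_solution \<omega> \<gamma> s u\<^sub>0 S v \<longrightarrow>
               (\<forall>t \<in> time_interval T \<inter> time_interval S. AE x in lborel. v t x = u t x))"
      by (intro exI conjI allI impI ballI) auto
  next
    fix u\<^sub>0 assume u0: "u\<^sub>0 \<in> sobolev s"
    show "\<forall>T u u'.
            maximal_rod_solution \<omega> \<gamma> s u\<^sub>0 T u \<longrightarrow> sobolev_C1 (s - 1) T u u' \<longrightarrow>
            (\<forall>\<tau> \<in> time_interval T. \<forall>\<epsilon>>0. \<exists>\<delta>>0. \<forall>v\<^sub>0 \<in> sobolev s. \<forall>S v v'.
               sobolev_norm s (\<lambda>x. v\<^sub>0 x - u\<^sub>0 x) < \<delta> \<longrightarrow>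
               maximal_rod_solution \<omega> \<gamma> s v\<^sub>0 S v \<longrightarrow> sobolev_C1 (s - 1) S v v' \<longrightarrow>
               \<tau> \<in> time_interval S \<and>
               (\<forall>t \<in> {0..\<tau>}. sobolev_norm s (\<lambda>x. v t x - u t x) < \<epsilon> \<and>
                  sobolev_norm (s - 1) (\<lambda>x. v' t x - u' t x) < \<epsilon>))"
      by (intro allI impI ballI) (rule dependence[OF u0])
  qed
qed

end
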